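(* Let $H\in(0,1)$, $K\in(0,1]$ with $HK\ge\frac12$, and let $X=B^{H,K}$ be a bifractional Brownian motion on $[0,T]$. Let $f\in C^2(\mathbb{R})$ with $f''$ bounded. Then for every $t\in[0,T]$ $$f(X_t)=f(0)+\int_0^tf'(X_s)\,\delta X_s+HK\int_0^tf''(X_s)s^{2HK-1}\,ds,$$ where $\delta$ denotes the Skorohod integral with respect to $X$. In particular, if $2HK=1$, $$f(X_t)=f(0)+\int_0^tf'(X_s)\,\delta X_s+\frac12\int_0^tf''(X_s)\,ds.$$
   Context: Fix $T>0$. The bifractional Brownian motion $B^{H,K}$ is the continuous centered Gaussian process starting from $0$ with covariance $R(t,s)=2^{-K}\big((t^{2H}+s^{2H})^K-|t-s|^{2HK}\big)$. The probability space is the canonical one, $\Omega=C_0([0,T])$ (continuous functions on $[0,T]$ vanishing at $0$), with the (completed) $\sigma$-field generated by $X$. For $HK\ge\frac12$ there is a finite signed measure $\mu$ on $\mathcal{B}([0,T]^2)$ (the covariance measure) with $\mu([0,s]\times[0,t])=R(s,t)$ for all $s,t$. Skorohod integral. $L_\mu$ is the space of Borel functions $\varphi:[0,T]\to\mathbb{R}$ with $\|\varphi\|_{|\mathcal H|}^2:=\int_{[0,T]^2}|\varphi(u)||\varphi(v)|\,d|\mu|(u,v)<\infty$, with semiscalar product $\langle\varphi,\phi\rangle_{\mathcal H}=\int_{[0,T]^2}\varphi(u)\phi(v)\,d\mu(u,v)$. The Wiener integral $\varphi\mapsto\int_0^T\varphi\,dX$ is the linear map $L_\mu\to L^2(\Omega)$,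 continuous for $\|\cdot\|_{\mathcal H}$, with $\int1_{[0,t]}dX=X_t$. $Cyl$ is the set of random variables $F=g(\int\phi_1dX,\dots,\int\phi_ndX)$, $g\in C_b^\infty(\mathbb{R}^n)$, $\phi_i\in L_\mu$, and $DF=\sum_i\partial_ig(\int\phi_1dX,\dots,\int\phi_ndX)\phi_i$. A process $u$ with $E\|u\|_{|\mathcal H|}^2<\infty$ belongs to $Dom(\delta)$ if there is a zero-mean $Z\in L^2(\Omega)$ with $E(FZ)=E\langle DF,u\rangle_{\mathcal H}$ for every $F\in Cyl$; such $Z$ is unique and $\int_0^Tu\,\delta X:=Z$. Moreover $\int_0^tu\,\delta X:=\int_0^Tu1_{[0,t]}\,\delta X$ when $u1_{[0,t]}\in Dom(\delta)$. *)

theory Defs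
  imports "HOL-Probability.Probability"
begin

section \<open>Bifractional Brownian motion on its canonical space\<close>

definition bifbm_cov :: "real \<Rightarrow> real \<Rightarrow> real \<Rightarrow> real \<Rightarrow> real" where
  "bifbm_cov H K t s =
     2 powr (- K) *
       ((t powr (2 * H) + s powr (2 * H)) powr K - \<bar>t - s\<bar> powr (2 * H * K))"

text \<open>Functions on \<open>[0,T]\<close> are represented by functions that are \<^const>\<open>undefined\<close>
  outside \<open>[0,T]\<close>, as in the product measure \<^const>\<open>PiM\<close>.\<close>

definition C0_paths :: "real \<Rightarrow> (real \<Rightarrow> real) set" where
  "C0_paths T = {\<omega> \<in> extensional {0..T}. continuous_on {0..T} \<omega> \<and> \<omega> 0 = 0}"

text \<open>Only the \<open>\<sigma>\<close>-field of this measure space matters: it is the one generated by the coordinate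
  maps \<open>\<omega> \<mapsto> \<omega> t\<close> on \<open>C0_paths T\<close>.\<close>

definition path_space :: "real \<Rightarrow> (real \<Rightarrow> real) measure" where
  "path_space T = restrict_space (\<Pi>\<^sub>M t\<in>{0..T}. (borel :: real measure)) (C0_paths T)"

lemma space_path_space: "space (path_space T) = C0_paths T"
  by (auto simp: path_space_def space_restrict_space space_PiM C0_paths_def PiE_def)

text \<open>Gaussian laws may be degenerate (zero variance).\<close>

definition gaussian_rv :: "'w measure \<Rightarrow> ('w \<Rightarrow> real) \<Rightarrow> bool" where
  "gaussian_rv M Y \<longleftrightarrow>
     (\<exists>m. Y \<in> borel_measurable M \<and> (AE \<omega> in M. Y \<omega> = m)) \<or>
     (\<exists>m \<sigma>. 0 < \<sigma> \<and> distributed M lborel Y (normal_density m \<sigma>))"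

definition gaussian_process :: "'w measure \<Rightarrow> 'i set \<Rightarrow> ('i \<Rightarrow> 'w \<Rightarrow> real) \<Rightarrow> bool" where
  "gaussian_process M A X \<longleftrightarrow>
     (\<forall>J a. finite J \<and> J \<subseteq> A \<longrightarrow> gaussian_rv M (\<lambda>\<omega>. \<Sum>j\<in>J. a j * X j \<omega>))"

text \<open>The law \<open>P\<close> on the path space under which the coordinate process is \<open>B\<^sup>H\<^sup>,\<^sup>K\<close>.\<close>

definition bifbm_law :: "real \<Rightarrow> real \<Rightarrow> real \<Rightarrow> (real \<Rightarrow> real) measure \<Rightarrow> bool" where
  "bifbm_law H K T P \<longleftrightarrow>
     prob_space P \<and> sets P = sets (path_space T) \<and>
     gaussian_process P {0..T} (\<lambda>t \<omega>. \<omega> t) \<and>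
     (\<forall>t\<in>{0..T}. (\<integral>\<omega>. \<omega> t \<partial>P) = 0) \<and>
     (\<forall>t\<in>{0..T}. \<forall>s\<in>{0..T}. (\<integral>\<omega>. \<omega> t * \<omega> s \<partial>P) = bifbm_cov H K t s)"


section \<open>The covariance measure\<close>

text \<open>A finite signed measure \<open>\<mu>\<close> is represented by its Jordan decomposition
  \<open>(\<mu>\<^sup>+, \<mu>\<^sup>-)\<close>, i.e. by two mutually singular finite measures; so \<open>\<mu> = \<mu>\<^sup>+ - \<mu>\<^sup>-\<close>
  and \<open>\<bar>\<mu>\<bar> = \<mu>\<^sup>+ + \<mu>\<^sup>-\<close>.\<close>

type_synonym 'a signed_measure = "'a measure \<times> 'a measure"

definition finite_signed_measure :: "'a measure \<Rightarrow> 'a signed_measure \<Rightarrow> bool" where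
  "finite_signed_measure S \<mu> \<longleftrightarrow>
     finite_measure (fst \<mu>) \<and> sets (fst \<mu>) = sets S \<and>
     finite_measure (snd \<mu>) \<and> sets (snd \<mu>) = sets S \<and>
     (\<exists>A\<in>sets S. emeasure (fst \<mu>) (space S - A) = 0 \<and> emeasure (snd \<mu>) A = 0)"

definition smeasure :: "'a signed_measure \<Rightarrow> 'a set \<Rightarrow> real" where
  "smeasure \<mu> A = measure (fst \<mu>) A - measure (snd \<mu>) A"

definition sintegral :: "'a signed_measure \<Rightarrow> ('a \<Rightarrow> real) \<Rightarrow> real" where
  "sintegral \<mu> h = integral\<^sup>L (fst \<mu>) h - integral\<^sup>L (snd \<mu>) h"

definition nn_integral_variation :: "'a signed_measure \<Rightarrow> ('a \<Rightarrow> ennreal) \<Rightarrow> ennreal" where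
  "nn_integral_variation \<mu> h = integral\<^sup>N (fst \<mu>) h + integral\<^sup>N (snd \<mu>) h"

definition covariance_measure ::
  "real \<Rightarrow> real \<Rightarrow> real \<Rightarrow> (real \<times> real) signed_measure \<Rightarrow> bool" where
  "covariance_measure H K T \<mu> \<longleftrightarrow>
     finite_signed_measure (restrict_space borel ({0..T} \<times> {0..T})) \<mu> \<and>
     (\<forall>s\<in>{0..T}. \<forall>t\<in>{0..T}. smeasure \<mu> ({0..s} \<times> {0..t}) = bifbm_cov H K s t)"


section \<open>The Wiener integral\<close>

definition norm_absH_sq :: "(real \<times> real) signed_measure \<Rightarrow> (real \<Rightarrow> real) \<Rightarrow> ennreal" where
  "norm_absH_sq \<mu> \<phi> = nn_integral_variation \<mu> (\<lambda>(u, v). ennreal (\<bar>\<phi> u\<bar> * \<bar>\<phi> v\<bar>))"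

definition inner_H ::
  "(real \<times> real) signed_measure \<Rightarrow> (real \<Rightarrow> real) \<Rightarrow> (real \<Rightarrow> real) \<Rightarrow> real" where
  "inner_H \<mu> \<phi> \<psi> = sintegral \<mu> (\<lambda>(u, v). \<phi> u * \<psi> v)"

text \<open>Values of the functions outside \<open>[0,T]\<close> are irrelevant.\<close>

definition L_mu :: "real \<Rightarrow> (real \<times> real) signed_measure \<Rightarrow> (real \<Rightarrow> real) set" where
  "L_mu T \<mu> = {\<phi> \<in> borel_measurable (restrict_space borel {0..T}). norm_absH_sq \<mu> \<phi> < \<infinity>}"

definition L2_rv :: "'w measure \<Rightarrow> ('w \<Rightarrow> real) set" where
  "L2_rv M = {Z \<in> borel_measurable M. integrable M (\<lambda>\<omega>. (Z \<omega>)\<^sup>2)}"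

text \<open>\<open>W \<phi>\<close> is a version of \<open>\<integral>\<phi> dX\<close>, with \<open>X\<close> the coordinate process on \<open>M\<close>.\<close>

definition wiener_integral ::
  "real \<Rightarrow> (real \<times> real) signed_measure \<Rightarrow> (real \<Rightarrow> real) measure \<Rightarrow>
   ((real \<Rightarrow> real) \<Rightarrow> (real \<Rightarrow> real) \<Rightarrow> real) \<Rightarrow> bool" where
  "wiener_integral T \<mu> M W \<longleftrightarrow>
     W ` L_mu T \<mu> \<subseteq> L2_rv M \<and>
     (\<forall>\<phi>\<in>L_mu T \<mu>. \<forall>\<psi>\<in>L_mu T \<mu>. \<forall>a b.
        AE \<omega> in M. W (\<lambda>s. a * \<phi> s + b * \<psi> s) \<omega> = a * W \<phi> \<omega> + b * W \<psi> \<omega>) \<and>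
     (\<forall>\<phi>\<in>L_mu T \<mu>. \<forall>\<Phi>. range \<Phi> \<subseteq> L_mu T \<mu> \<longrightarrow>
        (\<lambda>n. inner_H \<mu> (\<lambda>s. \<Phi> n s - \<phi> s) (\<lambda>s. \<Phi> n s - \<phi> s)) \<longlonglongrightarrow> 0 \<longrightarrow>
        (\<lambda>n::nat. \<integral>\<omega>. (W (\<Phi> n) \<omega> - W \<phi> \<omega>)\<^sup>2 \<partial>M) \<longlonglongrightarrow> 0) \<and>
     (\<forall>t\<in>{0..T}. AE \<omega> in M. W (indicator {0..t}) \<omega> = \<omega> t)"


section \<open>Smooth cylindrical random variables\<close>

text \<open>A function on \<open>\<real>\<^sup>n\<close> is represented by a function of sequences \<open>x\<close> that depends on
  \<open>x 0, \<dots>, x (n - 1)\<close> only; for such functions continuity in the product topology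
  is continuity on \<open>\<real>\<^sup>n\<close>.\<close>

definition partial_deriv ::
  "nat \<Rightarrow> ((nat \<Rightarrow> real) \<Rightarrow> real) \<Rightarrow> (nat \<Rightarrow> real) \<Rightarrow> real" where
  "partial_deriv i g x = deriv (\<lambda>y. g (x(i := y))) (x i)"

primrec iter_partial_deriv ::
  "nat list \<Rightarrow> ((nat \<Rightarrow> real) \<Rightarrow> real) \<Rightarrow> (nat \<Rightarrow> real) \<Rightarrow> real" where
  "iter_partial_deriv [] g = g"
| "iter_partial_deriv (i # is) g = partial_deriv i (iter_partial_deriv is g)"

definition Cb_infinity :: "nat \<Rightarrow> ((nat \<Rightarrow> real) \<Rightarrow> real) set" where
  "Cb_infinity n =
     {g. (\<forall>x y. (\<forall>i<n. x i = y i) \<longrightarrow> g x = g y) \<and>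
         (\<forall>is. set is \<subseteq> {..<n} \<longrightarrow>
            continuous_on UNIV (iter_partial_deriv is g) \<and>
            bounded (range (iter_partial_deriv is g)) \<and>
            (\<forall>i<n. \<forall>x. (\<lambda>y. iter_partial_deriv is g (x(i := y))) differentiable (at (x i))))}"

text \<open>\<open>cyl W g \<phi>\<close> is \<open>F = g(\<integral>\<phi>\<^sub>0 dX, \<dots>, \<integral>\<phi>\<^sub>n\<^sub>-\<^sub>1 dX)\<close>, and
  \<open>cyl_deriv W n g \<phi>\<close> is \<open>DF\<close>.\<close>

definition cyl ::
  "((real \<Rightarrow> real) \<Rightarrow> 'w \<Rightarrow> real) \<Rightarrow> ((nat \<Rightarrow> real) \<Rightarrow> real) \<Rightarrow>
   (nat \<Rightarrow> real \<Rightarrow> real) \<Rightarrow> 'w \<Rightarrow> real" where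
  "cyl W g \<phi> \<omega> = g (\<lambda>i. W (\<phi> i) \<omega>)"

definition cyl_deriv ::
  "((real \<Rightarrow> real) \<Rightarrow> 'w \<Rightarrow> real) \<Rightarrow> nat \<Rightarrow> ((nat \<Rightarrow> real) \<Rightarrow> real) \<Rightarrow>
   (nat \<Rightarrow> real \<Rightarrow> real) \<Rightarrow> real \<Rightarrow> 'w \<Rightarrow> real" where
  "cyl_deriv W n g \<phi> s \<omega> = (\<Sum>i<n. partial_deriv i g (\<lambda>j. W (\<phi> j) \<omega>) * \<phi> i s)"


section \<open>The Skorohod integral\<close>

definition has_skorohod_integral ::
  "real \<Rightarrow> (real \<times> real) signed_measure \<Rightarrow> (real \<Rightarrow> real) measure \<Rightarrow>
   ((real \<Rightarrow> real) \<Rightarrow> (real \<Rightarrow> real) \<Rightarrow> real) \<Rightarrow>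
   (real \<Rightarrow> (real \<Rightarrow> real) \<Rightarrow> real) \<Rightarrow> ((real \<Rightarrow> real) \<Rightarrow> real) \<Rightarrow> bool" where
  "has_skorohod_integral T \<mu> M W u Z \<longleftrightarrow>
     (\<lambda>(s, \<omega>). u s \<omega>) \<in> borel_measurable (restrict_space borel {0..T} \<Otimes>\<^sub>M M) \<and>
     (\<integral>\<^sup>+\<omega>. norm_absH_sq \<mu> (\<lambda>s. u s \<omega>) \<partial>M) < \<infinity> \<and>
     Z \<in> L2_rv M \<and> (\<integral>\<omega>. Z \<omega> \<partial>M) = 0 \<and>
     (\<forall>n. \<forall>g\<in>Cb_infinity n. \<forall>\<phi>. (\<forall>i<n. \<phi> i \<in> L_mu T \<mu>) \<longrightarrow>
        (\<integral>\<omega>. cyl W g \<phi> \<omega> * Z \<omega> \<partial>M) =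
        (\<integral>\<omega>. inner_H \<mu> (\<lambda>s. cyl_deriv W n g \<phi> s \<omega>) (\<lambda>s. u s \<omega>) \<partial>M))"

definition skorohod_dom ::
  "real \<Rightarrow> (real \<times> real) signed_measure \<Rightarrow> (real \<Rightarrow> real) measure \<Rightarrow>
   ((real \<Rightarrow> real) \<Rightarrow> (real \<Rightarrow> real) \<Rightarrow> real) \<Rightarrow> (real \<Rightarrow> (real \<Rightarrow> real) \<Rightarrow> real) set" where
  "skorohod_dom T \<mu> M W = {u. \<exists>Z. has_skorohod_integral T \<mu> M W u Z}"

text \<open>A version of the almost surely unique \<open>Z\<close>.\<close>

definition skorohod_integral ::
  "real \<Rightarrow> (real \<times> real) signed_measure \<Rightarrow> (real \<Rightarrow> real) measure \<Rightarrow>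
   ((real \<Rightarrow> real) \<Rightarrow> (real \<Rightarrow> real) \<Rightarrow> real) \<Rightarrow>
   (real \<Rightarrow> (real \<Rightarrow> real) \<Rightarrow> real) \<Rightarrow> (real \<Rightarrow> real) \<Rightarrow> real" where
  "skorohod_integral T \<mu> M W u = (SOME Z. has_skorohod_integral T \<mu> M W u Z)"

definition restrict_process ::
  "real \<Rightarrow> (real \<Rightarrow> 'w \<Rightarrow> real) \<Rightarrow> real \<Rightarrow> 'w \<Rightarrow> real" where
  "restrict_process t u s \<omega> = u s \<omega> * indicator {0..t} s"

end

theory Submission
  imports Defs
begin

text \<open>The proof avoids stochastic calculus on the Wiener space. By uniqueness of the Skorohod integral
  it suffices to test \<open>Z = f(X\<^sub>t) - f(0) - HK \<integral>\<^sub>0\<^sup>t f''(X\<^sub>s) s\<^sup>2\<^sup>H\<^sup>K\<^sup>-\<^sup>1 ds\<close> against cylindrical variables \<open>F\<close>.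
  Both sides of the duality relation pass from \<open>F = cos (\<Gamma> + b)\<close> with \<open>\<Gamma>\<close> in the Gaussian space
  to general \<open>F\<close>, and from trigonometric polynomials \<open>f\<close> to general \<open>f\<close>. For
  \<open>f = cos (\<theta> x + a)\<close> all expectations are explicit, and the relation becomes the chain rule for
  the exponential of \<open>s \<mapsto> - E(\<Gamma> + \<theta> X\<^sub>s)\<^sup>2 / 2\<close>, because \<open>E X\<^sub>s\<^sup>2 = s\<^sup>2\<^sup>H\<^sup>K\<close> and
  \<open>s \<mapsto> E(\<Gamma> X\<^sub>s)\<close> is absolutely continuous. The latter holds since the variation of \<open>\<mu>\<close> has
  marginals with bounded Lebesgue densities, which one reads off a decomposition of the covariance into two
  distribution functions of positive measures; a lower bound on the marginals of \<open>\<mu>\<close> itself gives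
  \<open>L\<^sub>\<mu> \<subseteq> L\<^sup>1\<close>, so that every \<open>\<phi> \<in> L\<^sub>\<mu>\<close> pairs with bounded functions through a Lebesgue density.\<close>

section \<open>Approximation by trigonometric polynomials\<close>

text \<open>Bounded pointwise convergence of trigonometric polynomials to a test function says
  nothing about derivatives; the duality relation must therefore first be brought into a form that
  contains only values of the test function. The Wiener integral is given merely by linearity, its
  values on indicators and continuity along sequences for the seminorm. Its isometry, Gaussian
  character and covariance with the coordinates have to be derived, for bounded integrands by a
  monotone class argument and then for \<open>L_mu\<close> by truncation. The decomposition of the
  covariance comes from adding and subtracting \<open>s^(2HK) + t^(2HK)\<close>: up to a constant,
  one part is the covariance of fractional Brownian motion with Hurst index \<open>HK\<close>, the
  other measures the subadditivity of \<open>x^K\<close>. The derivative of each in the first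
  variable is nonnegative and nondecreasing in the second, which makes both of them distribution
  functions. To reach general \<open>f\<close>, it is \<open>f''\<close> that is approximated; two
  integrations with the initial data of \<open>f\<close> keep the growth bounds uniform. The
  antiderivatives contain polynomials of degree up to two, which have to be reached by a
  limit.\<close>

inductive trig_poly :: "nat \<Rightarrow> ((nat \<Rightarrow> real) \<Rightarrow> real) \<Rightarrow> bool" for n where
  cos: "trig_poly n (\<lambda>x. cos ((\<Sum>i<n. l i * x i) + b))"
| add: "trig_poly n g \<Longrightarrow> trig_poly n h \<Longrightarrow> trig_poly n (\<lambda>x. g x + h x)"
| scale: "trig_poly n g \<Longrightarrow> trig_poly n (\<lambda>x. c * g x)"

lemma trig_poly_const: "trig_poly n (\<lambda>x. c)"
  using trig_poly.scale[OF trig_poly.cos[of n "\<lambda>_. 0" 0], of c] by simp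

lemma trig_poly_sin_coord:
  assumes "i < n" shows "trig_poly n (\<lambda>x. sin (a * x i))"
proof -
  have "(\<Sum>j<n. (if j = i then a else 0) * x j) = a * x i" for x :: "nat \<Rightarrow> real"
    using assms by (simp add: if_distrib[of "\<lambda>z. z * _"] cong: if_cong)
  then show ?thesis
    using trig_poly.cos[of n "\<lambda>j. if j = i then a else 0" "- pi / 2"]
    by (simp add: cos_diff)
qed

text \<open>The product-to-sum formula: frequencies and phases are added and subtracted. The free
  phase \<open>b\<close> lets a class built from cosines alone contain the sines as well.\<close>

lemma trig_poly_cos_mult:
  assumes "trig_poly n g"
  shows "trig_poly n (\<lambda>x. cos ((\<Sum>i<n. l i * x i) + b) * g x)"
  using assms
proof induction
  case (cos l' b')
  have eq: "cos ((\<Sum>i<n. l i * x i) + b) * cos ((\<Sum>i<n. l' i * x i) + b') =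
      1 / 2 * cos ((\<Sum>i<n. (l i + l' i) * x i) + (b + b')) +
      1 / 2 * cos ((\<Sum>i<n. (l i - l' i) * x i) + (b - b'))" for x :: "nat \<Rightarrow> real"
    by (simp add: cos_times_cos sum_subtractf sum.distrib algebra_simps add_divide_distrib)
  show ?case unfolding eq by (intro trig_poly.intros)
next
  case (add g h)
  then show ?case using trig_poly.add[OF add.IH] by (simp add: algebra_simps)
next
  case (scale g c)
  then show ?case using trig_poly.scale[OF scale.IH, of c] by (simp add: algebra_simps)
qed

lemma trig_poly_mult:
  assumes "trig_poly n g" "trig_poly n h"
  shows "trig_poly n (\<lambda>x. g x * h x)"
  using assms
proof (induction arbitrary: h)
  case (cos l b) then show ?case by (rule trig_poly_cos_mult)
next
  case (add g1 g2)
  then show ?case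
    unfolding distrib_right by (intro trig_poly.add add.IH)
next
  case (scale g c)
  then show ?case unfolding mult.assoc by (intro trig_poly.scale scale.IH)
qed

lemma trig_poly_continuous: "trig_poly n g \<Longrightarrow> continuous_on UNIV g"
  by (induction rule: trig_poly.induct)
     (auto intro!: continuous_intros continuous_on_product_coordinates)

lemma trig_poly_bounded: "trig_poly n g \<Longrightarrow> \<exists>B. \<forall>x. \<bar>g x\<bar> \<le> B"
proof (induction rule: trig_poly.induct)
  case (cos l b) then show ?case by (intro exI[of _ 1]) simp
next
  case (add g h)
  then obtain B1 B2 where "\<And>x. \<bar>g x\<bar> \<le> B1" "\<And>x. \<bar>h x\<bar> \<le> B2" by auto
  then show ?case by (intro exI[of _ "B1 + B2"] allI order_trans[OF abs_triangle_ineq] add_mono)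
next
  case (scale g c)
  then obtain B where "\<And>x. \<bar>g x\<bar> \<le> B" by auto
  then show ?case by (intro exI[of _ "\<bar>c\<bar> * B"]) (auto simp: abs_mult intro: mult_left_mono)
qed

text \<open>The algebra for Stone-Weierstrass. Ordinary polynomials are taken because they separate
  the points of the cube; sines are substituted for the coordinates afterwards.\<close>

inductive coord_poly :: "nat \<Rightarrow> ((nat \<Rightarrow> real) \<Rightarrow> real) \<Rightarrow> bool" for n where
  const: "coord_poly n (\<lambda>x. c)"
| coord: "i < n \<Longrightarrow> coord_poly n (\<lambda>x. x i)"
| add: "coord_poly n g \<Longrightarrow> coord_poly n h \<Longrightarrow> coord_poly n (\<lambda>x. g x + h x)"
| mult: "coord_poly n g \<Longrightarrow> coord_poly n h \<Longrightarrow> coord_poly n (\<lambda>x. g x * h x)"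

lemma coord_poly_continuous: "coord_poly n g \<Longrightarrow> continuous_on UNIV g"
  by (induction rule: coord_poly.induct)
     (auto intro!: continuous_intros continuous_on_product_coordinates)

lemma trig_poly_coord_poly_sin:
  assumes "coord_poly n g"
  shows "trig_poly n (\<lambda>x. g (\<lambda>i. if i < n then sin (a * x i) else 0))"
  using assms
  by induction (simp_all add: trig_poly_const trig_poly_sin_coord trig_poly.add trig_poly_mult)

text \<open>Compact by Tychonoff. The coordinates from \<open>n\<close> on are frozen at 0, so that
  polynomials in the first \<open>n\<close> coordinates separate the points of this set of
  sequences.\<close>

lemma compact_cube: "compact {z :: nat \<Rightarrow> real. (\<forall>i<n. z i \<in> {-1..1}) \<and> (\<forall>i\<ge>n. z i = 0)}"
proof -
  have "{z :: nat \<Rightarrow> real. (\<forall>i<n. z i \<in> {-1..1}) \<and> (\<forall>i\<ge>n. z i = 0)} =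
      PiE UNIV (\<lambda>i. if i < n then {-1..1} else {0})"
    by (auto simp: PiE_def Pi_def not_less split: if_splits)
  moreover have "compactin (product_topology (\<lambda>i. euclidean) UNIV)
      (PiE UNIV (\<lambda>i::nat. if i < n then {-1..1} else {0::real}))"
    by (subst compactin_PiE) (auto simp: compact_Icc)
  ultimately show ?thesis
    by (simp add: euclidean_product_topology)
qed

text \<open>Stone--Weierstrass applied to \<open>g\<close> in the coordinates \<open>sin (\<pi> x\<^sub>i / (2 R))\<close>: composing \<open>g\<close>
  with the triangle wave \<open>(2 R / \<pi>) arcsin (sin (\<pi> x / (2 R)))\<close>, which is the identity on
  \<open>[-R, R]\<close>, makes the approximation uniform on the whole space.\<close>

lemma trig_poly_approx:
  fixes g :: "(nat \<Rightarrow> real) \<Rightarrow> real"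
  assumes dep: "\<And>x y. (\<forall>i<n. x i = y i) \<Longrightarrow> g x = g y"
    and cont: "continuous_on UNIV g" and bdd: "\<And>x. \<bar>g x\<bar> \<le> B"
    and R: "0 < R" and e: "0 < e"
  shows "\<exists>p. trig_poly n p \<and> (\<forall>x. \<bar>p x\<bar> \<le> B + e) \<and>
    (\<forall>x. (\<forall>i<n. \<bar>x i\<bar> \<le> R) \<longrightarrow> \<bar>g x - p x\<bar> < e)"
proof -
  define S where "S = {z :: nat \<Rightarrow> real. (\<forall>i<n. z i \<in> {-1..1}) \<and> (\<forall>i\<ge>n. z i = 0)}"
  define h where "h z = g (\<lambda>i. 2 * R / pi * arcsin (z i))" for z
  define s where "s x = (\<lambda>i. if i < n then sin (pi / (2 * R) * x i) else 0)" for x :: "nat \<Rightarrow> real"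
  have "function_ring_on (Collect (coord_poly n)) S"
  proof
    show "compact S" unfolding S_def by (rule compact_cube)
    fix x y :: "nat \<Rightarrow> real" assume xy: "x \<in> S" "y \<in> S" "x \<noteq> y"
    obtain i where "i < n" "x i \<noteq> y i"
    proof -
      from xy(3) obtain i where i: "x i \<noteq> y i" by auto
      moreover have "i < n"
      proof (rule ccontr)
        assume "\<not> i < n"
        then have "x i = 0" "y i = 0" using xy(1,2) by (auto simp: S_def)
        then show False using i by simp
      qed
      ultimately show thesis using that by blast
    qed
    then show "\<exists>f\<in>Collect (coord_poly n). f x \<noteq> f y"
      by (intro bexI[of _ "\<lambda>x. x i"]) (auto intro: coord_poly.coord)
  next
    fix f assume "f \<in> Collect (coord_poly n)"
    then show "continuous_on S f"
      by (metis coord_poly_continuous continuous_on_subset mem_Collect_eq subset_UNIV)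
  qed (simp_all add: coord_poly.const coord_poly.add coord_poly.mult)
  moreover have "continuous_on S h"
  proof -
    have "continuous_on S (\<lambda>z i. 2 * R / pi * arcsin (z i))"
    proof (rule continuous_on_coordinatewise_then_product)
      fix i
      have "z i \<in> {-1..1}" if "z \<in> S" for z using that unfolding S_def by (cases "i < n") auto
      then have "continuous_on S (\<lambda>z. arcsin (z i))"
        by (intro continuous_on_arcsin continuous_on_subset[OF continuous_on_product_coordinates]) auto
      then show "continuous_on S (\<lambda>z. 2 * R / pi * arcsin (z i))"
        by (rule continuous_on_mult_left)
    qed
    then show ?thesis unfolding h_def
      by (rule continuous_on_compose2[OF cont]) auto
  qed
  ultimately obtain q where q: "coord_poly n q" "\<And>z. z \<in> S \<Longrightarrow> \<bar>h z - q z\<bar> < e"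
    using function_ring_on.Stone_Weierstrass_basic[of "Collect (coord_poly n)" S h e] e by auto
  have sS: "s x \<in> S" for x by (auto simp: S_def s_def)
  show ?thesis
  proof (intro exI[of _ "\<lambda>x. q (s x)"] conjI allI impI)
    show "trig_poly n (\<lambda>x. q (s x))"
      unfolding s_def by (rule trig_poly_coord_poly_sin) fact
    fix x
    \<comment> \<open>The global bound costs nothing: \<open>s x\<close> always lies in
      \<open>S\<close>, where \<open>q\<close> is \<open>e\<close>-close to \<open>h\<close>, and
      every value of \<open>h\<close> is a value of \<open>g\<close>.\<close>
    have "\<bar>h (s x)\<bar> \<le> B" unfolding h_def by (rule bdd)
    then show "\<bar>q (s x)\<bar> \<le> B + e" using q(2)[OF sS, of x] by linarith
    assume x: "\<forall>i<n. \<bar>x i\<bar> \<le> R"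
    have "h (s x) = g x" unfolding h_def
    proof (rule dep, intro allI impI)
      fix i assume i: "i < n"
      have "- (pi / 2) \<le> pi / (2 * R) * x i" "pi / (2 * R) * x i \<le> pi / 2"
      proof -
        have "pi / (2 * R) * \<bar>x i\<bar> \<le> pi / (2 * R) * R"
          by (intro mult_left_mono) (use x i R in auto)
        then have "\<bar>pi / (2 * R) * x i\<bar> \<le> pi / 2" using R by (simp add: abs_mult)
        then show "- (pi / 2) \<le> pi / (2 * R) * x i" "pi / (2 * R) * x i \<le> pi / 2"
          by (simp_all only: abs_le_iff) linarith
      qed
      then have "arcsin (sin (pi / (2 * R) * x i)) = pi / (2 * R) * x i"
        by (rule arcsin_sin)
      then show "2 * R / pi * arcsin (s x i) = x i" using i R by (simp add: s_def)
    qed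
    then show "\<bar>g x - q (s x)\<bar> < e" using q(2)[OF sS, of x] by simp
  qed
qed

text \<open>Error and cube are tied to the same index: accuracy \<open>1 / (k + 1)\<close> on the
  cube of radius \<open>k + 1\<close>, so every fixed point is eventually inside. The bound
  \<open>B + 1\<close> is uniform in \<open>k\<close>, which is what dominated convergence asks
  for.\<close>

lemma trig_poly_approx_seq:
  fixes g :: "(nat \<Rightarrow> real) \<Rightarrow> real"
  assumes dep: "\<And>x y. (\<forall>i<n. x i = y i) \<Longrightarrow> g x = g y"
    and cont: "continuous_on UNIV g" and bdd: "\<And>x. \<bar>g x\<bar> \<le> B"
  obtains p where "\<And>k. trig_poly n (p k)" "\<And>k x. \<bar>p k x\<bar> \<le> B + 1" "\<And>x. (\<lambda>k. p k x) \<longlonglongrightarrow> g x"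
proof -
  have "\<exists>p. trig_poly n p \<and> (\<forall>x. \<bar>p x\<bar> \<le> B + 1 / real (Suc k)) \<and>
    (\<forall>x. (\<forall>i<n. \<bar>x i\<bar> \<le> real (Suc k)) \<longrightarrow> \<bar>g x - p x\<bar> < 1 / real (Suc k))" for k
    by (rule trig_poly_approx[OF dep cont bdd]) auto
  then obtain p where p: "\<And>k. trig_poly n (p k)" "\<And>k x. \<bar>p k x\<bar> \<le> B + 1 / real (Suc k)"
    "\<And>k x. (\<forall>i<n. \<bar>x i\<bar> \<le> real (Suc k)) \<Longrightarrow> \<bar>g x - p k x\<bar> < 1 / real (Suc k)"
    by metis
  show thesis
  proof (rule that[of p])
    fix k x
    have "1 / real (Suc k) \<le> 1" by simp
    then show "\<bar>p k x\<bar> \<le> B + 1" using p(2)[of k x] by linarith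
  next
    fix x
    obtain N where N: "(\<Sum>i<n. \<bar>x i\<bar>) \<le> real N" using real_arch_simple by blast
    have "\<bar>x i\<bar> \<le> real (Suc k)" if "N \<le> k" "i < n" for i k
      using member_le_sum[of i "{..<n}" "\<lambda>i. \<bar>x i\<bar>"] N that by auto
    then have "\<forall>\<^sub>F k in sequentially. norm (p k x - g x) \<le> 1 / real (Suc k)"
      using p(3) by (intro eventually_sequentiallyI[of N])
        (auto simp: abs_minus_commute intro!: less_imp_le)
    then have "(\<lambda>k. p k x - g x) \<longlonglongrightarrow> 0"
      by (rule Lim_null_comparison) (rule LIMSEQ_Suc[OF lim_1_over_n])
    then show "(\<lambda>k. p k x) \<longlonglongrightarrow> g x" by (simp add: LIM_zero_iff)
  qed (fact p(1))
qed

section \<open>Integration by parts: from trigonometric to smooth test functions\<close>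

definition box_shift :: "nat \<Rightarrow> real \<Rightarrow> (nat \<Rightarrow> real) \<Rightarrow> (nat \<Rightarrow> real) \<Rightarrow> nat \<Rightarrow> real" where
  "box_shift n e x u = (\<lambda>i. if i < n then x i + e * u i else x i)"

abbreviation unif01 :: "real measure" where
  "unif01 \<equiv> density lborel (\<lambda>x. ennreal (indicator {0..1} x))"

lemma prob_space_unif01: "prob_space unif01"
  by standard (simp add: emeasure_density ennreal_indicator)

lemma unif01_FTC:
  assumes "\<And>x. (F has_real_derivative f x) (at x)" "continuous_on UNIV f"
  shows "(\<integral>x. f x \<partial>unif01) = F 1 - F 0"
proof -
  have "(\<integral>x. f x \<partial>unif01) = (\<integral>x. f x * indicator {0..1} x \<partial>lborel)"
    using assms(2) by (subst integral_density)
      (auto simp: mult.commute intro!: borel_measurable_continuous_onI)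
  also have "\<dots> = F 1 - F 0"
    by (rule integral_FTC_Icc_real)
      (use assms in \<open>auto simp: continuous_on_eq_continuous_at\<close>)
  finally show ?thesis .
qed

abbreviation box_noise :: "nat \<Rightarrow> (nat \<Rightarrow> real) measure" where
  "box_noise n \<equiv> Pi\<^sub>M {..<n} (\<lambda>_. unif01)"

lemma prob_space_box_noise: "prob_space (box_noise n)"
  by (intro prob_space_PiM prob_space_unif01)

text \<open>In the direction \<open>j\<close> the fundamental theorem of calculus applies: the left
  integrand is the derivative of the cosine divided by \<open>e\<close> with respect to
  \<open>u j\<close>. What remains is constant in \<open>u j\<close>, so it may be integrated over
  the full cube again.\<close>

lemma box_noise_integral_sin:
  assumes j: "j < n" and e: "e \<noteq> 0"
  shows "(\<integral>u. - l j * sin (y + e * (\<Sum>i<n. l i * u i)) \<partial>box_noise n) =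
    (\<integral>u. (cos (y + e * (\<Sum>i<n. l i * (u(j := 1)) i)) - cos (y + e * (\<Sum>i<n. l i * (u(j := 0)) i))) / e
      \<partial>box_noise n)"
proof -
  interpret unif: prob_space unif01 by (rule prob_space_unif01)
  interpret product_prob_space "\<lambda>_. unif01" "UNIV :: nat set" by unfold_locales
  interpret bn: prob_space "box_noise n" by (rule prob_space_box_noise)
  define I where "I = {..<n} - {j}"
  have I: "{..<n} = insert j I" "finite I" "j \<notin> I" using j by (auto simp: I_def)
  have upd: "(\<Sum>i<n. l i * (u(j := r)) i) = (\<Sum>i\<in>I. l i * u i) + l j * r" for u r
  proof -
    have "(\<Sum>i\<in>I. l i * (u(j := r)) i) = (\<Sum>i\<in>I. l i * u i)"
      using I(3) by (intro sum.cong) auto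
    then show ?thesis using I by simp
  qed
  have ints: "(\<lambda>u. \<Sum>i<n. l i * u i) \<in> borel_measurable (box_noise n)"
    by (intro borel_measurable_sum borel_measurable_times borel_measurable_const)
       (auto intro!: measurable_component_singleton[THEN measurable_compose])
  have meas_upd: "(\<lambda>u. (u(j := r)) i) \<in> borel_measurable (box_noise n)" if "i < n" for i r
    using that by (cases "i = j") (auto intro!: measurable_component_singleton[THEN measurable_compose])
  have int2: "(\<lambda>u. \<Sum>i<n. l i * (u(j := r)) i) \<in> borel_measurable (box_noise n)" for r
    by (intro borel_measurable_sum borel_measurable_times borel_measurable_const meas_upd) auto
  have i1: "integrable (box_noise n) (\<lambda>u. - l j * sin (y + e * (\<Sum>i<n. l i * u i)))"
    by (rule bn.integrable_const_bound[where B = "\<bar>l j\<bar>"])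
       (use ints in \<open>auto simp: abs_mult intro!: mult_left_le\<close>)
  have i2: "integrable (box_noise n) (\<lambda>u. (cos (y + e * (\<Sum>i<n. l i * (u(j := 1)) i)) - cos (y + e * (\<Sum>i<n. l i * (u(j := 0)) i))) / e)"
  proof (rule bn.integrable_const_bound[where B = "2 / \<bar>e\<bar>"])
    have "\<bar>cos a - cos b\<bar> \<le> 2" for a b :: real
      using cos_ge_minus_one[of a] cos_le_one[of a] cos_ge_minus_one[of b] cos_le_one[of b] by linarith
    then show "AE u in box_noise n. norm ((cos (y + e * (\<Sum>i<n. l i * (u(j := 1)) i)) - cos (y + e * (\<Sum>i<n. l i * (u(j := 0)) i))) / e) \<le> 2 / \<bar>e\<bar>"
      by (auto simp: intro!: divide_right_mono)
  qed (use int2 in measurable)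
  have inner: "(\<integral>r. - l j * sin (y + e * (s + l j * r)) \<partial>unif01) =
      (cos (y + e * (s + l j * 1)) - cos (y + e * (s + l j * 0))) / e" for s
    by (subst unif01_FTC[where F = "\<lambda>r. cos (y + e * (s + l j * r)) / e"])
       (use e in \<open>auto intro!: derivative_eq_intros continuous_intros simp: diff_divide_distrib\<close>)
  have "(\<integral>u. - l j * sin (y + e * (\<Sum>i<n. l i * u i)) \<partial>box_noise n) =
      (\<integral>u. \<integral>r. - l j * sin (y + e * (\<Sum>i<n. l i * (u(j := r)) i)) \<partial>unif01 \<partial>Pi\<^sub>M I (\<lambda>_. unif01))"
    using i1 unfolding I(1) by (intro product_integral_insert I) auto
  also have "\<dots> = (\<integral>u. (cos (y + e * ((\<Sum>i\<in>I. l i * u i) + l j * 1)) - cos (y + e * ((\<Sum>i\<in>I. l i * u i) + l j * 0))) / e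
      \<partial>Pi\<^sub>M I (\<lambda>_. unif01))"
    unfolding upd inner ..
  \<comment> \<open>The new variable \<open>r\<close> is overwritten at once by
    \<open>j := 1\<close> and \<open>j := 0\<close>; the integral over it has total mass 1 and only
    restores the product form.\<close>
  also have "\<dots> = (\<integral>u. \<integral>r. (cos (y + e * (\<Sum>i<n. l i * (u(j := r, j := 1)) i)) - cos (y + e * (\<Sum>i<n. l i * (u(j := r, j := 0)) i))) / e
      \<partial>unif01 \<partial>Pi\<^sub>M I (\<lambda>_. unif01))"
    unfolding fun_upd_upd upd using unif.prob_space by simp
  also have "\<dots> = (\<integral>u. (cos (y + e * (\<Sum>i<n. l i * (u(j := 1)) i)) - cos (y + e * (\<Sum>i<n. l i * (u(j := 0)) i))) / e
      \<partial>box_noise n)"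
    using i2 unfolding I(1) by (intro product_integral_insert[symmetric] I) auto
  finally show ?thesis .
qed

lemma measurable_box_shift:
  assumes "\<And>i. (\<lambda>x. v x i) \<in> borel_measurable N" "\<And>i. i < n \<Longrightarrow> (\<lambda>x. w x i) \<in> borel_measurable N"
  shows "(\<lambda>x. box_shift n e (v x) (w x)) \<in> borel_measurable N"
proof (rule measurable_coordinatewise_then_product)
  fix i
  show "(\<lambda>x. box_shift n e (v x) (w x) i) \<in> borel_measurable N"
    using assms[of i] by (cases "i < n") (auto simp: box_shift_def)
qed

text \<open>Integrating over a uniform noise in the cube turns the partial derivatives of the test
  function into difference quotients; the resulting identity only involves bounded continuous
  functionals of the test function, so it passes from trigonometric polynomials to all
  bounded continuous functions.\<close>

context prob_space
begin

context
  fixes n :: nat and G :: "nat \<Rightarrow> 'a \<Rightarrow> real" and Z :: "'a \<Rightarrow> real" and A :: "nat \<Rightarrow> 'a \<Rightarrow> real"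
  assumes G [measurable]: "\<And>i. G i \<in> borel_measurable M"
    and Z: "integrable M Z" and A: "\<And>j. j < n \<Longrightarrow> integrable M (A j)"
    and trig_ibp: "\<And>l b. (\<integral>\<omega>. cos ((\<Sum>i<n. l i * G i \<omega>) + b) * Z \<omega> \<partial>M) =
      (\<Sum>j<n. \<integral>\<omega>. - l j * sin ((\<Sum>i<n. l i * G i \<omega>) + b) * A j \<omega> \<partial>M)"
begin

interpretation bn: prob_space "box_noise n" by (rule prob_space_box_noise)
interpretation pair: pair_prob_space M "box_noise n" ..

text \<open>The difference of the two sides of the duality relation under noise of size
  \<open>e\<close>, with each partial derivative replaced by a difference quotient between opposite
  faces of the noise cube. Only values of \<open>g\<close> occur, so for fixed \<open>e\<close>
  bounded pointwise limits in \<open>g\<close> are harmless.\<close>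

definition noisy_defect :: "real \<Rightarrow> ((nat \<Rightarrow> real) \<Rightarrow> real) \<Rightarrow> 'a \<times> (nat \<Rightarrow> real) \<Rightarrow> real" where
  "noisy_defect e g z = g (box_shift n e (\<lambda>i. G i (fst z)) (snd z)) * Z (fst z) -
     (\<Sum>j<n. (g (box_shift n e (\<lambda>i. G i (fst z)) ((snd z)(j := 1))) -
              g (box_shift n e (\<lambda>i. G i (fst z)) ((snd z)(j := 0)))) / e * A j (fst z))"

lemma
  assumes g [measurable]: "g \<in> borel_measurable borel"
  shows meas_box_shift: "(\<lambda>z. g (box_shift n e (\<lambda>i. G i (fst z)) (snd z))) \<in> borel_measurable (M \<Otimes>\<^sub>M box_noise n)" (is ?a)
    and meas_box_shift_upd: "(\<lambda>z. g (box_shift n e (\<lambda>i. G i (fst z)) ((snd z)(j := r)))) \<in> borel_measurable (M \<Otimes>\<^sub>M box_noise n)" (is ?b)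
proof -
  have c: "(\<lambda>z. snd z i) \<in> borel_measurable (M \<Otimes>\<^sub>M box_noise n)" if "i < n" for i
    using that by (auto intro!: measurable_compose[OF measurable_snd]
        measurable_component_singleton[THEN measurable_compose])
  have c2: "(\<lambda>z. ((snd z)(j := r)) i) \<in> borel_measurable (M \<Otimes>\<^sub>M box_noise n)" if "i < n" for i
    using c[OF that] by (cases "i = j") auto
  show ?a by (rule measurable_compose[OF measurable_box_shift g]) (auto intro: c)
  show ?b by (rule measurable_compose[OF measurable_box_shift g]) (auto intro: c2 simp del: fun_upd_apply)
qed

lemma integrable_fst_mult_bounded:
  fixes Y :: "'a \<Rightarrow> real"
  assumes "integrable M Y" "h \<in> borel_measurable (M \<Otimes>\<^sub>M box_noise n)" "\<And>z. \<bar>h z\<bar> \<le> B"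
  shows "integrable (M \<Otimes>\<^sub>M box_noise n) (\<lambda>z. h z * Y (fst z))"
proof -
  have "integrable (distr (M \<Otimes>\<^sub>M box_noise n) M fst) Y"
    using assms(1) by (simp add: bn.distr_pair_fst)
  then have Y: "integrable (M \<Otimes>\<^sub>M box_noise n) (\<lambda>z. Y (fst z))"
    by (subst (asm) integrable_distr_eq) (use assms(1) in auto)
  show ?thesis
  proof (rule Bochner_Integration.integrable_bound[OF integrable_mult_right[OF Y, of B]])
    show "AE z in M \<Otimes>\<^sub>M box_noise n. norm (h z * Y (fst z)) \<le> norm (B * Y (fst z))"
      by (intro AE_I2) (auto simp: abs_mult intro!: mult_right_mono order_trans[OF assms(3) abs_ge_self])
  qed (use assms(2) Y in auto)
qed

lemma integrable_noisy_terms: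
  assumes g: "g \<in> borel_measurable borel" "\<And>x. \<bar>g x\<bar> \<le> B"
  shows "integrable (M \<Otimes>\<^sub>M box_noise n) (\<lambda>z. g (box_shift n e (\<lambda>i. G i (fst z)) (snd z)) * Z (fst z))"
    and "j < n \<Longrightarrow> integrable (M \<Otimes>\<^sub>M box_noise n)
      (\<lambda>z. (g (box_shift n e (\<lambda>i. G i (fst z)) ((snd z)(j := 1))) -
              g (box_shift n e (\<lambda>i. G i (fst z)) ((snd z)(j := 0)))) / e * A j (fst z))"
    and "integrable (M \<Otimes>\<^sub>M box_noise n) (noisy_defect e g)"
proof -
  show 1: "integrable (M \<Otimes>\<^sub>M box_noise n) (\<lambda>z. g (box_shift n e (\<lambda>i. G i (fst z)) (snd z)) * Z (fst z))"
    by (rule integrable_fst_mult_bounded[OF Z meas_box_shift[OF g(1)]]) (rule g(2))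
  show 2: "integrable (M \<Otimes>\<^sub>M box_noise n)
      (\<lambda>z. (g (box_shift n e (\<lambda>i. G i (fst z)) ((snd z)(j := 1))) -
              g (box_shift n e (\<lambda>i. G i (fst z)) ((snd z)(j := 0)))) / e * A j (fst z))" if "j < n" for j
  proof (rule integrable_fst_mult_bounded[OF A[OF that]])
    show "(\<lambda>z. (g (box_shift n e (\<lambda>i. G i (fst z)) ((snd z)(j := 1))) -
              g (box_shift n e (\<lambda>i. G i (fst z)) ((snd z)(j := 0)))) / e)
        \<in> borel_measurable (M \<Otimes>\<^sub>M box_noise n)"
      by (intro borel_measurable_divide borel_measurable_diff meas_box_shift_upd g borel_measurable_const)
    fix z
    show "\<bar>(g (box_shift n e (\<lambda>i. G i (fst z)) ((snd z)(j := 1))) -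
              g (box_shift n e (\<lambda>i. G i (fst z)) ((snd z)(j := 0)))) / e\<bar> \<le> (B + B) / \<bar>e\<bar>"
      using add_mono[OF g(2) g(2)]
      by (auto simp: simp del: mult_2 intro!: divide_right_mono order_trans[OF abs_triangle_ineq4])
  qed
  show "integrable (M \<Otimes>\<^sub>M box_noise n) (noisy_defect e g)"
    unfolding noisy_defect_def[abs_def]
    by (intro Bochner_Integration.integrable_diff Bochner_Integration.integrable_sum 1 2) auto
qed

text \<open>For a fixed noise \<open>u\<close> the shift of the arguments only changes the phase
  from \<open>b\<close> to \<open>b + e * (\<Sum>i<n. l i * u i)\<close>, and
  \<open>trig_ibp\<close> still applies. Fubini then brings the noise integral inside, where
  \<open>box_noise_integral_sin\<close> converts the sines into difference quotients.\<close>

lemma integral_noisy_defect_cos: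
  assumes e: "e \<noteq> 0"
  shows "(\<integral>z. noisy_defect e (\<lambda>x. cos ((\<Sum>i<n. l i * x i) + b)) z \<partial>(M \<Otimes>\<^sub>M box_noise n)) = 0"
proof -
  define g where "g x = cos ((\<Sum>i<n. l i * x i) + b)" for x :: "nat \<Rightarrow> real"
  have tp: "trig_poly n g" unfolding g_def[abs_def] by (rule trig_poly.cos)
  have gm: "g \<in> borel_measurable borel"
    by (rule borel_measurable_continuous_onI[OF trig_poly_continuous[OF tp]])
  have gb: "\<bar>g x\<bar> \<le> 1" for x by (simp add: g_def)
  define h where "h j x = - l j * sin ((\<Sum>i<n. l i * x i) + b)" for j and x :: "nat \<Rightarrow> real"
  have hm: "h j \<in> borel_measurable borel" for j
    unfolding h_def[abs_def]
    by (intro borel_measurable_continuous_onI continuous_intros continuous_on_product_coordinates)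
  have hb: "\<bar>h j x\<bar> \<le> \<bar>l j\<bar>" for j x by (auto simp: h_def abs_mult intro!: mult_left_le)
  have sh: "(\<Sum>i<n. l i * box_shift n e x u i) = (\<Sum>i<n. l i * x i) + e * (\<Sum>i<n. l i * u i)" for x u
    by (simp add: box_shift_def sum_distrib_left algebra_simps sum.distrib)
  note int1 = integrable_noisy_terms(1)[OF gm gb, of e]
  note int2 = integrable_noisy_terms(2)[OF gm gb, of _ e]
  have inth: "integrable (M \<Otimes>\<^sub>M box_noise n) (\<lambda>z. h j (box_shift n e (\<lambda>i. G i (fst z)) (snd z)) * A j (fst z))"
    if "j < n" for j
    by (rule integrable_fst_mult_bounded[OF A[OF that] meas_box_shift[OF hm] hb])
  have ibp: "(\<integral>\<omega>. g (box_shift n e (\<lambda>i. G i \<omega>) u) * Z \<omega> \<partial>M) =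
      (\<Sum>j<n. \<integral>\<omega>. h j (box_shift n e (\<lambda>i. G i \<omega>) u) * A j \<omega> \<partial>M)" for u
    using trig_ibp[of l "b + e * (\<Sum>i<n. l i * u i)"]
    unfolding g_def h_def sh by (simp add: algebra_simps)
  have "(\<integral>z. g (box_shift n e (\<lambda>i. G i (fst z)) (snd z)) * Z (fst z) \<partial>(M \<Otimes>\<^sub>M box_noise n)) =
      (\<integral>u. \<integral>\<omega>. g (box_shift n e (\<lambda>i. G i \<omega>) u) * Z \<omega> \<partial>M \<partial>box_noise n)"
    using pair.integral_snd[of "\<lambda>\<omega> u. g (box_shift n e (\<lambda>i. G i \<omega>) u) * Z \<omega>"] int1
    unfolding case_prod_beta' by metis
  also have "\<dots> = (\<Sum>j<n. \<integral>u. \<integral>\<omega>. h j (box_shift n e (\<lambda>i. G i \<omega>) u) * A j \<omega> \<partial>M \<partial>box_noise n)"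
    unfolding ibp
  proof (rule Bochner_Integration.integral_sum)
    fix j assume "j \<in> {..<n}"
    then have j: "j < n" by simp
    show "integrable (box_noise n) (\<lambda>u. \<integral>\<omega>. h j (box_shift n e (\<lambda>i. G i \<omega>) u) * A j \<omega> \<partial>M)"
      by (rule pair.integrable_snd[of "\<lambda>\<omega> u. h j (box_shift n e (\<lambda>i. G i \<omega>) u) * A j \<omega>", unfolded case_prod_beta', OF inth[OF j]])
  qed
  also have "\<dots> = (\<Sum>j<n. \<integral>\<omega>. \<integral>u. h j (box_shift n e (\<lambda>i. G i \<omega>) u) * A j \<omega> \<partial>box_noise n \<partial>M)"
  proof (rule sum.cong[OF refl])
    fix j assume "j \<in> {..<n}"
    then have j: "j < n" by simp
    show "(\<integral>u. \<integral>\<omega>. h j (box_shift n e (\<lambda>i. G i \<omega>) u) * A j \<omega> \<partial>M \<partial>box_noise n) =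
       (\<integral>\<omega>. \<integral>u. h j (box_shift n e (\<lambda>i. G i \<omega>) u) * A j \<omega> \<partial>box_noise n \<partial>M)"
      by (rule pair.Fubini_integral[of "\<lambda>\<omega> u. h j (box_shift n e (\<lambda>i. G i \<omega>) u) * A j \<omega>", unfolded case_prod_beta', OF inth[OF j]])
  qed
  also have "\<dots> = (\<Sum>j<n. \<integral>z. (g (box_shift n e (\<lambda>i. G i (fst z)) ((snd z)(j := 1))) -
              g (box_shift n e (\<lambda>i. G i (fst z)) ((snd z)(j := 0)))) / e * A j (fst z) \<partial>(M \<Otimes>\<^sub>M box_noise n))"
  proof (rule sum.cong[OF refl])
    fix j assume "j \<in> {..<n}"
    then have j: "j < n" by simp
    have "(\<integral>u. h j (box_shift n e (\<lambda>i. G i \<omega>) u) \<partial>box_noise n) =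
        (\<integral>u. (g (box_shift n e (\<lambda>i. G i \<omega>) (u(j := 1))) - g (box_shift n e (\<lambda>i. G i \<omega>) (u(j := 0)))) / e \<partial>box_noise n)" for \<omega>
      using box_noise_integral_sin[OF j e, of l "(\<Sum>i<n. l i * G i \<omega>) + b"]
      unfolding g_def h_def sh by (simp add: algebra_simps del: fun_upd_apply)
    then have "(\<integral>\<omega>. \<integral>u. h j (box_shift n e (\<lambda>i. G i \<omega>) u) * A j \<omega> \<partial>box_noise n \<partial>M) =
      (\<integral>\<omega>. \<integral>u. (g (box_shift n e (\<lambda>i. G i \<omega>) (u(j := 1))) - g (box_shift n e (\<lambda>i. G i \<omega>) (u(j := 0)))) / e * A j \<omega> \<partial>box_noise n \<partial>M)"
      by (simp only: integral_mult_left_zero)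
    also have "\<dots> = (\<integral>z. (g (box_shift n e (\<lambda>i. G i (fst z)) ((snd z)(j := 1))) -
              g (box_shift n e (\<lambda>i. G i (fst z)) ((snd z)(j := 0)))) / e * A j (fst z) \<partial>(M \<Otimes>\<^sub>M box_noise n))"
      by (rule pair.integral_fst[of "\<lambda>\<omega> u. (g (box_shift n e (\<lambda>i. G i \<omega>) (u(j := 1))) - g (box_shift n e (\<lambda>i. G i \<omega>) (u(j := 0)))) / e * A j \<omega>",
            unfolded case_prod_beta', OF int2[OF j]])
    finally show "(\<integral>\<omega>. \<integral>u. h j (box_shift n e (\<lambda>i. G i \<omega>) u) * A j \<omega> \<partial>box_noise n \<partial>M) = \<dots>" .
  qed
  finally show ?thesis
    unfolding g_def[symmetric, abs_def] noisy_defect_def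
    by (subst Bochner_Integration.integral_diff) (use int1 int2 in \<open>auto simp: Bochner_Integration.integral_sum\<close>)
qed

lemma noisy_defect_add: "noisy_defect e (\<lambda>x. g x + h x) z = noisy_defect e g z + noisy_defect e h z"
  by (simp add: noisy_defect_def algebra_simps sum.distrib sum_subtractf add_divide_distrib diff_divide_distrib)

lemma noisy_defect_scale: "noisy_defect e (\<lambda>x. c * g x) z = c * noisy_defect e g z"
proof -
  have *: "(c * a - c * b) / e * d = c * ((a - b) / e * d)" for a b d :: real
    by (simp add: algebra_simps diff_divide_distrib)
  show ?thesis unfolding noisy_defect_def * sum_distrib_left[symmetric] by (simp add: algebra_simps)
qed

lemma integrable_noisy_defect_trig_poly:
  assumes "trig_poly n g" shows "integrable (M \<Otimes>\<^sub>M box_noise n) (noisy_defect e g)"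
proof -
  obtain B where "\<And>x. \<bar>g x\<bar> \<le> B" using trig_poly_bounded[OF assms] by blast
  then show ?thesis
    by (intro integrable_noisy_terms(3) borel_measurable_continuous_onI[OF trig_poly_continuous[OF assms]])
qed

lemma integral_noisy_defect_trig_poly:
  assumes "trig_poly n g" "e \<noteq> 0"
  shows "(\<integral>z. noisy_defect e g z \<partial>(M \<Otimes>\<^sub>M box_noise n)) = 0"
  using assms(1)
proof induction
  case (cos l b) show ?case by (rule integral_noisy_defect_cos[OF assms(2)])
qed (simp_all add: noisy_defect_add noisy_defect_scale integrable_noisy_defect_trig_poly)

text \<open>Dominated convergence along \<open>trig_poly_approx_seq\<close> with \<open>e\<close>
  fixed. The factor \<open>1 / \<bar>e\<bar>\<close> in the majorant is the reason why
  \<open>e\<close> may tend to 0 only afterwards.\<close>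

lemma integral_noisy_defect:
  assumes dep: "\<And>x y. (\<forall>i<n. x i = y i) \<Longrightarrow> g x = g y"
    and cont: "continuous_on UNIV g" and bdd: "\<And>x. \<bar>g x\<bar> \<le> B" and e: "e \<noteq> 0"
  shows "(\<integral>z. noisy_defect e g z \<partial>(M \<Otimes>\<^sub>M box_noise n)) = 0"
proof -
  obtain p where p: "\<And>k. trig_poly n (p k)" "\<And>k x. \<bar>p k x\<bar> \<le> B + 1" "\<And>x. (\<lambda>k. p k x) \<longlonglongrightarrow> g x"
    by (rule trig_poly_approx_seq[OF dep cont bdd]) blast+
  have gb: "\<bar>g x\<bar> \<le> B + 1" for x using bdd[of x] by simp
  have gm: "g \<in> borel_measurable borel" by (rule borel_measurable_continuous_onI[OF cont])
  define b where "b z = (B + 1) * \<bar>Z (fst z)\<bar> + (\<Sum>j<n. 2 * (B + 1) / \<bar>e\<bar> * \<bar>A j (fst z)\<bar>)" for z :: "'a \<times> (nat \<Rightarrow> real)"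
  have ib: "integrable (M \<Otimes>\<^sub>M box_noise n) b"
    unfolding b_def[abs_def]
    by (intro Bochner_Integration.integrable_add Bochner_Integration.integrable_sum
        integrable_fst_mult_bounded[where B = "\<bar>B + 1\<bar>"] integrable_fst_mult_bounded[where B = "\<bar>2 * (B + 1) / \<bar>e\<bar>\<bar>"])
       (use Z A in auto)
  have "(\<lambda>k. \<integral>z. noisy_defect e (p k) z \<partial>(M \<Otimes>\<^sub>M box_noise n)) \<longlonglongrightarrow> (\<integral>z. noisy_defect e g z \<partial>(M \<Otimes>\<^sub>M box_noise n))"
  proof (rule integral_dominated_convergence[OF _ _ ib])
    show "noisy_defect e g \<in> borel_measurable (M \<Otimes>\<^sub>M box_noise n)"
      using integrable_noisy_terms(3)[OF gm gb] by auto
    show "noisy_defect e (p k) \<in> borel_measurable (M \<Otimes>\<^sub>M box_noise n)" for k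
      using integrable_noisy_defect_trig_poly[OF p(1)] by auto
    show "AE z in M \<Otimes>\<^sub>M box_noise n. (\<lambda>k. noisy_defect e (p k) z) \<longlonglongrightarrow> noisy_defect e g z"
      unfolding noisy_defect_def using e by (intro AE_I2 tendsto_intros p) auto
    have dq: "\<bar>(p k x - p k y) / e\<bar> \<le> 2 * (B + 1) / \<bar>e\<bar>" for k x y
      using add_mono[OF p(2)[of k x] p(2)[of k y]]
      by (auto simp: simp del: mult_2 intro!: divide_right_mono order_trans[OF abs_triangle_ineq4])
    show "AE z in M \<Otimes>\<^sub>M box_noise n. norm (noisy_defect e (p k) z) \<le> b z" for k
      unfolding noisy_defect_def b_def real_norm_def
      by (intro AE_I2 order_trans[OF abs_triangle_ineq4] add_mono order_trans[OF sum_abs] sum_mono)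
         (auto simp only: abs_mult intro!: mult_right_mono p(2) dq)
  qed
  then have "(\<lambda>k. 0) \<longlonglongrightarrow> (\<integral>z. noisy_defect e g z \<partial>(M \<Otimes>\<^sub>M box_noise n))"
    by (simp add: integral_noisy_defect_trig_poly[OF p(1) e])
  then show ?thesis by (simp add: LIMSEQ_const_iff)
qed

text \<open>The mean value theorem serves twice below: the quotient inherits the bound of
  \<open>d\<close>, and since the intermediate point tends to \<open>x\<close> as \<open>e\<close>
  tends to 0, it also inherits the limit \<open>d x\<close>.\<close>

lemma difference_quotient_mean_value:
  assumes deriv: "\<And>x. ((\<lambda>y. g (x(j := y))) has_real_derivative d x) (at (x j))"
    and j: "j < n" and e: "0 < e"
  obtains r where "0 < r" "r < 1"
    "(g (box_shift n e x (u(j := 1))) - g (box_shift n e x (u(j := 0)))) / e = d (box_shift n e x (u(j := r)))"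
proof -
  have upd: "box_shift n e x (u(j := r)) = (box_shift n e x u)(j := x j + e * r)" for r
    using j by (auto simp: box_shift_def)
  have "((\<lambda>r. g (box_shift n e x (u(j := r)))) has_real_derivative e * d (box_shift n e x (u(j := r)))) (at r)" for r
  proof -
    have "((\<lambda>y. g ((box_shift n e x u)(j := y))) has_real_derivative d (box_shift n e x (u(j := r)))) (at (x j + e * r))"
      using deriv[of "box_shift n e x (u(j := r))"] unfolding upd by simp
    moreover have "((\<lambda>r. x j + e * r) has_real_derivative e) (at r)"
      by (auto intro!: derivative_eq_intros)
    ultimately have "((\<lambda>r. g ((box_shift n e x u)(j := x j + e * r))) has_real_derivative
        d (box_shift n e x (u(j := r))) * e) (at r)"
      by (rule DERIV_chain2)
    then show ?thesis unfolding upd by (simp only: mult.commute)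
  qed
  from MVT2[OF zero_less_one, of "\<lambda>r. g (box_shift n e x (u(j := r)))", OF this]
  obtain r where "0 < r" "r < 1"
    "g (box_shift n e x (u(j := 1))) - g (box_shift n e x (u(j := 0))) = e * d (box_shift n e x (u(j := r)))"
    by auto
  then show thesis using that e by simp
qed

text \<open>The position \<open>r k\<close> may change with \<open>k\<close>, since the intermediate
  points of the mean value theorem do; that it stays in the unit interval is enough, as the noise is
  multiplied by \<open>e k\<close>.\<close>

lemma tendsto_box_shift:
  assumes "e \<longlonglongrightarrow> 0" "\<And>k. 0 \<le> r k \<and> r k \<le> (1 :: real)"
  shows "(\<lambda>k. box_shift n (e k) x (u(j := r k))) \<longlonglongrightarrow> x"
proof -
  have "(\<lambda>k. box_shift n (e k) x (u(j := r k)) i) \<longlonglongrightarrow> x i" for i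
  proof (cases "i < n")
    case True
    have "(\<lambda>k. e k * (u(j := r k)) i) \<longlonglongrightarrow> 0"
    proof (rule Lim_null_comparison)
      have "\<bar>(u(j := r k)) i\<bar> \<le> 1 + \<bar>u i\<bar>" for k using assms(2)[of k] by auto
      then show "\<forall>\<^sub>F k in sequentially. norm (e k * (u(j := r k)) i) \<le> \<bar>e k\<bar> * (1 + \<bar>u i\<bar>)"
        by (intro always_eventually) (auto simp only: abs_mult real_norm_def intro!: mult_left_mono)
      show "(\<lambda>k. \<bar>e k\<bar> * (1 + \<bar>u i\<bar>)) \<longlonglongrightarrow> 0"
        using tendsto_mult_left_zero[OF tendsto_rabs_zero[OF assms(1)]] .
    qed
    from tendsto_add[OF tendsto_const this, of "x i"] True show ?thesis
      by (simp add: box_shift_def del: fun_upd_apply)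
  qed (simp add: box_shift_def)
  then have "limitin (product_topology (\<lambda>i. euclidean) UNIV) (\<lambda>k. box_shift n (e k) x (u(j := r k))) x sequentially"
    by (subst limitin_componentwise) auto
  then show ?thesis by (simp add: euclidean_product_topology)
qed

text \<open>The noise is now sent to 0: the difference quotients converge to \<open>d j\<close> and
  stay below \<open>C j\<close>, so the integrals of the noisy defects, all equal to 0, converge to
  the defect of the identity without noise.\<close>

lemma integration_by_parts_extend:
  assumes dep: "\<And>x y. (\<forall>i<n. x i = y i) \<Longrightarrow> g x = g y"
    and cont: "continuous_on UNIV g" and bdd: "\<And>x. \<bar>g x\<bar> \<le> B"
    and deriv: "\<And>j x. j < n \<Longrightarrow> ((\<lambda>y. g (x(j := y))) has_real_derivative d j x) (at (x j))"
    and d_cont: "\<And>j. j < n \<Longrightarrow> continuous_on UNIV (d j)"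
    and d_bdd: "\<And>j x. j < n \<Longrightarrow> \<bar>d j x\<bar> \<le> C j"
  shows "(\<integral>\<omega>. g (\<lambda>i. G i \<omega>) * Z \<omega> \<partial>M) = (\<Sum>j<n. \<integral>\<omega>. d j (\<lambda>i. G i \<omega>) * A j \<omega> \<partial>M)"
proof -
  define e where "e k = 1 / real (Suc k)" for k
  have e: "e \<longlonglongrightarrow> 0" unfolding e_def by (rule LIMSEQ_Suc[OF lim_1_over_n])
  have e0: "0 < e k" for k by (simp add: e_def)
  have gm: "g \<in> borel_measurable borel" by (rule borel_measurable_continuous_onI[OF cont])
  have Gm: "(\<lambda>\<omega> i. G i \<omega>) \<in> borel_measurable M" by (rule measurable_coordinatewise_then_product) (rule G)
  have ghm: "(\<lambda>\<omega>. g (\<lambda>i. G i \<omega>)) \<in> borel_measurable M"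
    by (rule measurable_compose[OF Gm gm])
  have dm: "(\<lambda>\<omega>. d j (\<lambda>i. G i \<omega>)) \<in> borel_measurable M" if "j < n" for j
    by (rule measurable_compose[OF Gm borel_measurable_continuous_onI[OF d_cont[OF that]]])
  have dist: "isCont (d j) x" if "j < n" for j x
    using d_cont[OF that] by (simp add: continuous_on_eq_continuous_at)
  define L where "L \<omega> = g (\<lambda>i. G i \<omega>) * Z \<omega> - (\<Sum>j<n. d j (\<lambda>i. G i \<omega>) * A j \<omega>)" for \<omega>
  have int_gZ: "integrable M (\<lambda>\<omega>. g (\<lambda>i. G i \<omega>) * Z \<omega>)"
    by (rule Bochner_Integration.integrable_bound[OF integrable_mult_right[OF Z, of B]])
       (use ghm Z in \<open>auto simp: abs_mult intro!: mult_right_mono order_trans[OF bdd abs_ge_self]\<close>)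
  have int_dA: "integrable M (\<lambda>\<omega>. d j (\<lambda>i. G i \<omega>) * A j \<omega>)" if "j < n" for j
    by (rule Bochner_Integration.integrable_bound[OF integrable_mult_right[OF A[OF that], of "C j"]])
       (use dm[OF that] A[OF that] in \<open>auto simp: abs_mult intro!: mult_right_mono order_trans[OF d_bdd[OF that] abs_ge_self]\<close>)
  have int_L: "integrable M L" unfolding L_def[abs_def]
    by (intro Bochner_Integration.integrable_diff Bochner_Integration.integrable_sum int_gZ int_dA) auto
  have int_L': "integrable (M \<Otimes>\<^sub>M box_noise n) (\<lambda>z. L (fst z))"
    using integrable_fst_mult_bounded[OF int_L, of "\<lambda>_. 1" 1] by simp
  define b where "b z = B * \<bar>Z (fst z)\<bar> + (\<Sum>j<n. C j * \<bar>A j (fst z)\<bar>)" for z :: "'a \<times> (nat \<Rightarrow> real)"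
  have ib: "integrable (M \<Otimes>\<^sub>M box_noise n) b"
    unfolding b_def[abs_def]
    by (intro Bochner_Integration.integrable_add Bochner_Integration.integrable_sum
        integrable_fst_mult_bounded[where B = "\<bar>B\<bar>"] integrable_fst_mult_bounded[where B = "\<bar>C j\<bar>" for j])
       (use Z A in auto)
  have dq_bdd: "\<bar>(g (box_shift n (e k) x (u(j := 1))) - g (box_shift n (e k) x (u(j := 0)))) / e k\<bar> \<le> C j"
    if j: "j < n" for j k x u
    using difference_quotient_mean_value[OF deriv[OF j] j e0] d_bdd[OF j] by metis
  have dq_lim: "(\<lambda>k. (g (box_shift n (e k) x (u(j := 1))) - g (box_shift n (e k) x (u(j := 0)))) / e k) \<longlonglongrightarrow> d j x"
    if j: "j < n" for j x u
  proof -
    have "\<exists>r. 0 < r \<and> r < 1 \<and> (g (box_shift n (e k) x (u(j := 1))) - g (box_shift n (e k) x (u(j := 0)))) / e k =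
        d j (box_shift n (e k) x (u(j := r)))" for k
      using difference_quotient_mean_value[OF deriv[OF j] j e0] by metis
    then obtain r where r: "\<And>k. 0 < r k" "\<And>k. r k < 1"
      "\<And>k. (g (box_shift n (e k) x (u(j := 1))) - g (box_shift n (e k) x (u(j := 0)))) / e k =
        d j (box_shift n (e k) x (u(j := r k)))" by metis
    have "(\<lambda>k. box_shift n (e k) x (u(j := r k))) \<longlonglongrightarrow> x"
      by (rule tendsto_box_shift[OF e]) (intro conjI less_imp_le r(1,2))
    then show ?thesis unfolding r(3) by (rule isCont_tendsto_compose[OF dist[OF j]])
  qed
  have g_lim: "(\<lambda>k. g (box_shift n (e k) x u)) \<longlonglongrightarrow> g x" for x u
  proof (rule isCont_tendsto_compose[of x g])
    show "isCont g x" using cont by (simp add: continuous_on_eq_continuous_at)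
    \<comment> \<open>Coordinate \<open>n\<close> is invisible to \<open>box_shift n\<close>;
      updating it brings the plain shift into the form of \<open>tendsto_box_shift\<close>.\<close>
    have "box_shift n (e k) x (u(n := 0)) = box_shift n (e k) x u" for k by (auto simp: box_shift_def)
    then show "(\<lambda>k. box_shift n (e k) x u) \<longlonglongrightarrow> x"
      using tendsto_box_shift[OF e, of "\<lambda>_. 0" x u n] by simp
  qed
  have "(\<lambda>k. \<integral>z. noisy_defect (e k) g z \<partial>(M \<Otimes>\<^sub>M box_noise n)) \<longlonglongrightarrow> (\<integral>z. L (fst z) \<partial>(M \<Otimes>\<^sub>M box_noise n))"
  proof (rule integral_dominated_convergence[OF _ _ ib])
    show "(\<lambda>z. L (fst z)) \<in> borel_measurable (M \<Otimes>\<^sub>M box_noise n)" using int_L' by auto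
    show "noisy_defect (e k) g \<in> borel_measurable (M \<Otimes>\<^sub>M box_noise n)" for k
      using integrable_noisy_terms(3)[OF gm bdd] by auto
    show "AE z in M \<Otimes>\<^sub>M box_noise n. (\<lambda>k. noisy_defect (e k) g z) \<longlonglongrightarrow> L (fst z)"
      unfolding noisy_defect_def L_def by (intro AE_I2 tendsto_intros dq_lim g_lim) auto
    show "AE z in M \<Otimes>\<^sub>M box_noise n. norm (noisy_defect (e k) g z) \<le> b z" for k
      unfolding noisy_defect_def b_def real_norm_def
      by (intro AE_I2 order_trans[OF abs_triangle_ineq4] add_mono order_trans[OF sum_abs] sum_mono)
         (auto simp only: abs_mult lessThan_iff intro!: mult_right_mono bdd dq_bdd)
  qed
  then have "(\<lambda>k. 0) \<longlonglongrightarrow> (\<integral>z. L (fst z) \<partial>(M \<Otimes>\<^sub>M box_noise n))"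
    using e0 by (subst (asm) integral_noisy_defect[OF dep cont bdd]) (auto simp: less_imp_neq[symmetric])
  then have "(\<integral>z. L (fst z) \<partial>(M \<Otimes>\<^sub>M box_noise n)) = 0" by (simp add: LIMSEQ_const_iff)
  moreover have "(\<integral>z. L (fst z) \<partial>(M \<Otimes>\<^sub>M box_noise n)) = (\<integral>\<omega>. L \<omega> \<partial>M)"
    using integral_distr[of fst "M \<Otimes>\<^sub>M box_noise n" M L] int_L by (simp add: bn.distr_pair_fst)
  moreover have "(\<integral>\<omega>. L \<omega> \<partial>M) = (\<integral>\<omega>. g (\<lambda>i. G i \<omega>) * Z \<omega> \<partial>M) - (\<Sum>j<n. \<integral>\<omega>. d j (\<lambda>i. G i \<omega>) * A j \<omega> \<partial>M)"
    unfolding L_def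
    by (subst Bochner_Integration.integral_diff) (use int_gZ int_dA in \<open>auto simp: Bochner_Integration.integral_sum\<close>)
  ultimately show ?thesis by simp
qed

end
end

section \<open>The covariance measure\<close>

lemma sets_borel_Times:
  fixes A B :: "real set"
  assumes "A \<in> sets borel" "B \<in> sets borel"
  shows "A \<times> B \<in> sets (borel :: (real \<times> real) measure)"
  unfolding borel_prod[symmetric] by (rule pair_measureI[OF assms])

text \<open>Uniqueness of a signed measure with given distribution function, written with sums of
  positive measures to avoid subtraction. Quadrants form an intersection-stable generator;
  complements need equal total masses, which come from exhausting the plane by quadrants.\<close>

lemma finite_measures_add_eq:
  fixes A B C D :: "(real \<times> real) measure"
  assumes fin: "finite_measure A" "finite_measure B" "finite_measure C" "finite_measure D"
    and sets: "sets A = sets borel" "sets B = sets borel" "sets C = sets borel" "sets D = sets borel"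
    and eq: "\<And>s t. measure A ({..s} \<times> {..t}) + measure B ({..s} \<times> {..t}) =
      measure C ({..s} \<times> {..t}) + measure D ({..s} \<times> {..t})"
    and E: "E \<in> sets borel"
  shows "measure A E + measure B E = measure C E + measure D E"
proof -
  interpret A: finite_measure A by fact
  interpret B: finite_measure B by fact
  interpret C: finite_measure C by fact
  interpret D: finite_measure D by fact
  note [simp] = sets
  have [simp]: "space A = UNIV" "space B = UNIV" "space C = UNIV" "space D = UNIV"
    using sets[THEN sets_eq_imp_space_eq] by simp_all
  have atMost_pair: "{..(s, t)} = {..s} \<times> {..t}" for s t :: real by (auto simp: less_eq_prod_def)
  define \<G> where "\<G> = range (\<lambda>a::real \<times> real. {..a})"
  have univ: "measure A UNIV + measure B UNIV = measure C UNIV + measure D UNIV"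
  proof -
    define X where "X k = {..real k} \<times> {..real k}" for k :: nat
    have X: "range X \<subseteq> sets borel" "incseq X" "(\<Union>k. X k) = UNIV"
    proof -
      show "range X \<subseteq> sets borel" unfolding X_def
        by (auto intro!: borel_closed closed_Times)
      show "incseq X" unfolding X_def incseq_def by auto
      have "\<exists>k. z \<in> X k" for z
      proof -
        obtain k where "max (fst z) (snd z) \<le> real k" using real_arch_simple by blast
        then show ?thesis by (intro exI[of _ k]) (auto simp: X_def mem_Times_iff)
      qed
      then show "(\<Union>k. X k) = UNIV" by auto
    qed
    have "(\<lambda>k. measure A (X k) + measure B (X k)) \<longlonglongrightarrow> measure A UNIV + measure B UNIV"
      using A.finite_Lim_measure_incseq[of X] B.finite_Lim_measure_incseq[of X] X
      by (intro tendsto_add) auto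
    moreover have "(\<lambda>k. measure C (X k) + measure D (X k)) \<longlonglongrightarrow> measure C UNIV + measure D UNIV"
      using C.finite_Lim_measure_incseq[of X] D.finite_Lim_measure_incseq[of X] X
      by (intro tendsto_add) auto
    ultimately show ?thesis unfolding X_def eq by (rule LIMSEQ_unique)
  qed
  have sig: "sigma_sets UNIV \<G> = sets borel"
    unfolding \<G>_def by (subst borel_eq_atMost) simp
  have "Int_stable \<G>"
    unfolding \<G>_def
  proof (rule Int_stableI)
    fix a b assume "a \<in> range (\<lambda>a::real \<times> real. {..a})" "b \<in> range (\<lambda>a::real \<times> real. {..a})"
    then obtain x y where "a = {..x}" "b = {..y}" by auto
    then have "a \<inter> b = {..inf x y}" by auto
    then show "a \<inter> b \<in> range (\<lambda>a::real \<times> real. {..a})" by blast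
  qed
  moreover have "\<G> \<subseteq> Pow UNIV" by simp
  moreover have "E \<in> sigma_sets UNIV \<G>" using E sig by simp
  ultimately show ?thesis
  proof (induction rule: sigma_sets_induct_disjoint)
    case (basic X)
    then obtain s t where "X = {..(s, t)}" unfolding \<G>_def by auto
    then show ?case using eq atMost_pair by simp
  next
    case (compl X)
    then have "X \<in> sets borel" using sig by simp
    then show ?case
      using A.finite_measure_compl[of X] B.finite_measure_compl[of X]
        C.finite_measure_compl[of X] D.finite_measure_compl[of X] compl(2) univ by simp
  next
    case (union X)
    then have X: "range X \<subseteq> sets borel" "disjoint_family X" using sig by auto
    have "(\<lambda>i. measure A (X i) + measure B (X i)) sums (measure A (\<Union>i. X i) + measure B (\<Union>i. X i))"
      by (intro sums_add A.finite_measure_UNION B.finite_measure_UNION) (use X in auto)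
    moreover have "(\<lambda>i. measure C (X i) + measure D (X i)) sums (measure C (\<Union>i. X i) + measure D (\<Union>i. X i))"
      by (intro sums_add C.finite_measure_UNION D.finite_measure_UNION) (use X in auto)
    ultimately show ?case unfolding union(3) by (rule sums_unique2)
  qed simp
qed

text \<open>The conditional quantile transform: \<open>\<nu>\<close> is the image of the Lebesgue measure on the
  region under the graph of \<open>G u T\<close> under \<open>(u, x) \<mapsto> (u, inf {v. x \<le> G u v})\<close>.\<close>

lemma quantile_measure:
  fixes G F :: "real \<Rightarrow> real \<Rightarrow> real"
  assumes T: "0 < T"
    and meas: "\<And>v. (\<lambda>u. G u v) \<in> borel_measurable borel"
    and bounds: "\<And>u v. u \<in> {0..T} \<Longrightarrow> v \<in> {0..T} \<Longrightarrow> 0 \<le> G u v \<and> G u v \<le> C"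
    and mono: "\<And>u v w. u \<in> {0..T} \<Longrightarrow> 0 \<le> v \<Longrightarrow> v \<le> w \<Longrightarrow> w \<le> T \<Longrightarrow> G u v \<le> G u w"
    and right_cont: "\<And>u v. u \<in> {0..T} \<Longrightarrow> 0 \<le> v \<Longrightarrow> v < T \<Longrightarrow> (G u \<longlongrightarrow> G u v) (at_right v)"
    and int: "\<And>s t. s \<in> {0..T} \<Longrightarrow> t \<in> {0..T} \<Longrightarrow> ((\<lambda>u. G u t) has_integral F s t) {0..s}"
  obtains \<nu> where "finite_measure \<nu>" "sets \<nu> = sets borel"
    "\<And>s t. s \<in> {0..T} \<Longrightarrow> t \<in> {0..T} \<Longrightarrow> measure \<nu> ({..s} \<times> {..t}) = F s t"
    "emeasure \<nu> (- ({0..T} \<times> {0..T})) = 0"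
    "\<And>A. A \<in> sets borel \<Longrightarrow> emeasure \<nu> (A \<times> UNIV) = (\<integral>\<^sup>+u. indicator (A \<inter> {0..T}) u * ennreal (G u T) \<partial>lborel)"
proof -
  define D where "D = {z :: real \<times> real. fst z \<in> {0..T} \<and> 0 \<le> snd z \<and> snd z \<le> G (fst z) T}"
  define S where "S z = {v \<in> {0..T}. snd z \<le> G (fst z) v}" for z :: "real \<times> real"
  define q where "q z = Inf (S z)" for z
  have G_fst: "(\<lambda>z :: real \<times> real. G (fst z) v) \<in> borel_measurable borel" for v
    by (rule measurable_compose[OF _ meas]) (simp add: borel_prod[symmetric])
  have fst_snd: "fst \<in> borel_measurable (borel :: (real \<times> real) measure)"
    "snd \<in> borel_measurable (borel :: (real \<times> real) measure)"
    by (simp_all add: borel_prod[symmetric])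
  have region_meas: "{z :: real \<times> real. fst z \<in> A \<and> 0 \<le> snd z \<and> snd z \<le> G (fst z) t} \<in> sets borel"
    if "A \<in> sets borel" for A t
  proof -
    have "{z :: real \<times> real. fst z \<in> A \<and> 0 \<le> snd z \<and> snd z \<le> G (fst z) t} =
      (fst -` A \<inter> space borel) \<inter> {z \<in> space borel. 0 \<le> snd z} \<inter> {z \<in> space borel. snd z \<le> G (fst z) t}"
      by auto
    also have "\<dots> \<in> sets borel"
      using that G_fst fst_snd by (intro sets.Int borel_measurable_le measurable_sets) simp_all
    finally show ?thesis .
  qed
  have D: "D \<in> sets borel" unfolding D_def by (rule region_meas) simp
  have ST: "T \<in> S z" if "z \<in> D" for z using that T by (auto simp: S_def D_def)
  have bdd: "bdd_below (S z)" for z by (rule bdd_belowI[of _ 0]) (simp add: S_def)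
  have q_range: "q z \<in> {0..T}" if "z \<in> D" for z
  proof -
    have "q z \<le> T" unfolding q_def by (rule cInf_lower[OF ST[OF that] bdd])
    moreover have "0 \<le> q z" unfolding q_def
      by (rule cInf_greatest) (use ST[OF that] in \<open>auto simp: S_def\<close>)
    ultimately show ?thesis by simp
  qed
  have q_le: "q z \<le> t \<longleftrightarrow> snd z \<le> G (fst z) t" if z: "z \<in> D" and t: "t \<in> {0..T}" for z t
  proof
    assume "snd z \<le> G (fst z) t"
    then show "q z \<le> t" unfolding q_def using t by (intro cInf_lower bdd) (auto simp: S_def)
  next
    assume le: "q z \<le> t"
    show "snd z \<le> G (fst z) t"
    proof (cases "t = T")
      case True then show ?thesis using z by (simp add: D_def)
    next
      case False
      then have tT: "t < T" using t by simp
      have u: "fst z \<in> {0..T}" using z by (simp add: D_def)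
      \<comment> \<open>Above its infimum \<open>S z\<close> has members arbitrarily close, which by
        monotonicity gives the inequality at every \<open>t'\<close> beyond \<open>t\<close>; right
        continuity then carries it to \<open>t\<close> itself. In this way the infimum belongs to
        \<open>S z\<close>, and \<open>q\<close> behaves as a quantile.\<close>
      have "snd z \<le> G (fst z) t'" if t': "t < t'" "t' < T" for t'
      proof -
        have "Inf (S z) < t'" using le t' by (simp add: q_def)
        then obtain v where v: "v \<in> S z" "v < t'"
          using cInf_less_iff[OF _ bdd, of z t'] ST[OF z] by auto
        then show ?thesis using mono[OF u, of v t'] t' by (auto simp: S_def)
      qed
      then have "\<forall>\<^sub>F t' in at_right t. snd z \<le> G (fst z) t'"
        by (intro eventually_mono[OF eventually_at_right_real[OF tT]]) simp
      moreover have "0 \<le> t" using t by simp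
      ultimately show ?thesis
        using right_cont[OF u _ tT] by (intro tendsto_lowerbound[of "G (fst z)" _ "at_right t"]) simp_all
    qed
  qed
  define R where "R = restrict_space lborel D"
  have spR: "space R = D" unfolding R_def by (simp add: space_restrict_space)
  have sets_R: "sets R = sets (restrict_space borel D)"
    unfolding R_def by (rule sets_restrict_space_cong) simp
  have q_meas: "q \<in> borel_measurable R"
  proof (subst borel_measurable_iff_le, rule allI)
    fix a
    consider "a < 0" | "T < a" | "a \<in> {0..T}" by fastforce
    then show "{w \<in> space R. q w \<le> a} \<in> sets R"
    proof cases
      case 1
      then have "{w \<in> space R. q w \<le> a} = {}" using q_range unfolding spR by fastforce
      then show ?thesis by (metis sets.empty_sets)
    next
      case 2
      then have "{w \<in> space R. q w \<le> a} = space R" using q_range unfolding spR by fastforce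
      then show ?thesis by (metis sets.top)
    next
      case 3
      then have "{w \<in> space R. q w \<le> a} = {w \<in> space R. snd w \<le> G (fst w) a}"
        using q_le unfolding spR by auto
      also have "\<dots> \<in> sets R"
        unfolding R_def
        using G_fst fst_snd by (intro borel_measurable_le measurable_restrict_space1) simp_all
      finally show ?thesis .
    qed
  qed
  have fst_meas: "fst \<in> borel_measurable R" unfolding R_def
    by (intro measurable_restrict_space1) (simp add: fst_snd)
  have pair_meas: "(\<lambda>z. (fst z, q z)) \<in> R \<rightarrow>\<^sub>M borel"
    by (subst borel_prod[symmetric]) (intro measurable_Pair fst_meas q_meas)
  define \<nu> where "\<nu> = distr R borel (\<lambda>z. (fst z, q z))"
  have em: "emeasure \<nu> E = emeasure lborel {z \<in> D. (fst z, q z) \<in> E}" if "E \<in> sets borel" for E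
  proof -
    have "emeasure \<nu> E = emeasure R {z \<in> D. (fst z, q z) \<in> E}"
      unfolding \<nu>_def emeasure_distr[OF pair_meas that] spR
      by (intro arg_cong2[where f = emeasure]) auto
    also have "\<dots> = emeasure lborel {z \<in> D. (fst z, q z) \<in> E}"
      unfolding R_def by (rule emeasure_restrict_space) (simp_all add: D)
    finally show ?thesis .
  qed
  have region: "emeasure lborel {z :: real \<times> real. fst z \<in> A \<inter> {0..T} \<and> 0 \<le> snd z \<and> snd z \<le> G (fst z) t} =
      (\<integral>\<^sup>+u. indicator (A \<inter> {0..T}) u * ennreal (G u t) \<partial>lborel)"
    if A: "A \<in> sets borel" and t: "t \<in> {0..T}" for A t
  proof -
    let ?E = "{z :: real \<times> real. fst z \<in> A \<inter> {0..T} \<and> 0 \<le> snd z \<and> snd z \<le> G (fst z) t}"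
    have E: "?E \<in> sets (lborel \<Otimes>\<^sub>M lborel)"
      unfolding lborel_prod sets_lborel by (rule region_meas) (use A in simp)
    have "emeasure lborel ?E = emeasure (lborel \<Otimes>\<^sub>M lborel) ?E"
      unfolding lborel_prod ..
    also have "\<dots> = (\<integral>\<^sup>+u. emeasure lborel (Pair u -` ?E) \<partial>lborel)"
      by (rule lborel.emeasure_pair_measure_alt[OF E])
    also have "\<dots> = (\<integral>\<^sup>+u. indicator (A \<inter> {0..T}) u * ennreal (G u t) \<partial>lborel)"
    proof (rule nn_integral_cong)
      fix u
      show "emeasure lborel (Pair u -` ?E) = indicator (A \<inter> {0..T}) u * ennreal (G u t)"
      proof (cases "u \<in> A \<inter> {0..T}")
        case True
        then have "Pair u -` ?E = {0..G u t}" by fastforce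
        then show ?thesis using True bounds[of u t] t by simp
      next
        case False
        then have "Pair u -` ?E = {}" by fastforce
        then show ?thesis using False by (simp only: emeasure_empty indicator_simps mult_zero_left) simp
      qed
    qed
    finally show ?thesis .
  qed
  have nu_Times: "emeasure \<nu> (A \<times> {..t}) = (\<integral>\<^sup>+u. indicator (A \<inter> {0..T}) u * ennreal (G u t) \<partial>lborel)"
    if A: "A \<in> sets borel" and t: "t \<in> {0..T}" for A t
  proof -
    have "{z \<in> D. (fst z, q z) \<in> A \<times> {..t}} = {z. fst z \<in> A \<inter> {0..T} \<and> 0 \<le> snd z \<and> snd z \<le> G (fst z) t}"
    proof (intro set_eqI iffI)
      fix z assume "z \<in> {z \<in> D. (fst z, q z) \<in> A \<times> {..t}}"
      then show "z \<in> {z. fst z \<in> A \<inter> {0..T} \<and> 0 \<le> snd z \<and> snd z \<le> G (fst z) t}"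
        using q_le[OF _ t, of z] by (auto simp: D_def)
    next
      fix z assume z: "z \<in> {z. fst z \<in> A \<inter> {0..T} \<and> 0 \<le> snd z \<and> snd z \<le> G (fst z) t}"
      then have "z \<in> D" using mono[of "fst z" t T] t by (auto simp: D_def)
      then show "z \<in> {z \<in> D. (fst z, q z) \<in> A \<times> {..t}}"
        using q_le[OF _ t, of z] z by auto
    qed
    moreover have "A \<times> {..t} \<in> sets borel"
      by (rule sets_borel_Times[OF A]) simp
    ultimately show ?thesis using em[of "A \<times> {..t}"] region[OF A t] by presburger
  qed
  have conc: "emeasure \<nu> (- ({0..T} \<times> {0..T})) = 0"
  proof -
    have "{z \<in> D. (fst z, q z) \<in> - ({0..T} \<times> {0..T})} = {}" using q_range by (auto simp: D_def)
    moreover have "- ({0..T} \<times> {0..T}) \<in> sets borel"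
      by (intro borel_open open_Compl closed_Times) auto
    ultimately show ?thesis by (simp only: em emeasure_empty)
  qed
  have nu_UNIV: "emeasure \<nu> (A \<times> UNIV) = (\<integral>\<^sup>+u. indicator (A \<inter> {0..T}) u * ennreal (G u T) \<partial>lborel)"
    if A: "A \<in> sets borel" for A
  proof -
    have "{z \<in> D. (fst z, q z) \<in> A \<times> UNIV} = {z \<in> D. (fst z, q z) \<in> A \<times> {..T}}"
      using q_range by auto
    moreover have "A \<times> {..T} \<in> sets borel" "A \<times> (UNIV :: real set) \<in> sets borel"
      by (rule sets_borel_Times[OF A], simp)+
    ultimately have "emeasure \<nu> (A \<times> UNIV) = emeasure \<nu> (A \<times> {..T})" by (simp only: em)
    then show ?thesis using nu_Times[OF A, of T] T by simp
  qed
  have nu_F: "emeasure \<nu> ({..s} \<times> {..t}) = ennreal (F s t)" "0 \<le> F s t" if s: "s \<in> {0..T}" and t: "t \<in> {0..T}" for s t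
  proof -
    have eq: "indicator ({..s} \<inter> {0..T}) u * ennreal (G u t) = ennreal (indicator {0..s} u * G u t)" for u
      using s by (auto simp: indicator_def)
    have "emeasure \<nu> ({..s} \<times> {..t}) = (\<integral>\<^sup>+u. indicator ({..s} \<inter> {0..T}) u * ennreal (G u t) \<partial>lborel)"
      by (rule nu_Times[OF _ t]) simp
    also have "\<dots> = (\<integral>\<^sup>+u. ennreal (indicator {0..s} u * G u t) \<partial>lborel)" by (simp only: eq)
    also have "\<dots> = ennreal (F s t)"
      by (rule nn_integral_has_integral_lebesgue[OF _ int[OF s t]]) (use bounds s t in auto)
    finally show "emeasure \<nu> ({..s} \<times> {..t}) = ennreal (F s t)" .
    show "0 \<le> F s t"
      by (rule has_integral_nonneg[OF int[OF s t]]) (use bounds s t in auto)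
  qed
  show thesis
  proof (rule that[of \<nu>])
    show sets: "sets \<nu> = sets borel" by (simp add: \<nu>_def)
    show "finite_measure \<nu>"
    proof
      have "emeasure \<nu> (space \<nu>) = emeasure \<nu> (UNIV \<times> UNIV)" by (simp add: \<nu>_def)
      also have "\<dots> = (\<integral>\<^sup>+u. indicator (UNIV \<inter> {0..T}) u * ennreal (G u T) \<partial>lborel)"
        by (rule nu_UNIV) simp
      also have "\<dots> \<le> (\<integral>\<^sup>+u. ennreal C * indicator {0..T} u \<partial>lborel)"
        by (intro nn_integral_mono) (use bounds T in \<open>auto simp: indicator_def ennreal_leI\<close>)
      also have "\<dots> < \<infinity>" using T by (simp add: nn_integral_cmult ennreal_mult_less_top)
      finally show "emeasure \<nu> (space \<nu>) \<noteq> \<infinity>" by simp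
    qed
    show "measure \<nu> ({..s} \<times> {..t}) = F s t" if "s \<in> {0..T}" "t \<in> {0..T}" for s t
      using nu_F[OF that] by (simp add: measure_def)
  qed (fact conc nu_UNIV)+
qed

text \<open>The usual induction from sets over simple functions to monotone limits. The sum on the
  left stands in for a difference of measures on the right; with \<open>N2\<close> a null measure it
  is plain comparison.\<close>

lemma nn_integral_add_le_of_emeasure:
  assumes sets: "sets N1 = sets N2" "sets N2 = sets N3"
    and le: "\<And>A. A \<in> sets N1 \<Longrightarrow> emeasure N1 A + emeasure N2 A \<le> emeasure N3 A"
    and h: "h \<in> borel_measurable N1"
  shows "(\<integral>\<^sup>+x. h x \<partial>N1) + (\<integral>\<^sup>+x. h x \<partial>N2) \<le> (\<integral>\<^sup>+x. h x \<partial>N3)"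
proof -
  have conv: "f \<in> borel_measurable N2 \<and> f \<in> borel_measurable N3" if "f \<in> borel_measurable N1" for f :: "'a \<Rightarrow> ennreal"
    using that by (metis measurable_cong_sets sets)
  show ?thesis using h
  proof induct
  case (cong f g)
  have [simp]: "space N2 = space N1" "space N3 = space N1"
    using sets by (auto dest!: sets_eq_imp_space_eq)
  have "integral\<^sup>N N f = integral\<^sup>N N g" if "space N = space N1" for N
    by (rule nn_integral_cong) (simp add: cong(3) that)
  then show ?case using cong(4) by simp
next
  case (set A)
  then show ?case using le[of A] sets by simp
next
  case (mult u c)
  have m: "u \<in> borel_measurable N2" "u \<in> borel_measurable N3"
    using conv[OF mult(2)] by auto
  show ?case using mult(2,4) m
    by (simp add: nn_integral_cmult distrib_left[symmetric] mult_left_mono)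
next
  case (add u v)
  have m: "u \<in> borel_measurable N2" "u \<in> borel_measurable N3" "v \<in> borel_measurable N2" "v \<in> borel_measurable N3"
    using conv[OF add(1)] conv[OF add(4)] by auto
  show ?case using add_mono[OF add(3) add(7)] add(1,4) m
    by (simp add: nn_integral_add algebra_simps)
next
  case (seq U)
  have m: "U i \<in> borel_measurable N2" "U i \<in> borel_measurable N3" for i
    using conv[OF seq(1)] by auto
  have "(\<integral>\<^sup>+x. (SUP i. U i) x \<partial>N1) + (\<integral>\<^sup>+x. (SUP i. U i) x \<partial>N2) =
      (SUP i. \<integral>\<^sup>+x. U i x \<partial>N1) + (SUP i. \<integral>\<^sup>+x. U i x \<partial>N2)"
    using seq(1,4) m by (simp add: nn_integral_monotone_convergence_SUP image_comp)
  also have "\<dots> = (SUP i. (\<integral>\<^sup>+x. U i x \<partial>N1) + (\<integral>\<^sup>+x. U i x \<partial>N2))"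
    using seq(4) by (intro ennreal_SUP_add[symmetric])
      (auto simp: incseq_def le_fun_def intro!: nn_integral_mono)
  also have "\<dots> \<le> (SUP i. \<integral>\<^sup>+x. U i x \<partial>N3)"
    by (intro SUP_mono) (use seq(3) in blast)
  also have "\<dots> = (\<integral>\<^sup>+x. (SUP i. U i) x \<partial>N3)"
    using seq(1,4) m by (simp add: nn_integral_monotone_convergence_SUP image_comp)
  finally show ?case .
  qed
qed

text \<open>A symmetric distribution function belongs to a measure that is invariant under the swap.
  This carries information on the first marginal over to the second; the null measures pad the
  four-measure uniqueness lemma.\<close>

lemma pair_swap_measure_eq:
  fixes \<nu> :: "(real \<times> real) measure"
  assumes fin: "finite_measure \<nu>" and sets: "sets \<nu> = sets borel"
    and sym: "\<And>s t. measure \<nu> ({..s} \<times> {..t}) = measure \<nu> ({..t} \<times> {..s})"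
    and A: "A \<in> sets borel"
  shows "emeasure \<nu> (UNIV \<times> A) = emeasure \<nu> (A \<times> UNIV)"
proof -
  interpret finite_measure \<nu> by fact
  have sw: "(\<lambda>(x, y). (y, x)) \<in> \<nu> \<rightarrow>\<^sub>M (borel :: (real \<times> real) measure)"
    using sets by (simp add: measurable_cong_sets[OF sets refl] borel_prod[symmetric])
  define \<nu>' where "\<nu>' = distr \<nu> borel (\<lambda>(x, y). (y, x))"
  have fin': "finite_measure \<nu>'" unfolding \<nu>'_def by (rule finite_measure_distr[OF sw])
  have sp: "space \<nu> = UNIV" using sets_eq_imp_space_eq[OF sets] by simp
  have m': "measure \<nu>' (X \<times> Y) = measure \<nu> (Y \<times> X)" if "X \<in> sets borel" "Y \<in> sets borel" for X Y
  proof -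
    have "X \<times> Y \<in> sets borel" using that by (rule sets_borel_Times)
    then have "measure \<nu>' (X \<times> Y) = measure \<nu> ((\<lambda>(x, y). (y, x)) -` (X \<times> Y) \<inter> space \<nu>)"
      unfolding \<nu>'_def by (rule measure_distr[OF sw])
    also have "(\<lambda>(x, y). (y, x)) -` (X \<times> Y) \<inter> space \<nu> = Y \<times> X" unfolding sp by auto
    finally show ?thesis .
  qed
  interpret null: finite_measure "null_measure (borel :: (real \<times> real) measure)"
    by standard simp
  have "measure \<nu> (A \<times> UNIV) + measure (null_measure (borel :: (real \<times> real) measure)) (A \<times> UNIV) =
      measure \<nu>' (A \<times> UNIV) + measure (null_measure (borel :: (real \<times> real) measure)) (A \<times> UNIV)"
  proof (rule finite_measures_add_eq[OF fin _ fin'])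
    show "A \<times> (UNIV :: real set) \<in> sets borel" by (rule sets_borel_Times[OF A]) simp
  qed (use sym m' null.finite_measure_axioms in \<open>simp_all add: sets \<nu>'_def\<close>)
  then show ?thesis using m'[of A UNIV] A by (simp add: emeasure_eq_measure)
qed

section \<open>The two parts of the covariance and their kernels\<close>

lemma continuous_on_powr_nonneg:
  fixes f :: "'a::topological_space \<Rightarrow> real"
  assumes "0 < a" "continuous_on A f" "\<And>x. x \<in> A \<Longrightarrow> 0 \<le> f x"
  shows "continuous_on A (\<lambda>x. f x powr a)"
  using assms by (intro continuous_on_powr' continuous_on_const) auto

text \<open>The covariance \<open>bifbm_cov\<close> is \<open>cov_fbm_part - cov_power_part\<close>.
  This part is nonnegative by the subadditivity of \<open>x^K\<close> for \<open>K \<le> 1\<close>,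
  applied to \<open>s^(2H)\<close> and \<open>t^(2H)\<close>.\<close>

definition cov_power_part :: "real \<Rightarrow> real \<Rightarrow> real \<Rightarrow> real \<Rightarrow> real" where
  "cov_power_part H K s t = 2 powr (- K) *
     (s powr (2 * H * K) + t powr (2 * H * K) - (s powr (2 * H) + t powr (2 * H)) powr K)"

text \<open>Up to the factor \<open>2 powr (1 - K)\<close> this is the covariance of fractional
  Brownian motion with Hurst index \<open>H * K\<close>.\<close>

definition cov_fbm_part :: "real \<Rightarrow> real \<Rightarrow> real \<Rightarrow> real \<Rightarrow> real" where
  "cov_fbm_part H K s t = 2 powr (- K) *
     (s powr (2 * H * K) + t powr (2 * H * K) - \<bar>t - s\<bar> powr (2 * H * K))"

text \<open>\<open>x\<^sup>a\<close> with the convention \<open>0\<^sup>0 = 1\<close>, in contrast to \<^const>\<open>powr\<close>.\<close>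

definition pw :: "real \<Rightarrow> real \<Rightarrow> real" where
  "pw a x = (if a = 0 then 1 else x powr a)"

lemma pw_mono: "0 \<le> a \<Longrightarrow> 0 \<le> x \<Longrightarrow> x \<le> y \<Longrightarrow> pw a x \<le> pw a y"
  by (simp add: pw_def powr_mono2)

lemma pw_nonneg: "0 \<le> pw a x" by (simp add: pw_def)

lemma pw_eq: "0 < x \<Longrightarrow> pw a x = x powr a" by (simp add: pw_def)

lemma pw_continuous: "0 \<le> a \<Longrightarrow> continuous_on {0..} (pw a)"
proof (cases "a = 0")
  case True
  then have "pw a = (\<lambda>_. 1)" by (auto simp: pw_def)
  then show ?thesis by simp
next
  case False
  assume "0 \<le> a"
  then have "continuous_on {0..} (\<lambda>x::real. x powr a)"
    using False by (intro continuous_on_powr' continuous_on_id continuous_on_const) auto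
  moreover have "pw a = (\<lambda>x. x powr a)" using False by (auto simp: pw_def)
  ultimately show ?thesis by simp
qed

lemma pw_measurable [measurable]: "pw a \<in> borel_measurable borel"
  by (simp add: pw_def[abs_def])

text \<open>The derivative of \<open>cov_fbm_part\<close> in its first argument. If
  \<open>2 * H * K = 1\<close> it is a step function of \<open>v\<close>; the value 1 of
  \<open>pw 0 0\<close> together with the weak inequality \<open>u \<le> v\<close> makes the jump at
  \<open>v = u\<close> right-continuous, as a distribution function must be.\<close>

definition fbm_kernel :: "real \<Rightarrow> real \<Rightarrow> real \<Rightarrow> real \<Rightarrow> real" where
  "fbm_kernel H K u v = 2 powr (- K) * (2 * H * K) *
     (pw (2 * H * K - 1) u + (if u \<le> v then pw (2 * H * K - 1) (v - u) else - pw (2 * H * K - 1) (u - v)))"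

text \<open>The derivative of \<open>cov_power_part\<close> in its first argument. Here the
  convention \<open>0 powr x = 0\<close> does no harm: it only sets the kernel to 0 at the single
  point \<open>u = 0\<close>.\<close>

definition power_kernel :: "real \<Rightarrow> real \<Rightarrow> real \<Rightarrow> real \<Rightarrow> real" where
  "power_kernel H K u v = 2 powr (- K) * (2 * H * K) *
     (u powr (2 * H * K - 1) - u powr (2 * H - 1) * (u powr (2 * H) + v powr (2 * H)) powr (K - 1))"

context
  fixes H K T :: real
  assumes T: "0 < T" and H: "0 < H" "H < 1" and K: "0 < K" "K \<le> 1" and HK: "1 / 2 \<le> H * K"
begin

lemma HK_bounds: "1 \<le> 2 * H * K" "2 * H * K < 2" "1 \<le> 2 * H"
proof -
  show "1 \<le> 2 * H * K" using HK by simp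
  have "H * K \<le> H * 1" using H K by (intro mult_left_mono) auto
  then have "H * K \<le> H" by simp
  then show "2 * H * K < 2" "1 \<le> 2 * H" using H HK by linarith+
qed

lemma fbm_kernel_has_integral:
  assumes s: "s \<in> {0..T}" and t: "t \<in> {0..T}"
  shows "((\<lambda>u. fbm_kernel H K u t) has_integral cov_fbm_part H K s t) {0..s}"
proof -
  define p where "p = 2 * H * K"
  have p: "1 \<le> p" using HK_bounds by (simp add: p_def)
  define \<Phi> where "\<Phi> u = 2 powr (- K) * (u powr p + t powr p - \<bar>t - u\<bar> powr p)" for u
  have "((\<lambda>u. fbm_kernel H K u t) has_integral \<Phi> s - \<Phi> 0) {0..s}"
  \<comment> \<open>The exceptional point is where \<open>\<bar>t - u\<bar> powr p\<close> changes
    its formula; for \<open>p = 1\<close> it has an actual corner there.\<close>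
  proof (rule fundamental_theorem_of_calculus_interior_strong[of "{t}"])
    show "continuous_on {0..s} \<Phi>" unfolding \<Phi>_def[abs_def]
      using p by (intro continuous_intros continuous_on_powr') auto
    fix u assume u: "u \<in> {0<..<s} - {t}"
    show "(\<Phi> has_vector_derivative fbm_kernel H K u t) (at u)"
      unfolding has_real_derivative_iff_has_vector_derivative[symmetric]
    proof (cases "u < t")
      case True
      have "((\<lambda>u. 2 powr (- K) * (u powr p + t powr p - (t - u) powr p)) has_real_derivative fbm_kernel H K u t) (at u)"
        using u True by (auto intro!: derivative_eq_intros simp: fbm_kernel_def pw_eq p_def algebra_simps)
      then show "(\<Phi> has_real_derivative fbm_kernel H K u t) (at u)"
        by (rule has_field_derivative_transform_within_open[where S = "{..<t}"]) (use True in \<open>auto simp: \<Phi>_def\<close>)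
    next
      case False
      then have ut: "t < u" using u by auto
      have "((\<lambda>u. 2 powr (- K) * (u powr p + t powr p - (u - t) powr p)) has_real_derivative fbm_kernel H K u t) (at u)"
        using u ut by (auto intro!: derivative_eq_intros simp: fbm_kernel_def pw_eq p_def algebra_simps)
      then show "(\<Phi> has_real_derivative fbm_kernel H K u t) (at u)"
        by (rule has_field_derivative_transform_within_open[where S = "{t<..}"]) (use ut in \<open>auto simp: \<Phi>_def\<close>)
    qed
  qed (use s in auto)
  moreover have "\<Phi> 0 = 0" using t by (simp add: \<Phi>_def)
  ultimately show ?thesis by (simp add: \<Phi>_def cov_fbm_part_def p_def)
qed

lemma power_kernel_has_integral:
  assumes s: "s \<in> {0..T}" and t: "t \<in> {0..T}"
  shows "((\<lambda>u. power_kernel H K u t) has_integral cov_power_part H K s t) {0..s}"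
proof -
  define p where "p = 2 * H * K"
  have p: "1 \<le> p" using HK_bounds by (simp add: p_def)
  define \<Phi> where "\<Phi> u = 2 powr (- K) * (u powr p + t powr p - (u powr (2 * H) + t powr (2 * H)) powr K)" for u
  have "((\<lambda>u. power_kernel H K u t) has_integral \<Phi> s - \<Phi> 0) {0..s}"
  proof (rule fundamental_theorem_of_calculus_interior_strong[of "{}"])
    show "continuous_on {0..s} \<Phi>" unfolding \<Phi>_def[abs_def]
      using p H K by (intro continuous_on_mult_left continuous_on_diff continuous_on_add
          continuous_on_powr_nonneg continuous_on_const continuous_on_id) auto
    fix u assume "u \<in> {0<..<s} - {}"
    then have u: "0 < u" by simp
    have pos: "0 < u powr (2 * H) + t powr (2 * H)" using u by (simp add: add_pos_nonneg)
    show "(\<Phi> has_vector_derivative power_kernel H K u t) (at u)"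
      unfolding has_real_derivative_iff_has_vector_derivative[symmetric] \<Phi>_def[abs_def]
      using u pos by (auto intro!: derivative_eq_intros simp: power_kernel_def p_def algebra_simps)
  qed (use s in auto)
  moreover have "\<Phi> 0 = 0" using t H K by (simp add: \<Phi>_def p_def powr_powr)
  ultimately show ?thesis by (simp add: \<Phi>_def cov_power_part_def p_def)
qed

text \<open>By \<open>1 / 2 \<le> H * K\<close> the exponent \<open>a = 2 * H * K - 1\<close> is
  nonnegative: \<open>- (u - v)^a\<close> increases and is at most 0 while \<open>v\<close> rises to
  \<open>u\<close>, and from there on \<open>(v - u)^a\<close> increases and is at least 0. For
  fixed \<open>u\<close> the kernel is thus a distribution function in \<open>v\<close>.\<close>

lemma fbm_kernel_mono:
  assumes "0 \<le> v" "v \<le> w"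
  shows "fbm_kernel H K u v \<le> fbm_kernel H K u w"
proof -
  define a where "a = 2 * H * K - 1"
  have a: "0 \<le> a" using HK_bounds by (simp add: a_def)
  have "(if u \<le> v then pw a (v - u) else - pw a (u - v)) \<le> (if u \<le> w then pw a (w - u) else - pw a (u - w))"
    using pw_mono[OF a, of "v - u" "w - u"] pw_mono[OF a, of "u - w" "u - v"] pw_nonneg[of a "u - v"] pw_nonneg[of a "w - u"] assms
    by auto
  then show ?thesis unfolding fbm_kernel_def a_def using H K by (intro mult_left_mono add_mono) auto
qed

lemma fbm_kernel_bounds:
  assumes u: "u \<in> {0..T}" and v: "v \<in> {0..T}"
  shows "0 \<le> fbm_kernel H K u v \<and> fbm_kernel H K u v \<le> 4 * pw (2 * H * K - 1) T"
proof -
  define a where "a = 2 * H * K - 1"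
  have a: "0 \<le> a" using HK_bounds by (simp add: a_def)
  let ?x = "pw a u + (if u \<le> v then pw a (v - u) else - pw a (u - v))"
  have x: "0 \<le> ?x" "?x \<le> 2 * pw a T"
    using pw_mono[OF a, of "u - v" u] pw_mono[OF a, of "v - u" T] pw_mono[OF a, of u T]
      pw_nonneg[of a u] pw_nonneg[of a "v - u"] pw_nonneg[of a "u - v"] u v by auto
  \<comment> \<open>The 4 in the bound: 2 for the constant factor, since
    \<open>2 powr (- K) \<le> 1\<close> and \<open>2 * H * K < 2\<close>, times 2 for the two
    summands of the bracket.\<close>
  have c: "0 \<le> 2 powr (- K) * (2 * H * K)" "2 powr (- K) * (2 * H * K) \<le> 2"
  proof -
    have "2 powr (- K) \<le> (2::real) powr 0" using K by (intro powr_mono) auto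
    then have "2 powr (- K) * (2 * H * K) \<le> 1 * 2" using HK_bounds by (intro mult_mono) auto
    then show "2 powr (- K) * (2 * H * K) \<le> 2" by simp
  qed (use H K in simp)
  have "2 powr (- K) * (2 * H * K) * ?x \<le> 2 * (2 * pw a T)" by (rule mult_mono) (use x c in auto)
  moreover have "0 \<le> 2 powr (- K) * (2 * H * K) * ?x" by (rule mult_nonneg_nonneg) (use x c in auto)
  ultimately show ?thesis unfolding fbm_kernel_def a_def by simp
qed

lemma fbm_kernel_right_cont:
  assumes u: "u \<in> {0..T}" and v: "0 \<le> v" "v < T"
  shows "(fbm_kernel H K u \<longlongrightarrow> fbm_kernel H K u v) (at_right v)"
proof -
  define a where "a = 2 * H * K - 1"
  have a: "0 \<le> a" using HK_bounds by (simp add: a_def)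
  define h where "h w = (if u \<le> w then pw a (w - u) else - pw a (u - w))" for w
  have "(h \<longlongrightarrow> h v) (at_right v)"
  proof (cases "u \<le> v")
    case True
    have "continuous_on {v..} (\<lambda>w. pw a (w - u))"
      by (rule continuous_on_compose2[OF pw_continuous[OF a]]) (use True in \<open>auto intro!: continuous_intros\<close>)
    then have "((\<lambda>w. pw a (w - u)) \<longlongrightarrow> pw a (v - u)) (at v within {v..})"
      by (auto simp: continuous_on_def)
    then have "((\<lambda>w. pw a (w - u)) \<longlongrightarrow> pw a (v - u)) (at_right v)"
      by (rule tendsto_within_subset) auto
    moreover have "\<forall>\<^sub>F w in at_right v. pw a (w - u) = h w"
      unfolding eventually_at_filter using True by (auto simp: h_def)
    ultimately show ?thesis using True by (auto simp: h_def elim: Lim_transform_eventually)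
  next
    case False
    have "continuous_on {..u} (\<lambda>w. - pw a (u - w))"
      by (intro continuous_on_minus continuous_on_compose2[OF pw_continuous[OF a]]) (auto intro!: continuous_intros)
    then have "((\<lambda>w. - pw a (u - w)) \<longlongrightarrow> - pw a (u - v)) (at v within {..u})"
      using False by (auto simp: continuous_on_def)
    then have "((\<lambda>w. - pw a (u - w)) \<longlongrightarrow> - pw a (u - v)) (at v within {v..u})"
      by (rule tendsto_within_subset) auto
    then have "((\<lambda>w. - pw a (u - w)) \<longlongrightarrow> - pw a (u - v)) (at_right v)"
      using False by (simp add: at_within_Icc_at_right)
    moreover have "\<forall>\<^sub>F w in at_right v. - pw a (u - w) = h w"
      using eventually_at_right_real[of v u] False by (auto simp: h_def elim!: eventually_mono)
    ultimately have "(h \<longlongrightarrow> - pw a (u - v)) (at_right v)" by (rule Lim_transform_eventually)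
    then show ?thesis using False by (simp add: h_def)
  qed
  then have "((\<lambda>w. 2 powr (- K) * (2 * H * K) * (pw a u + h w)) \<longlongrightarrow> 2 powr (- K) * (2 * H * K) * (pw a u + h v)) (at_right v)"
    by (intro tendsto_intros)
  then show ?thesis unfolding h_def a_def fbm_kernel_def[abs_def] .
qed

lemma fbm_kernel_measurable: "(\<lambda>u. fbm_kernel H K u v) \<in> borel_measurable borel"
  unfolding fbm_kernel_def by measurable

lemma power_kernel_measurable: "(\<lambda>u. power_kernel H K u v) \<in> borel_measurable borel"
  unfolding power_kernel_def by measurable

text \<open>For \<open>K \<le> 1\<close> the power with exponent \<open>K - 1\<close> is
  nonincreasing, and it is subtracted.\<close>

lemma power_kernel_mono:
  assumes "0 \<le> u" "0 \<le> v" "v \<le> w"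
  shows "power_kernel H K u v \<le> power_kernel H K u w"
proof (cases "u = 0")
  case True then show ?thesis by (simp add: power_kernel_def)
next
  case False
  have "(u powr (2 * H) + w powr (2 * H)) powr (K - 1) \<le> (u powr (2 * H) + v powr (2 * H)) powr (K - 1)"
    using assms False H K by (intro powr_mono2' add_left_mono powr_mono2) (auto intro: add_pos_nonneg)
  then show ?thesis unfolding power_kernel_def using H K by (intro mult_left_mono diff_left_mono) auto
qed

text \<open>At \<open>v = 0\<close> the subtracted product is
  \<open>u powr (2 * H - 1 + 2 * H * (K - 1))\<close>, which equals the first power; so the kernel
  starts from 0, and monotonicity makes it nonnegative. The constant 4 is larger than what the proof
  gives and agrees with \<open>fbm_kernel_bounds\<close>.\<close>

lemma power_kernel_bounds:
  assumes u: "u \<in> {0..T}" and v: "v \<in> {0..T}"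
  shows "0 \<le> power_kernel H K u v \<and> power_kernel H K u v \<le> 4 * pw (2 * H * K - 1) T"
proof
  have "power_kernel H K u 0 = 0"
    using u by (cases "u = 0") (auto simp: power_kernel_def powr_powr powr_add[symmetric] algebra_simps)
  then show "0 \<le> power_kernel H K u v" using power_kernel_mono[of u 0 v] u v by simp
  have "2 powr (- K) \<le> (2::real) powr 0" using K by (intro powr_mono) auto
  then have c: "2 powr (- K) * (2 * H * K) \<le> 1 * 2" using HK_bounds by (intro mult_mono) auto
  have "u powr (2 * H * K - 1) \<le> pw (2 * H * K - 1) T"
    using u HK_bounds by (auto simp: pw_def intro!: powr_mono2)
  then have "u powr (2 * H * K - 1) - u powr (2 * H - 1) * (u powr (2 * H) + v powr (2 * H)) powr (K - 1) \<le> pw (2 * H * K - 1) T"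
    by (simp add: diff_le_eq add_increasing2)
  then have "power_kernel H K u v \<le> 2 powr (- K) * (2 * H * K) * pw (2 * H * K - 1) T"
    unfolding power_kernel_def using H K by (intro mult_left_mono) auto
  also have "\<dots> \<le> 2 * pw (2 * H * K - 1) T" using c pw_nonneg by (intro mult_right_mono) auto
  also have "\<dots> \<le> 4 * pw (2 * H * K - 1) T" using pw_nonneg[of "2 * H * K - 1" T] by simp
  finally show "power_kernel H K u v \<le> 4 * pw (2 * H * K - 1) T" .
qed

lemma power_kernel_right_cont:
  assumes u: "u \<in> {0..T}" and v: "0 \<le> v" "v < T"
  shows "(power_kernel H K u \<longlongrightarrow> power_kernel H K u v) (at_right v)"
proof (cases "u = 0")
  case True then show ?thesis by (simp add: power_kernel_def[abs_def])
next
  case False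
  have "continuous_on {0..} (power_kernel H K u)"
    unfolding power_kernel_def[abs_def]
  proof (intro continuous_on_mult_left continuous_on_diff continuous_on_const continuous_on_powr)
    show "continuous_on {0..} (\<lambda>v. u powr (2 * H) + v powr (2 * H))"
      using H by (intro continuous_on_add continuous_on_powr_nonneg continuous_on_const continuous_on_id) auto
    have "0 < u powr (2 * H) + v powr (2 * H)" for v using u False by (intro add_pos_nonneg) auto
    then show "\<forall>v\<in>{0..}. u powr (2 * H) + v powr (2 * H) \<noteq> 0" by (metis less_irrefl)
  qed
  then have "(power_kernel H K u \<longlongrightarrow> power_kernel H K u v) (at v within {0..})"
    using v by (auto simp: continuous_on_def)
  then show ?thesis by (rule tendsto_within_subset) (use v in auto)
qed

end

section \<open>Marginals of the covariance measure\<close>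

lemma rectangle_zero:
  fixes \<nu> :: "(real \<times> real) measure"
  assumes "finite_measure \<nu>" "sets \<nu> = sets borel" "emeasure \<nu> (- ({0..T} \<times> {0..T})) = 0" "E \<in> sets borel"
  shows "measure \<nu> E = measure \<nu> (E \<inter> ({0..T} \<times> {0..T}))"
proof -
  interpret finite_measure \<nu> by fact
  have sq: "{0..T} \<times> {0..T} \<in> sets \<nu>" unfolding assms(2) by (intro sets_borel_Times) simp_all
  then have "measure \<nu> E = measure \<nu> (E \<inter> ({0..T} \<times> {0..T})) + measure \<nu> (E - {0..T} \<times> {0..T})"
    using assms(2,4) by (subst finite_measure_Union[symmetric]) (auto simp: Int_Diff_Un)
  moreover have "measure \<nu> (E - {0..T} \<times> {0..T}) \<le> measure \<nu> (- ({0..T} \<times> {0..T}))"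
  proof (rule finite_measure_mono)
    have "space \<nu> = UNIV" using sets_eq_imp_space_eq[OF assms(2)] by simp
    then show "- ({0..T} \<times> {0..T}) \<in> sets \<nu>" using sets.compl_sets[OF sq] by (simp add: Compl_eq_Diff_UNIV)
  qed auto
  moreover have "measure \<nu> (- ({0..T} \<times> {0..T})) = 0" using assms(3) by (simp add: measure_def)
  ultimately show ?thesis using measure_nonneg[of \<nu> "E - {0..T} \<times> {0..T}"] by linarith
qed

locale covariance_setting =
  fixes T H K :: real and \<mu> :: "(real \<times> real) signed_measure"
  assumes T: "0 < T" and H: "0 < H" "H < 1" and K: "0 < K" "K \<le> 1" and HK: "1 / 2 \<le> H * K"
    and cov: "covariance_measure H K T \<mu>"
begin

abbreviation "\<mu>p \<equiv> fst \<mu>"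
abbreviation "\<mu>m \<equiv> snd \<mu>"
abbreviation "sq \<equiv> {0..T} \<times> {0..T}"

lemma sets_mu: "sets \<mu>p = sets (restrict_space borel sq)" "sets \<mu>m = sets (restrict_space borel sq)"
  using cov by (auto simp: covariance_measure_def finite_signed_measure_def)

lemma finite_mu: "finite_measure \<mu>p" "finite_measure \<mu>m"
  using cov by (auto simp: covariance_measure_def finite_signed_measure_def)

lemma space_mu: "space \<mu>p = sq" "space \<mu>m = sq"
  using sets_mu[THEN sets_eq_imp_space_eq] by (simp_all add: space_restrict_space)

lemma sq_borel: "sq \<in> sets borel" by (intro sets_borel_Times) simp_all

lemma sets_mu_iff: "E \<in> sets \<mu>p \<longleftrightarrow> E \<in> sets borel \<and> E \<subseteq> sq" "E \<in> sets \<mu>m \<longleftrightarrow> E \<in> sets borel \<and> E \<subseteq> sq"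
  using sq_borel by (auto simp: sets_mu sets_restrict_space_iff)

lemma id_mu: "(\<lambda>z. z) \<in> \<mu>p \<rightarrow>\<^sub>M borel" "(\<lambda>z. z) \<in> \<mu>m \<rightarrow>\<^sub>M borel"
  by (simp_all add: measurable_cong_sets[OF sets_mu(1) refl] measurable_cong_sets[OF sets_mu(2) refl]
      measurable_restrict_space1)

lemma measurable_mu:
  assumes "f \<in> borel \<rightarrow>\<^sub>M N" shows "f \<in> \<mu>p \<rightarrow>\<^sub>M N" "f \<in> \<mu>m \<rightarrow>\<^sub>M N"
  using measurable_compose[OF id_mu(1) assms] measurable_compose[OF id_mu(2) assms] by simp_all

lemma fst_snd_measurable:
  "fst \<in> \<mu>p \<rightarrow>\<^sub>M borel" "snd \<in> \<mu>p \<rightarrow>\<^sub>M borel" "fst \<in> \<mu>m \<rightarrow>\<^sub>M borel" "snd \<in> \<mu>m \<rightarrow>\<^sub>M borel"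
  by (intro measurable_mu; simp add: borel_prod[symmetric])+

lemma fbm_quantile:
  obtains \<nu> where "finite_measure \<nu>" "sets \<nu> = sets borel"
    "\<And>s t. s \<in> {0..T} \<Longrightarrow> t \<in> {0..T} \<Longrightarrow> measure \<nu> ({..s} \<times> {..t}) = cov_fbm_part H K s t"
    "emeasure \<nu> (- sq) = 0"
    "\<And>A. A \<in> sets borel \<Longrightarrow> emeasure \<nu> (A \<times> UNIV) = (\<integral>\<^sup>+u. indicator (A \<inter> {0..T}) u * ennreal (fbm_kernel H K u T) \<partial>lborel)"
  by (rule quantile_measure[where T = T and G = "fbm_kernel H K" and F = "cov_fbm_part H K"
        and C = "4 * pw (2 * H * K - 1) T"])
     (assumption | rule T fbm_kernel_measurable[OF T H K HK] fbm_kernel_bounds[OF T H K HK]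
        fbm_kernel_mono[OF T H K HK] fbm_kernel_right_cont[OF T H K HK] fbm_kernel_has_integral[OF T H K HK] | rule that)+

lemma power_quantile:
  obtains \<nu> where "finite_measure \<nu>" "sets \<nu> = sets borel"
    "\<And>s t. s \<in> {0..T} \<Longrightarrow> t \<in> {0..T} \<Longrightarrow> measure \<nu> ({..s} \<times> {..t}) = cov_power_part H K s t"
    "emeasure \<nu> (- sq) = 0"
    "\<And>A. A \<in> sets borel \<Longrightarrow> emeasure \<nu> (A \<times> UNIV) = (\<integral>\<^sup>+u. indicator (A \<inter> {0..T}) u * ennreal (power_kernel H K u T) \<partial>lborel)"
proof -
  have mono: "power_kernel H K u v \<le> power_kernel H K u w" if "u \<in> {0..T}" "0 \<le> v" "v \<le> w" "w \<le> T" for u v w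
    using power_kernel_mono[OF T H K HK, of u v w] that by simp
  show thesis
    by (rule quantile_measure[where T = T and G = "power_kernel H K" and F = "cov_power_part H K"
          and C = "4 * pw (2 * H * K - 1) T"])
       (assumption | rule T power_kernel_measurable[OF T H K HK] power_kernel_bounds[OF T H K HK]
          mono power_kernel_right_cont[OF T H K HK] power_kernel_has_integral[OF T H K HK] | rule that)+
qed

text \<open>At \<open>v = T\<close> the kernels differ by a constant times
  \<open>(T - u) powr a + x\<close>, with \<open>a = 2 * H * K - 1\<close>. The first summand may
  vanish at \<open>u = T\<close> and the second at \<open>u = 0\<close>, but never both: on the left
  half of the interval the first is at least \<open>c1\<close>, on the right half the second is at
  least \<open>c2\<close>.\<close>

lemma kernel_difference_lower_bound:
  obtains c where "0 < c" "\<And>u. u \<in> {0<..<T} \<Longrightarrow> c + power_kernel H K u T \<le> fbm_kernel H K u T"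
proof -
  define a where "a = 2 * H * K - 1"
  note b = HK_bounds[OF T H K HK]
  have a: "0 \<le> a" using b by (simp add: a_def)
  define c1 where "c1 = (T / 2) powr a"
  define c2 where "c2 = (T / 2) powr (2 * H - 1) * (T powr (2 * H) + T powr (2 * H)) powr (K - 1)"
  define c where "c = 2 powr (- K) * (2 * H * K) * min c1 c2"
  have "0 < T powr (2 * H) + T powr (2 * H)" using T by (intro add_pos_pos) simp_all
  then have pos: "0 < c1" "0 < c2" using T by (simp_all add: c1_def c2_def)
  then have "0 < c" using H K by (simp add: c_def)
  moreover have "c + power_kernel H K u T \<le> fbm_kernel H K u T" if u: "u \<in> {0<..<T}" for u
  proof -
    define x where "x = u powr (2 * H - 1) * (u powr (2 * H) + T powr (2 * H)) powr (K - 1)"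
    have eq: "fbm_kernel H K u T - power_kernel H K u T = 2 powr (- K) * (2 * H * K) * ((T - u) powr a + x)"
      using u by (simp add: fbm_kernel_def power_kernel_def pw_eq a_def x_def algebra_simps)
    have x0: "0 \<le> x" by (simp add: x_def)
    have "min c1 c2 \<le> (T - u) powr a + x"
    proof (cases "u \<le> T / 2")
      case True
      then have "c1 \<le> (T - u) powr a" unfolding c1_def using T a by (intro powr_mono2) auto
      then show ?thesis using x0 by linarith
    next
      case False
      have "(T / 2) powr (2 * H - 1) \<le> u powr (2 * H - 1)"
        using False T b by (intro powr_mono2) auto
      moreover have "(T powr (2 * H) + T powr (2 * H)) powr (K - 1) \<le> (u powr (2 * H) + T powr (2 * H)) powr (K - 1)"
        using u T H K by (intro powr_mono2' add_right_mono powr_mono2 add_pos_pos) auto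
      ultimately have "c2 \<le> x" unfolding c2_def x_def by (intro mult_mono) auto
      moreover have "0 \<le> (T - u) powr a" by simp
      ultimately show ?thesis by linarith
    qed
    then have "c \<le> 2 powr (- K) * (2 * H * K) * ((T - u) powr a + x)"
      unfolding c_def using H K by (intro mult_left_mono) auto
    then show ?thesis using eq by linarith
  qed
  ultimately show thesis using that by blast
qed

text \<open>On rectangles with a corner at the origin this is
  \<open>bifbm_cov = cov_fbm_part - cov_power_part\<close>, rearranged into sums; uniqueness extends
  it to Borel sets. It is the bridge from the abstract Jordan parts to the two explicit
  measures.\<close>

lemma jordan_rectangle:
  fixes \<nu>a \<nu>b :: "(real \<times> real) measure"
  assumes a: "finite_measure \<nu>a" "sets \<nu>a = sets borel"
      "\<And>s t. s \<in> {0..T} \<Longrightarrow> t \<in> {0..T} \<Longrightarrow> measure \<nu>a ({..s} \<times> {..t}) = cov_power_part H K s t"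
      "emeasure \<nu>a (- sq) = 0"
    and b: "finite_measure \<nu>b" "sets \<nu>b = sets borel"
      "\<And>s t. s \<in> {0..T} \<Longrightarrow> t \<in> {0..T} \<Longrightarrow> measure \<nu>b ({..s} \<times> {..t}) = cov_fbm_part H K s t"
      "emeasure \<nu>b (- sq) = 0"
    and E: "E \<in> sets borel"
  shows "measure \<mu>p (E \<inter> sq) + measure \<nu>a E = measure \<mu>m (E \<inter> sq) + measure \<nu>b E"
proof -
  define P where "P = distr \<mu>p borel (\<lambda>z. z)"
  define N where "N = distr \<mu>m borel (\<lambda>z. z)"
  have P: "measure P E = measure \<mu>p (E \<inter> sq)" if "E \<in> sets borel" for E
    unfolding P_def using that by (subst measure_distr[OF id_mu(1)]) (simp_all add: space_mu)
  have N: "measure N E = measure \<mu>m (E \<inter> sq)" if "E \<in> sets borel" for E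
    unfolding N_def using that by (subst measure_distr[OF id_mu(2)]) (simp_all add: space_mu)
  have fin: "finite_measure P" "finite_measure N"
    unfolding P_def N_def using finite_mu id_mu by (auto intro: finite_measure.finite_measure_distr)
  have "measure P E + measure \<nu>a E = measure N E + measure \<nu>b E"
  proof (rule finite_measures_add_eq[OF fin(1) a(1) fin(2) b(1)])
    show "sets P = sets borel" "sets N = sets borel" by (simp_all add: P_def N_def)
    fix s t :: real
    define X where "X = {..s} \<times> {..t}"
    have X: "X \<in> sets borel" unfolding X_def by (intro sets_borel_Times) simp_all
    have "measure \<mu>p (X \<inter> sq) + measure \<nu>a X = measure \<mu>m (X \<inter> sq) + measure \<nu>b X"
    proof (cases "0 \<le> s \<and> 0 \<le> t")
      case False
      then have e: "X \<inter> sq = {}" by (auto simp: X_def)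
      show ?thesis using rectangle_zero[OF a(1,2,4) X] rectangle_zero[OF b(1,2,4) X] unfolding e by simp
    next
      case True
      \<comment> \<open>\<open>\<mu>\<close> lives on the square, so a quadrant reaching beyond it
        is cut back to \<open>min s T\<close> and \<open>min t T\<close>;
        \<open>rectangle_zero\<close> does the same for the explicit measures.\<close>
      define s' t' where "s' = min s T" and "t' = min t T"
      have st: "s' \<in> {0..T}" "t' \<in> {0..T}" using True T by (auto simp: s'_def t'_def)
      have e: "X \<inter> sq = {0..s'} \<times> {0..t'}" by (auto simp: X_def s'_def t'_def)
      have e': "({..s'} \<times> {..t'}) \<inter> sq = {0..s'} \<times> {0..t'}" using st by auto
      have X': "{..s'} \<times> {..t'} \<in> sets borel" by (intro sets_borel_Times) simp_all
      have m: "measure \<nu>a X = cov_power_part H K s' t'" "measure \<nu>b X = cov_fbm_part H K s' t'"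
        using rectangle_zero[OF a(1,2,4) X] rectangle_zero[OF a(1,2,4) X']
          rectangle_zero[OF b(1,2,4) X] rectangle_zero[OF b(1,2,4) X'] a(3)[OF st] b(3)[OF st]
        unfolding e e' by simp_all
      have "smeasure \<mu> ({0..s'} \<times> {0..t'}) = bifbm_cov H K s' t'"
        using cov st by (simp add: covariance_measure_def)
      also have "\<dots> = cov_fbm_part H K s' t' - cov_power_part H K s' t'"
        by (simp add: bifbm_cov_def cov_fbm_part_def cov_power_part_def abs_minus_commute algebra_simps)
      finally show ?thesis unfolding m e smeasure_def by linarith
    qed
    then show "measure P ({..s} \<times> {..t}) + measure \<nu>a ({..s} \<times> {..t}) = measure N ({..s} \<times> {..t}) + measure \<nu>b ({..s} \<times> {..t})"
      using P[OF X] N[OF X] by (simp add: X_def)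
  qed (use a(2) b(2) E in auto)
  then show ?thesis using P[OF E] N[OF E] by simp
qed

text \<open>The Jordan decomposition is minimal: on the set \<open>S\<close> that carries
  \<open>\<mu>p\<close> the other part vanishes, so \<open>\<mu>p \<le> \<nu>b\<close>, and in the
  same way \<open>\<mu>m \<le> \<nu>a\<close>. The marginals of \<open>\<nu>a\<close> and
  \<open>\<nu>b\<close> have the bounded kernels at \<open>v = T\<close> as densities. The last
  claim concerns the difference \<open>\<mu>p - \<mu>m\<close>, whose first marginal has the
  difference of the kernels as density.\<close>

lemma marginal_sets:
  obtains C c where "0 < c"
    "\<And>A M. A \<in> sets borel \<Longrightarrow> M \<in> {\<mu>p, \<mu>m} \<Longrightarrow> emeasure M ((A \<times> UNIV) \<inter> sq) \<le> ennreal C * emeasure lborel (A \<inter> {0..T})"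
    "\<And>A M. A \<in> sets borel \<Longrightarrow> M \<in> {\<mu>p, \<mu>m} \<Longrightarrow> emeasure M ((UNIV \<times> A) \<inter> sq) \<le> ennreal C * emeasure lborel (A \<inter> {0..T})"
    "\<And>A. A \<in> sets borel \<Longrightarrow> emeasure \<mu>m ((A \<times> UNIV) \<inter> sq) + ennreal c * emeasure lborel (A \<inter> {0..T}) \<le> emeasure \<mu>p ((A \<times> UNIV) \<inter> sq)"
proof -
  interpret p: finite_measure \<mu>p by (rule finite_mu)
  interpret m: finite_measure \<mu>m by (rule finite_mu)
  obtain \<nu>b where b: "finite_measure \<nu>b" "sets \<nu>b = sets borel"
    "\<And>s t. s \<in> {0..T} \<Longrightarrow> t \<in> {0..T} \<Longrightarrow> measure \<nu>b ({..s} \<times> {..t}) = cov_fbm_part H K s t"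
    "emeasure \<nu>b (- sq) = 0"
    "\<And>A. A \<in> sets borel \<Longrightarrow> emeasure \<nu>b (A \<times> UNIV) = (\<integral>\<^sup>+u. indicator (A \<inter> {0..T}) u * ennreal (fbm_kernel H K u T) \<partial>lborel)"
    using fbm_quantile by blast
  obtain \<nu>a where a: "finite_measure \<nu>a" "sets \<nu>a = sets borel"
    "\<And>s t. s \<in> {0..T} \<Longrightarrow> t \<in> {0..T} \<Longrightarrow> measure \<nu>a ({..s} \<times> {..t}) = cov_power_part H K s t"
    "emeasure \<nu>a (- sq) = 0"
    "\<And>A. A \<in> sets borel \<Longrightarrow> emeasure \<nu>a (A \<times> UNIV) = (\<integral>\<^sup>+u. indicator (A \<inter> {0..T}) u * ennreal (power_kernel H K u T) \<partial>lborel)"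
    using power_quantile by blast
  interpret a: finite_measure \<nu>a by (rule a(1))
  interpret b: finite_measure \<nu>b by (rule b(1))
  note eq = jordan_rectangle[OF a(1-4) b(1-4)]
  obtain c where c: "0 < c" "\<And>u. u \<in> {0<..<T} \<Longrightarrow> c + power_kernel H K u T \<le> fbm_kernel H K u T"
    using kernel_difference_lower_bound by blast
  define C where "C = 4 * pw (2 * H * K - 1) T"
  obtain S where S: "S \<in> sets (restrict_space borel sq)" "emeasure \<mu>p (sq - S) = 0" "emeasure \<mu>m S = 0"
    using cov by (auto simp: covariance_measure_def finite_signed_measure_def space_restrict_space)
  have S': "S \<in> sets borel" "S \<subseteq> sq" using S(1) sets_mu_iff(1) sets_mu(1) by auto
  \<comment> \<open>Reduction to \<open>E \<inter> S\<close>, where \<open>\<mu>m\<close> is 0 and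
    the Jordan identity reads \<open>\<mu>p + \<nu>a = \<nu>b\<close>.\<close>
  have p_le: "emeasure \<mu>p E \<le> emeasure \<nu>b E" if E: "E \<in> sets borel" "E \<subseteq> sq" for E
  proof -
    have "measure \<mu>p E = measure \<mu>p (E \<inter> S)"
    proof -
      have "measure \<mu>p E \<le> measure \<mu>p (E \<inter> S \<union> (sq - S))"
        using E S' sq_borel by (intro p.finite_measure_mono) (auto simp: sets_mu_iff)
      also have "\<dots> \<le> measure \<mu>p (E \<inter> S) + measure \<mu>p (sq - S)"
        using E S' sq_borel by (intro measure_Un_le) (auto simp: sets_mu_iff)
      also have "measure \<mu>p (sq - S) = 0" using S(2) by (simp add: measure_def)
      finally have "measure \<mu>p E \<le> measure \<mu>p (E \<inter> S)" by simp
      moreover have "measure \<mu>p (E \<inter> S) \<le> measure \<mu>p E"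
        using E S' by (intro p.finite_measure_mono) (auto simp: sets_mu_iff)
      ultimately show ?thesis by simp
    qed
    also have "\<dots> \<le> measure \<nu>b (E \<inter> S)"
    proof -
      have "measure \<mu>m (E \<inter> S) \<le> measure \<mu>m S" using E S' by (intro m.finite_measure_mono) (auto simp: sets_mu_iff)
      moreover have "measure \<mu>m S = 0" using S(3) by (simp add: measure_def)
      moreover have "(E \<inter> S) \<inter> sq = E \<inter> S" using E by auto
      moreover have "measure \<mu>p (E \<inter> S \<inter> sq) + measure \<nu>a (E \<inter> S) = measure \<mu>m (E \<inter> S \<inter> sq) + measure \<nu>b (E \<inter> S)"
        using E S' by (intro eq) auto
      ultimately show ?thesis using measure_nonneg[of \<nu>a "E \<inter> S"] by (simp only: | linarith)+
    qed
    also have "\<dots> \<le> measure \<nu>b E" using E b(2) by (intro b.finite_measure_mono) auto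
    finally show ?thesis by (simp add: p.emeasure_eq_measure b.emeasure_eq_measure)
  qed
  have m_le: "emeasure \<mu>m E \<le> emeasure \<nu>a E" if E: "E \<in> sets borel" "E \<subseteq> sq" for E
  proof -
    have "measure \<mu>m E = measure \<mu>m (E - S)"
    proof -
      have "measure \<mu>m E \<le> measure \<mu>m ((E - S) \<union> S)"
        using E S' sq_borel by (intro m.finite_measure_mono) (auto simp: sets_mu_iff)
      also have "\<dots> \<le> measure \<mu>m (E - S) + measure \<mu>m S"
        using E S' sq_borel by (intro measure_Un_le) (auto simp: sets_mu_iff)
      also have "measure \<mu>m S = 0" using S(3) by (simp add: measure_def)
      finally have "measure \<mu>m E \<le> measure \<mu>m (E - S)" by simp
      moreover have "measure \<mu>m (E - S) \<le> measure \<mu>m E"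
        using E S' by (intro m.finite_measure_mono) (auto simp: sets_mu_iff)
      ultimately show ?thesis by simp
    qed
    also have "\<dots> \<le> measure \<nu>a (E - S)"
    proof -
      have "measure \<mu>p (E - S) \<le> measure \<mu>p (sq - S)"
        using E S' sq_borel by (intro p.finite_measure_mono) (auto simp: sets_mu_iff)
      moreover have "measure \<mu>p (sq - S) = 0" using S(2) by (simp add: measure_def)
      moreover have "(E - S) \<inter> sq = E - S" using E by auto
      moreover have "measure \<mu>p ((E - S) \<inter> sq) + measure \<nu>a (E - S) = measure \<mu>m ((E - S) \<inter> sq) + measure \<nu>b (E - S)"
        using E S' by (intro eq) auto
      ultimately show ?thesis using measure_nonneg[of \<nu>b "E - S"] measure_nonneg[of \<mu>p "E - S"] by (simp only: | linarith)+
    qed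
    also have "\<dots> \<le> measure \<nu>a E" using E a(2) by (intro a.finite_measure_mono) auto
    finally show ?thesis by (simp add: m.emeasure_eq_measure a.emeasure_eq_measure)
  qed
  have kb: "fbm_kernel H K u T \<le> C" "power_kernel H K u T \<le> C" "0 \<le> fbm_kernel H K u T" "0 \<le> power_kernel H K u T"
    if "u \<in> {0..T}" for u
    using fbm_kernel_bounds[OF T H K HK that, of T] power_kernel_bounds[OF T H K HK that, of T] T
    by (auto simp: C_def)
  have int_le: "(\<integral>\<^sup>+u. indicator (A \<inter> {0..T}) u * ennreal (g u) \<partial>lborel) \<le> ennreal C * emeasure lborel (A \<inter> {0..T})"
    if "A \<in> sets borel" "\<And>u. u \<in> {0..T} \<Longrightarrow> g u \<le> C" for A g
  proof -
    have "(\<integral>\<^sup>+u. indicator (A \<inter> {0..T}) u * ennreal (g u) \<partial>lborel) \<le> (\<integral>\<^sup>+u. ennreal C * indicator (A \<inter> {0..T}) u \<partial>lborel)"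
      using that(2) by (intro nn_integral_mono) (auto simp: indicator_def ennreal_leI)
    also have "\<dots> = ennreal C * emeasure lborel (A \<inter> {0..T})" using that(1) by (simp add: nn_integral_cmult_indicator)
    finally show ?thesis .
  qed
  \<comment> \<open>The quantile construction controls the first marginal only; the symmetry of the
    covariance parts in \<open>s\<close> and \<open>t\<close> supplies the second.\<close>
  have sym_a: "measure \<nu>a ({..s} \<times> {..t}) = measure \<nu>a ({..t} \<times> {..s})"
    and sym_b: "measure \<nu>b ({..s} \<times> {..t}) = measure \<nu>b ({..t} \<times> {..s})" for s t
  proof -
    have X: "{..s} \<times> {..t} \<in> sets borel" for s t :: real by (intro sets_borel_Times) simp_all
    have e: "({..s} \<times> {..t}) \<inter> sq = (if s < 0 \<or> t < 0 then {} else ({..min s T} \<times> {..min t T}) \<inter> sq)" for s t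
      by auto
    have va: "measure \<nu>a ({..s} \<times> {..t}) = (if s < 0 \<or> t < 0 then 0 else cov_power_part H K (min s T) (min t T))" for s t
      using rectangle_zero[OF a(1,2,4) X, of s t] rectangle_zero[OF a(1,2,4) X, of "min s T" "min t T"]
        a(3)[of "min s T" "min t T"] T e[of s t] by (auto split: if_splits)
    have vb: "measure \<nu>b ({..s} \<times> {..t}) = (if s < 0 \<or> t < 0 then 0 else cov_fbm_part H K (min s T) (min t T))" for s t
      using rectangle_zero[OF b(1,2,4) X, of s t] rectangle_zero[OF b(1,2,4) X, of "min s T" "min t T"]
        b(3)[of "min s T" "min t T"] T e[of s t] by (auto split: if_splits)
    show "measure \<nu>a ({..s} \<times> {..t}) = measure \<nu>a ({..t} \<times> {..s})"
      unfolding va by (auto simp: cov_power_part_def add.commute)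
    show "measure \<nu>b ({..s} \<times> {..t}) = measure \<nu>b ({..t} \<times> {..s})"
      unfolding vb by (auto simp: cov_fbm_part_def add.commute abs_minus_commute)
  qed
  have nu_le: "emeasure \<nu> (A \<times> UNIV) \<le> ennreal C * emeasure lborel (A \<inter> {0..T})"
     "emeasure \<nu> (UNIV \<times> A) \<le> ennreal C * emeasure lborel (A \<inter> {0..T})"
    if A: "A \<in> sets borel" and nu: "\<nu> = \<nu>a \<or> \<nu> = \<nu>b" for A \<nu>
  proof -
    show 1: "emeasure \<nu> (A \<times> UNIV) \<le> ennreal C * emeasure lborel (A \<inter> {0..T})"
      using nu a(5)[OF A] b(5)[OF A] int_le[OF A] kb(1,2) by auto
    have "emeasure \<nu> (UNIV \<times> A) = emeasure \<nu> (A \<times> UNIV)"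
      using nu pair_swap_measure_eq[OF a(1,2) sym_a A] pair_swap_measure_eq[OF b(1,2) sym_b A] by auto
    then show "emeasure \<nu> (UNIV \<times> A) \<le> ennreal C * emeasure lborel (A \<inter> {0..T})" using 1 by simp
  qed
  have mono_nu: "emeasure \<nu> (E \<inter> sq) \<le> emeasure \<nu> E" if "\<nu> = \<nu>a \<or> \<nu> = \<nu>b" "E \<in> sets borel" for E \<nu>
    using that a(2) b(2) by (intro emeasure_mono) auto
  show thesis
  proof (rule that[OF c(1)])
    fix A :: "real set" and M assume A: "A \<in> sets borel" and M: "M \<in> {\<mu>p, \<mu>m}"
    have AU: "A \<times> (UNIV :: real set) \<in> sets borel" "(UNIV :: real set) \<times> A \<in> sets borel" using A by (auto intro: sets_borel_Times)
    obtain \<nu> where nu: "\<nu> = \<nu>a \<or> \<nu> = \<nu>b" "\<And>E. E \<in> sets borel \<Longrightarrow> E \<subseteq> sq \<Longrightarrow> emeasure M E \<le> emeasure \<nu> E"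
      using M p_le m_le by blast
    have "emeasure M (E \<inter> sq) \<le> emeasure \<nu> E" if "E \<in> sets borel" for E
      using nu(2)[of "E \<inter> sq"] that sq_borel mono_nu[OF nu(1) that] by (auto intro: order_trans)
    then show "emeasure M ((A \<times> UNIV) \<inter> sq) \<le> ennreal C * emeasure lborel (A \<inter> {0..T})"
      "emeasure M ((UNIV \<times> A) \<inter> sq) \<le> ennreal C * emeasure lborel (A \<inter> {0..T})"
      using AU nu_le[OF A nu(1)] by (blast intro: order_trans)+
  next
    fix A :: "real set" assume A: "A \<in> sets borel"
    have AU: "A \<times> (UNIV :: real set) \<in> sets borel" using A by (auto intro: sets_borel_Times)
    define B where "B = A \<inter> {0..T}"
    have Bm: "B \<in> sets borel" using A by (simp add: B_def)
    have "emeasure \<nu>a (A \<times> UNIV) + ennreal c * emeasure lborel B =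
        (\<integral>\<^sup>+u. indicator B u * ennreal (power_kernel H K u T) + ennreal c * indicator B u \<partial>lborel)"
      unfolding a(5)[OF A] B_def[symmetric] using Bm power_kernel_measurable[OF T H K HK]
      by (subst nn_integral_add) (auto simp: nn_integral_cmult_indicator)
    also have "\<dots> \<le> (\<integral>\<^sup>+u. indicator B u * ennreal (fbm_kernel H K u T) \<partial>lborel)"
    proof (rule nn_integral_mono_AE)
      \<comment> \<open>The lower bound for the kernels is available on the open interval only; the
        endpoints are negligible.\<close>
      have "AE u in lborel. u \<noteq> 0 \<and> u \<noteq> T" using AE_lborel_singleton[of 0] AE_lborel_singleton[of T] by auto
      then show "AE u in lborel. indicator B u * ennreal (power_kernel H K u T) + ennreal c * indicator B u
          \<le> indicator B u * ennreal (fbm_kernel H K u T)"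
      proof (eventually_elim)
        case (elim u)
        show ?case
        proof (cases "u \<in> B")
          case True
          then have u: "u \<in> {0<..<T}" "u \<in> {0..T}" using elim by (auto simp: B_def)
          have "ennreal (power_kernel H K u T) + ennreal c \<le> ennreal (fbm_kernel H K u T)"
          proof -
            have "ennreal (power_kernel H K u T) + ennreal c = ennreal (power_kernel H K u T + c)"
              using kb(4)[OF u(2)] c(1) by simp
            also have "\<dots> \<le> ennreal (fbm_kernel H K u T)"
              by (rule ennreal_leI) (use c(2)[OF u(1)] in linarith)
            finally show ?thesis .
          qed
          then show ?thesis using True by simp
        qed simp
      qed
    qed
    also have "\<dots> = emeasure \<nu>b (A \<times> UNIV)" unfolding b(5)[OF A] B_def ..
    finally have "ennreal (measure \<nu>a (A \<times> UNIV)) + ennreal c * emeasure lborel B \<le> ennreal (measure \<nu>b (A \<times> UNIV))"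
      by (simp add: a.emeasure_eq_measure b.emeasure_eq_measure)
    moreover have "emeasure lborel B \<noteq> \<infinity>"
      using emeasure_mono[of B "{0..T}" lborel] T Bm by (auto simp: B_def top_unique)
    then have fin: "ennreal c * emeasure lborel B = ennreal (c * measure lborel B)"
      using c(1) by (simp add: emeasure_eq_ennreal_measure ennreal_mult)
    ultimately have 1: "measure \<nu>a (A \<times> UNIV) + c * measure lborel B \<le> measure \<nu>b (A \<times> UNIV)"
      using c(1) by (simp add: ennreal_plus[symmetric] del: ennreal_plus)
    have "measure \<mu>m ((A \<times> UNIV) \<inter> sq) + c * measure lborel B \<le> measure \<mu>p ((A \<times> UNIV) \<inter> sq)"
    proof -
      have "measure \<mu>p ((A \<times> UNIV) \<inter> sq) + measure \<nu>a (A \<times> UNIV) = measure \<mu>m ((A \<times> UNIV) \<inter> sq) + measure \<nu>b (A \<times> UNIV)"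
        by (intro eq) (use AU in auto)
      then show ?thesis using 1 by linarith
    qed
    then have "ennreal (measure \<mu>m ((A \<times> UNIV) \<inter> sq) + c * measure lborel B) \<le> ennreal (measure \<mu>p ((A \<times> UNIV) \<inter> sq))"
      by (rule ennreal_leI)
    then show "emeasure \<mu>m ((A \<times> UNIV) \<inter> sq) + ennreal c * emeasure lborel (A \<inter> {0..T}) \<le> emeasure \<mu>p ((A \<times> UNIV) \<inter> sq)"
      using fin c(1) by (simp add: B_def p.emeasure_eq_measure m.emeasure_eq_measure ennreal_plus)
  qed
qed

end

text \<open>Only a modulus estimate is used: \<open>D(s) = exp (q s) - \<integral>\<^sub>0\<^sup>s exp q k\<close> satisfies
  \<open>\<bar>D s' - D s\<bar> \<le> \<epsilon> \<integral>\<^sub>s\<^sup>s' \<bar>k\<bar>\<close> for \<open>s, s'\<close> close to each other, hence is constant.\<close>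

lemma exp_chain_rule_integral:
  fixes k q :: "real \<Rightarrow> real"
  assumes t: "0 \<le> t" and k: "set_integrable lborel {0..t} k"
    and q: "\<And>s. s \<in> {0..t} \<Longrightarrow> q s = q 0 + (LBINT r:{0..s}. k r)"
  shows "exp (q t) - exp (q 0) = (LBINT r:{0..t}. exp (q r) * k r)"
proof -
  have ki: "k integrable_on {0..t}" "\<And>s. s \<in> {0..t} \<Longrightarrow> (LBINT r:{0..s}. k r) = integral {0..s} k"
    and kabs: "(\<lambda>r. \<bar>k r\<bar>) integrable_on {0..t}"
  proof -
    show "k integrable_on {0..t}" by (rule set_borel_integral_eq_integral(1)[OF k])
    show "(LBINT r:{0..s}. k r) = integral {0..s} k" if "s \<in> {0..t}" for s
      by (rule set_borel_integral_eq_integral(2)[OF set_integrable_subset[OF k]]) (use that in auto)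
    show "(\<lambda>r. \<bar>k r\<bar>) integrable_on {0..t}"
      by (rule set_borel_integral_eq_integral(1)) (rule set_integrable_abs[OF k])
  qed
  have q': "q s = q 0 + integral {0..s} k" if "s \<in> {0..t}" for s using q[OF that] ki(2)[OF that] by simp
  have "continuous_on {0..t} (\<lambda>s. q 0 + integral {0..s} k)"
    by (intro continuous_intros indefinite_integral_continuous_1 ki)
  then have qc: "continuous_on {0..t} q"
    by (rule continuous_on_eq) (rule q'[symmetric])
  obtain B where B: "\<And>s. s \<in> {0..t} \<Longrightarrow> \<bar>q s\<bar> \<le> B"
    using compact_imp_bounded[OF compact_continuous_image[OF qc compact_Icc]]
    unfolding bounded_iff by (metis imageI real_norm_def)
  have exp_lip: "\<bar>exp a - exp b\<bar> \<le> exp B * \<bar>a - b\<bar>" if "\<bar>a\<bar> \<le> B" "\<bar>b\<bar> \<le> B" for a b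
  proof -
    have "\<bar>exp a - exp b\<bar> \<le> exp B * \<bar>a - b\<bar>" if "a \<le> B" "b \<le> B" "b \<le> a" for a b :: real
    proof -
      have "1 - (a - b) \<le> exp (b - a)" using exp_ge_add_one_self[of "b - a"] by linarith
      then have "exp a * (1 - exp (b - a)) \<le> exp a * (a - b)" by (intro mult_left_mono) auto
      then have "exp a - exp b \<le> exp a * (a - b)" by (simp add: algebra_simps flip: exp_add)
      also have "\<dots> \<le> exp B * (a - b)" using that by (intro mult_right_mono) auto
      finally show ?thesis using that by simp
    qed
    from this[of a b] this[of b a] that show ?thesis by (cases "b \<le> a") (auto simp: abs_minus_commute)
  qed
  have eqki: "(\<lambda>r. exp (q r) * k r) integrable_on {0..t}" and eq_set: "set_integrable lborel {0..t} (\<lambda>r. exp (q r) * k r)"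
  proof -
    show "set_integrable lborel {0..t} (\<lambda>r. exp (q r) * k r)"
    proof -
      have "continuous_on {0..t} (\<lambda>r. exp (q r))" by (intro continuous_intros qc)
      then have m: "(\<lambda>r. indicator {0..t} r *\<^sub>R exp (q r)) \<in> borel_measurable borel"
        by (intro borel_measurable_continuous_on_indicator) auto
      have "integrable lborel (\<lambda>r. (indicator {0..t} r *\<^sub>R exp (q r)) * (indicator {0..t} r *\<^sub>R k r))"
      proof (rule Bochner_Integration.integrable_bound)
        show "integrable lborel (\<lambda>r. exp B * (indicator {0..t} r *\<^sub>R k r))"
          using k by (simp add: set_integrable_def)
        show "(\<lambda>r. (indicator {0..t} r *\<^sub>R exp (q r)) * (indicator {0..t} r *\<^sub>R k r)) \<in> borel_measurable lborel"
          using m k unfolding set_integrable_def by (intro borel_measurable_times) auto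
        show "AE r in lborel. norm ((indicator {0..t} r *\<^sub>R exp (q r)) * (indicator {0..t} r *\<^sub>R k r)) \<le> norm (exp B * (indicator {0..t} r *\<^sub>R k r))"
          using B by (intro AE_I2) (auto simp: indicator_def abs_mult abs_le_iff intro!: mult_right_mono)
      qed
      then show ?thesis unfolding set_integrable_def
        by (rule Bochner_Integration.integrable_cong[THEN iffD1, rotated 2]) (auto simp: indicator_def)
    qed
    then show "(\<lambda>r. exp (q r) * k r) integrable_on {0..t}" by (rule set_borel_integral_eq_integral(1))
  qed
  have iab: "\<bar>integral A f\<bar> \<le> integral A g" if "f integrable_on A" "g integrable_on A" "\<And>r. r \<in> A \<Longrightarrow> \<bar>f r\<bar> \<le> g r"
    for f g :: "real \<Rightarrow> real" and A
    using Henstock_Kurzweil_Integration.integral_norm_bound_integral[of f A g] that by simp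
  define D where "D s = exp (q s) - integral {0..s} (\<lambda>r. exp (q r) * k r)" for s
  define K where "K = integral {0..t} (\<lambda>r. \<bar>k r\<bar>)"
  \<comment> \<open>Freezing \<open>exp (q r)\<close> at \<open>r = a\<close> causes two errors: the
    second-order remainder of \<open>exp (q b)\<close>, of size
    \<open>exp B * \<bar>q b - q a\<bar>^2\<close>, and the error under the integral. In each, one
    factor is at most the oscillation \<open>e\<close> and the other at most the integral of
    \<open>\<bar>k\<bar>\<close>; together they give the factor 2.\<close>
  have local: "\<bar>D b - D a\<bar> \<le> 2 * exp B * e * integral {a..b} (\<lambda>r. \<bar>k r\<bar>)"
    if ab: "0 \<le> a" "a \<le> b" "b \<le> t" and osc: "\<And>r. r \<in> {a..b} \<Longrightarrow> \<bar>q r - q a\<bar> \<le> e" for a b e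
  proof -
    have sub: "{a..b} \<subseteq> {0..t}" using ab by auto
    have kI: "k integrable_on {a..b}" by (rule integrable_on_subinterval[OF ki(1) sub])
    have kA: "(\<lambda>r. \<bar>k r\<bar>) integrable_on {a..b}" by (rule integrable_on_subinterval[OF kabs sub])
    have eI: "(\<lambda>r. exp (q r) * k r) integrable_on {a..b}" by (rule integrable_on_subinterval[OF eqki sub])
    have e0: "0 \<le> e" using osc[of a] ab by auto
    have qab: "q b - q a = integral {a..b} k"
      using q'[of a] q'[of b] ab Henstock_Kurzweil_Integration.integral_combine[OF ab(1,2), of k]
        integrable_on_subinterval[OF ki(1), of 0 b] by auto
    have Dab: "D b - D a = (exp (q b) - exp (q a)) - integral {a..b} (\<lambda>r. exp (q r) * k r)"
      using ab Henstock_Kurzweil_Integration.integral_combine[OF ab(1,2), of "\<lambda>r. exp (q r) * k r"]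
        integrable_on_subinterval[OF eqki, of 0 b] by (auto simp: D_def)
    let ?I = "integral {a..b} (\<lambda>r. \<bar>k r\<bar>)"
    have Iq: "\<bar>q b - q a\<bar> \<le> ?I"
      unfolding qab by (rule iab[OF kI kA]) simp
    have 1: "\<bar>exp (q b) - exp (q a) - exp (q a) * (q b - q a)\<bar> \<le> exp B * e * ?I"
    proof -
      have "\<bar>exp (q b) - exp (q a) - exp (q a) * (q b - q a)\<bar> \<le> exp B * \<bar>q b - q a\<bar> * \<bar>q b - q a\<bar>"
      proof -
        have "\<exists>z. min (q a) (q b) \<le> z \<and> z \<le> max (q a) (q b) \<and> exp (q b) - exp (q a) = exp z * (q b - q a)"
        proof (cases "q a" "q b" rule: linorder_cases)
          case less
          then show ?thesis using MVT2[of "q a" "q b" exp exp] by (auto intro!: derivative_eq_intros)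
        next
          case greater
          then obtain z where z: "q b < z" "z < q a" "exp (q a) - exp (q b) = (q a - q b) * exp z"
            using MVT2[of "q b" "q a" exp exp] DERIV_exp by blast
          have "exp (q b) - exp (q a) = exp z * (q b - q a)" using z(3) by (simp add: algebra_simps)
          then show ?thesis using z(1,2) by (intro exI[of _ z]) auto
        qed auto
        then obtain z where z: "min (q a) (q b) \<le> z" "z \<le> max (q a) (q b)" "exp (q b) - exp (q a) = exp z * (q b - q a)"
          by blast
        have "\<bar>z\<bar> \<le> B" "\<bar>z - q a\<bar> \<le> \<bar>q b - q a\<bar>" using z(1,2) B[of a] B[of b] ab by auto
        then have "\<bar>exp z - exp (q a)\<bar> \<le> exp B * \<bar>z - q a\<bar>" "exp B * \<bar>z - q a\<bar> \<le> exp B * \<bar>q b - q a\<bar>"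
          using exp_lip[of z "q a"] B[of a] ab by (simp_all add: mult_left_mono)
        then have "\<bar>exp z - exp (q a)\<bar> \<le> exp B * \<bar>q b - q a\<bar>" by (rule order_trans)
        then have "\<bar>exp z - exp (q a)\<bar> * \<bar>q b - q a\<bar> \<le> exp B * \<bar>q b - q a\<bar> * \<bar>q b - q a\<bar>"
          by (intro mult_right_mono) auto
        then show ?thesis unfolding z(3) by (simp add: abs_mult[symmetric] algebra_simps)
      qed
      also have "\<dots> \<le> exp B * e * ?I" using osc[of b] ab Iq e0 by (intro mult_mono mult_nonneg_nonneg) auto
      finally show ?thesis .
    qed
    have 2: "\<bar>integral {a..b} (\<lambda>r. (exp (q r) - exp (q a)) * k r)\<bar> \<le> exp B * e * ?I"
    proof -
      have i1: "(\<lambda>r. (exp (q r) - exp (q a)) * k r) integrable_on {a..b}"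
        unfolding left_diff_distrib
        using eI kI by (intro Henstock_Kurzweil_Integration.integrable_diff integrable_on_mult_right) auto
      have "\<bar>integral {a..b} (\<lambda>r. (exp (q r) - exp (q a)) * k r)\<bar> \<le> integral {a..b} (\<lambda>r. exp B * e * \<bar>k r\<bar>)"
      proof (rule iab[OF i1])
        show "(\<lambda>r. exp B * e * \<bar>k r\<bar>) integrable_on {a..b}" by (rule integrable_on_mult_right[OF kA])
        fix r assume r: "r \<in> {a..b}"
        have "\<bar>exp (q r) - exp (q a)\<bar> \<le> exp B * \<bar>q r - q a\<bar>" using exp_lip B r ab by auto
        also have "\<dots> \<le> exp B * e" using osc[OF r] by (intro mult_left_mono) auto
        finally show "\<bar>(exp (q r) - exp (q a)) * k r\<bar> \<le> exp B * e * \<bar>k r\<bar>"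
          by (auto simp: abs_mult intro: mult_right_mono)
      qed
      then show ?thesis by simp
    qed
    have "integral {a..b} (\<lambda>r. exp (q r) * k r) = integral {a..b} (\<lambda>r. (exp (q r) - exp (q a)) * k r) + exp (q a) * integral {a..b} k"
    proof -
      have "integral {a..b} (\<lambda>r. (exp (q r) - exp (q a)) * k r) = integral {a..b} (\<lambda>r. exp (q r) * k r) - integral {a..b} (\<lambda>r. exp (q a) * k r)"
        unfolding left_diff_distrib
        using eI kI by (intro Henstock_Kurzweil_Integration.integral_diff integrable_on_mult_right) auto
      then show ?thesis by simp
    qed
    then have "D b - D a = (exp (q b) - exp (q a) - exp (q a) * (q b - q a)) - integral {a..b} (\<lambda>r. (exp (q r) - exp (q a)) * k r)"
      unfolding Dab qab by simp
    then show ?thesis using 1 2 by linarith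
  qed
  \<comment> \<open>Uniform continuity of \<open>q\<close> provides one mesh for all local
    estimates. Advancing by \<open>d / 2\<close> keeps the oscillation below \<open>e\<close>, and
    the integrals of \<open>\<bar>k\<bar>\<close> add up, so the total error is still
    \<open>e\<close> times a constant.\<close>
  have glob: "\<bar>D t - D 0\<bar> \<le> 2 * exp B * e * K" if e: "0 < e" for e
  proof -
    obtain d where d: "0 < d" "\<And>r s. r \<in> {0..t} \<Longrightarrow> s \<in> {0..t} \<Longrightarrow> \<bar>r - s\<bar> < d \<Longrightarrow> \<bar>q r - q s\<bar> < e"
      using compact_uniformly_continuous[OF qc compact_Icc] e
      unfolding uniformly_continuous_on_def dist_real_def by metis
    have step: "\<bar>D s - D 0\<bar> \<le> 2 * exp B * e * integral {0..s} (\<lambda>r. \<bar>k r\<bar>)"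
      if "s \<in> {0..t}" "s \<le> real n * (d / 2)" for n s
      using that
    proof (induction n arbitrary: s)
      case 0
      then have "s = 0" by simp
      then show ?case by simp
    next
      case (Suc n)
      define a where "a = max 0 (s - d / 2)"
      have a: "a \<in> {0..t}" "a \<le> s" "a \<le> real n * (d / 2)" "s - a < d"
      proof -
        have "0 \<le> real n * (d / 2)" "s - d / 2 \<le> real n * (d / 2)"
          using Suc.prems d(1) by (simp_all add: algebra_simps)
        then show "a \<le> real n * (d / 2)" unfolding a_def by (rule max.boundedI)
      qed (use Suc.prems d(1) in \<open>auto simp: a_def\<close>)
      have "\<bar>D s - D a\<bar> \<le> 2 * exp B * e * integral {a..s} (\<lambda>r. \<bar>k r\<bar>)"
      proof (rule local)
        fix r assume "r \<in> {a..s}"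
        then show "\<bar>q r - q a\<bar> \<le> e" using d(2)[of r a] a Suc.prems by (auto intro!: less_imp_le)
      qed (use a Suc.prems in auto)
      moreover have "\<bar>D a - D 0\<bar> \<le> 2 * exp B * e * integral {0..a} (\<lambda>r. \<bar>k r\<bar>)"
        using Suc.IH[of a] a by auto
      moreover have "integral {0..a} (\<lambda>r. \<bar>k r\<bar>) + integral {a..s} (\<lambda>r. \<bar>k r\<bar>) = integral {0..s} (\<lambda>r. \<bar>k r\<bar>)"
        using a Suc.prems integrable_on_subinterval[OF kabs, of 0 s]
        by (intro Henstock_Kurzweil_Integration.integral_combine) auto
      then have "2 * exp B * e * integral {0..a} (\<lambda>r. \<bar>k r\<bar>) + 2 * exp B * e * integral {a..s} (\<lambda>r. \<bar>k r\<bar>) = 2 * exp B * e * integral {0..s} (\<lambda>r. \<bar>k r\<bar>)"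
        by (metis distrib_left)
      ultimately show ?case by linarith
    qed
    obtain n where "t / (d / 2) \<le> real n" using real_arch_simple by blast
    then have "t \<le> real n * (d / 2)" using d(1) by (simp add: field_simps)
    then show ?thesis using step[of t n] t by (simp add: K_def)
  qed
  have "\<bar>D t - D 0\<bar> \<le> 0"
  proof (rule field_le_epsilon)
    fix e :: real assume e: "0 < e"
    have K0: "0 \<le> K" unfolding K_def by (rule integral_nonneg[OF kabs]) simp
    \<comment> \<open>\<open>K\<close>, here the total integral of \<open>\<bar>k\<bar>\<close>, may
      be 0; \<open>K + 1\<close> keeps the divisor positive.\<close>
    define e' where "e' = e / (2 * exp B * (K + 1))"
    have e': "0 < e'" using e K0 by (simp add: e'_def)
    have "2 * exp B * e' * K \<le> 2 * exp B * e' * (K + 1)" using e' by (intro mult_left_mono) auto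
    also have "\<dots> = e" using K0 by (simp add: e'_def)
    finally show "\<bar>D t - D 0\<bar> \<le> 0 + e" using glob[OF e'] by simp
  qed
  then show ?thesis
    using set_borel_integral_eq_integral(2)[OF eq_set] by (simp add: D_def)
qed

section \<open>Densities of the covariance measure\<close>

text \<open>The image under \<open>snd\<close> of the measure with density \<open>g\<close> is
  finite and charges no Lebesgue null set, so Radon-Nikodym applies; \<open>k\<close> is its
  real-valued density.\<close>

lemma AE_zero_density_kernel:
  fixes M :: "(real \<times> real) measure" and g :: "real \<times> real \<Rightarrow> real"
  assumes fin: "finite_measure M" and snd: "snd \<in> M \<rightarrow>\<^sub>M borel"
    and g: "integrable M g" "\<And>z. 0 \<le> g z"
    and null: "\<And>A. A \<in> sets borel \<Longrightarrow> emeasure lborel A = 0 \<Longrightarrow> AE z in M. snd z \<notin> A"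
  obtains k where "integrable lborel k" "\<And>\<psi> B. \<psi> \<in> borel_measurable borel \<Longrightarrow> (\<And>x. \<bar>\<psi> x\<bar> \<le> (B::real)) \<Longrightarrow>
    (\<integral>z. g z * \<psi> (snd z) \<partial>M) = (\<integral>x. k x * \<psi> x \<partial>lborel)"
proof -
  interpret finite_measure M by fact
  have gm [measurable]: "g \<in> borel_measurable M" using g(1) by auto
  note snd [measurable]
  define N where "N = distr (density M g) borel snd"
  have snd': "snd \<in> density M g \<rightarrow>\<^sub>M borel" using snd by simp
  have em: "emeasure N A = (\<integral>\<^sup>+z. ennreal (g z) * indicator A (snd z) \<partial>M)" if "A \<in> sets borel" for A
  proof -
    have "emeasure N A = emeasure (density M g) (snd -` A \<inter> space M)"
      unfolding N_def using that by (subst emeasure_distr[OF snd']) auto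
    also have "\<dots> = (\<integral>\<^sup>+z. ennreal (g z) * indicator (snd -` A \<inter> space M) z \<partial>M)"
      by (rule emeasure_density) (use that in measurable)
    also have "\<dots> = (\<integral>\<^sup>+z. ennreal (g z) * indicator A (snd z) \<partial>M)"
      by (rule nn_integral_cong) (simp add: indicator_def)
    finally show ?thesis .
  qed
  have gfin: "(\<integral>\<^sup>+z. ennreal (g z) \<partial>M) < \<infinity>"
    using g unfolding integrable_iff_bounded by (simp add: abs_of_nonneg)
  have Nfin: "finite_measure N"
  proof
    have "emeasure N (space N) = (\<integral>\<^sup>+z. ennreal (g z) \<partial>M)" using em[of UNIV] by (simp add: N_def)
    then show "emeasure N (space N) \<noteq> \<infinity>" using gfin by simp
  qed
  have setsN: "sets N = sets lborel" by (simp add: N_def)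
  have ac: "absolutely_continuous lborel N"
    unfolding absolutely_continuous_def
  proof
    fix A :: "real set" assume "A \<in> null_sets lborel"
    then have A: "A \<in> sets borel" "emeasure lborel A = 0" by auto
    have "emeasure N A = (\<integral>\<^sup>+z. 0 \<partial>M)"
      unfolding em[OF A(1)] by (rule nn_integral_cong_AE) (use null[OF A] in \<open>eventually_elim, simp\<close>)
    then show "A \<in> null_sets N" using A(1) setsN by (intro null_setsI) auto
  qed
  obtain D where D: "D \<in> borel_measurable lborel" "AE x in lborel. RN_deriv lborel N x = ennreal (D x)" "\<And>x. 0 \<le> D x"
    using sigma_finite_measure.real_RN_deriv[OF sigma_finite_lborel Nfin ac setsN] by blast
  have NN: "N = density lborel (\<lambda>x. ennreal (D x))"
  proof -
    have "density lborel (RN_deriv lborel N) = N" by (rule sigma_finite_measure.density_RN_deriv[OF sigma_finite_lborel ac setsN])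
    moreover have "density lborel (RN_deriv lborel N) = density lborel (\<lambda>x. ennreal (D x))"
      by (rule density_cong) (use D in auto)
    ultimately show ?thesis by simp
  qed
  show thesis
  proof (rule that[of D])
    have "(\<integral>\<^sup>+x. ennreal (D x) \<partial>lborel) = emeasure N UNIV"
      unfolding NN using D(1) by (subst emeasure_density) auto
    also have "\<dots> < \<infinity>" using finite_measure.emeasure_finite[OF Nfin, of UNIV] by (simp add: top.not_eq_extremum)
    finally show "integrable lborel D" using D(1,3) by (simp add: integrable_iff_bounded)
    fix \<psi> :: "real \<Rightarrow> real" and B assume \<psi>: "\<psi> \<in> borel_measurable borel" "\<And>x. \<bar>\<psi> x\<bar> \<le> B"
    have "(\<integral>z. g z * \<psi> (snd z) \<partial>M) = (\<integral>z. \<psi> (snd z) \<partial>density M g)"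
      using \<psi>(1) g(2) by (subst integral_density) (auto intro: measurable_compose[OF snd])
    also have "\<dots> = (\<integral>x. \<psi> x \<partial>N)" unfolding N_def by (rule integral_distr[symmetric, OF snd' \<psi>(1)])
    also have "\<dots> = (\<integral>x. D x * \<psi> x \<partial>lborel)"
      unfolding NN using \<psi>(1) D by (subst integral_density) auto
    finally show "(\<integral>z. g z * \<psi> (snd z) \<partial>M) = (\<integral>x. D x * \<psi> x \<partial>lborel)" .
  qed
qed

context covariance_setting
begin

text \<open>The set inequalities of \<open>marginal_sets\<close>, read as comparisons of image
  measures on the line with \<open>C\<close> or \<open>c\<close> times Lebesgue measure on
  \<open>[0,T]\<close>, and integrated by \<open>nn_integral_add_le_of_emeasure\<close>.\<close>

lemma nn_marginals:
  obtains C c where "0 < c"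
    "\<And>h M. h \<in> borel_measurable borel \<Longrightarrow> M \<in> {\<mu>p, \<mu>m} \<Longrightarrow>
      (\<integral>\<^sup>+z. h (fst z) \<partial>M) \<le> ennreal C * (\<integral>\<^sup>+x. h x * indicator {0..T} x \<partial>lborel)"
    "\<And>h M. h \<in> borel_measurable borel \<Longrightarrow> M \<in> {\<mu>p, \<mu>m} \<Longrightarrow>
      (\<integral>\<^sup>+z. h (snd z) \<partial>M) \<le> ennreal C * (\<integral>\<^sup>+x. h x * indicator {0..T} x \<partial>lborel)"
    "\<And>h. h \<in> borel_measurable borel \<Longrightarrow>
      (\<integral>\<^sup>+z. h (fst z) \<partial>\<mu>m) + ennreal c * (\<integral>\<^sup>+x. h x * indicator {0..T} x \<partial>lborel) \<le> (\<integral>\<^sup>+z. h (fst z) \<partial>\<mu>p)"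
proof -
  obtain C c where Cc: "0 < c"
    "\<And>A M. A \<in> sets borel \<Longrightarrow> M \<in> {\<mu>p, \<mu>m} \<Longrightarrow> emeasure M ((A \<times> UNIV) \<inter> sq) \<le> ennreal C * emeasure lborel (A \<inter> {0..T})"
    "\<And>A M. A \<in> sets borel \<Longrightarrow> M \<in> {\<mu>p, \<mu>m} \<Longrightarrow> emeasure M ((UNIV \<times> A) \<inter> sq) \<le> ennreal C * emeasure lborel (A \<inter> {0..T})"
    "\<And>A. A \<in> sets borel \<Longrightarrow> emeasure \<mu>m ((A \<times> UNIV) \<inter> sq) + ennreal c * emeasure lborel (A \<inter> {0..T}) \<le> emeasure \<mu>p ((A \<times> UNIV) \<inter> sq)"
    by (rule marginal_sets) (assumption | rule that)+
  define L where "L b = density lborel (\<lambda>x. ennreal b * indicator {0..T} x)" for b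
  have L_em: "emeasure (L b) A = ennreal b * emeasure lborel (A \<inter> {0..T})" if "A \<in> sets borel" for A b
    using that unfolding L_def
    by (subst emeasure_density) (auto simp: nn_integral_cmult_indicator mult.assoc indicator_inter_arith[symmetric] Int_commute)
  have L_nn: "(\<integral>\<^sup>+x. h x \<partial>L b) = ennreal b * (\<integral>\<^sup>+x. h x * indicator {0..T} x \<partial>lborel)"
    if "h \<in> borel_measurable borel" for h b
  proof -
    have "(\<integral>\<^sup>+x. h x \<partial>L b) = (\<integral>\<^sup>+x. ennreal b * indicator {0..T} x * h x \<partial>lborel)"
      unfolding L_def by (rule nn_integral_density) (use that in auto)
    also have "\<dots> = (\<integral>\<^sup>+x. ennreal b * (h x * indicator {0..T} x) \<partial>lborel)"
      by (simp add: ac_simps)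
    also have "\<dots> = ennreal b * (\<integral>\<^sup>+x. h x * indicator {0..T} x \<partial>lborel)"
      using that by (intro nn_integral_cmult) auto
    finally show ?thesis .
  qed
  have fm: "fst \<in> M \<rightarrow>\<^sub>M (borel :: real measure)" "snd \<in> M \<rightarrow>\<^sub>M (borel :: real measure)" "space M = sq" if "M \<in> {\<mu>p, \<mu>m}" for M
    using that fst_snd_measurable space_mu by auto
  have d1: "emeasure (distr M borel fst) A = emeasure M ((A \<times> UNIV) \<inter> sq)" if "A \<in> sets borel" "M \<in> {\<mu>p, \<mu>m}" for A M
    using that fm[OF that(2)] by (subst emeasure_distr) (auto intro!: arg_cong2[where f = emeasure])
  have d2: "emeasure (distr M borel snd) A = emeasure M ((UNIV \<times> A) \<inter> sq)" if "A \<in> sets borel" "M \<in> {\<mu>p, \<mu>m}" for A M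
    using that fm[OF that(2)] by (subst emeasure_distr) (auto intro!: arg_cong2[where f = emeasure])
  have ub: "(\<integral>\<^sup>+z. h (p z) \<partial>M) \<le> ennreal C * (\<integral>\<^sup>+x. h x * indicator {0..T} x \<partial>lborel)"
    if h: "h \<in> borel_measurable borel" and M: "M \<in> {\<mu>p, \<mu>m}" and p: "p \<in> M \<rightarrow>\<^sub>M borel"
      and le: "\<And>A. A \<in> sets borel \<Longrightarrow> emeasure (distr M borel p) A \<le> ennreal C * emeasure lborel (A \<inter> {0..T})" for h p M
  proof -
    have "(\<integral>\<^sup>+x. h x \<partial>distr M borel p) + (\<integral>\<^sup>+x. h x \<partial>null_measure borel) \<le> (\<integral>\<^sup>+x. h x \<partial>L C)"
      by (rule nn_integral_add_le_of_emeasure) (use h le L_em in \<open>auto simp: L_def\<close>)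
    moreover have "(\<integral>\<^sup>+x. h x \<partial>distr M borel p) = (\<integral>\<^sup>+z. h (p z) \<partial>M)" by (rule nn_integral_distr[OF p]) (simp add: h)
    ultimately show ?thesis unfolding L_nn[OF h] by (auto intro: order_trans[rotated])
  qed
  show thesis
  proof (rule that[OF Cc(1)])
    fix h :: "real \<Rightarrow> ennreal" and M assume h: "h \<in> borel_measurable borel" and M: "M \<in> {\<mu>p, \<mu>m}"
    show "(\<integral>\<^sup>+z. h (fst z) \<partial>M) \<le> ennreal C * (\<integral>\<^sup>+x. h x * indicator {0..T} x \<partial>lborel)"
      by (rule ub[OF h M fm(1)[OF M]]) (simp add: d1[OF _ M] Cc(2)[OF _ M])
    show "(\<integral>\<^sup>+z. h (snd z) \<partial>M) \<le> ennreal C * (\<integral>\<^sup>+x. h x * indicator {0..T} x \<partial>lborel)"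
      by (rule ub[OF h M fm(2)[OF M]]) (simp add: d2[OF _ M] Cc(3)[OF _ M])
  next
    fix h :: "real \<Rightarrow> ennreal" assume h: "h \<in> borel_measurable borel"
    have pm: "\<mu>p \<in> {\<mu>p, \<mu>m}" "\<mu>m \<in> {\<mu>p, \<mu>m}" by auto
    have "(\<integral>\<^sup>+x. h x \<partial>distr \<mu>m borel fst) + (\<integral>\<^sup>+x. h x \<partial>L c) \<le> (\<integral>\<^sup>+x. h x \<partial>distr \<mu>p borel fst)"
    proof (rule nn_integral_add_le_of_emeasure)
      fix A assume "A \<in> sets (distr \<mu>m borel fst)"
      then have A: "A \<in> sets borel" by simp
      show "emeasure (distr \<mu>m borel fst) A + emeasure (L c) A \<le> emeasure (distr \<mu>p borel fst) A"
        unfolding d1[OF A pm(1)] d1[OF A pm(2)] L_em[OF A] by (rule Cc(4)[OF A])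
    qed (use h in \<open>auto simp: L_def\<close>)
    then show "(\<integral>\<^sup>+z. h (fst z) \<partial>\<mu>m) + ennreal c * (\<integral>\<^sup>+x. h x * indicator {0..T} x \<partial>lborel) \<le> (\<integral>\<^sup>+z. h (fst z) \<partial>\<mu>p)"
      using nn_integral_distr[OF fm(1)[OF pm(1)], of h] nn_integral_distr[OF fm(1)[OF pm(2)], of h] h
      unfolding L_nn[OF h] by simp
  qed
qed

section \<open>Integrable and bounded functions and their pairing\<close>

abbreviation "brl \<equiv> borel_measurable (restrict_space borel {0..T}) :: (real \<Rightarrow> real) set"

text \<open>Members of \<open>brl\<close> carry no information outside \<open>[0,T]\<close>;
  extending them by 0 gives Borel functions on the line, for which Lebesgue integrals and image
  measures are available.\<close>

abbreviation cut :: "(real \<Rightarrow> real) \<Rightarrow> real \<Rightarrow> real" where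
  "cut \<phi> \<equiv> \<lambda>s. indicator {0..T} s * \<phi> s"

lemma cut_measurable: "\<phi> \<in> brl \<longleftrightarrow> cut \<phi> \<in> borel_measurable borel"
  by (subst borel_measurable_restrict_space_iff) auto

lemma cut_eq: "M \<in> {\<mu>p, \<mu>m} \<Longrightarrow> z \<in> space M \<Longrightarrow> cut \<phi> (fst z) = \<phi> (fst z)"
  "M \<in> {\<mu>p, \<mu>m} \<Longrightarrow> z \<in> space M \<Longrightarrow> cut \<phi> (snd z) = \<phi> (snd z)"
  using space_mu by auto

lemma brl_measurable:
  assumes "\<phi> \<in> brl" "M \<in> {\<mu>p, \<mu>m}"
  shows "(\<lambda>z. \<phi> (fst z)) \<in> borel_measurable M" "(\<lambda>z. \<phi> (snd z)) \<in> borel_measurable M"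
proof -
  have m: "cut \<phi> \<in> borel_measurable borel" using assms(1) cut_measurable by blast
  have f: "fst \<in> M \<rightarrow>\<^sub>M (borel :: real measure)" "snd \<in> M \<rightarrow>\<^sub>M (borel :: real measure)"
    using assms(2) fst_snd_measurable by auto
  have "(\<lambda>z. cut \<phi> (fst z)) \<in> borel_measurable M" by (rule measurable_compose[OF f(1) m])
  then show "(\<lambda>z. \<phi> (fst z)) \<in> borel_measurable M"
    by (subst measurable_cong[OF cut_eq(1)[OF assms(2), symmetric]])
  have "(\<lambda>z. cut \<phi> (snd z)) \<in> borel_measurable M" by (rule measurable_compose[OF f(2) m])
  then show "(\<lambda>z. \<phi> (snd z)) \<in> borel_measurable M"
    by (subst measurable_cong[OF cut_eq(2)[OF assms(2), symmetric]])
qed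

lemma norm_absH_sq_eq:
  "norm_absH_sq \<mu> \<phi> = (\<integral>\<^sup>+z. ennreal (\<bar>\<phi> (fst z)\<bar> * \<bar>\<phi> (snd z)\<bar>) \<partial>\<mu>p) + (\<integral>\<^sup>+z. ennreal (\<bar>\<phi> (fst z)\<bar> * \<bar>\<phi> (snd z)\<bar>) \<partial>\<mu>m)"
  unfolding norm_absH_sq_def nn_integral_variation_def by (simp add: case_prod_beta')

lemma inner_H_eq: "inner_H \<mu> \<phi> \<psi> = (\<integral>z. \<phi> (fst z) * \<psi> (snd z) \<partial>\<mu>p) - (\<integral>z. \<phi> (fst z) * \<psi> (snd z) \<partial>\<mu>m)"
  unfolding inner_H_def sintegral_def by (simp add: case_prod_beta')

text \<open>The pairing \<open>inner_H\<close> is handled with its left argument in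
  \<open>L1\<close> and its right one in \<open>Lbdd\<close>. Absolute convergence then follows from
  the bounded first marginal, without a Cauchy-Schwarz inequality for the total variation of
  \<open>\<mu>\<close>.\<close>

definition L1 :: "(real \<Rightarrow> real) set" where
  "L1 = {\<phi> \<in> brl. integrable lborel (cut \<phi>)}"

definition Lbdd :: "(real \<Rightarrow> real) set" where
  "Lbdd = {\<phi> \<in> brl. \<exists>B. \<forall>s\<in>{0..T}. \<bar>\<phi> s\<bar> \<le> B}"

lemma LbddE:
  assumes "\<phi> \<in> Lbdd"
  obtains B where "\<phi> \<in> brl" "\<And>s. s \<in> {0..T} \<Longrightarrow> \<bar>\<phi> s\<bar> \<le> B"
  using assms unfolding Lbdd_def by blast

lemma Lbdd_L1: "Lbdd \<subseteq> L1"
proof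
  fix \<phi> assume "\<phi> \<in> Lbdd"
  then obtain B where B: "\<phi> \<in> brl" "\<And>s. s \<in> {0..T} \<Longrightarrow> \<bar>\<phi> s\<bar> \<le> B" by (rule LbddE) (assumption | rule that)+
  have "integrable lborel (cut \<phi>)"
  proof (rule Bochner_Integration.integrable_bound[where f = "\<lambda>s. B * indicator {0..T} s"])
    show "cut \<phi> \<in> borel_measurable lborel" using B(1) cut_measurable by simp
    show "AE s in lborel. norm (cut \<phi> s) \<le> norm (B * indicator {0..T} s)"
      using B(2) by (intro AE_I2) (auto simp: indicator_def intro: order_trans[OF _ abs_ge_self])
    have "integrable lborel (indicator {0..T} :: real \<Rightarrow> real)"
      by (rule integrable_real_indicator) (use T in simp_all)
    then show "integrable lborel (\<lambda>s. B * indicator {0..T} s)" by (rule integrable_mult_right)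
  qed
  then show "\<phi> \<in> L1" using B(1) by (simp add: L1_def)
qed

lemma L1_integrable:
  assumes \<phi>: "\<phi> \<in> L1" and \<psi>: "\<psi> \<in> Lbdd" and M: "M \<in> {\<mu>p, \<mu>m}"
  shows "integrable M (\<lambda>z. \<phi> (fst z) * \<psi> (snd z))"
proof -
  obtain C c where C: "0 < c"
    "\<And>h M. h \<in> borel_measurable borel \<Longrightarrow> M \<in> {\<mu>p, \<mu>m} \<Longrightarrow>
      (\<integral>\<^sup>+z. h (fst z) \<partial>M) \<le> ennreal C * (\<integral>\<^sup>+x. h x * indicator {0..T} x \<partial>lborel)"
    "\<And>h M. h \<in> borel_measurable borel \<Longrightarrow> M \<in> {\<mu>p, \<mu>m} \<Longrightarrow>
      (\<integral>\<^sup>+z. h (snd z) \<partial>M) \<le> ennreal C * (\<integral>\<^sup>+x. h x * indicator {0..T} x \<partial>lborel)"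
    "\<And>h. h \<in> borel_measurable borel \<Longrightarrow>
      (\<integral>\<^sup>+z. h (fst z) \<partial>\<mu>m) + ennreal c * (\<integral>\<^sup>+x. h x * indicator {0..T} x \<partial>lborel) \<le> (\<integral>\<^sup>+z. h (fst z) \<partial>\<mu>p)"
    by (rule nn_marginals) (assumption | rule that)+
  obtain B where B: "\<psi> \<in> brl" "\<And>s. s \<in> {0..T} \<Longrightarrow> \<bar>\<psi> s\<bar> \<le> B" using \<psi> by (rule LbddE) (assumption | rule that)+
  have \<phi>': "\<phi> \<in> brl" "integrable lborel (cut \<phi>)" using \<phi> by (auto simp: L1_def)
  have cm: "(\<lambda>s. ennreal \<bar>cut \<phi> s\<bar>) \<in> borel_measurable borel"
    using cut_measurable \<phi>'(1) by (intro measurable_compose[OF _ measurable_ennreal] borel_measurable_abs) blast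
  have "(\<integral>\<^sup>+z. ennreal \<bar>\<phi> (fst z)\<bar> \<partial>M) = (\<integral>\<^sup>+z. ennreal \<bar>cut \<phi> (fst z)\<bar> \<partial>M)"
    by (rule nn_integral_cong) (simp only: cut_eq[OF M])
  also have "\<dots> \<le> ennreal C * (\<integral>\<^sup>+x. ennreal \<bar>cut \<phi> x\<bar> * indicator {0..T} x \<partial>lborel)"
    by (rule C(2)[OF cm M])
  also have "(\<integral>\<^sup>+x. ennreal \<bar>cut \<phi> x\<bar> * indicator {0..T} x \<partial>lborel) = (\<integral>\<^sup>+x. ennreal \<bar>cut \<phi> x\<bar> \<partial>lborel)"
    by (rule nn_integral_cong) (simp add: indicator_def)
  also have "ennreal C * \<dots> < \<infinity>"
    using \<phi>'(2) by (simp add: integrable_iff_bounded ennreal_mult_less_top)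
  finally have "integrable M (\<lambda>z. \<phi> (fst z))"
    using brl_measurable(1)[OF \<phi>'(1) M] by (simp add: integrable_iff_bounded)
  then have "integrable M (\<lambda>z. B * \<phi> (fst z))" by simp
  then show ?thesis
  proof (rule Bochner_Integration.integrable_bound)
    show "(\<lambda>z. \<phi> (fst z) * \<psi> (snd z)) \<in> borel_measurable M"
      by (intro borel_measurable_times brl_measurable[OF _ M] \<phi>' B)
    have "snd z \<in> {0..T}" if "z \<in> space M" for z using that M space_mu by auto
    then have "\<bar>\<psi> (snd z)\<bar> \<le> \<bar>B\<bar>" if "z \<in> space M" for z using B(2) that by (blast intro: order_trans[OF _ abs_ge_self])
    then have "norm (\<phi> (fst z) * \<psi> (snd z)) \<le> norm (B * \<phi> (fst z))" if "z \<in> space M" for z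
      unfolding real_norm_def abs_mult using that by (subst mult.commute) (rule mult_right_mono, auto)
    then show "AE z in M. norm (\<phi> (fst z) * \<psi> (snd z)) \<le> norm (B * \<phi> (fst z))"
      by (intro AE_I2)
  qed
qed

lemma inner_H_linear_left:
  assumes "\<phi>1 \<in> L1" "\<phi>2 \<in> L1" "\<psi> \<in> Lbdd"
  shows "inner_H \<mu> (\<lambda>s. a * \<phi>1 s + b * \<phi>2 s) \<psi> = a * inner_H \<mu> \<phi>1 \<psi> + b * inner_H \<mu> \<phi>2 \<psi>"
proof -
  have "(\<integral>z. (a * \<phi>1 (fst z) + b * \<phi>2 (fst z)) * \<psi> (snd z) \<partial>M) =
      a * (\<integral>z. \<phi>1 (fst z) * \<psi> (snd z) \<partial>M) + b * (\<integral>z. \<phi>2 (fst z) * \<psi> (snd z) \<partial>M)" if "M \<in> {\<mu>p, \<mu>m}" for M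
    using L1_integrable[OF assms(1,3) that] L1_integrable[OF assms(2,3) that]
    by (simp add: distrib_right mult.assoc)
  then show ?thesis unfolding inner_H_eq by (simp add: algebra_simps)
qed

text \<open>The covariance measure has absolutely continuous marginals, so \<open>\<langle>\<phi>, \<psi>\<rangle>\<close> is a Lebesgue
  integral in \<open>\<psi>\<close>; the density is the derivative of \<open>s \<mapsto> \<langle>\<phi>, 1\<^sub>[\<^sub>0\<^sub>,\<^sub>s\<^sub>]\<rangle>\<close>.\<close>

lemma inner_H_density:
  assumes \<phi>: "\<phi> \<in> L1"
  obtains k where "integrable lborel k" "\<And>\<psi>. \<psi> \<in> Lbdd \<Longrightarrow> inner_H \<mu> \<phi> \<psi> = (LBINT s:{0..T}. k s * \<psi> s)"
proof -
  obtain C c where C: "0 < c"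
    "\<And>h M. h \<in> borel_measurable borel \<Longrightarrow> M \<in> {\<mu>p, \<mu>m} \<Longrightarrow>
      (\<integral>\<^sup>+z. h (fst z) \<partial>M) \<le> ennreal C * (\<integral>\<^sup>+x. h x * indicator {0..T} x \<partial>lborel)"
    "\<And>h M. h \<in> borel_measurable borel \<Longrightarrow> M \<in> {\<mu>p, \<mu>m} \<Longrightarrow>
      (\<integral>\<^sup>+z. h (snd z) \<partial>M) \<le> ennreal C * (\<integral>\<^sup>+x. h x * indicator {0..T} x \<partial>lborel)"
    "\<And>h. h \<in> borel_measurable borel \<Longrightarrow>
      (\<integral>\<^sup>+z. h (fst z) \<partial>\<mu>m) + ennreal c * (\<integral>\<^sup>+x. h x * indicator {0..T} x \<partial>lborel) \<le> (\<integral>\<^sup>+z. h (fst z) \<partial>\<mu>p)"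
    by (rule nn_marginals) (assumption | rule that)+
  have one: "(\<lambda>_. 1) \<in> Lbdd" by (auto simp: Lbdd_def)
  have null: "AE z in M. snd z \<notin> A" if M: "M \<in> {\<mu>p, \<mu>m}" and A: "A \<in> sets borel" "emeasure lborel A = 0" for A M
  proof -
    have "(\<integral>\<^sup>+z. indicator A (snd z) \<partial>M) \<le> ennreal C * (\<integral>\<^sup>+x. indicator A x * indicator {0..T} x \<partial>lborel)"
      by (rule C(3)[OF _ M]) (use A in auto)
    also have "(\<integral>\<^sup>+x. indicator A x * indicator {0..T} x \<partial>lborel) \<le> (\<integral>\<^sup>+x. indicator A x \<partial>lborel)"
      by (rule nn_integral_mono) (auto simp: indicator_def)
    also have "\<dots> = 0" using A by simp
    finally have "(\<integral>\<^sup>+z. indicator A (snd z) \<partial>M) = 0" by (simp add: mult_left_mono)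
    moreover have "(\<lambda>z. indicator A (snd z) :: ennreal) \<in> borel_measurable M"
    proof -
      have "snd \<in> M \<rightarrow>\<^sub>M (borel :: real measure)" using fst_snd_measurable M by blast
      then show ?thesis by (rule measurable_compose[OF _ borel_measurable_indicator]) (use A(1) in simp)
    qed
    ultimately have "AE z in M. (indicator A (snd z) :: ennreal) = 0" by (simp add: nn_integral_0_iff_AE)
    then show ?thesis by eventually_elim (auto simp: indicator_def split: if_splits)
  qed
  \<comment> \<open>\<open>AE_zero_density_kernel\<close> asks for a nonnegative weight:
    \<open>a = 1\<close> and \<open>a = -1\<close> give the positive and the negative part of
    \<open>\<phi>\<close>. Together with the two Jordan parts, \<open>k\<close> is made of four
    densities.\<close>
  have ex: "\<exists>k. integrable lborel k \<and> (\<forall>\<psi> B. \<psi> \<in> borel_measurable borel \<longrightarrow> (\<forall>x. \<bar>\<psi> x\<bar> \<le> (B::real)) \<longrightarrow>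
      (\<integral>z. max 0 (a * \<phi> (fst z)) * \<psi> (snd z) \<partial>M) = (\<integral>x. k x * \<psi> x \<partial>lborel))" if M: "M \<in> {\<mu>p, \<mu>m}" for M a
  proof -
    have i: "integrable M (\<lambda>z. max 0 (a * \<phi> (fst z)))"
      using L1_integrable[OF \<phi> one M] by (intro integrable_max) auto
    have f: "finite_measure M" "snd \<in> M \<rightarrow>\<^sub>M borel" using M finite_mu fst_snd_measurable by auto
    show ?thesis
      by (rule AE_zero_density_kernel[OF f i _ null[OF M]]) (simp, assumption, assumption, blast)
  qed
  define kk where "kk M a = (SOME k. integrable lborel k \<and> (\<forall>\<psi> B. \<psi> \<in> borel_measurable borel \<longrightarrow> (\<forall>x. \<bar>\<psi> x\<bar> \<le> (B::real)) \<longrightarrow>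
      (\<integral>z. max 0 (a * \<phi> (fst z)) * \<psi> (snd z) \<partial>M) = (\<integral>x. k x * \<psi> x \<partial>lborel)))" for M :: "(real \<times> real) measure" and a :: real
  have kk: "integrable lborel (kk M a)" "\<And>\<psi> B. \<psi> \<in> borel_measurable borel \<Longrightarrow> (\<And>x. \<bar>\<psi> x\<bar> \<le> (B::real)) \<Longrightarrow>
      (\<integral>z. max 0 (a * \<phi> (fst z)) * \<psi> (snd z) \<partial>M) = (\<integral>x. kk M a x * \<psi> x \<partial>lborel)" if "M \<in> {\<mu>p, \<mu>m}" for M a
    using someI_ex[OF ex[OF that, of a]] unfolding kk_def by blast+
  define k where "k x = kk \<mu>p 1 x - kk \<mu>p (-1) x - (kk \<mu>m 1 x - kk \<mu>m (-1) x)" for x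
  show thesis
  proof (rule that[of k])
    show "integrable lborel k" unfolding k_def
      by (intro Bochner_Integration.integrable_diff kk(1)) auto
    fix \<psi> assume \<psi>: "\<psi> \<in> Lbdd"
    then obtain B where B: "\<psi> \<in> brl" "\<And>s. s \<in> {0..T} \<Longrightarrow> \<bar>\<psi> s\<bar> \<le> B" by (rule LbddE) (assumption | rule that)+
    have cm: "cut \<psi> \<in> borel_measurable borel" using cut_measurable B(1) by blast
    have cb: "\<bar>cut \<psi> x\<bar> \<le> \<bar>B\<bar>" for x using B(2)[of x] by (auto simp: indicator_def)
    have cL: "cut \<psi> \<in> Lbdd" unfolding Lbdd_def
      using cb measurable_restrict_space1[OF cm] by blast
    have split: "(\<integral>z. \<phi> (fst z) * \<psi> (snd z) \<partial>M) = (\<integral>x. kk M 1 x * cut \<psi> x \<partial>lborel) - (\<integral>x. kk M (-1) x * cut \<psi> x \<partial>lborel)"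
      if M: "M \<in> {\<mu>p, \<mu>m}" for M
    proof -
      have maxL: "(\<lambda>s. max 0 (a * \<phi> s)) \<in> L1" for a
      proof -
        have m: "(\<lambda>s. max 0 (a * \<phi> s)) \<in> brl" using \<phi> by (auto simp: L1_def)
        have "integrable lborel (\<lambda>s. max 0 (a * cut \<phi> s))" using \<phi> by (intro integrable_max) (auto simp: L1_def)
        moreover have "(\<lambda>s. max 0 (a * cut \<phi> s)) = cut (\<lambda>s. max 0 (a * \<phi> s))" by (auto simp: indicator_def)
        ultimately show ?thesis using m by (simp add: L1_def)
      qed
      have "(\<integral>z. \<phi> (fst z) * \<psi> (snd z) \<partial>M) =
          (\<integral>z. max 0 (1 * \<phi> (fst z)) * cut \<psi> (snd z) - max 0 (-1 * \<phi> (fst z)) * cut \<psi> (snd z) \<partial>M)"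
      proof (rule Bochner_Integration.integral_cong[OF refl])
        fix z assume "z \<in> space M"
        then have e: "cut \<psi> (snd z) = \<psi> (snd z)" by (rule cut_eq(2)[OF M])
        show "\<phi> (fst z) * \<psi> (snd z) = max 0 (1 * \<phi> (fst z)) * cut \<psi> (snd z) - max 0 (-1 * \<phi> (fst z)) * cut \<psi> (snd z)"
          unfolding e by (simp add: max_def)
      qed
      also have "\<dots> = (\<integral>z. max 0 (1 * \<phi> (fst z)) * cut \<psi> (snd z) \<partial>M) - (\<integral>z. max 0 (-1 * \<phi> (fst z)) * cut \<psi> (snd z) \<partial>M)"
        using L1_integrable[OF maxL cL M] by (intro Bochner_Integration.integral_diff)
      finally show ?thesis unfolding kk(2)[OF M cm cb] .
    qed
    have ki: "integrable lborel (\<lambda>x. kk M a x * cut \<psi> x)" if "M \<in> {\<mu>p, \<mu>m}" for M a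
    proof (rule Bochner_Integration.integrable_bound[OF integrable_mult_right[OF kk(1)[OF that, of a], of "\<bar>B\<bar>"]])
      show "(\<lambda>x. kk M a x * cut \<psi> x) \<in> borel_measurable lborel" using kk(1)[OF that, of a] cm by auto
      show "AE x in lborel. norm (kk M a x * cut \<psi> x) \<le> norm (\<bar>B\<bar> * kk M a x)"
      proof (rule AE_I2)
        fix x show "norm (kk M a x * cut \<psi> x) \<le> norm (\<bar>B\<bar> * kk M a x)"
          using mult_right_mono[OF cb[of x], of "\<bar>kk M a x\<bar>"] by (simp add: abs_mult mult.commute mult.left_commute)
      qed
    qed
    have pm: "\<mu>p \<in> {\<mu>p, \<mu>m}" "\<mu>m \<in> {\<mu>p, \<mu>m}" by auto
    have "inner_H \<mu> \<phi> \<psi> = (\<integral>x. kk \<mu>p 1 x * cut \<psi> x \<partial>lborel) - (\<integral>x. kk \<mu>p (-1) x * cut \<psi> x \<partial>lborel) -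
        ((\<integral>x. kk \<mu>m 1 x * cut \<psi> x \<partial>lborel) - (\<integral>x. kk \<mu>m (-1) x * cut \<psi> x \<partial>lborel))"
      unfolding inner_H_eq split[OF pm(1)] split[OF pm(2)] ..
    also have "\<dots> = (\<integral>x. k x * cut \<psi> x \<partial>lborel)"
      unfolding k_def left_diff_distrib
      using ki[OF pm(1), of 1] ki[OF pm(1), of "-1"] ki[OF pm(2), of 1] ki[OF pm(2), of "-1"] by simp
    also have "\<dots> = (LBINT s:{0..T}. k s * \<psi> s)"
      unfolding set_lebesgue_integral_def by (rule Bochner_Integration.integral_cong) auto
    finally show "inner_H \<mu> \<phi> \<psi> = (LBINT s:{0..T}. k s * \<psi> s)" .
  qed
qed

lemma Lbdd_L_mu: "Lbdd \<subseteq> L_mu T \<mu>"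
proof
  fix \<phi> assume \<phi>: "\<phi> \<in> Lbdd"
  then obtain B where B: "\<phi> \<in> brl" "\<And>s. s \<in> {0..T} \<Longrightarrow> \<bar>\<phi> s\<bar> \<le> B" by (rule LbddE) (assumption | rule that)+
  have abs: "(\<lambda>s. \<bar>\<phi> s\<bar>) \<in> Lbdd" using \<phi> by (auto simp: Lbdd_def)
  have "(\<integral>\<^sup>+z. ennreal (\<bar>\<phi> (fst z)\<bar> * \<bar>\<phi> (snd z)\<bar>) \<partial>M) < \<infinity>" if "M \<in> {\<mu>p, \<mu>m}" for M
    using L1_integrable[OF _ abs that, of "\<lambda>s. \<bar>\<phi> s\<bar>"] abs Lbdd_L1 by (auto simp: integrable_iff_bounded abs_mult)
  then show "\<phi> \<in> L_mu T \<mu>" using B(1) by (simp add: L_mu_def norm_absH_sq_eq)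
qed

end

section \<open>Gaussian random variables\<close>

text \<open>A degenerate variable of mean 0 vanishes almost surely. Otherwise one scales to a
  standard normal variable and takes real and imaginary part of its characteristic function at
  \<open>\<sigma>\<close>; the phase \<open>a\<close> is separated by the addition theorem.\<close>

lemma (in prob_space) gaussian_rv_cos_expectation:
  assumes Y: "gaussian_rv M Y" and mean: "(\<integral>\<omega>. Y \<omega> \<partial>M) = 0"
  shows "Y \<in> borel_measurable M" and "integrable M (\<lambda>\<omega>. (Y \<omega>)\<^sup>2)"
    and "(\<integral>\<omega>. cos (Y \<omega> + a) \<partial>M) = cos a * exp (- (\<integral>\<omega>. (Y \<omega>)\<^sup>2 \<partial>M) / 2)"
proof -
  have "Y \<in> borel_measurable M \<and> integrable M (\<lambda>\<omega>. (Y \<omega>)\<^sup>2) \<and>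
    (\<integral>\<omega>. cos (Y \<omega> + a) \<partial>M) = cos a * exp (- (\<integral>\<omega>. (Y \<omega>)\<^sup>2 \<partial>M) / 2)"
    using Y unfolding gaussian_rv_def
  proof
    assume "\<exists>m. Y \<in> borel_measurable M \<and> (AE \<omega> in M. Y \<omega> = m)"
    then obtain m where m: "Y \<in> borel_measurable M" "AE \<omega> in M. Y \<omega> = m" by blast
    have "(\<integral>\<omega>. Y \<omega> \<partial>M) = (\<integral>\<omega>. m \<partial>M)" by (rule integral_cong_AE) (use m in auto)
    then have "m = 0" using mean by (simp add: prob_space)
    then have Y0: "AE \<omega> in M. Y \<omega> = 0" using m by simp
    have sq0: "AE \<omega> in M. (Y \<omega>)\<^sup>2 = 0" using Y0 by eventually_elim simp
    have "(\<integral>\<omega>. cos (Y \<omega> + a) \<partial>M) = (\<integral>\<omega>. cos a \<partial>M)"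
      by (rule integral_cong_AE) (use m(1) Y0 in auto)
    moreover have "(\<integral>\<omega>. (Y \<omega>)\<^sup>2 \<partial>M) = (\<integral>\<omega>. 0 \<partial>M)"
      by (rule integral_cong_AE) (use m(1) sq0 in auto)
    moreover have "integrable M (\<lambda>\<omega>. (Y \<omega>)\<^sup>2)"
      by (subst integrable_cong_AE[of _ _ "\<lambda>_. 0"]) (use m(1) sq0 in auto)
    ultimately show ?thesis using m(1) by (simp add: prob_space)
  next
    assume "\<exists>m \<sigma>. 0 < \<sigma> \<and> distributed M lborel Y (normal_density m \<sigma>)"
    then obtain m \<sigma> where s: "0 < \<sigma>" and D: "distributed M lborel Y (normal_density m \<sigma>)" by blast
    have m: "m = 0" using normal_distributed_expectation[OF s D] mean by simp
    have Ym: "Y \<in> borel_measurable M" using distributed_measurable[OF D] by simp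
    have var: "(\<integral>\<omega>. (Y \<omega>)\<^sup>2 \<partial>M) = \<sigma>\<^sup>2" using normal_distributed_variance[OF s D] mean by simp
    \<comment> \<open>A non-integrable square would have Bochner integral 0 by convention, against
      the positive variance.\<close>
    have sq: "integrable M (\<lambda>\<omega>. (Y \<omega>)\<^sup>2)"
    proof (rule ccontr)
      assume "\<not> integrable M (\<lambda>\<omega>. (Y \<omega>)\<^sup>2)"
      then have "(\<integral>\<omega>. (Y \<omega>)\<^sup>2 \<partial>M) = 0" by (rule not_integrable_integral_eq)
      then show False using var s by simp
    qed
    define U where "U \<omega> = Y \<omega> / \<sigma>" for \<omega>
    have DU: "distributed M lborel U std_normal_density"
      using normal_standard_normal_convert[OF s, of Y m] D m by (simp add: U_def[abs_def])
    have Um: "U \<in> borel_measurable M" using Ym by (simp add: U_def[abs_def])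
    have dU: "distr M borel U = std_normal_distribution"
    proof -
      have "distr M borel U = distr M lborel U" by (rule distr_cong) simp_all
      then show ?thesis using distributed_distr_eq_density[OF DU] by simp
    qed
    have ch: "(\<integral>\<omega>. iexp (\<sigma> * U \<omega>) \<partial>M) = complex_of_real (exp (- (\<sigma>\<^sup>2) / 2))"
    proof -
      have "(\<integral>\<omega>. iexp (\<sigma> * U \<omega>) \<partial>M) = char (distr M borel U) \<sigma>"
        unfolding char_def using Um by (subst integral_distr) auto
      then show ?thesis unfolding dU char_std_normal_distribution by simp
    qed
    have ie: "integrable M (\<lambda>\<omega>. iexp (\<sigma> * U \<omega>))"
      by (rule integrable_const_bound[where B = 1]) (use Um in auto)
    have YU: "Y \<omega> = \<sigma> * U \<omega>" for \<omega> using s by (simp add: U_def)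
    have c: "(\<integral>\<omega>. cos (Y \<omega>) \<partial>M) = exp (- (\<sigma>\<^sup>2) / 2)"
      using arg_cong[OF ch, of Re] integral_Re[OF ie] by (simp add: YU Re_exp)
    have s': "(\<integral>\<omega>. sin (Y \<omega>) \<partial>M) = 0"
      using arg_cong[OF ch, of Im] integral_Im[OF ie] by (simp add: YU Im_exp)
    have ic: "integrable M (\<lambda>\<omega>. cos (Y \<omega>))" "integrable M (\<lambda>\<omega>. sin (Y \<omega>))"
      by (rule integrable_const_bound[where B = 1]; use Ym in auto)+
    have "(\<integral>\<omega>. cos (Y \<omega> + a) \<partial>M) = (\<integral>\<omega>. cos (Y \<omega>) \<partial>M) * cos a - (\<integral>\<omega>. sin (Y \<omega>) \<partial>M) * sin a"
      unfolding cos_add using ic by simp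
    then show ?thesis using c s' var Ym sq by simp
  qed
  then show "Y \<in> borel_measurable M" "integrable M (\<lambda>\<omega>. (Y \<omega>)\<^sup>2)"
    "(\<integral>\<omega>. cos (Y \<omega> + a) \<partial>M) = cos a * exp (- (\<integral>\<omega>. (Y \<omega>)\<^sup>2 \<partial>M) / 2)" by auto
qed

section \<open>Square-integrable variables and their limits\<close>

lemma L2_rv_measurable: "Y \<in> L2_rv M \<Longrightarrow> Y \<in> borel_measurable M"
  by (simp add: L2_rv_def)

lemma L2_rv_mult:
  assumes "Y \<in> L2_rv M" "Z \<in> L2_rv M" shows "integrable M (\<lambda>\<omega>. Y \<omega> * Z \<omega>)"
proof (rule Bochner_Integration.integrable_bound)
  show "integrable M (\<lambda>\<omega>. (Y \<omega>)\<^sup>2 + (Z \<omega>)\<^sup>2)" using assms by (simp add: L2_rv_def)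
  show "(\<lambda>\<omega>. Y \<omega> * Z \<omega>) \<in> borel_measurable M"
    by (intro borel_measurable_times L2_rv_measurable assms)
  have "\<bar>y * z\<bar> \<le> y\<^sup>2 + z\<^sup>2" for y z :: real
  proof -
    have "0 \<le> (\<bar>y\<bar> - \<bar>z\<bar>)\<^sup>2" by simp
    then have "2 * (\<bar>y\<bar> * \<bar>z\<bar>) \<le> y\<^sup>2 + z\<^sup>2" by (simp add: power2_diff)
    then show ?thesis by (simp add: abs_mult) (smt (verit) mult_nonneg_nonneg abs_ge_zero)
  qed
  then show "AE \<omega> in M. norm (Y \<omega> * Z \<omega>) \<le> norm ((Y \<omega>)\<^sup>2 + (Z \<omega>)\<^sup>2)" by simp
qed

lemma L2_rv_lin:
  assumes Y: "Y \<in> L2_rv M" and Z: "Z \<in> L2_rv M"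
  shows "(\<lambda>\<omega>. a * Y \<omega> + b * Z \<omega>) \<in> L2_rv M"
proof -
  have eq: "(a * y + b * z)\<^sup>2 = a\<^sup>2 * y\<^sup>2 + 2 * a * b * (y * z) + b\<^sup>2 * z\<^sup>2" for y z :: real
    by (simp add: power2_eq_square algebra_simps)
  show ?thesis unfolding L2_rv_def mem_Collect_eq eq
    using assms L2_rv_mult[OF Y Z] by (auto simp: L2_rv_def)
qed

lemma L2_rv_diff: "Y \<in> L2_rv M \<Longrightarrow> Z \<in> L2_rv M \<Longrightarrow> (\<lambda>\<omega>. Y \<omega> - Z \<omega>) \<in> L2_rv M"
  using L2_rv_lin[of Y M Z 1 "-1"] by simp

lemma (in prob_space) L2_rv_integrable: "Y \<in> L2_rv M \<Longrightarrow> integrable M Y"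
  using L2_rv_mult[of Y M "\<lambda>_. 1"] by (simp add: L2_rv_def)

lemma L2_Cauchy_Schwarz:
  assumes Y: "Y \<in> L2_rv M" and Z: "Z \<in> L2_rv M"
  shows "(\<integral>\<omega>. Y \<omega> * Z \<omega> \<partial>M)\<^sup>2 \<le> (\<integral>\<omega>. (Y \<omega>)\<^sup>2 \<partial>M) * (\<integral>\<omega>. (Z \<omega>)\<^sup>2 \<partial>M)"
proof -
  define A B C where "A = (\<integral>\<omega>. (Y \<omega>)\<^sup>2 \<partial>M)" and "B = (\<integral>\<omega>. Y \<omega> * Z \<omega> \<partial>M)" and "C = (\<integral>\<omega>. (Z \<omega>)\<^sup>2 \<partial>M)"
  have q: "0 \<le> A - 2 * t * B + t\<^sup>2 * C" for t
  proof -
    have "0 \<le> (\<integral>\<omega>. (Y \<omega> - t * Z \<omega>)\<^sup>2 \<partial>M)" by simp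
    also have "\<dots> = (\<integral>\<omega>. (Y \<omega>)\<^sup>2 - 2 * t * (Y \<omega> * Z \<omega>) + t\<^sup>2 * (Z \<omega>)\<^sup>2 \<partial>M)"
      by (simp add: power2_eq_square algebra_simps)
    also have "\<dots> = A - 2 * t * B + t\<^sup>2 * C"
      using Y Z L2_rv_mult[OF Y Z] by (simp add: A_def B_def C_def L2_rv_def)
    finally show ?thesis .
  qed
  show ?thesis
  proof (cases "C = 0")
    case True
    have "B = 0"
    proof (rule ccontr)
      assume "B \<noteq> 0"
      \<comment> \<open>With \<open>C = 0\<close> the quadratic is linear in the parameter; this
        choice gives it the value -1.\<close>
      then show False using q[of "(A + 1) / (2 * B)"] True by simp
    qed
    then show ?thesis by (simp add: A_def[symmetric] B_def[symmetric] C_def[symmetric] True)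
  next
    case False
    have "0 \<le> C" by (simp add: C_def)
    then have C: "0 < C" using False by simp
    have "0 \<le> A - B\<^sup>2 / C" using q[of "B / C"] C by (simp add: power2_eq_square field_simps)
    then show ?thesis using C by (simp add: field_simps A_def[symmetric] B_def[symmetric] C_def[symmetric])
  qed
qed

lemma L2_limit_mult:
  assumes Y: "Y \<in> L2_rv M" and Yn: "\<And>n. Yn n \<in> L2_rv M" and Z: "Z \<in> L2_rv M"
    and lim: "(\<lambda>n. \<integral>\<omega>. (Yn n \<omega> - Y \<omega>)\<^sup>2 \<partial>M) \<longlonglongrightarrow> 0"
  shows "(\<lambda>n. \<integral>\<omega>. Yn n \<omega> * Z \<omega> \<partial>M) \<longlonglongrightarrow> (\<integral>\<omega>. Y \<omega> * Z \<omega> \<partial>M)"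
proof -
  have "(\<lambda>n. (\<integral>\<omega>. Yn n \<omega> * Z \<omega> \<partial>M) - (\<integral>\<omega>. Y \<omega> * Z \<omega> \<partial>M)) \<longlonglongrightarrow> 0"
  proof (rule Lim_null_comparison)
    show "\<forall>\<^sub>F n in sequentially. norm ((\<integral>\<omega>. Yn n \<omega> * Z \<omega> \<partial>M) - (\<integral>\<omega>. Y \<omega> * Z \<omega> \<partial>M))
        \<le> sqrt ((\<integral>\<omega>. (Yn n \<omega> - Y \<omega>)\<^sup>2 \<partial>M) * (\<integral>\<omega>. (Z \<omega>)\<^sup>2 \<partial>M))"
    proof (rule always_eventually, rule allI)
      fix n
      have "(\<integral>\<omega>. Yn n \<omega> * Z \<omega> \<partial>M) - (\<integral>\<omega>. Y \<omega> * Z \<omega> \<partial>M) = (\<integral>\<omega>. (Yn n \<omega> - Y \<omega>) * Z \<omega> \<partial>M)"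
        using L2_rv_mult[OF Y Z] L2_rv_mult[OF Yn Z] by (simp add: left_diff_distrib)
      then show "norm ((\<integral>\<omega>. Yn n \<omega> * Z \<omega> \<partial>M) - (\<integral>\<omega>. Y \<omega> * Z \<omega> \<partial>M))
        \<le> sqrt ((\<integral>\<omega>. (Yn n \<omega> - Y \<omega>)\<^sup>2 \<partial>M) * (\<integral>\<omega>. (Z \<omega>)\<^sup>2 \<partial>M))"
        using L2_Cauchy_Schwarz[OF L2_rv_diff[OF Yn Y] Z] by (simp add: real_le_rsqrt)
    qed
    have "(\<lambda>n. (\<integral>\<omega>. (Yn n \<omega> - Y \<omega>)\<^sup>2 \<partial>M) * (\<integral>\<omega>. (Z \<omega>)\<^sup>2 \<partial>M)) \<longlonglongrightarrow> 0"
      using tendsto_mult_left_zero[OF lim] by simp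
    from tendsto_real_sqrt[OF this]
    show "(\<lambda>n. sqrt ((\<integral>\<omega>. (Yn n \<omega> - Y \<omega>)\<^sup>2 \<partial>M) * (\<integral>\<omega>. (Z \<omega>)\<^sup>2 \<partial>M))) \<longlonglongrightarrow> 0" by simp
  qed
  then show ?thesis by (simp add: LIM_zero_iff)
qed

lemma L2_limit_square:
  assumes Y: "Y \<in> L2_rv M" and Yn: "\<And>n. Yn n \<in> L2_rv M"
    and lim: "(\<lambda>n. \<integral>\<omega>. (Yn n \<omega> - Y \<omega>)\<^sup>2 \<partial>M) \<longlonglongrightarrow> 0"
  shows "(\<lambda>n. \<integral>\<omega>. (Yn n \<omega>)\<^sup>2 \<partial>M) \<longlonglongrightarrow> (\<integral>\<omega>. (Y \<omega>)\<^sup>2 \<partial>M)"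
proof -
  have eq: "(\<integral>\<omega>. (Yn n \<omega>)\<^sup>2 \<partial>M) = (\<integral>\<omega>. (Yn n \<omega> - Y \<omega>)\<^sup>2 \<partial>M) + 2 * (\<integral>\<omega>. Yn n \<omega> * Y \<omega> \<partial>M) - (\<integral>\<omega>. (Y \<omega>)\<^sup>2 \<partial>M)" for n
  proof -
    have "(\<integral>\<omega>. (Yn n \<omega>)\<^sup>2 \<partial>M) = (\<integral>\<omega>. (Yn n \<omega> - Y \<omega>)\<^sup>2 + 2 * (Yn n \<omega> * Y \<omega>) - (Y \<omega>)\<^sup>2 \<partial>M)"
      by (simp add: power2_eq_square algebra_simps)
    also have "\<dots> = (\<integral>\<omega>. (Yn n \<omega> - Y \<omega>)\<^sup>2 \<partial>M) + 2 * (\<integral>\<omega>. Yn n \<omega> * Y \<omega> \<partial>M) - (\<integral>\<omega>. (Y \<omega>)\<^sup>2 \<partial>M)"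
      using L2_rv_diff[OF Yn Y, of n] L2_rv_mult[OF Yn Y, of n] Y by (simp add: L2_rv_def)
    finally show ?thesis .
  qed
  have "(\<lambda>n. (\<integral>\<omega>. (Yn n \<omega> - Y \<omega>)\<^sup>2 \<partial>M) + 2 * (\<integral>\<omega>. Yn n \<omega> * Y \<omega> \<partial>M) - (\<integral>\<omega>. (Y \<omega>)\<^sup>2 \<partial>M))
      \<longlonglongrightarrow> 0 + 2 * (\<integral>\<omega>. Y \<omega> * Y \<omega> \<partial>M) - (\<integral>\<omega>. (Y \<omega>)\<^sup>2 \<partial>M)"
    by (intro tendsto_intros lim L2_limit_mult[OF Y Yn Y lim])
  then show ?thesis unfolding eq by (simp add: power2_eq_square)
qed

text \<open>The cosine is 1-Lipschitz, and on a probability space the mean of the absolute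
  difference is at most its L2 norm.\<close>

lemma (in prob_space) L2_limit_cos:
  assumes Y: "Y \<in> L2_rv M" and Yn: "\<And>n. Yn n \<in> L2_rv M"
    and lim: "(\<lambda>n. \<integral>\<omega>. (Yn n \<omega> - Y \<omega>)\<^sup>2 \<partial>M) \<longlonglongrightarrow> 0"
  shows "(\<lambda>n. \<integral>\<omega>. cos (Yn n \<omega> + a) \<partial>M) \<longlonglongrightarrow> (\<integral>\<omega>. cos (Y \<omega> + a) \<partial>M)"
proof -
  have ic: "integrable M (\<lambda>\<omega>. cos (V \<omega> + a))" if "V \<in> L2_rv M" for V
    by (rule integrable_const_bound[where B = 1]) (use L2_rv_measurable[OF that] in auto)
  have "(\<lambda>n. (\<integral>\<omega>. cos (Yn n \<omega> + a) \<partial>M) - (\<integral>\<omega>. cos (Y \<omega> + a) \<partial>M)) \<longlonglongrightarrow> 0"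
  proof (rule Lim_null_comparison)
    show "\<forall>\<^sub>F n in sequentially. norm ((\<integral>\<omega>. cos (Yn n \<omega> + a) \<partial>M) - (\<integral>\<omega>. cos (Y \<omega> + a) \<partial>M))
        \<le> sqrt (\<integral>\<omega>. (Yn n \<omega> - Y \<omega>)\<^sup>2 \<partial>M)"
    proof (rule always_eventually, rule allI)
      fix n
      have D: "(\<lambda>\<omega>. \<bar>Yn n \<omega> - Y \<omega>\<bar>) \<in> L2_rv M"
        using L2_rv_diff[OF Yn Y, of n] by (auto simp: L2_rv_def)
      have one: "(\<lambda>_. 1) \<in> L2_rv M" by (simp add: L2_rv_def)
      have "\<bar>(\<integral>\<omega>. cos (Yn n \<omega> + a) \<partial>M) - (\<integral>\<omega>. cos (Y \<omega> + a) \<partial>M)\<bar> =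
          \<bar>\<integral>\<omega>. cos (Yn n \<omega> + a) - cos (Y \<omega> + a) \<partial>M\<bar>"
        using ic[OF Y] ic[OF Yn] by simp
      also have "\<dots> \<le> (\<integral>\<omega>. \<bar>cos (Yn n \<omega> + a) - cos (Y \<omega> + a)\<bar> \<partial>M)" by (rule integral_abs_bound)
      also have "\<dots> \<le> (\<integral>\<omega>. \<bar>Yn n \<omega> - Y \<omega>\<bar> \<partial>M)"
      proof (rule integral_mono)
        show "integrable M (\<lambda>\<omega>. \<bar>cos (Yn n \<omega> + a) - cos (Y \<omega> + a)\<bar>)" using ic[OF Y] ic[OF Yn] by simp
        show "integrable M (\<lambda>\<omega>. \<bar>Yn n \<omega> - Y \<omega>\<bar>)" by (rule L2_rv_integrable[OF D])
        fix \<omega>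
        have "\<bar>cos x - cos y\<bar> \<le> \<bar>x - y\<bar>" for x y :: real
        proof -
          have "\<bar>cos x - cos y\<bar> = 2 * \<bar>sin ((x + y) / 2)\<bar> * \<bar>sin ((y - x) / 2)\<bar>"
            by (simp add: cos_diff_cos abs_mult)
          also have "\<dots> \<le> 2 * 1 * \<bar>(y - x) / 2\<bar>"
            by (intro mult_mono abs_sin_le_one abs_sin_x_le_abs_x) auto
          finally show ?thesis by simp
        qed
        from this[of "Yn n \<omega> + a" "Y \<omega> + a"]
        show "\<bar>cos (Yn n \<omega> + a) - cos (Y \<omega> + a)\<bar> \<le> \<bar>Yn n \<omega> - Y \<omega>\<bar>" by simp
      qed
      also have "\<dots> \<le> sqrt (\<integral>\<omega>. (Yn n \<omega> - Y \<omega>)\<^sup>2 \<partial>M)"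
        using L2_Cauchy_Schwarz[OF D one] by (intro real_le_rsqrt) (simp add: prob_space)
      finally show "norm ((\<integral>\<omega>. cos (Yn n \<omega> + a) \<partial>M) - (\<integral>\<omega>. cos (Y \<omega> + a) \<partial>M)) \<le> sqrt (\<integral>\<omega>. (Yn n \<omega> - Y \<omega>)\<^sup>2 \<partial>M)"
        by simp
    qed
    show "(\<lambda>n. sqrt (\<integral>\<omega>. (Yn n \<omega> - Y \<omega>)\<^sup>2 \<partial>M)) \<longlonglongrightarrow> 0" using tendsto_real_sqrt[OF lim] by simp
  qed
  then show ?thesis by (simp add: LIM_zero_iff)
qed

text \<open>A functional monotone class theorem for functions on \<open>[0,T]\<close>, generated by
  the indicators of \<open>[0,t]\<close>. It leads from indicators to bounded integrands, because
  the properties of \<open>W\<close> in question are stable under linear combinations and bounded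
  pointwise limits.\<close>

lemma bounded_borel_class:
  fixes Q :: "(real \<Rightarrow> real) \<Rightarrow> bool"
  assumes T: "0 < (T::real)"
    and ind: "\<And>t. t \<in> {0..T} \<Longrightarrow> Q (indicator {0..t})"
    and lin: "\<And>\<phi> \<psi> a b. Q \<phi> \<Longrightarrow> Q \<psi> \<Longrightarrow> Q (\<lambda>s. a * \<phi> s + b * \<psi> s)"
    and lim: "\<And>\<Phi> \<phi> B. (\<And>n. Q (\<Phi> n)) \<Longrightarrow> (\<And>n s. \<bar>\<Phi> n s\<bar> \<le> B) \<Longrightarrow> (\<And>s. (\<lambda>n::nat. \<Phi> n s) \<longlonglongrightarrow> \<phi> s) \<Longrightarrow>
      \<phi> \<in> borel_measurable borel \<Longrightarrow> Q \<phi>"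
    and \<phi>: "\<phi> \<in> borel_measurable borel" "\<And>s. \<bar>\<phi> s\<bar> \<le> B"
  shows "Q (\<lambda>s. indicator {0..T} s * \<phi> s)"
proof -
  have Q0: "Q (\<lambda>_. 0)"
    using lin[OF ind[of 0] ind[of 0], of 0 0] T by simp
  have sets: "Q (indicator (A \<inter> {0..T}))" if "A \<in> sets borel" for A
  proof -
    define \<G> where "\<G> = range (\<lambda>a::real. {..a})"
    have sig: "sigma_sets UNIV \<G> = sets borel" unfolding \<G>_def by (subst borel_eq_atMost) simp
    have "Int_stable \<G>"
      unfolding \<G>_def
    proof (rule Int_stableI)
      fix a b assume "a \<in> range (\<lambda>a::real. {..a})" "b \<in> range (\<lambda>a::real. {..a})"
      then obtain x y where "a = {..x}" "b = {..y}" by auto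
      then have "a \<inter> b = {..min x y}" by auto
      then show "a \<inter> b \<in> range (\<lambda>a::real. {..a})" by blast
    qed
    moreover have "\<G> \<subseteq> Pow UNIV" by simp
    moreover have "A \<in> sigma_sets UNIV \<G>" using that sig by simp
    ultimately show ?thesis
    proof (induction rule: sigma_sets_induct_disjoint)
      case (basic X)
      then obtain a where a: "X = {..a}" unfolding \<G>_def by auto
      show ?case
      proof (cases "0 \<le> a")
        case True
        then have "X \<inter> {0..T} = {0..min a T}" using a by auto
        then show ?thesis using ind[of "min a T"] True T by simp
      next
        case False
        then have e: "X \<inter> {0..T} = {}" using a by auto
        show ?thesis unfolding e using Q0 by (simp add: indicator_def[abs_def])
      qed
    next
      case empty
      then show ?case using Q0 by (simp add: indicator_def[abs_def])
    next
      case (compl X)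
      have "indicator ((UNIV - X) \<inter> {0..T}) = (\<lambda>s. 1 * indicator {0..T} s + (-1) * indicator (X \<inter> {0..T}) s :: real)"
        by (auto simp: indicator_def)
      then show ?case using lin[OF ind[of T] compl(2), of 1 "-1"] T by simp
    next
      case (union X)
      have part: "Q (indicator ((\<Union>i<n. X i) \<inter> {0..T}))" for n
      proof (induction n)
        case 0
        then show ?case using Q0 by (simp add: indicator_def[abs_def])
      next
        case (Suc n)
        have "X n \<inter> X i = {}" if "i < n" for i
          using union(1) that unfolding disjoint_family_on_def by (metis UNIV_I less_irrefl)
        then have "(indicator ((\<Union>i<Suc n. X i) \<inter> {0..T}) :: real \<Rightarrow> real) = (\<lambda>s. 1 * indicator ((\<Union>i<n. X i) \<inter> {0..T}) s + 1 * indicator (X n \<inter> {0..T}) s)"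
          by (auto simp: indicator_def fun_eq_iff less_Suc_eq)
        then show ?case using lin[OF Suc.IH union(3)[of n], of 1 1] by simp
      qed
      show ?case
      proof (rule lim[OF part, where B = 1])
        show "\<bar>indicator ((\<Union>i<n. X i) \<inter> {0..T}) s :: real\<bar> \<le> 1" for n s by (simp add: indicator_def)
        have "X i \<in> sets borel" for i using union(2) sig by auto
        then show "(indicator ((\<Union>i. X i) \<inter> {0..T}) :: real \<Rightarrow> real) \<in> borel_measurable borel" by simp
        fix s
        show "(\<lambda>n. indicator ((\<Union>i<n. X i) \<inter> {0..T}) s :: real) \<longlonglongrightarrow> indicator ((\<Union>i. X i) \<inter> {0..T}) s"
        proof (cases "s \<in> (\<Union>i. X i)")
          case True
          then obtain i where i: "s \<in> X i" by blast
          have "\<forall>\<^sub>F n in sequentially. (indicator ((\<Union>i<n. X i) \<inter> {0..T}) s :: real) = indicator ((\<Union>i. X i) \<inter> {0..T}) s"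
            by (rule eventually_sequentiallyI[of "Suc i"]) (use i in \<open>auto simp: indicator_def\<close>)
          then show ?thesis by (rule tendsto_eventually)
        next
          case False
          then have "s \<notin> (\<Union>i<n. X i)" for n by auto
          then show ?thesis using False by (simp add: indicator_def)
        qed
      qed
    qed
  qed
  have pos: "Q (\<lambda>s. indicator {0..T} s * u s)"
    if "u \<in> borel_measurable borel" "\<And>s. 0 \<le> u s" "\<And>s. u s \<le> B" for u :: "real \<Rightarrow> real" and B
  proof -
    \<comment> \<open>The induction for nonnegative functions does not carry a bound along, hence
      the bound as a premise. Summands and increasing approximations inherit it from the function
      that they build up.\<close>
    have "(\<exists>B. \<forall>s. u s \<le> B) \<longrightarrow> Q (\<lambda>s. indicator {0..T} s * u s)"
      using that(1,2)
    proof (induct rule: borel_measurable_induct_real)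
      case (set A)
      have "(indicator (A \<inter> {0..T}) :: real \<Rightarrow> real) = (\<lambda>s. indicator {0..T} s * indicator A s)" by (auto simp: indicator_def)
      then show ?case using sets[of A] set by simp
    next
      case (mult u c)
      show ?case
      proof
        assume "\<exists>B. \<forall>s. c * u s \<le> B"
        then obtain B where B: "\<And>s. c * u s \<le> B" by blast
        show "Q (\<lambda>s. indicator {0..T} s * (c * u s))"
        proof (cases "c = 0")
          case False
          then have "u s \<le> B / c" for s using B[of s] mult(1) by (simp add: field_simps)
          then have "Q (\<lambda>s. indicator {0..T} s * u s)" using mult(4) by blast
          from lin[OF this Q0, of c 0] show ?thesis by (simp add: ac_simps)
        qed (use Q0 in simp)
      qed
    next
      case (add u v)
      show ?case
      proof
        assume "\<exists>B. \<forall>s. v s + u s \<le> B"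
        then obtain B where B: "\<And>s. v s + u s \<le> B" by blast
        have "u s \<le> B" "v s \<le> B" for s using B[of s] add(2)[of s] add(5)[of s] by linarith+
        then have "Q (\<lambda>s. indicator {0..T} s * u s)" "Q (\<lambda>s. indicator {0..T} s * v s)" using add(3,7) by blast+
        from lin[OF this, of 1 1] show "Q (\<lambda>s. indicator {0..T} s * (v s + u s))" by (simp add: algebra_simps)
      qed
    next
      case (seq U)
      show ?case
      proof
        assume "\<exists>B. \<forall>s. u s \<le> B"
        then obtain B where B: "\<And>s. u s \<le> B" by blast
        have Un: "U n s \<le> u s" for n s
          using incseq_le[of "\<lambda>n. U n s" "u s" n] seq by (auto simp: incseq_def le_fun_def)
        have Q: "Q (\<lambda>s. indicator {0..T} s * U n s)" for n
          using seq(3)[of n] Un[of n] B by (blast intro: order_trans)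
        show "Q (\<lambda>s. indicator {0..T} s * u s)"
        proof (rule lim[OF Q, where B = B])
          show "\<bar>indicator {0..T} s * U n s\<bar> \<le> B" for n s
            using Un[of n s] B[of s] seq(2)[of n s] by (auto simp: indicator_def)
          show "(\<lambda>n. indicator {0..T} s * U n s) \<longlonglongrightarrow> indicator {0..T} s * u s" for s
            using seq(5) by (intro tendsto_intros) simp
          show "(\<lambda>s. indicator {0..T} s * u s) \<in> borel_measurable borel"
          proof -
            have "u \<in> borel_measurable borel"
              by (rule borel_measurable_LIMSEQ_real[OF _ seq(1)]) (use seq(5) in simp)
            then show ?thesis by simp
          qed
        qed
      qed
    qed
    then show ?thesis using that(3) by blast
  qed
  have B0: "max 0 (\<phi> s) \<le> \<bar>B\<bar>" "max 0 (- \<phi> s) \<le> \<bar>B\<bar>" for s using \<phi>(2)[of s] by auto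
  have "Q (\<lambda>s. indicator {0..T} s * max 0 (\<phi> s))" "Q (\<lambda>s. indicator {0..T} s * max 0 (- \<phi> s))"
    by (rule pos[OF _ _ B0(1)]; use \<phi>(1) in simp) (rule pos[OF _ _ B0(2)]; use \<phi>(1) in simp)
  from lin[OF this, of 1 "-1"] have "Q (\<lambda>s. 1 * (indicator {0..T} s * max 0 (\<phi> s)) + - 1 * (indicator {0..T} s * max 0 (- \<phi> s)))" .
  moreover have "(\<lambda>s. 1 * (indicator {0..T} s * max 0 (\<phi> s)) + - 1 * (indicator {0..T} s * max 0 (- \<phi> s))) = (\<lambda>s. indicator {0..T} s * \<phi> s)"
    by (auto simp: fun_eq_iff max_def indicator_def)
  ultimately show ?thesis by simp
qed

section \<open>The Wiener integral\<close>

locale bifbm_setting = covariance_setting T H K \<mu>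
  for T H K :: real and \<mu> :: "(real \<times> real) signed_measure" +
  fixes P :: "(real \<Rightarrow> real) measure" and W :: "(real \<Rightarrow> real) \<Rightarrow> (real \<Rightarrow> real) \<Rightarrow> real"
  assumes law: "bifbm_law H K T P" and wiener: "wiener_integral T \<mu> (completion P) W"
begin

abbreviation "\<Omega> \<equiv> completion P"

sublocale P: prob_space P using law by (simp add: bifbm_law_def)
sublocale \<Omega>: prob_space \<Omega> by (rule P.prob_space_completion)

lemma sets_P: "sets P = sets (path_space T)" using law by (simp add: bifbm_law_def)

lemma space_P: "space P = C0_paths T"
  using sets_eq_imp_space_eq[OF sets_P] by (simp add: space_path_space)

lemma coord_measurable_P: "t \<in> {0..T} \<Longrightarrow> (\<lambda>\<omega>. \<omega> t) \<in> borel_measurable P"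
  unfolding measurable_cong_sets[OF sets_P refl] path_space_def
  by (intro measurable_restrict_space1 measurable_component_singleton)

lemma coord_measurable: "t \<in> {0..T} \<Longrightarrow> (\<lambda>\<omega>. \<omega> t) \<in> borel_measurable \<Omega>"
  by (rule measurable_completion[OF coord_measurable_P])

section \<open>The Gaussian space of the coordinate process\<close>

definition gspan :: "((real \<Rightarrow> real) \<Rightarrow> real) set" where
  "gspan = {Y. \<exists>J a. finite J \<and> J \<subseteq> {0..T} \<and> Y = (\<lambda>\<omega>. \<Sum>j\<in>J. a j * \<omega> j)}"

lemma gspan_P:
  assumes "Y \<in> gspan"
  shows "gaussian_rv P Y" "(\<integral>\<omega>. Y \<omega> \<partial>P) = 0"
proof -
  obtain J a where J: "finite J" "J \<subseteq> {0..T}" "Y = (\<lambda>\<omega>. \<Sum>j\<in>J. a j * \<omega> j)"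
    using assms unfolding gspan_def by blast
  have gp: "gaussian_process P {0..T} (\<lambda>t \<omega>. \<omega> t)" using law by (simp add: bifbm_law_def)
  then show "gaussian_rv P Y" unfolding J(3) gaussian_process_def using J by blast
  have mean: "(\<integral>\<omega>. \<omega> t \<partial>P) = 0" if "t \<in> {0..T}" for t using law that by (simp add: bifbm_law_def)
  have one: "integrable P (\<lambda>\<omega>. \<omega> t)" if t: "t \<in> {0..T}" for t
  proof -
    have g: "gaussian_rv P (\<lambda>\<omega>. \<omega> t)"
      using gp[unfolded gaussian_process_def, rule_format, of "{t}" "\<lambda>_. 1"] t by simp
    have "(\<lambda>\<omega>. \<omega> t) \<in> L2_rv P"
      unfolding L2_rv_def using P.gaussian_rv_cos_expectation(1,2)[OF g mean[OF t]] by blast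
    then show ?thesis by (rule P.L2_rv_integrable)
  qed
  show "(\<integral>\<omega>. Y \<omega> \<partial>P) = 0"
    unfolding J(3) using J(2) one mean
    by (subst Bochner_Integration.integral_sum) (auto intro!: sum.neutral)
qed

lemma gspan_Omega:
  assumes "Y \<in> gspan"
  shows "Y \<in> L2_rv \<Omega>" "(\<integral>\<omega>. cos (Y \<omega> + a) \<partial>\<Omega>) = cos a * exp (- (\<integral>\<omega>. (Y \<omega>)\<^sup>2 \<partial>\<Omega>) / 2)"
proof -
  note g = P.gaussian_rv_cos_expectation[OF gspan_P[OF assms]]
  have m: "(\<lambda>\<omega>. (Y \<omega>)\<^sup>2) \<in> borel_measurable P" "(\<lambda>\<omega>. cos (Y \<omega> + a)) \<in> borel_measurable P"
    using g(1) by simp_all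
  show "Y \<in> L2_rv \<Omega>"
    unfolding L2_rv_def using g(1,2) measurable_completion[OF g(1)] integrable_completion[OF m(1)] by simp
  show "(\<integral>\<omega>. cos (Y \<omega> + a) \<partial>\<Omega>) = cos a * exp (- (\<integral>\<omega>. (Y \<omega>)\<^sup>2 \<partial>\<Omega>) / 2)"
    unfolding integral_completion[OF m(1)] integral_completion[OF m(2)] by (rule g(3))
qed

lemma gspan_lin:
  assumes "Y \<in> gspan" "Z \<in> gspan" shows "(\<lambda>\<omega>. c * Y \<omega> + d * Z \<omega>) \<in> gspan"
proof -
  obtain J a where J: "finite J" "J \<subseteq> {0..T}" "Y = (\<lambda>\<omega>. \<Sum>j\<in>J. a j * \<omega> j)"
    using assms(1) unfolding gspan_def by blast
  obtain L b where L: "finite L" "L \<subseteq> {0..T}" "Z = (\<lambda>\<omega>. \<Sum>j\<in>L. b j * \<omega> j)"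
    using assms(2) unfolding gspan_def by blast
  define e where "e j = c * (if j \<in> J then a j else 0) + d * (if j \<in> L then b j else 0)" for j
  have "c * Y \<omega> + d * Z \<omega> = (\<Sum>j\<in>J \<union> L. e j * \<omega> j)" for \<omega>
  proof -
    have "(\<Sum>j\<in>J. a j * \<omega> j) = (\<Sum>j\<in>J \<union> L. (if j \<in> J then a j else 0) * \<omega> j)"
      using J L by (intro sum.mono_neutral_cong_left) auto
    moreover have "(\<Sum>j\<in>L. b j * \<omega> j) = (\<Sum>j\<in>J \<union> L. (if j \<in> L then b j else 0) * \<omega> j)"
      using J L by (intro sum.mono_neutral_cong_left) auto
    ultimately show ?thesis unfolding J(3) L(3) e_def
      by (simp add: sum_distrib_left sum.distrib distrib_right mult.assoc)
  qed
  then show ?thesis unfolding gspan_def using J L by blast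
qed

lemma coord_gspan: "t \<in> {0..T} \<Longrightarrow> (\<lambda>\<omega>. \<omega> t) \<in> gspan"
  unfolding gspan_def by (auto intro!: exI[of _ "{t}"] exI[of _ "\<lambda>_. 1"])

lemma coord_cov:
  assumes "t \<in> {0..T}" "s \<in> {0..T}"
  shows "(\<integral>\<omega>. \<omega> t * \<omega> s \<partial>\<Omega>) = bifbm_cov H K t s"
proof -
  have "(\<lambda>\<omega>. \<omega> t * \<omega> s) \<in> borel_measurable P"
    using coord_measurable_P assms by (intro borel_measurable_times)
  then show ?thesis using law assms by (simp add: integral_completion bifbm_law_def)
qed

text \<open>The L2 closure of the finite linear combinations of coordinates. Its Gaussian character
  is expressed through the expectation of cosines alone, a property that passes to L2
  limits.\<close>

definition gaussian_space :: "((real \<Rightarrow> real) \<Rightarrow> real) set" where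
  "gaussian_space = {Y \<in> L2_rv \<Omega>. \<forall>e>0. \<exists>Y'\<in>gspan. (\<integral>\<omega>. (Y' \<omega> - Y \<omega>)\<^sup>2 \<partial>\<Omega>) < e}"

lemma gaussian_space_L2: "Y \<in> gaussian_space \<Longrightarrow> Y \<in> L2_rv \<Omega>" by (simp add: gaussian_space_def)

lemma gspan_gaussian_space: "gspan \<subseteq> gaussian_space"
  unfolding gaussian_space_def using gspan_Omega(1) by (auto intro!: bexI)

lemma gaussian_space_seq:
  assumes "Y \<in> gaussian_space"
  obtains Yn where "\<And>n. Yn n \<in> gspan" "(\<lambda>n. \<integral>\<omega>. (Yn n \<omega> - Y \<omega>)\<^sup>2 \<partial>\<Omega>) \<longlonglongrightarrow> 0"
proof -
  have "\<exists>Y'. Y' \<in> gspan \<and> (\<integral>\<omega>. (Y' \<omega> - Y \<omega>)\<^sup>2 \<partial>\<Omega>) < 1 / real (Suc n)" for n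
  proof -
    have "\<forall>e>0. \<exists>Y'\<in>gspan. (\<integral>\<omega>. (Y' \<omega> - Y \<omega>)\<^sup>2 \<partial>\<Omega>) < e"
      using assms by (simp add: gaussian_space_def)
    from this[rule_format, of "1 / real (Suc n)"] show ?thesis by auto
  qed
  then obtain Yn where Yn: "\<And>n. Yn n \<in> gspan" "\<And>n. (\<integral>\<omega>. (Yn n \<omega> - Y \<omega>)\<^sup>2 \<partial>\<Omega>) < 1 / real (Suc n)"
    by metis
  have "(\<lambda>n. \<integral>\<omega>. (Yn n \<omega> - Y \<omega>)\<^sup>2 \<partial>\<Omega>) \<longlonglongrightarrow> 0"
  proof (rule Lim_null_comparison)
    show "\<forall>\<^sub>F n in sequentially. norm (\<integral>\<omega>. (Yn n \<omega> - Y \<omega>)\<^sup>2 \<partial>\<Omega>) \<le> 1 / real (Suc n)"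
      using Yn(2) by (intro always_eventually) (simp add: less_imp_le)
  qed (rule LIMSEQ_Suc[OF lim_1_over_n])
  then show thesis using that Yn(1) by blast
qed

text \<open>Both sides are continuous in L2: the left by the Lipschitz bound for the cosine, the
  right because second moments converge.\<close>

lemma gaussian_space_cos:
  assumes "Y \<in> gaussian_space"
  shows "(\<integral>\<omega>. cos (Y \<omega> + a) \<partial>\<Omega>) = cos a * exp (- (\<integral>\<omega>. (Y \<omega>)\<^sup>2 \<partial>\<Omega>) / 2)"
proof -
  obtain Yn where Yn: "\<And>n. Yn n \<in> gspan" "(\<lambda>n. \<integral>\<omega>. (Yn n \<omega> - Y \<omega>)\<^sup>2 \<partial>\<Omega>) \<longlonglongrightarrow> 0"
    using assms by (rule gaussian_space_seq) (assumption | rule that)+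
  note Y = gaussian_space_L2[OF assms] and L = gspan_Omega(1)[OF Yn(1)]
  have "(\<lambda>n. \<integral>\<omega>. cos (Yn n \<omega> + a) \<partial>\<Omega>) \<longlonglongrightarrow> (\<integral>\<omega>. cos (Y \<omega> + a) \<partial>\<Omega>)"
    by (rule \<Omega>.L2_limit_cos[OF Y L Yn(2)])
  moreover have "(\<lambda>n. cos a * exp (- (\<integral>\<omega>. (Yn n \<omega>)\<^sup>2 \<partial>\<Omega>) / 2)) \<longlonglongrightarrow> cos a * exp (- (\<integral>\<omega>. (Y \<omega>)\<^sup>2 \<partial>\<Omega>) / 2)"
    by (intro tendsto_intros L2_limit_square[OF Y L Yn(2)]) simp
  ultimately show ?thesis unfolding gspan_Omega(2)[OF Yn(1)] by (rule LIMSEQ_unique)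
qed

lemma square_add_le: "(x + y)\<^sup>2 \<le> 2 * x\<^sup>2 + 2 * (y::real)\<^sup>2"
proof -
  have "0 \<le> (x - y)\<^sup>2" by simp
  then show ?thesis by (simp add: power2_eq_square algebra_simps)
qed

lemma L2_distance_triangle:
  assumes "X \<in> L2_rv \<Omega>" "Y \<in> L2_rv \<Omega>" "Z \<in> L2_rv \<Omega>"
  shows "(\<integral>\<omega>. (X \<omega> - Z \<omega>)\<^sup>2 \<partial>\<Omega>) \<le> 2 * (\<integral>\<omega>. (X \<omega> - Y \<omega>)\<^sup>2 \<partial>\<Omega>) + 2 * (\<integral>\<omega>. (Y \<omega> - Z \<omega>)\<^sup>2 \<partial>\<Omega>)"
proof -
  have i: "integrable \<Omega> (\<lambda>\<omega>. (X \<omega> - Z \<omega>)\<^sup>2)" "integrable \<Omega> (\<lambda>\<omega>. (X \<omega> - Y \<omega>)\<^sup>2)" "integrable \<Omega> (\<lambda>\<omega>. (Y \<omega> - Z \<omega>)\<^sup>2)"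
    using L2_rv_diff[OF assms(1,3)] L2_rv_diff[OF assms(1,2)] L2_rv_diff[OF assms(2,3)] by (simp_all add: L2_rv_def)
  have "(\<integral>\<omega>. (X \<omega> - Z \<omega>)\<^sup>2 \<partial>\<Omega>) \<le> (\<integral>\<omega>. 2 * (X \<omega> - Y \<omega>)\<^sup>2 + 2 * (Y \<omega> - Z \<omega>)\<^sup>2 \<partial>\<Omega>)"
    using i square_add_le[of "X \<omega> - Y \<omega>" "Y \<omega> - Z \<omega>" for \<omega>] by (intro integral_mono) auto
  then show ?thesis using i by simp
qed

lemma gaussian_space_lin:
  assumes Y: "Y \<in> gaussian_space" and Z: "Z \<in> gaussian_space"
  shows "(\<lambda>\<omega>. c * Y \<omega> + d * Z \<omega>) \<in> gaussian_space"
  unfolding gaussian_space_def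
proof (intro CollectI conjI allI impI)
  show L: "(\<lambda>\<omega>. c * Y \<omega> + d * Z \<omega>) \<in> L2_rv \<Omega>"
    by (rule L2_rv_lin[OF gaussian_space_L2[OF Y] gaussian_space_L2[OF Z]])
  fix e :: real assume e: "0 < e"
  \<comment> \<open>\<open>square_add_le\<close> turns the error into
    \<open>2 * c^2 * e' + 2 * d^2 * e'\<close>; the divisor more than compensates this, and its
    summand 1 keeps it positive when \<open>c = d = 0\<close>.\<close>
  define e' where "e' = e / (4 * (c\<^sup>2 + d\<^sup>2 + 1))"
  have pos: "0 < c\<^sup>2 + d\<^sup>2 + 1" by (simp add: add_nonneg_pos)
  have e': "0 < e'" using e pos by (simp add: e'_def)
  obtain Y' where Y': "Y' \<in> gspan" "(\<integral>\<omega>. (Y' \<omega> - Y \<omega>)\<^sup>2 \<partial>\<Omega>) < e'"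
    using Y e' unfolding gaussian_space_def by blast
  obtain Z' where Z': "Z' \<in> gspan" "(\<integral>\<omega>. (Z' \<omega> - Z \<omega>)\<^sup>2 \<partial>\<Omega>) < e'"
    using Z e' unfolding gaussian_space_def by blast
  have i: "integrable \<Omega> (\<lambda>\<omega>. (Y' \<omega> - Y \<omega>)\<^sup>2)" "integrable \<Omega> (\<lambda>\<omega>. (Z' \<omega> - Z \<omega>)\<^sup>2)"
    using L2_rv_diff[OF gspan_Omega(1)[OF Y'(1)] gaussian_space_L2[OF Y]]
      L2_rv_diff[OF gspan_Omega(1)[OF Z'(1)] gaussian_space_L2[OF Z]] by (simp_all add: L2_rv_def)
  have L': "integrable \<Omega> (\<lambda>\<omega>. ((c * Y' \<omega> + d * Z' \<omega>) - (c * Y \<omega> + d * Z \<omega>))\<^sup>2)"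
    using L2_rv_diff[OF gspan_Omega(1)[OF gspan_lin[OF Y'(1) Z'(1)]] L] by (simp add: L2_rv_def)
  have "(\<integral>\<omega>. ((c * Y' \<omega> + d * Z' \<omega>) - (c * Y \<omega> + d * Z \<omega>))\<^sup>2 \<partial>\<Omega>) \<le>
      (\<integral>\<omega>. 2 * c\<^sup>2 * (Y' \<omega> - Y \<omega>)\<^sup>2 + 2 * d\<^sup>2 * (Z' \<omega> - Z \<omega>)\<^sup>2 \<partial>\<Omega>)"
  proof (rule integral_mono[OF L'])
    fix \<omega>
    have "(c * Y' \<omega> + d * Z' \<omega>) - (c * Y \<omega> + d * Z \<omega>) = c * (Y' \<omega> - Y \<omega>) + d * (Z' \<omega> - Z \<omega>)"
      by (simp add: algebra_simps)
    then show "((c * Y' \<omega> + d * Z' \<omega>) - (c * Y \<omega> + d * Z \<omega>))\<^sup>2 \<le> 2 * c\<^sup>2 * (Y' \<omega> - Y \<omega>)\<^sup>2 + 2 * d\<^sup>2 * (Z' \<omega> - Z \<omega>)\<^sup>2"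
      using square_add_le[of "c * (Y' \<omega> - Y \<omega>)" "d * (Z' \<omega> - Z \<omega>)"] by (simp add: power_mult_distrib)
  qed (use i in simp)
  also have "\<dots> = 2 * c\<^sup>2 * (\<integral>\<omega>. (Y' \<omega> - Y \<omega>)\<^sup>2 \<partial>\<Omega>) + 2 * d\<^sup>2 * (\<integral>\<omega>. (Z' \<omega> - Z \<omega>)\<^sup>2 \<partial>\<Omega>)"
    using i by simp
  also have "\<dots> \<le> 2 * c\<^sup>2 * e' + 2 * d\<^sup>2 * e'"
    using Y'(2) Z'(2) by (intro add_mono mult_left_mono) auto
  also have "\<dots> < 4 * (c\<^sup>2 + d\<^sup>2 + 1) * e'"
  proof -
    have "0 \<le> c\<^sup>2 * e'" "0 \<le> d\<^sup>2 * e'" using e' by simp_all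
    moreover have "4 * (c\<^sup>2 + d\<^sup>2 + 1) * e' = 4 * (c\<^sup>2 * e') + 4 * (d\<^sup>2 * e') + 4 * e'"
      "2 * c\<^sup>2 * e' + 2 * d\<^sup>2 * e' = 2 * (c\<^sup>2 * e') + 2 * (d\<^sup>2 * e')"
      by (simp_all add: algebra_simps)
    ultimately show ?thesis using e' by linarith
  qed
  also have "\<dots> = e" using pos by (simp add: e'_def)
  finally show "\<exists>V\<in>gspan. (\<integral>\<omega>. (V \<omega> - (c * Y \<omega> + d * Z \<omega>))\<^sup>2 \<partial>\<Omega>) < e"
    by (intro bexI[OF _ gspan_lin[OF Y'(1) Z'(1), of c d]])
qed

lemma gaussian_space_closed:
  assumes Yn: "\<And>n. Yn n \<in> gaussian_space" and Y: "Y \<in> L2_rv \<Omega>"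
    and lim: "(\<lambda>n. \<integral>\<omega>. (Yn n \<omega> - Y \<omega>)\<^sup>2 \<partial>\<Omega>) \<longlonglongrightarrow> 0"
  shows "Y \<in> gaussian_space"
  unfolding gaussian_space_def
proof (intro CollectI conjI allI impI Y)
  fix e :: real assume e: "0 < e"
  \<comment> \<open>A quarter for each distance, because the triangle inequality for squared
    distances carries a factor 2.\<close>
  then obtain n where n: "(\<integral>\<omega>. (Yn n \<omega> - Y \<omega>)\<^sup>2 \<partial>\<Omega>) < e / 4"
    using order_tendstoD(2)[OF lim, of "e / 4"] by (auto simp: eventually_sequentially)
  obtain Y' where Y': "Y' \<in> gspan" "(\<integral>\<omega>. (Y' \<omega> - Yn n \<omega>)\<^sup>2 \<partial>\<Omega>) < e / 4"
  proof -
    have "0 < e / 4" using e by simp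
    then show thesis using that Yn[of n] unfolding gaussian_space_def by blast
  qed
  show "\<exists>Y'\<in>gspan. (\<integral>\<omega>. (Y' \<omega> - Y \<omega>)\<^sup>2 \<partial>\<Omega>) < e"
    using L2_distance_triangle[OF gspan_Omega(1)[OF Y'(1)] gaussian_space_L2[OF Yn] Y, of n] n Y'
    by (intro bexI[OF _ Y'(1)]) linarith
qed

text \<open>Linearity of \<open>W\<close> and its values on indicators hold almost surely only,
  while \<open>gaussian_space\<close> is a set of functions.\<close>

lemma gaussian_space_cong_AE:
  assumes Y: "Y \<in> gaussian_space" and Z: "Z \<in> L2_rv \<Omega>" and eq: "AE \<omega> in \<Omega>. Z \<omega> = Y \<omega>"
  shows "Z \<in> gaussian_space"
proof (rule gaussian_space_closed[OF _ Z])
  have "AE \<omega> in \<Omega>. (Y \<omega> - Z \<omega>)\<^sup>2 = 0" using eq by eventually_elim simp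
  then have "(\<integral>\<omega>. (Y \<omega> - Z \<omega>)\<^sup>2 \<partial>\<Omega>) = (\<integral>\<omega>. 0 \<partial>\<Omega>)"
    using L2_rv_measurable[OF gaussian_space_L2[OF Y]] L2_rv_measurable[OF Z] by (intro integral_cong_AE) auto
  then show "(\<lambda>n. \<integral>\<omega>. (Y \<omega> - Z \<omega>)\<^sup>2 \<partial>\<Omega>) \<longlonglongrightarrow> 0" by simp
qed (rule Y)

lemma W_L2: "\<phi> \<in> L_mu T \<mu> \<Longrightarrow> W \<phi> \<in> L2_rv \<Omega>"
  using wiener unfolding wiener_integral_def by blast

lemma W_lin: "\<phi> \<in> L_mu T \<mu> \<Longrightarrow> \<psi> \<in> L_mu T \<mu> \<Longrightarrow> AE \<omega> in \<Omega>. W (\<lambda>s. a * \<phi> s + b * \<psi> s) \<omega> = a * W \<phi> \<omega> + b * W \<psi> \<omega>"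
  using wiener unfolding wiener_integral_def by blast

lemma W_lim: "\<phi> \<in> L_mu T \<mu> \<Longrightarrow> (\<And>n. \<Phi> n \<in> L_mu T \<mu>) \<Longrightarrow>
    (\<lambda>n. inner_H \<mu> (\<lambda>s. \<Phi> n s - \<phi> s) (\<lambda>s. \<Phi> n s - \<phi> s)) \<longlonglongrightarrow> 0 \<Longrightarrow>
    (\<lambda>n::nat. \<integral>\<omega>. (W (\<Phi> n) \<omega> - W \<phi> \<omega>)\<^sup>2 \<partial>\<Omega>) \<longlonglongrightarrow> 0"
  using wiener unfolding wiener_integral_def by blast

lemma W_ind: "t \<in> {0..T} \<Longrightarrow> AE \<omega> in \<Omega>. W (indicator {0..t}) \<omega> = \<omega> t"
  using wiener unfolding wiener_integral_def by blast

lemma ind_Lbdd: "indicator {0..t} \<in> Lbdd"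
proof -
  have "(indicator {0..t} :: real \<Rightarrow> real) \<in> brl" by (intro measurable_restrict_space1) simp
  moreover have "\<bar>indicator {0..t} s :: real\<bar> \<le> 1" for s by (simp add: indicator_def)
  ultimately show ?thesis unfolding Lbdd_def by blast
qed

lemma inner_H_ind:
  assumes "t \<in> {0..T}" "s \<in> {0..T}"
  shows "inner_H \<mu> (indicator {0..t}) (indicator {0..s}) = bifbm_cov H K t s"
proof -
  have "(\<lambda>(u, v). indicator {0..t} u * indicator {0..s} v :: real) = indicator ({0..t} \<times> {0..s})"
    by (auto simp: indicator_def fun_eq_iff)
  moreover have "{0..t} \<times> {0..s} \<in> sets \<mu>p" "{0..t} \<times> {0..s} \<in> sets \<mu>m"
    using assms by (auto simp: sets_mu_iff intro: sets_borel_Times)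
  ultimately have "inner_H \<mu> (indicator {0..t}) (indicator {0..s}) = smeasure \<mu> ({0..t} \<times> {0..s})"
    using finite_mu finite_measure.emeasure_finite unfolding inner_H_def sintegral_def smeasure_def by simp
  then show ?thesis using cov assms by (simp add: covariance_measure_def)
qed

lemma W_ind_cov:
  assumes "Y \<in> L2_rv \<Omega>" "s \<in> {0..T}"
  shows "(\<integral>\<omega>. Y \<omega> * W (indicator {0..s}) \<omega> \<partial>\<Omega>) = (\<integral>\<omega>. Y \<omega> * \<omega> s \<partial>\<Omega>)"
proof (rule integral_cong_AE)
  show "AE \<omega> in \<Omega>. Y \<omega> * W (indicator {0..s}) \<omega> = Y \<omega> * \<omega> s"
    using W_ind[OF assms(2)] by eventually_elim simp
  have "indicator {0..s} \<in> L_mu T \<mu>" using ind_Lbdd Lbdd_L_mu by blast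
  then show "(\<lambda>\<omega>. Y \<omega> * W (indicator {0..s}) \<omega>) \<in> borel_measurable \<Omega>"
    by (intro borel_measurable_times L2_rv_measurable assms W_L2)
  show "(\<lambda>\<omega>. Y \<omega> * \<omega> s) \<in> borel_measurable \<Omega>"
    by (intro borel_measurable_times L2_rv_measurable assms coord_measurable)
qed

lemma Lbdd_lin:
  assumes "\<phi> \<in> Lbdd" "\<psi> \<in> Lbdd" shows "(\<lambda>s. a * \<phi> s + b * \<psi> s) \<in> Lbdd"
proof -
  obtain B where B: "\<phi> \<in> brl" "\<And>s. s \<in> {0..T} \<Longrightarrow> \<bar>\<phi> s\<bar> \<le> B" using assms(1) by (rule LbddE) (assumption | rule that)+
  obtain C where C: "\<psi> \<in> brl" "\<And>s. s \<in> {0..T} \<Longrightarrow> \<bar>\<psi> s\<bar> \<le> C" using assms(2) by (rule LbddE) (assumption | rule that)+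
  have "(\<lambda>s. a * \<phi> s + b * \<psi> s) \<in> brl" using B(1) C(1) by simp
  moreover have "\<bar>a * \<phi> s + b * \<psi> s\<bar> \<le> \<bar>a\<bar> * B + \<bar>b\<bar> * C" if "s \<in> {0..T}" for s
    using B(2)[OF that] C(2)[OF that]
    by (intro order_trans[OF abs_triangle_ineq] add_mono) (simp_all add: abs_mult mult_left_mono)
  ultimately show ?thesis unfolding Lbdd_def by blast
qed

text \<open>Dominated convergence on both Jordan parts at once, with a product as majorant. The
  majorant is kept general: constants serve for bounded functions, \<open>\<bar>\<phi>\<bar>\<close>
  for truncations of \<open>\<phi>\<close>.\<close>

lemma inner_H_dominated:
  assumes m: "\<And>n. \<Phi> n \<in> brl" "\<And>n. \<Psi> n \<in> brl" "\<phi> \<in> brl" "\<psi> \<in> brl"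
    and lim: "\<And>s. s \<in> {0..T} \<Longrightarrow> (\<lambda>n. \<Phi> n s) \<longlonglongrightarrow> \<phi> s" "\<And>s. s \<in> {0..T} \<Longrightarrow> (\<lambda>n. \<Psi> n s) \<longlonglongrightarrow> \<psi> s"
    and dom: "\<And>M. M \<in> {\<mu>p, \<mu>m} \<Longrightarrow> integrable M (\<lambda>z. a (fst z) * b (snd z))"
    and bound: "\<And>n s. s \<in> {0..T} \<Longrightarrow> \<bar>\<Phi> n s\<bar> \<le> a s" "\<And>n s. s \<in> {0..T} \<Longrightarrow> \<bar>\<Psi> n s\<bar> \<le> b s"
  shows "(\<lambda>n. inner_H \<mu> (\<Phi> n) (\<Psi> n)) \<longlonglongrightarrow> inner_H \<mu> \<phi> \<psi>"
proof -
  have "(\<lambda>n. \<integral>z. \<Phi> n (fst z) * \<Psi> n (snd z) \<partial>M) \<longlonglongrightarrow> (\<integral>z. \<phi> (fst z) * \<psi> (snd z) \<partial>M)" if M: "M \<in> {\<mu>p, \<mu>m}" for M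
  proof (rule integral_dominated_convergence[OF _ _ dom[OF M]])
    have r: "fst z \<in> {0..T}" "snd z \<in> {0..T}" if "z \<in> space M" for z using that M space_mu by auto
    show "(\<lambda>z. \<phi> (fst z) * \<psi> (snd z)) \<in> borel_measurable M" "(\<lambda>z. \<Phi> n (fst z) * \<Psi> n (snd z)) \<in> borel_measurable M" for n
      by (intro borel_measurable_times brl_measurable[OF _ M] m)+
    show "AE z in M. (\<lambda>n. \<Phi> n (fst z) * \<Psi> n (snd z)) \<longlonglongrightarrow> \<phi> (fst z) * \<psi> (snd z)"
      by (intro AE_I2 tendsto_mult lim r)
    show "AE z in M. norm (\<Phi> n (fst z) * \<Psi> n (snd z)) \<le> a (fst z) * b (snd z)" for n
    proof (rule AE_I2)
      fix z assume z: "z \<in> space M"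
      have "0 \<le> a (fst z)" using bound(1)[OF r(1)[OF z], of n] by linarith
      then show "norm (\<Phi> n (fst z) * \<Psi> n (snd z)) \<le> a (fst z) * b (snd z)"
        unfolding real_norm_def abs_mult by (intro mult_mono bound r z) simp_all
    qed
  qed
  then show ?thesis unfolding inner_H_eq by (intro tendsto_diff) auto
qed

lemma const_Lbdd: "(\<lambda>_. c) \<in> Lbdd" by (auto simp: Lbdd_def)

text \<open>The second claim is the convergence in seminorm that \<open>W_lim\<close> requires; the
  other two move a limit through either argument of the pairing.\<close>

lemma inner_H_dominated_bounded:
  assumes "\<And>n. \<Phi> n \<in> Lbdd" "\<phi> \<in> Lbdd" "\<psi> \<in> Lbdd" "\<And>n s. \<bar>\<Phi> n s\<bar> \<le> B" "\<And>s. (\<lambda>n. \<Phi> n s) \<longlonglongrightarrow> \<phi> s"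
  shows "(\<lambda>n. inner_H \<mu> (\<Phi> n) \<psi>) \<longlonglongrightarrow> inner_H \<mu> \<phi> \<psi>"
    "(\<lambda>n. inner_H \<mu> (\<lambda>s. \<Phi> n s - \<phi> s) (\<lambda>s. \<Phi> n s - \<phi> s)) \<longlonglongrightarrow> 0"
    "(\<lambda>n. inner_H \<mu> \<psi> (\<Phi> n)) \<longlonglongrightarrow> inner_H \<mu> \<psi> \<phi>"
proof -
  have m: "\<Phi> n \<in> brl" "\<phi> \<in> brl" "\<psi> \<in> brl" for n using assms(1)[of n] assms(2,3) by (auto simp: Lbdd_def)
  obtain C where C: "\<And>s. s \<in> {0..T} \<Longrightarrow> \<bar>\<psi> s\<bar> \<le> C"
    using assms(3) by (rule LbddE) (assumption | rule that)+
  have phiB: "\<bar>\<phi> s\<bar> \<le> B" for s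
    by (rule LIMSEQ_le_const2[OF tendsto_rabs[OF assms(5)]]) (use assms(4) in auto)
  have dom: "integrable M (\<lambda>z. c * d)" if "M \<in> {\<mu>p, \<mu>m}" for M and c d :: real
    using L1_integrable[OF _ const_Lbdd that, of "\<lambda>_. c" d] const_Lbdd Lbdd_L1 by blast
  show "(\<lambda>n. inner_H \<mu> (\<Phi> n) \<psi>) \<longlonglongrightarrow> inner_H \<mu> \<phi> \<psi>"
    by (rule inner_H_dominated[where a = "\<lambda>_. B" and b = "\<lambda>_. C"]) (use m assms C dom in auto)
  show "(\<lambda>n. inner_H \<mu> \<psi> (\<Phi> n)) \<longlonglongrightarrow> inner_H \<mu> \<psi> \<phi>"
    by (rule inner_H_dominated[where a = "\<lambda>_. C" and b = "\<lambda>_. B"]) (use m assms C dom in auto)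
  have "(\<lambda>n. inner_H \<mu> (\<lambda>s. \<Phi> n s - \<phi> s) (\<lambda>s. \<Phi> n s - \<phi> s)) \<longlonglongrightarrow> inner_H \<mu> (\<lambda>_. 0) (\<lambda>_. 0)"
  proof (rule inner_H_dominated[where a = "\<lambda>_. 2 * B" and b = "\<lambda>_. 2 * B"])
    show "(\<lambda>s. \<Phi> n s - \<phi> s) \<in> brl" "(\<lambda>s. \<Phi> n s - \<phi> s) \<in> brl" for n using m by auto
    show "(\<lambda>n. \<Phi> n s - \<phi> s) \<longlonglongrightarrow> 0" "(\<lambda>n. \<Phi> n s - \<phi> s) \<longlonglongrightarrow> 0" for s
      using tendsto_diff[OF assms(5) tendsto_const, of s "\<phi> s"] by simp_all
    have "\<bar>\<Phi> n s - \<phi> s\<bar> \<le> 2 * B" for n s using assms(4)[of n s] phiB[of s] by linarith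
    then show "\<bar>\<Phi> n s - \<phi> s\<bar> \<le> 2 * B" "\<bar>\<Phi> n s - \<phi> s\<bar> \<le> 2 * B" for n s by simp_all
  qed (use dom in auto)
  then show "(\<lambda>n. inner_H \<mu> (\<lambda>s. \<Phi> n s - \<phi> s) (\<lambda>s. \<Phi> n s - \<phi> s)) \<longlonglongrightarrow> 0" by (simp add: inner_H_eq)
qed

end

section \<open>From bounded integrands to all of \<open>L_mu\<close>\<close>

context bifbm_setting
begin

text \<open>The three claims go through the monotone class argument together: membership in
  \<open>Lbdd\<close> allows \<open>W_lin\<close>, \<open>W_lim\<close> and the limit of the pairing
  to be used in the closure steps. The start is the covariance: the pairing of two indicators and
  the expected product of two coordinates are both \<open>bifbm_cov\<close>.\<close>

lemma W_bounded:
  assumes \<phi>: "\<phi> \<in> borel_measurable borel" "\<And>s. \<bar>\<phi> s\<bar> \<le> B"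
  shows "cut \<phi> \<in> Lbdd \<and> W (cut \<phi>) \<in> gaussian_space \<and>
    (\<forall>s\<in>{0..T}. (\<integral>\<omega>. W (cut \<phi>) \<omega> * \<omega> s \<partial>\<Omega>) = inner_H \<mu> (cut \<phi>) (indicator {0..s}))"
proof (rule bounded_borel_class[OF T _ _ _ \<phi>])
  fix t assume t: "t \<in> {0..T}"
  have L: "indicator {0..t} \<in> L_mu T \<mu>" using ind_Lbdd Lbdd_L_mu by blast
  have "W (indicator {0..t}) \<in> gaussian_space"
    by (rule gaussian_space_cong_AE[OF _ W_L2[OF L] W_ind[OF t]]) (use coord_gspan[OF t] gspan_gaussian_space in blast)
  moreover have "(\<integral>\<omega>. W (indicator {0..t}) \<omega> * \<omega> s \<partial>\<Omega>) = inner_H \<mu> (indicator {0..t}) (indicator {0..s})"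
    if s: "s \<in> {0..T}" for s
  proof -
    have c: "(\<lambda>\<omega>. \<omega> s) \<in> L2_rv \<Omega>" using gspan_Omega(1)[OF coord_gspan[OF s]] .
    have "(\<integral>\<omega>. W (indicator {0..t}) \<omega> * \<omega> s \<partial>\<Omega>) = (\<integral>\<omega>. \<omega> s * W (indicator {0..t}) \<omega> \<partial>\<Omega>)" by (simp add: mult.commute)
    also have "\<dots> = (\<integral>\<omega>. \<omega> s * \<omega> t \<partial>\<Omega>)" by (rule W_ind_cov[OF c t])
    also have "\<dots> = (\<integral>\<omega>. \<omega> t * \<omega> s \<partial>\<Omega>)" by (simp add: mult.commute)
    finally show ?thesis using coord_cov[OF t s] inner_H_ind[OF t s] by simp
  qed
  ultimately show "indicator {0..t} \<in> Lbdd \<and> W (indicator {0..t}) \<in> gaussian_space \<and>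
    (\<forall>s\<in>{0..T}. (\<integral>\<omega>. W (indicator {0..t}) \<omega> * \<omega> s \<partial>\<Omega>) = inner_H \<mu> (indicator {0..t}) (indicator {0..s}))"
    using ind_Lbdd by blast
next
  fix \<phi> \<psi> a b
  assume 1: "\<phi> \<in> Lbdd \<and> W \<phi> \<in> gaussian_space \<and> (\<forall>s\<in>{0..T}. (\<integral>\<omega>. W \<phi> \<omega> * \<omega> s \<partial>\<Omega>) = inner_H \<mu> \<phi> (indicator {0..s}))"
    and 2: "\<psi> \<in> Lbdd \<and> W \<psi> \<in> gaussian_space \<and> (\<forall>s\<in>{0..T}. (\<integral>\<omega>. W \<psi> \<omega> * \<omega> s \<partial>\<Omega>) = inner_H \<mu> \<psi> (indicator {0..s}))"
  let ?c = "\<lambda>s. a * \<phi> s + b * \<psi> s"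
  have L: "?c \<in> Lbdd" using Lbdd_lin 1 2 by blast
  have Lm: "\<phi> \<in> L_mu T \<mu>" "\<psi> \<in> L_mu T \<mu>" "?c \<in> L_mu T \<mu>" using 1 2 L Lbdd_L_mu by blast+
  note AE = W_lin[OF Lm(1,2), of a b]
  have "W ?c \<in> gaussian_space"
    by (rule gaussian_space_cong_AE[OF gaussian_space_lin W_L2[OF Lm(3)] AE]) (use 1 2 in blast)+
  moreover have "(\<integral>\<omega>. W ?c \<omega> * \<omega> s \<partial>\<Omega>) = inner_H \<mu> ?c (indicator {0..s})" if s: "s \<in> {0..T}" for s
  proof -
    have c: "(\<lambda>\<omega>. \<omega> s) \<in> L2_rv \<Omega>" using gspan_Omega(1)[OF coord_gspan[OF s]] .
    have AE': "AE \<omega> in \<Omega>. W ?c \<omega> * \<omega> s = a * (W \<phi> \<omega> * \<omega> s) + b * (W \<psi> \<omega> * \<omega> s)"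
      using AE by eventually_elim (simp add: algebra_simps)
    have "(\<integral>\<omega>. W ?c \<omega> * \<omega> s \<partial>\<Omega>) = (\<integral>\<omega>. a * (W \<phi> \<omega> * \<omega> s) + b * (W \<psi> \<omega> * \<omega> s) \<partial>\<Omega>)"
      using L2_rv_mult[OF W_L2[OF Lm(3)] c] L2_rv_mult[OF W_L2[OF Lm(1)] c] L2_rv_mult[OF W_L2[OF Lm(2)] c]
      by (intro integral_cong_AE AE') auto
    also have "\<dots> = a * (\<integral>\<omega>. W \<phi> \<omega> * \<omega> s \<partial>\<Omega>) + b * (\<integral>\<omega>. W \<psi> \<omega> * \<omega> s \<partial>\<Omega>)"
      using L2_rv_mult[OF W_L2[OF Lm(1)] c] L2_rv_mult[OF W_L2[OF Lm(2)] c] by simp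
    also have "\<dots> = inner_H \<mu> ?c (indicator {0..s})"
    proof -
      have "\<phi> \<in> L1" "\<psi> \<in> L1" using 1 2 Lbdd_L1 by blast+
      then show ?thesis using 1 2 s inner_H_linear_left[OF _ _ ind_Lbdd, of \<phi> \<psi> a b s] by simp
    qed
    finally show ?thesis .
  qed
  ultimately show "?c \<in> Lbdd \<and> W ?c \<in> gaussian_space \<and> (\<forall>s\<in>{0..T}. (\<integral>\<omega>. W ?c \<omega> * \<omega> s \<partial>\<Omega>) = inner_H \<mu> ?c (indicator {0..s}))"
    using L by blast
next
  fix \<Phi> :: "nat \<Rightarrow> real \<Rightarrow> real" and \<phi> B
  assume Q: "\<And>n. \<Phi> n \<in> Lbdd \<and> W (\<Phi> n) \<in> gaussian_space \<and> (\<forall>s\<in>{0..T}. (\<integral>\<omega>. W (\<Phi> n) \<omega> * \<omega> s \<partial>\<Omega>) = inner_H \<mu> (\<Phi> n) (indicator {0..s}))"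
    and B: "\<And>n s. \<bar>\<Phi> n s\<bar> \<le> B" and lim: "\<And>s. (\<lambda>n. \<Phi> n s) \<longlonglongrightarrow> \<phi> s" and m: "\<phi> \<in> borel_measurable borel"
  have \<Phi>L: "\<Phi> n \<in> Lbdd" for n using Q by blast
  have "\<bar>\<phi> s\<bar> \<le> B" for s by (rule LIMSEQ_le_const2[OF tendsto_rabs[OF lim]]) (use B in auto)
  then have \<phi>L: "\<phi> \<in> Lbdd" unfolding Lbdd_def using measurable_restrict_space1[OF m] by blast
  have Lm: "\<phi> \<in> L_mu T \<mu>" "\<Phi> n \<in> L_mu T \<mu>" for n using \<phi>L \<Phi>L Lbdd_L_mu by blast+
  have c: "(\<lambda>n. \<integral>\<omega>. (W (\<Phi> n) \<omega> - W \<phi> \<omega>)\<^sup>2 \<partial>\<Omega>) \<longlonglongrightarrow> 0"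
    by (rule W_lim[OF Lm inner_H_dominated_bounded(2)[OF \<Phi>L \<phi>L \<phi>L B lim]])
  have "W \<phi> \<in> gaussian_space"
    by (rule gaussian_space_closed[OF _ W_L2[OF Lm(1)] c]) (use Q in blast)
  moreover have "(\<integral>\<omega>. W \<phi> \<omega> * \<omega> s \<partial>\<Omega>) = inner_H \<mu> \<phi> (indicator {0..s})" if s: "s \<in> {0..T}" for s
  proof (rule LIMSEQ_unique)
    show "(\<lambda>n. \<integral>\<omega>. W (\<Phi> n) \<omega> * \<omega> s \<partial>\<Omega>) \<longlonglongrightarrow> (\<integral>\<omega>. W \<phi> \<omega> * \<omega> s \<partial>\<Omega>)"
      by (rule L2_limit_mult[OF W_L2[OF Lm(1)] W_L2[OF Lm(2)] gspan_Omega(1)[OF coord_gspan[OF s]] c])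
    have "(\<lambda>n. inner_H \<mu> (\<Phi> n) (indicator {0..s})) \<longlonglongrightarrow> inner_H \<mu> \<phi> (indicator {0..s})"
      by (rule inner_H_dominated_bounded(1)[OF \<Phi>L \<phi>L ind_Lbdd B lim])
    then show "(\<lambda>n. \<integral>\<omega>. W (\<Phi> n) \<omega> * \<omega> s \<partial>\<Omega>) \<longlonglongrightarrow> inner_H \<mu> \<phi> (indicator {0..s})" using Q s by simp
  qed
  ultimately show "\<phi> \<in> Lbdd \<and> W \<phi> \<in> gaussian_space \<and> (\<forall>s\<in>{0..T}. (\<integral>\<omega>. W \<phi> \<omega> * \<omega> s \<partial>\<Omega>) = inner_H \<mu> \<phi> (indicator {0..s}))"
    using \<phi>L by blast
qed

lemma inner_H_linear_right:
  assumes "\<phi> \<in> L1" "\<psi>1 \<in> Lbdd" "\<psi>2 \<in> Lbdd"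
  shows "inner_H \<mu> \<phi> (\<lambda>s. a * \<psi>1 s + b * \<psi>2 s) = a * inner_H \<mu> \<phi> \<psi>1 + b * inner_H \<mu> \<phi> \<psi>2"
proof -
  have "(\<integral>z. \<phi> (fst z) * (a * \<psi>1 (snd z) + b * \<psi>2 (snd z)) \<partial>M) =
      a * (\<integral>z. \<phi> (fst z) * \<psi>1 (snd z) \<partial>M) + b * (\<integral>z. \<phi> (fst z) * \<psi>2 (snd z) \<partial>M)" if "M \<in> {\<mu>p, \<mu>m}" for M
    using L1_integrable[OF assms(1,2) that] L1_integrable[OF assms(1,3) that]
    by (simp add: distrib_left mult.left_commute)
  then show ?thesis unfolding inner_H_eq by (simp add: algebra_simps)
qed

text \<open>\<open>wiener_integral\<close> speaks of linearity, continuity and values on indicators;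
  the isometry follows by a second monotone class argument, in \<open>\<psi>\<close> with
  \<open>\<phi>\<close> fixed, which starts from the covariances with coordinates in
  \<open>W_bounded\<close>.\<close>

lemma W_bounded_isometry:
  assumes \<phi>: "\<phi> \<in> borel_measurable borel" "\<And>s. \<bar>\<phi> s\<bar> \<le> B"
    and \<psi>: "\<psi> \<in> borel_measurable borel" "\<And>s. \<bar>\<psi> s\<bar> \<le> B"
  shows "cut \<psi> \<in> Lbdd \<and> (\<integral>\<omega>. W (cut \<phi>) \<omega> * W (cut \<psi>) \<omega> \<partial>\<Omega>) = inner_H \<mu> (cut \<phi>) (cut \<psi>)"
proof (rule bounded_borel_class[OF T _ _ _ \<psi>])
  define \<phi>0 where "\<phi>0 = cut \<phi>"
  have \<phi>0: "\<phi>0 \<in> Lbdd" "\<And>s. s \<in> {0..T} \<Longrightarrow> (\<integral>\<omega>. W \<phi>0 \<omega> * \<omega> s \<partial>\<Omega>) = inner_H \<mu> \<phi>0 (indicator {0..s})"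
    using W_bounded[OF \<phi>] unfolding \<phi>0_def by blast+
  have W0: "W \<phi>0 \<in> L2_rv \<Omega>" using \<phi>0(1) Lbdd_L_mu W_L2 by blast
  have \<phi>01: "\<phi>0 \<in> L1" using \<phi>0(1) Lbdd_L1 by blast
  fix t assume t: "t \<in> {0..T}"
  show "indicator {0..t} \<in> Lbdd \<and> (\<integral>\<omega>. W (cut \<phi>) \<omega> * W (indicator {0..t}) \<omega> \<partial>\<Omega>) = inner_H \<mu> (cut \<phi>) (indicator {0..t})"
    using W_ind_cov[OF W0 t] \<phi>0(2)[OF t] ind_Lbdd unfolding \<phi>0_def by simp
next
  have \<phi>0: "cut \<phi> \<in> Lbdd" using W_bounded[OF \<phi>] by blast
  have W0: "W (cut \<phi>) \<in> L2_rv \<Omega>" using \<phi>0 Lbdd_L_mu W_L2 by blast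
  have \<phi>01: "cut \<phi> \<in> L1" using \<phi>0 Lbdd_L1 by blast
  fix \<psi>1 \<psi>2 a b
  assume 1: "\<psi>1 \<in> Lbdd \<and> (\<integral>\<omega>. W (cut \<phi>) \<omega> * W \<psi>1 \<omega> \<partial>\<Omega>) = inner_H \<mu> (cut \<phi>) \<psi>1"
    and 2: "\<psi>2 \<in> Lbdd \<and> (\<integral>\<omega>. W (cut \<phi>) \<omega> * W \<psi>2 \<omega> \<partial>\<Omega>) = inner_H \<mu> (cut \<phi>) \<psi>2"
  let ?c = "\<lambda>s. a * \<psi>1 s + b * \<psi>2 s"
  have L: "?c \<in> Lbdd" using Lbdd_lin 1 2 by blast
  have Lm: "\<psi>1 \<in> L_mu T \<mu>" "\<psi>2 \<in> L_mu T \<mu>" "?c \<in> L_mu T \<mu>" using 1 2 L Lbdd_L_mu by blast+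
  have AE': "AE \<omega> in \<Omega>. W (cut \<phi>) \<omega> * W ?c \<omega> = a * (W (cut \<phi>) \<omega> * W \<psi>1 \<omega>) + b * (W (cut \<phi>) \<omega> * W \<psi>2 \<omega>)"
    using W_lin[OF Lm(1,2), of a b] by eventually_elim (simp add: algebra_simps)
  have "(\<integral>\<omega>. W (cut \<phi>) \<omega> * W ?c \<omega> \<partial>\<Omega>) = (\<integral>\<omega>. a * (W (cut \<phi>) \<omega> * W \<psi>1 \<omega>) + b * (W (cut \<phi>) \<omega> * W \<psi>2 \<omega>) \<partial>\<Omega>)"
    using L2_rv_mult[OF W0 W_L2[OF Lm(3)]] L2_rv_mult[OF W0 W_L2[OF Lm(1)]] L2_rv_mult[OF W0 W_L2[OF Lm(2)]]
    by (intro integral_cong_AE AE') auto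
  also have "\<dots> = a * (\<integral>\<omega>. W (cut \<phi>) \<omega> * W \<psi>1 \<omega> \<partial>\<Omega>) + b * (\<integral>\<omega>. W (cut \<phi>) \<omega> * W \<psi>2 \<omega> \<partial>\<Omega>)"
    using L2_rv_mult[OF W0 W_L2[OF Lm(1)]] L2_rv_mult[OF W0 W_L2[OF Lm(2)]] by simp
  also have "\<dots> = inner_H \<mu> (cut \<phi>) ?c"
    using 1 2 inner_H_linear_right[OF \<phi>01, of \<psi>1 \<psi>2 a b] by simp
  finally show "?c \<in> Lbdd \<and> (\<integral>\<omega>. W (cut \<phi>) \<omega> * W ?c \<omega> \<partial>\<Omega>) = inner_H \<mu> (cut \<phi>) ?c" using L by blast
next
  have \<phi>0: "cut \<phi> \<in> Lbdd" using W_bounded[OF \<phi>] by blast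
  have W0: "W (cut \<phi>) \<in> L2_rv \<Omega>" using \<phi>0 Lbdd_L_mu W_L2 by blast
  fix \<Phi> :: "nat \<Rightarrow> real \<Rightarrow> real" and \<psi> B
  assume Q: "\<And>n. \<Phi> n \<in> Lbdd \<and> (\<integral>\<omega>. W (cut \<phi>) \<omega> * W (\<Phi> n) \<omega> \<partial>\<Omega>) = inner_H \<mu> (cut \<phi>) (\<Phi> n)"
    and B: "\<And>n s. \<bar>\<Phi> n s\<bar> \<le> B" and lim: "\<And>s. (\<lambda>n. \<Phi> n s) \<longlonglongrightarrow> \<psi> s" and m: "\<psi> \<in> borel_measurable borel"
  have \<Phi>L: "\<Phi> n \<in> Lbdd" for n using Q by blast
  have "\<bar>\<psi> s\<bar> \<le> B" for s by (rule LIMSEQ_le_const2[OF tendsto_rabs[OF lim]]) (use B in auto)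
  then have \<psi>L: "\<psi> \<in> Lbdd" unfolding Lbdd_def using measurable_restrict_space1[OF m] by blast
  have Lm: "\<psi> \<in> L_mu T \<mu>" "\<Phi> n \<in> L_mu T \<mu>" for n using \<psi>L \<Phi>L Lbdd_L_mu by blast+
  have c: "(\<lambda>n. \<integral>\<omega>. (W (\<Phi> n) \<omega> - W \<psi> \<omega>)\<^sup>2 \<partial>\<Omega>) \<longlonglongrightarrow> 0"
    by (rule W_lim[OF Lm inner_H_dominated_bounded(2)[OF \<Phi>L \<psi>L \<psi>L B lim]])
  have "(\<integral>\<omega>. W (cut \<phi>) \<omega> * W \<psi> \<omega> \<partial>\<Omega>) = inner_H \<mu> (cut \<phi>) \<psi>"
  proof (rule LIMSEQ_unique)
    have "(\<lambda>n. \<integral>\<omega>. W (\<Phi> n) \<omega> * W (cut \<phi>) \<omega> \<partial>\<Omega>) \<longlonglongrightarrow> (\<integral>\<omega>. W \<psi> \<omega> * W (cut \<phi>) \<omega> \<partial>\<Omega>)"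
      by (rule L2_limit_mult[OF W_L2[OF Lm(1)] W_L2[OF Lm(2)] W0 c])
    then show "(\<lambda>n. \<integral>\<omega>. W (cut \<phi>) \<omega> * W (\<Phi> n) \<omega> \<partial>\<Omega>) \<longlonglongrightarrow> (\<integral>\<omega>. W (cut \<phi>) \<omega> * W \<psi> \<omega> \<partial>\<Omega>)" by (simp only: mult.commute)
    have "(\<lambda>n. inner_H \<mu> (cut \<phi>) (\<Phi> n)) \<longlonglongrightarrow> inner_H \<mu> (cut \<phi>) \<psi>"
      by (rule inner_H_dominated_bounded(3)[OF \<Phi>L \<psi>L \<phi>0 B lim])
    then show "(\<lambda>n. \<integral>\<omega>. W (cut \<phi>) \<omega> * W (\<Phi> n) \<omega> \<partial>\<Omega>) \<longlonglongrightarrow> inner_H \<mu> (cut \<phi>) \<psi>" using Q by simp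
  qed
  then show "\<psi> \<in> Lbdd \<and> (\<integral>\<omega>. W (cut \<phi>) \<omega> * W \<psi> \<omega> \<partial>\<Omega>) = inner_H \<mu> (cut \<phi>) \<psi>" using \<psi>L by blast
qed

lemma L_mu_integrable_square:
  assumes "\<phi> \<in> L_mu T \<mu>" "M \<in> {\<mu>p, \<mu>m}"
  shows "integrable M (\<lambda>z. \<bar>\<phi> (fst z)\<bar> * \<bar>\<phi> (snd z)\<bar>)"
proof -
  have b: "\<phi> \<in> brl" and n: "norm_absH_sq \<mu> \<phi> < \<infinity>" using assms(1) by (auto simp: L_mu_def)
  have "(\<integral>\<^sup>+z. ennreal (\<bar>\<phi> (fst z)\<bar> * \<bar>\<phi> (snd z)\<bar>) \<partial>M) < \<infinity>"
    using n assms(2) unfolding norm_absH_sq_eq by auto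
  then show ?thesis
    using brl_measurable[OF b assms(2)] by (simp add: integrable_iff_bounded abs_mult)
qed

text \<open>The density of the marginal of \<open>\<mu>\<close> is bounded below, so
  \<open>c \<integral> \<psi> \<le> \<langle>\<psi>, 1\<rangle> = E (\<integral>\<psi> dX X\<^sub>T) \<le> \<parallel>\<psi>\<parallel> \<parallel>X\<^sub>T\<parallel>\<close> for the truncations \<open>\<psi>\<close> of \<open>\<bar>\<phi>\<bar>\<close>.\<close>

lemma L_mu_L1: "L_mu T \<mu> \<subseteq> L1"
proof
  fix \<phi> assume \<phi>: "\<phi> \<in> L_mu T \<mu>"
  have brl: "\<phi> \<in> brl" using \<phi> by (auto simp: L_mu_def)
  have cm: "cut \<phi> \<in> borel_measurable borel" using cut_measurable brl by blast
  obtain C c where C: "0 < c"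
    "\<And>h M. h \<in> borel_measurable borel \<Longrightarrow> M \<in> {\<mu>p, \<mu>m} \<Longrightarrow>
      (\<integral>\<^sup>+z. h (fst z) \<partial>M) \<le> ennreal C * (\<integral>\<^sup>+x. h x * indicator {0..T} x \<partial>lborel)"
    "\<And>h M. h \<in> borel_measurable borel \<Longrightarrow> M \<in> {\<mu>p, \<mu>m} \<Longrightarrow>
      (\<integral>\<^sup>+z. h (snd z) \<partial>M) \<le> ennreal C * (\<integral>\<^sup>+x. h x * indicator {0..T} x \<partial>lborel)"
    "\<And>h. h \<in> borel_measurable borel \<Longrightarrow>
      (\<integral>\<^sup>+z. h (fst z) \<partial>\<mu>m) + ennreal c * (\<integral>\<^sup>+x. h x * indicator {0..T} x \<partial>lborel) \<le> (\<integral>\<^sup>+z. h (fst z) \<partial>\<mu>p)"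
    by (rule nn_marginals) (assumption | rule that)+
  define N where "N = (\<integral>z. \<bar>\<phi> (fst z)\<bar> * \<bar>\<phi> (snd z)\<bar> \<partial>\<mu>p)"
  define V where "V = (\<integral>\<omega>. (\<omega> T)\<^sup>2 \<partial>\<Omega>)"
  \<comment> \<open>Truncation makes the isometry for bounded functions applicable; the absolute
    value keeps every integral nonnegative.\<close>
  define \<psi> where "\<psi> n s = min \<bar>cut \<phi> s\<bar> (real n)" for n s
  have \<psi>m: "\<psi> n \<in> borel_measurable borel" for n unfolding \<psi>_def[abs_def] using cm by (intro borel_measurable_min borel_measurable_abs) auto
  have \<psi>0: "0 \<le> \<psi> n s" "\<psi> n s \<le> \<bar>cut \<phi> s\<bar>" "\<bar>\<psi> n s\<bar> \<le> real n" for n s by (auto simp: \<psi>_def)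
  have \<psi>cut: "cut (\<psi> n) = \<psi> n" for n by (auto simp: \<psi>_def indicator_def)
  have \<psi>L: "\<psi> n \<in> Lbdd" for n using W_bounded[OF \<psi>m \<psi>0(3)] \<psi>cut by simp
  have TT: "T \<in> {0..T}" using T by simp
  have XT: "(\<lambda>\<omega>. \<omega> T) \<in> L2_rv \<Omega>" by (rule gspan_Omega(1)[OF coord_gspan[OF TT]])
  have pm: "\<mu>p \<in> {\<mu>p, \<mu>m}" "\<mu>m \<in> {\<mu>p, \<mu>m}" by auto
  have r: "fst z \<in> {0..T}" "snd z \<in> {0..T}" if "z \<in> space M" "M \<in> {\<mu>p, \<mu>m}" for z M using that space_mu by auto
  have bound: "ennreal c * (\<integral>\<^sup>+x. ennreal (\<psi> n x) \<partial>lborel) \<le> ennreal (sqrt (N * V))" for n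
  proof -
    have i1: "integrable M (\<lambda>z. \<psi> n (fst z))" if "M \<in> {\<mu>p, \<mu>m}" for M
      using L1_integrable[OF _ const_Lbdd that, of "\<psi> n" 1] \<psi>L Lbdd_L1 by auto
    have nn: "(\<integral>\<^sup>+z. ennreal (\<psi> n (fst z)) \<partial>M) = ennreal (\<integral>z. \<psi> n (fst z) \<partial>M)" if "M \<in> {\<mu>p, \<mu>m}" for M
      using \<psi>0 i1[OF that] by (intro nn_integral_eq_integral) auto
    have iH: "inner_H \<mu> (\<psi> n) (indicator {0..T}) = (\<integral>z. \<psi> n (fst z) \<partial>\<mu>p) - (\<integral>z. \<psi> n (fst z) \<partial>\<mu>m)"
    proof -
      have "(\<integral>z. \<psi> n (fst z) * indicator {0..T} (snd z) \<partial>M) = (\<integral>z. \<psi> n (fst z) \<partial>M)" if "M \<in> {\<mu>p, \<mu>m}" for M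
        by (rule Bochner_Integration.integral_cong[OF refl]) (use r(2)[OF _ that] in simp)
      then show ?thesis unfolding inner_H_eq by simp
    qed
    have "(\<integral>\<^sup>+z. ennreal (\<psi> n (fst z)) \<partial>\<mu>m) + ennreal c * (\<integral>\<^sup>+x. ennreal (\<psi> n x) * indicator {0..T} x \<partial>lborel) \<le> (\<integral>\<^sup>+z. ennreal (\<psi> n (fst z)) \<partial>\<mu>p)"
      by (rule C(4)) (use \<psi>m in simp)
    moreover have "(\<integral>\<^sup>+x. ennreal (\<psi> n x) * indicator {0..T} x \<partial>lborel) = (\<integral>\<^sup>+x. ennreal (\<psi> n x) \<partial>lborel)"
      by (rule nn_integral_cong) (auto simp: \<psi>_def indicator_def)
    moreover have "integrable lborel (\<psi> n)" using \<psi>L[of n] Lbdd_L1 \<psi>cut[of n] by (auto simp: L1_def)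
    then have e: "(\<integral>\<^sup>+x. ennreal (\<psi> n x) \<partial>lborel) = ennreal (\<integral>x. \<psi> n x \<partial>lborel)"
      by (rule nn_integral_eq_integral) (use \<psi>0 in auto)
    moreover have I0: "0 \<le> (\<integral>x. \<psi> n x \<partial>lborel)" "0 \<le> (\<integral>z. \<psi> n (fst z) \<partial>\<mu>m)" "0 \<le> (\<integral>z. \<psi> n (fst z) \<partial>\<mu>p)"
      using \<psi>0 by (auto intro!: Bochner_Integration.integral_nonneg)
    ultimately have "ennreal (\<integral>z. \<psi> n (fst z) \<partial>\<mu>m) + ennreal (c * (\<integral>x. \<psi> n x \<partial>lborel)) \<le> ennreal (\<integral>z. \<psi> n (fst z) \<partial>\<mu>p)"
      using C(1) by (simp add: nn[OF pm(1)] nn[OF pm(2)] ennreal_mult)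
    moreover have "0 \<le> c * (\<integral>x. \<psi> n x \<partial>lborel)" using I0 C(1) by simp
    ultimately have "(\<integral>z. \<psi> n (fst z) \<partial>\<mu>m) + c * (\<integral>x. \<psi> n x \<partial>lborel) \<le> (\<integral>z. \<psi> n (fst z) \<partial>\<mu>p)"
      using I0 by (simp only: ennreal_plus[symmetric] ennreal_le_iff)
    then have le: "c * (\<integral>x. \<psi> n x \<partial>lborel) \<le> inner_H \<mu> (\<psi> n) (indicator {0..T})"
      unfolding iH by linarith
    have W\<psi>: "W (\<psi> n) \<in> L2_rv \<Omega>" using \<psi>L Lbdd_L_mu W_L2 by blast
    have "inner_H \<mu> (\<psi> n) (indicator {0..T}) = (\<integral>\<omega>. W (\<psi> n) \<omega> * \<omega> T \<partial>\<Omega>)"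
      using W_bounded[OF \<psi>m \<psi>0(3), of n] TT \<psi>cut[of n] by simp
    also have "\<dots> \<le> sqrt ((\<integral>\<omega>. (W (\<psi> n) \<omega>)\<^sup>2 \<partial>\<Omega>) * V)"
      unfolding V_def by (rule real_le_rsqrt[OF L2_Cauchy_Schwarz[OF W\<psi> XT]])
    also have "\<dots> \<le> sqrt (N * V)"
    proof (intro real_sqrt_le_mono mult_right_mono)
      have "(\<integral>\<omega>. (W (\<psi> n) \<omega>)\<^sup>2 \<partial>\<Omega>) = inner_H \<mu> (\<psi> n) (\<psi> n)"
        using W_bounded_isometry[OF \<psi>m \<psi>0(3) \<psi>m \<psi>0(3), of n] \<psi>cut[of n] by (simp add: power2_eq_square)
      \<comment> \<open>Dropping the part with \<open>\<mu>m\<close> enlarges the value since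
        \<open>\<psi> n\<close> is nonnegative; this is why \<open>N\<close> involves
        \<open>\<mu>p\<close> only.\<close>
      also have "\<dots> \<le> (\<integral>z. \<psi> n (fst z) * \<psi> n (snd z) \<partial>\<mu>p)"
        unfolding inner_H_eq using \<psi>0 by (simp add: Bochner_Integration.integral_nonneg)
      also have "\<dots> \<le> N" unfolding N_def
      proof (rule integral_mono)
        show "integrable \<mu>p (\<lambda>z. \<psi> n (fst z) * \<psi> n (snd z))"
          using L1_integrable[OF _ \<psi>L pm(1)] \<psi>L Lbdd_L1 by blast
        show "integrable \<mu>p (\<lambda>z. \<bar>\<phi> (fst z)\<bar> * \<bar>\<phi> (snd z)\<bar>)" by (rule L_mu_integrable_square[OF \<phi> pm(1)])
        fix z assume "z \<in> space \<mu>p"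
        then show "\<psi> n (fst z) * \<psi> n (snd z) \<le> \<bar>\<phi> (fst z)\<bar> * \<bar>\<phi> (snd z)\<bar>"
          using \<psi>0(1,2)[of n "fst z"] \<psi>0(1,2)[of n "snd z"] r[of z \<mu>p] by (intro mult_mono) simp_all
      qed
      finally show "(\<integral>\<omega>. (W (\<psi> n) \<omega>)\<^sup>2 \<partial>\<Omega>) \<le> N" .
      show "0 \<le> V" by (simp add: V_def)
    qed
    finally have "c * (\<integral>x. \<psi> n x \<partial>lborel) \<le> sqrt (N * V)" using le by simp
    then show ?thesis unfolding e using C(1) I0 by (simp add: ennreal_mult[symmetric] ennreal_leI)
  qed
  \<comment> \<open>The bound \<open>sqrt (N * V)\<close> does not depend on \<open>n\<close>, so
    monotone convergence removes the truncation.\<close>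
  have lim: "(\<lambda>n. \<integral>\<^sup>+x. ennreal (\<psi> n x) \<partial>lborel) \<longlonglongrightarrow> (\<integral>\<^sup>+x. ennreal \<bar>cut \<phi> x\<bar> \<partial>lborel)"
  proof (rule nn_integral_LIMSEQ)
    show "incseq (\<lambda>n x. ennreal (\<psi> n x))"
      unfolding incseq_def le_fun_def \<psi>_def by (intro allI impI ennreal_leI min.mono) auto
    show "(\<lambda>n. ennreal (\<psi> n x)) \<longlonglongrightarrow> ennreal \<bar>cut \<phi> x\<bar>" for x
    proof -
      obtain m where "\<bar>cut \<phi> x\<bar> \<le> real m" using real_arch_simple by blast
      then have "\<forall>\<^sub>F n in sequentially. ennreal (\<psi> n x) = ennreal \<bar>cut \<phi> x\<bar>"
        by (intro eventually_sequentiallyI[of m]) (simp add: \<psi>_def)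
      then show ?thesis by (rule tendsto_eventually)
    qed
    show "(\<lambda>x. ennreal (\<psi> n x)) \<in> borel_measurable lborel" for n using \<psi>m by simp
  qed
  have "(\<lambda>n. ennreal c * (\<integral>\<^sup>+x. ennreal (\<psi> n x) \<partial>lborel)) \<longlonglongrightarrow> ennreal c * (\<integral>\<^sup>+x. ennreal \<bar>cut \<phi> x\<bar> \<partial>lborel)"
    by (rule ennreal_tendsto_cmult[OF _ lim]) simp
  then have "ennreal c * (\<integral>\<^sup>+x. ennreal \<bar>cut \<phi> x\<bar> \<partial>lborel) \<le> ennreal (sqrt (N * V))"
    by (rule LIMSEQ_le_const2) (use bound in auto)
  then have "ennreal c * (\<integral>\<^sup>+x. ennreal \<bar>cut \<phi> x\<bar> \<partial>lborel) < \<infinity>" by (rule order.strict_trans1) simp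
  then have "(\<integral>\<^sup>+x. ennreal \<bar>cut \<phi> x\<bar> \<partial>lborel) < \<infinity>"
    using C(1) by (auto simp: ennreal_mult_less_top)
  then have "integrable lborel (cut \<phi>)" using cm unfolding integrable_iff_bounded by simp
  then show "\<phi> \<in> L1" using brl by (simp add: L1_def)
qed

text \<open>Truncations converge to \<open>\<phi>\<close> in the seminorm because
  \<open>\<bar>\<phi>\<bar> \<otimes> \<bar>\<phi>\<bar>\<close> is integrable for the total
  variation, by definition of \<open>L_mu\<close>. The pairing with an indicator has the majorant
  \<open>\<bar>\<phi>\<bar> \<otimes> 1\<close> instead, whose integrability rests on
  \<open>L_mu_L1\<close>.\<close>

lemma W_facts:
  assumes \<phi>: "\<phi> \<in> L_mu T \<mu>"
  shows "W \<phi> \<in> gaussian_space"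
    "s \<in> {0..T} \<Longrightarrow> (\<integral>\<omega>. W \<phi> \<omega> * \<omega> s \<partial>\<Omega>) = inner_H \<mu> \<phi> (indicator {0..s})"
proof -
  have brl: "\<phi> \<in> brl" using \<phi> by (auto simp: L_mu_def)
  have cm: "cut \<phi> \<in> borel_measurable borel" using cut_measurable brl by blast
  have \<phi>1: "\<phi> \<in> L1" using \<phi> L_mu_L1 by blast
  define \<Phi> where "\<Phi> n = (\<lambda>s. max (- real n) (min (real n) (cut \<phi> s)))" for n
  have \<Phi>m: "\<Phi> n \<in> borel_measurable borel" for n unfolding \<Phi>_def using cm by (intro borel_measurable_max borel_measurable_min) auto
  have \<Phi>b: "\<bar>\<Phi> n s\<bar> \<le> real n" for n s by (auto simp: \<Phi>_def)
  have \<Phi>c: "cut (\<Phi> n) = \<Phi> n" for n by (auto simp: \<Phi>_def indicator_def)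
  have Wn: "\<Phi> n \<in> Lbdd" "W (\<Phi> n) \<in> gaussian_space"
    "s \<in> {0..T} \<Longrightarrow> (\<integral>\<omega>. W (\<Phi> n) \<omega> * \<omega> s \<partial>\<Omega>) = inner_H \<mu> (\<Phi> n) (indicator {0..s})" for n s
    using W_bounded[OF \<Phi>m \<Phi>b, of n] unfolding \<Phi>c by blast+
  have b1: "\<bar>\<Phi> n s\<bar> \<le> \<bar>\<phi> s\<bar>" "\<bar>\<Phi> n s - \<phi> s\<bar> \<le> \<bar>\<phi> s\<bar>" if "s \<in> {0..T}" for n s
    using that by (auto simp: \<Phi>_def)
  have lim: "(\<lambda>n. \<Phi> n s) \<longlonglongrightarrow> \<phi> s" if "s \<in> {0..T}" for s
  proof -
    obtain m where "\<bar>\<phi> s\<bar> \<le> real m" using real_arch_simple by blast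
    then have "\<forall>\<^sub>F n in sequentially. \<Phi> n s = \<phi> s"
      using that by (intro eventually_sequentiallyI[of m]) (simp add: \<Phi>_def)
    then show ?thesis by (rule tendsto_eventually)
  qed
  have Lm: "\<Phi> n \<in> L_mu T \<mu>" for n using Wn(1) Lbdd_L_mu by blast
  have \<Phi>brl: "\<Phi> n \<in> brl" for n using Wn(1)[of n] by (auto simp: Lbdd_def)
  have "(\<lambda>n. inner_H \<mu> (\<lambda>s. \<Phi> n s - \<phi> s) (\<lambda>s. \<Phi> n s - \<phi> s)) \<longlonglongrightarrow> inner_H \<mu> (\<lambda>_. 0) (\<lambda>_. 0)"
  proof (rule inner_H_dominated[where a = "\<lambda>s. \<bar>\<phi> s\<bar>" and b = "\<lambda>s. \<bar>\<phi> s\<bar>"])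
    show "(\<lambda>s. \<Phi> n s - \<phi> s) \<in> brl" "(\<lambda>s. \<Phi> n s - \<phi> s) \<in> brl" for n using \<Phi>brl[of n] brl by auto
    show "(\<lambda>n. \<Phi> n s - \<phi> s) \<longlonglongrightarrow> 0" "(\<lambda>n. \<Phi> n s - \<phi> s) \<longlonglongrightarrow> 0" if "s \<in> {0..T}" for s
      using tendsto_diff[OF lim[OF that] tendsto_const, of "\<phi> s"] by simp_all
  qed (use b1 L_mu_integrable_square[OF \<phi>] in auto)
  then have "(\<lambda>n. inner_H \<mu> (\<lambda>s. \<Phi> n s - \<phi> s) (\<lambda>s. \<Phi> n s - \<phi> s)) \<longlonglongrightarrow> 0" by (simp add: inner_H_eq)
  then have c: "(\<lambda>n. \<integral>\<omega>. (W (\<Phi> n) \<omega> - W \<phi> \<omega>)\<^sup>2 \<partial>\<Omega>) \<longlonglongrightarrow> 0" by (rule W_lim[OF \<phi> Lm])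
  show "W \<phi> \<in> gaussian_space"
    by (rule gaussian_space_closed[OF Wn(2) W_L2[OF \<phi>] c])
  assume s: "s \<in> {0..T}"
  show "(\<integral>\<omega>. W \<phi> \<omega> * \<omega> s \<partial>\<Omega>) = inner_H \<mu> \<phi> (indicator {0..s})"
  proof (rule LIMSEQ_unique)
    show "(\<lambda>n. \<integral>\<omega>. W (\<Phi> n) \<omega> * \<omega> s \<partial>\<Omega>) \<longlonglongrightarrow> (\<integral>\<omega>. W \<phi> \<omega> * \<omega> s \<partial>\<Omega>)"
      by (rule L2_limit_mult[OF W_L2[OF \<phi>] W_L2[OF Lm] gspan_Omega(1)[OF coord_gspan[OF s]] c])
    have "(\<lambda>n. inner_H \<mu> (\<Phi> n) (indicator {0..s})) \<longlonglongrightarrow> inner_H \<mu> \<phi> (indicator {0..s})"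
    proof (rule inner_H_dominated[where a = "\<lambda>s. \<bar>\<phi> s\<bar>" and b = "\<lambda>_. 1"])
      show "indicator {0..s} \<in> brl" "indicator {0..s} \<in> brl" using ind_Lbdd[of s] by (auto simp: Lbdd_def)
      have "(\<lambda>s. \<bar>\<phi> s\<bar>) \<in> L1"
      proof -
        have "cut (\<lambda>s. \<bar>\<phi> s\<bar>) = (\<lambda>s. \<bar>cut \<phi> s\<bar>)" by (auto simp: indicator_def)
        then show ?thesis using \<phi>1 by (auto simp: L1_def)
      qed
      then show "integrable M (\<lambda>z. \<bar>\<phi> (fst z)\<bar> * 1)" if "M \<in> {\<mu>p, \<mu>m}" for M
        by (rule L1_integrable[OF _ const_Lbdd that])
      show "\<bar>indicator {0..s} r :: real\<bar> \<le> 1" for r by (simp add: indicator_def)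
    qed (use \<Phi>brl brl lim b1 in auto)
    then show "(\<lambda>n. \<integral>\<omega>. W (\<Phi> n) \<omega> * \<omega> s \<partial>\<Omega>) \<longlonglongrightarrow> inner_H \<mu> \<phi> (indicator {0..s})" using Wn(3)[OF s] by simp
  qed
qed

end

section \<open>The weak Ito formula\<close>

context bifbm_setting
begin

abbreviation "p \<equiv> 2 * H * K"

lemma p_ge_1: "1 \<le> p" using HK by simp

text \<open>The factor \<open>2 powr (- K)\<close> of the covariance cancels the one from
  \<open>(2 * s powr (2 * H)) powr K\<close>.\<close>

lemma variance_power: "0 \<le> s \<Longrightarrow> bifbm_cov H K s s = s powr p"
  using K by (simp add: bifbm_cov_def powr_mult powr_powr powr_minus field_simps mult_2[symmetric])

lemma coord_square: "s \<in> {0..T} \<Longrightarrow> (\<integral>\<omega>. (\<omega> s)\<^sup>2 \<partial>\<Omega>) = s powr p"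
  using coord_cov[of s s] variance_power[of s] by (simp add: power2_eq_square)

lemma coord_L2: "s \<in> {0..T} \<Longrightarrow> (\<lambda>\<omega>. \<omega> s) \<in> L2_rv \<Omega>"
  by (rule gspan_Omega(1)[OF coord_gspan])

lemma coord_0: "\<omega> \<in> space \<Omega> \<Longrightarrow> \<omega> 0 = 0"
  by (simp add: space_P C0_paths_def)

text \<open>Joint measurability and Fubini are stated over the whole time axis, on which paths are
  not specified; clamping makes \<open>\<omega> (clamp s)\<close> a continuous function of every
  real \<open>s\<close> for each path \<open>\<omega>\<close>.\<close>

definition clamp :: "real \<Rightarrow> real" where "clamp s = max 0 (min T s)"

lemma clamp_range: "clamp s \<in> {0..T}" using T by (auto simp: clamp_def)

lemma clamp_id: "s \<in> {0..T} \<Longrightarrow> clamp s = s" by (auto simp: clamp_def)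

text \<open>Only single coordinates are known to be measurable. Freezing the path at the grid points
  \<open>floor ((n + 1) s) / (n + 1)\<close> leaves countably many of them, and continuity of the
  paths gives convergence to the process.\<close>

lemma coord_joint_measurable: "(\<lambda>z. snd z (clamp (fst z))) \<in> borel_measurable (borel \<Otimes>\<^sub>M \<Omega>)"
proof (rule borel_measurable_LIMSEQ_real)
  define g where "g n z = snd z (clamp (real_of_int \<lfloor>real (Suc n) * fst z\<rfloor> / real (Suc n)))" for n :: nat and z :: "real \<times> (real \<Rightarrow> real)"
  show "g n \<in> borel_measurable (borel \<Otimes>\<^sub>M \<Omega>)" for n
    unfolding g_def
  proof (rule measurable_compose_countable[where f = "\<lambda>i z. snd z (clamp (real_of_int i / real (Suc n)))"])
    show "(\<lambda>z. snd z (clamp (real_of_int i / real (Suc n)))) \<in> borel_measurable (borel \<Otimes>\<^sub>M \<Omega>)" for i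
      by (rule measurable_compose[OF measurable_snd coord_measurable[OF clamp_range]])
    show "(\<lambda>z. \<lfloor>real (Suc n) * fst z\<rfloor>) \<in> borel \<Otimes>\<^sub>M \<Omega> \<rightarrow>\<^sub>M count_space UNIV"
      by measurable
  qed
  fix z :: "real \<times> (real \<Rightarrow> real)" assume z: "z \<in> space (borel \<Otimes>\<^sub>M \<Omega>)"
  then have "snd z \<in> C0_paths T" by (auto simp: space_pair_measure space_P)
  then have cont: "continuous_on {0..T} (snd z)" by (simp add: C0_paths_def)
  have a: "(\<lambda>n. real_of_int \<lfloor>real (Suc n) * fst z\<rfloor> / real (Suc n)) \<longlonglongrightarrow> fst z"
  proof (rule LIM_zero_cancel, rule Lim_null_comparison)
    show "\<forall>\<^sub>F n in sequentially. norm (real_of_int \<lfloor>real (Suc n) * fst z\<rfloor> / real (Suc n) - fst z) \<le> 1 / real (Suc n)"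
    proof (rule always_eventually, rule allI)
      fix n
      have "\<bar>real_of_int \<lfloor>real (Suc n) * fst z\<rfloor> - real (Suc n) * fst z\<bar> \<le> 1" by linarith
      then have "\<bar>real_of_int \<lfloor>real (Suc n) * fst z\<rfloor> - real (Suc n) * fst z\<bar> / real (Suc n) \<le> 1 / real (Suc n)"
        by (intro divide_right_mono) auto
      moreover have "real_of_int \<lfloor>real (Suc n) * fst z\<rfloor> / real (Suc n) - fst z =
          (real_of_int \<lfloor>real (Suc n) * fst z\<rfloor> - real (Suc n) * fst z) / real (Suc n)"
        by (simp add: diff_divide_distrib del: of_nat_Suc)
      ultimately show "norm (real_of_int \<lfloor>real (Suc n) * fst z\<rfloor> / real (Suc n) - fst z) \<le> 1 / real (Suc n)"
        by (simp only: real_norm_def abs_divide abs_of_nat)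
    qed
  qed (rule LIMSEQ_Suc[OF lim_1_over_n])
  have "(\<lambda>n. clamp (real_of_int \<lfloor>real (Suc n) * fst z\<rfloor> / real (Suc n))) \<longlonglongrightarrow> clamp (fst z)"
    unfolding clamp_def by (intro tendsto_max tendsto_min tendsto_const a)
  then show "(\<lambda>n. g n z) \<longlonglongrightarrow> snd z (clamp (fst z))"
    unfolding g_def by (rule continuous_on_tendsto_compose[OF cont]) (use clamp_range in auto)
qed

text \<open>\<open>F1\<close> plays the role of the derivative of the test variable \<open>F\<close>, i.e. \<open>DF = F1 \<phi>\<close>, where \<open>\<kappa>\<close>
  is the Lebesgue density of \<open>\<langle>\<phi>, \<cdot>\<rangle>\<close>.\<close>

definition ito_defect ::
  "((real \<Rightarrow> real) \<Rightarrow> real) \<Rightarrow> ((real \<Rightarrow> real) \<Rightarrow> real) \<Rightarrow> (real \<Rightarrow> real) \<Rightarrow> real \<Rightarrow>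
   (real \<Rightarrow> real) \<Rightarrow> (real \<Rightarrow> real) \<Rightarrow> (real \<Rightarrow> real) \<Rightarrow> real" where
  "ito_defect F F1 \<kappa> t f f1 f2 = (\<integral>\<omega>. F \<omega> * (f (\<omega> t) - f 0) \<partial>\<Omega>)
     - H * K * (\<integral>s. indicator {0..t} s * ((\<integral>\<omega>. F \<omega> * f2 (\<omega> (clamp s)) \<partial>\<Omega>) * s powr (p - 1)) \<partial>lborel)
     - (\<integral>s. indicator {0..t} s * ((\<integral>\<omega>. F1 \<omega> * f1 (\<omega> (clamp s)) \<partial>\<Omega>) * \<kappa> s) \<partial>lborel)"

text \<open>One constant for all three functions lets dominated convergence run along a sequence.
  The functions are not tied by differentiation, so linear combinations and limits of triples can be
  taken freely.\<close>

definition quad_growth :: "real \<Rightarrow> (real \<Rightarrow> real) \<Rightarrow> (real \<Rightarrow> real) \<Rightarrow> (real \<Rightarrow> real) \<Rightarrow> bool" where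
  "quad_growth C f f1 f2 \<longleftrightarrow> f \<in> borel_measurable borel \<and> f1 \<in> borel_measurable borel \<and> f2 \<in> borel_measurable borel \<and>
     (\<forall>x. \<bar>f x\<bar> \<le> C * (1 + x\<^sup>2) \<and> \<bar>f1 x\<bar> \<le> C * (1 + \<bar>x\<bar>) \<and> \<bar>f2 x\<bar> \<le> C)"

lemma quad_growthD:
  assumes "quad_growth C f f1 f2"
  shows "f \<in> borel_measurable borel" "f1 \<in> borel_measurable borel" "f2 \<in> borel_measurable borel"
    "\<bar>f x\<bar> \<le> C * (1 + x\<^sup>2)" "\<bar>f1 x\<bar> \<le> C * (1 + \<bar>x\<bar>)" "\<bar>f2 x\<bar> \<le> C" "0 \<le> C"
proof -
  show "f \<in> borel_measurable borel" "f1 \<in> borel_measurable borel" "f2 \<in> borel_measurable borel"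
    "\<bar>f x\<bar> \<le> C * (1 + x\<^sup>2)" "\<bar>f1 x\<bar> \<le> C * (1 + \<bar>x\<bar>)" "\<bar>f2 x\<bar> \<le> C"
    using assms unfolding quad_growth_def by blast+
  have "\<bar>f2 0\<bar> \<le> C" using assms unfolding quad_growth_def by blast
  then show "0 \<le> C" by linarith
qed

lemma abs_le_one_square: "\<bar>x\<bar> \<le> 1 + (x::real)\<^sup>2"
proof -
  have "0 \<le> (\<bar>x\<bar> - 1)\<^sup>2" by simp
  then have "2 * \<bar>x\<bar> \<le> 1 + x\<^sup>2" by (simp add: power2_diff)
  then show ?thesis by linarith
qed

lemma expectation_abs_coord: "s \<in> {0..T} \<Longrightarrow> (\<integral>\<omega>. \<bar>\<omega> s\<bar> \<partial>\<Omega>) \<le> 1 + T powr p"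
proof -
  assume s: "s \<in> {0..T}"
  have "(\<integral>\<omega>. \<bar>\<omega> s\<bar> \<partial>\<Omega>) \<le> (\<integral>\<omega>. 1 + (\<omega> s)\<^sup>2 \<partial>\<Omega>)"
    using coord_L2[OF s] \<Omega>.L2_rv_integrable[OF coord_L2[OF s]] abs_le_one_square
    by (intro integral_mono) (auto simp: L2_rv_def)
  also have "\<dots> = 1 + s powr p"
    using coord_L2[OF s] coord_square[OF s] by (simp add: L2_rv_def \<Omega>.prob_space P.prob_space)
  also have "\<dots> \<le> 1 + T powr p" using s p_ge_1 by (simp add: powr_mono2)
  finally show ?thesis .
qed

context
  fixes F F1 :: "(real \<Rightarrow> real) \<Rightarrow> real" and \<kappa> :: "real \<Rightarrow> real" and t :: real
  assumes F: "F \<in> borel_measurable \<Omega>" "\<And>\<omega>. \<bar>F \<omega>\<bar> \<le> 1"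
    and F1: "F1 \<in> borel_measurable \<Omega>" "\<And>\<omega>. \<bar>F1 \<omega>\<bar> \<le> 1"
    and \<kappa>: "integrable lborel \<kappa>" and t: "t \<in> {0..T}"
begin

text \<open>The weight \<open>V\<close> is separate from \<open>F\<close> and \<open>F1\<close>, so
  that both of them, and later absolute values of weights, can be inserted.\<close>

lemma test_integrable:
  assumes "V \<in> borel_measurable \<Omega>" "\<And>\<omega>. \<bar>V \<omega>\<bar> \<le> 1" "quad_growth C f f1 f2" "s \<in> {0..T}"
  shows "integrable \<Omega> (\<lambda>\<omega>. V \<omega> * f (\<omega> s))" "integrable \<Omega> (\<lambda>\<omega>. V \<omega> * f1 (\<omega> s))" "integrable \<Omega> (\<lambda>\<omega>. V \<omega> * f2 (\<omega> s))"
    "\<bar>\<integral>\<omega>. V \<omega> * f1 (\<omega> s) \<partial>\<Omega>\<bar> \<le> C * (2 + T powr p)" "\<bar>\<integral>\<omega>. V \<omega> * f2 (\<omega> s) \<partial>\<Omega>\<bar> \<le> C"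
proof -
  note g = quad_growthD[OF assms(3)]
  have X: "(\<lambda>\<omega>. \<omega> s) \<in> borel_measurable \<Omega>" by (rule coord_measurable[OF assms(4)])
  have m: "(\<lambda>\<omega>. V \<omega> * h (\<omega> s)) \<in> borel_measurable \<Omega>" if "h \<in> borel_measurable borel" for h
    by (intro borel_measurable_times assms(1) measurable_compose[OF X that])
  have b: "\<bar>V \<omega> * y\<bar> \<le> \<bar>z\<bar>" if "\<bar>y\<bar> \<le> z" for \<omega> y z
  proof -
    have "\<bar>V \<omega> * y\<bar> \<le> 1 * z" unfolding abs_mult using assms(2)[of \<omega>] that by (intro mult_mono) auto
    then show ?thesis by simp
  qed
  have i0: "integrable \<Omega> (\<lambda>\<omega>. C * (1 + (\<omega> s)\<^sup>2))" using coord_L2[OF assms(4)] by (simp add: L2_rv_def)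
  have i1: "integrable \<Omega> (\<lambda>\<omega>. C * (1 + \<bar>\<omega> s\<bar>))" using \<Omega>.L2_rv_integrable[OF coord_L2[OF assms(4)]] by simp
  show "integrable \<Omega> (\<lambda>\<omega>. V \<omega> * f (\<omega> s))"
    by (rule Bochner_Integration.integrable_bound[OF i0 m[OF g(1)]]) (use b[OF g(4)] in simp)
  show I1: "integrable \<Omega> (\<lambda>\<omega>. V \<omega> * f1 (\<omega> s))"
    by (rule Bochner_Integration.integrable_bound[OF i1 m[OF g(2)]]) (use b[OF g(5)] in simp)
  show I2: "integrable \<Omega> (\<lambda>\<omega>. V \<omega> * f2 (\<omega> s))"
    by (rule \<Omega>.integrable_const_bound[where B = "\<bar>C\<bar>"]) (use b[OF g(6)] m[OF g(3)] in simp_all)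
  have "\<bar>\<integral>\<omega>. V \<omega> * f1 (\<omega> s) \<partial>\<Omega>\<bar> \<le> (\<integral>\<omega>. \<bar>V \<omega> * f1 (\<omega> s)\<bar> \<partial>\<Omega>)" by (rule integral_abs_bound)
  also have "\<dots> \<le> (\<integral>\<omega>. C * (1 + \<bar>\<omega> s\<bar>) \<partial>\<Omega>)"
    using b[OF g(5)] g(7) I1 i1 by (intro integral_mono) auto
  also have "\<dots> = C * (1 + (\<integral>\<omega>. \<bar>\<omega> s\<bar> \<partial>\<Omega>))"
    using \<Omega>.L2_rv_integrable[OF coord_L2[OF assms(4)]] by (simp add: \<Omega>.prob_space P.prob_space)
  also have "\<dots> \<le> C * (2 + T powr p)" using expectation_abs_coord[OF assms(4)] g(7) by (intro mult_left_mono) auto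
  finally show "\<bar>\<integral>\<omega>. V \<omega> * f1 (\<omega> s) \<partial>\<Omega>\<bar> \<le> C * (2 + T powr p)" .
  have "\<bar>\<integral>\<omega>. V \<omega> * f2 (\<omega> s) \<partial>\<Omega>\<bar> \<le> (\<integral>\<omega>. \<bar>V \<omega> * f2 (\<omega> s)\<bar> \<partial>\<Omega>)" by (rule integral_abs_bound)
  also have "\<dots> \<le> (\<integral>\<omega>. C \<partial>\<Omega>)"
    using b[OF g(6)] g(7) I2 by (intro integral_mono) auto
  finally show "\<bar>\<integral>\<omega>. V \<omega> * f2 (\<omega> s) \<partial>\<Omega>\<bar> \<le> C" by (simp add: \<Omega>.prob_space P.prob_space)
qed

lemma test_measurable:
  fixes V :: "(real \<Rightarrow> real) \<Rightarrow> real" and h :: "real \<Rightarrow> real"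
  assumes "V \<in> borel_measurable \<Omega>" "h \<in> borel_measurable borel"
  shows "(\<lambda>s. \<integral>\<omega>. V \<omega> * h (\<omega> (clamp s)) \<partial>\<Omega>) \<in> borel_measurable borel"
proof (rule \<Omega>.borel_measurable_lebesgue_integral[where f = "\<lambda>s \<omega>. V \<omega> * h (\<omega> (clamp s))"])
  show "(\<lambda>(s, \<omega>). V \<omega> * h (\<omega> (clamp s))) \<in> borel_measurable (borel \<Otimes>\<^sub>M \<Omega>)"
    unfolding case_prod_beta'
    by (intro borel_measurable_times measurable_compose[OF measurable_snd assms(1)]
        measurable_compose[OF coord_joint_measurable assms(2)])
qed

lemma time_integrands:
  assumes "quad_growth C f f1 f2"
  shows "\<bar>indicator {0..t} s * ((\<integral>\<omega>. F \<omega> * f2 (\<omega> (clamp s)) \<partial>\<Omega>) * s powr (p - 1))\<bar> \<le> C * T powr (p - 1) * indicator {0..t} s" (is ?a)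
    and "\<bar>indicator {0..t} s * ((\<integral>\<omega>. F1 \<omega> * f1 (\<omega> (clamp s)) \<partial>\<Omega>) * \<kappa> s)\<bar> \<le> C * (2 + T powr p) * \<bar>\<kappa> s\<bar>" (is ?b)
    and "(\<lambda>s. indicator {0..t} s * ((\<integral>\<omega>. F \<omega> * f2 (\<omega> (clamp s)) \<partial>\<Omega>) * s powr (p - 1))) \<in> borel_measurable lborel" (is ?c)
    and "(\<lambda>s. indicator {0..t} s * ((\<integral>\<omega>. F1 \<omega> * f1 (\<omega> (clamp s)) \<partial>\<Omega>) * \<kappa> s)) \<in> borel_measurable lborel" (is ?d)
proof -
  note g = quad_growthD[OF assms]
  have e2: "\<bar>\<integral>\<omega>. F \<omega> * f2 (\<omega> (clamp s)) \<partial>\<Omega>\<bar> \<le> C" by (rule test_integrable(5)[OF F assms clamp_range])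
  have e1: "\<bar>\<integral>\<omega>. F1 \<omega> * f1 (\<omega> (clamp s)) \<partial>\<Omega>\<bar> \<le> C * (2 + T powr p)" by (rule test_integrable(4)[OF F1 assms clamp_range])
  show ?a
  proof (cases "s \<in> {0..t}")
    case True
    then have "s powr (p - 1) \<le> T powr (p - 1)" using t p_ge_1 by (intro powr_mono2) auto
    then show ?thesis using True e2 g(7) by (auto simp: abs_mult intro!: mult_mono)
  qed simp
  show ?b
  proof (cases "s \<in> {0..t}")
    case True
    then show ?thesis using e1 by (auto simp: abs_mult intro!: mult_right_mono)
  next
    case False
    then show ?thesis using g(7) by simp
  qed
  show ?c using test_measurable[OF F(1) g(3)] by simp
  show ?d using test_measurable[OF F1(1) g(2)] \<kappa> by (auto intro!: borel_measurable_times)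
qed

lemma dominating_integrable:
  "integrable lborel (\<lambda>s. c * indicator {0..t} s :: real)" "integrable lborel (\<lambda>s. c * \<bar>\<kappa> s\<bar>)"
proof -
  have "integrable lborel (indicator {0..t} :: real \<Rightarrow> real)" by (rule integrable_real_indicator) (use t in simp_all)
  then show "integrable lborel (\<lambda>s. c * indicator {0..t} s :: real)" by (rule integrable_mult_right)
  show "integrable lborel (\<lambda>s. c * \<bar>\<kappa> s\<bar>)" using \<kappa> by simp
qed

lemma time_integrable:
  assumes "quad_growth C f f1 f2"
  shows "integrable lborel (\<lambda>s. indicator {0..t} s * ((\<integral>\<omega>. F \<omega> * f2 (\<omega> (clamp s)) \<partial>\<Omega>) * s powr (p - 1)))"
    and "integrable lborel (\<lambda>s. indicator {0..t} s * ((\<integral>\<omega>. F1 \<omega> * f1 (\<omega> (clamp s)) \<partial>\<Omega>) * \<kappa> s))"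
  by (rule Bochner_Integration.integrable_bound[OF dominating_integrable(1) time_integrands(3)[OF assms]],
      intro AE_I2, unfold real_norm_def, rule order_trans[OF time_integrands(1)[OF assms] abs_ge_self])
     (rule Bochner_Integration.integrable_bound[OF dominating_integrable(2) time_integrands(4)[OF assms]],
      intro AE_I2, unfold real_norm_def, rule order_trans[OF time_integrands(2)[OF assms] abs_ge_self])

lemma ito_defect_lin:
  assumes f: "quad_growth C f f1 f2" and g: "quad_growth D g g1 g2"
  shows "ito_defect F F1 \<kappa> t (\<lambda>x. a * f x + b * g x) (\<lambda>x. a * f1 x + b * g1 x) (\<lambda>x. a * f2 x + b * g2 x) =
    a * ito_defect F F1 \<kappa> t f f1 f2 + b * ito_defect F F1 \<kappa> t g g1 g2"
proof -
  have Fi: "integrable \<Omega> F" by (rule \<Omega>.integrable_const_bound[where B = 1]) (use F in auto)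
  have i0: "integrable \<Omega> (\<lambda>\<omega>. F \<omega> * (f (\<omega> t) - f 0))" "integrable \<Omega> (\<lambda>\<omega>. F \<omega> * (g (\<omega> t) - g 0))"
    using test_integrable(1)[OF F f t] test_integrable(1)[OF F g t] Fi by (simp_all add: right_diff_distrib)
  have 0: "(\<integral>\<omega>. F \<omega> * ((a * f (\<omega> t) + b * g (\<omega> t)) - (a * f 0 + b * g 0)) \<partial>\<Omega>) =
      a * (\<integral>\<omega>. F \<omega> * (f (\<omega> t) - f 0) \<partial>\<Omega>) + b * (\<integral>\<omega>. F \<omega> * (g (\<omega> t) - g 0) \<partial>\<Omega>)"
  proof -
    have "(\<integral>\<omega>. F \<omega> * ((a * f (\<omega> t) + b * g (\<omega> t)) - (a * f 0 + b * g 0)) \<partial>\<Omega>) =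
      (\<integral>\<omega>. a * (F \<omega> * (f (\<omega> t) - f 0)) + b * (F \<omega> * (g (\<omega> t) - g 0)) \<partial>\<Omega>)"
      by (rule Bochner_Integration.integral_cong) (simp_all add: algebra_simps)
    then show ?thesis using i0 by simp
  qed
  have 2: "(\<integral>\<omega>. F \<omega> * (a * f2 (\<omega> (clamp s)) + b * g2 (\<omega> (clamp s))) \<partial>\<Omega>) =
      a * (\<integral>\<omega>. F \<omega> * f2 (\<omega> (clamp s)) \<partial>\<Omega>) + b * (\<integral>\<omega>. F \<omega> * g2 (\<omega> (clamp s)) \<partial>\<Omega>)" for s
    using test_integrable(3)[OF F f clamp_range, of s] test_integrable(3)[OF F g clamp_range, of s]
    by (simp add: distrib_left mult.left_commute)
  have 1: "(\<integral>\<omega>. F1 \<omega> * (a * f1 (\<omega> (clamp s)) + b * g1 (\<omega> (clamp s))) \<partial>\<Omega>) =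
      a * (\<integral>\<omega>. F1 \<omega> * f1 (\<omega> (clamp s)) \<partial>\<Omega>) + b * (\<integral>\<omega>. F1 \<omega> * g1 (\<omega> (clamp s)) \<partial>\<Omega>)" for s
    using test_integrable(2)[OF F1 f clamp_range, of s] test_integrable(2)[OF F1 g clamp_range, of s]
    by (simp add: distrib_left mult.left_commute)
  have dist: "indicator {0..t} s * ((a * x + b * y) * z) = a * (indicator {0..t} s * (x * z)) + b * (indicator {0..t} s * (y * z))"
    for s x y z :: real by (simp add: algebra_simps)
  show ?thesis
    unfolding ito_defect_def 0 1 2 dist
    using time_integrable[OF f] time_integrable[OF g] by (simp add: algebra_simps)
qed

text \<open>Dominated convergence twice: first in \<open>\<omega>\<close>, with a majorant of at
  most quadratic growth in the coordinate, then in time with the majorants from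
  \<open>time_integrands\<close>.\<close>

lemma ito_defect_limit:
  assumes g: "\<And>n. quad_growth C (f n) (f1 n) (f2 n)" "quad_growth C f' f1' f2'"
    and lim: "\<And>x. (\<lambda>n. f n x) \<longlonglongrightarrow> f' x" "\<And>x. (\<lambda>n. f1 n x) \<longlonglongrightarrow> f1' x" "\<And>x. (\<lambda>n. f2 n x) \<longlonglongrightarrow> f2' x"
  shows "(\<lambda>n. ito_defect F F1 \<kappa> t (f n) (f1 n) (f2 n)) \<longlonglongrightarrow> ito_defect F F1 \<kappa> t f' f1' f2'"
proof -
  have b: "\<bar>V \<omega> * y\<bar> \<le> z" if "\<bar>y\<bar> \<le> z" "\<And>\<omega>. \<bar>V \<omega>\<bar> \<le> 1" for V and \<omega> :: "real \<Rightarrow> real" and y z :: real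
  proof -
    have "\<bar>V \<omega> * y\<bar> \<le> 1 * z" unfolding abs_mult using that(2)[of \<omega>] that(1) by (intro mult_mono) auto
    then show ?thesis by simp
  qed
  have Fi: "integrable \<Omega> F" by (rule \<Omega>.integrable_const_bound[where B = 1]) (use F in auto)
  have l0: "(\<lambda>n. \<integral>\<omega>. F \<omega> * f n (\<omega> t) \<partial>\<Omega>) \<longlonglongrightarrow> (\<integral>\<omega>. F \<omega> * f' (\<omega> t) \<partial>\<Omega>)"
  proof (rule integral_dominated_convergence[where w = "\<lambda>\<omega>. C * (1 + (\<omega> t)\<^sup>2)"])
    show "integrable \<Omega> (\<lambda>\<omega>. C * (1 + (\<omega> t)\<^sup>2))" using coord_L2[OF t] by (simp add: L2_rv_def)
    show "AE \<omega> in \<Omega>. (\<lambda>n. F \<omega> * f n (\<omega> t)) \<longlonglongrightarrow> F \<omega> * f' (\<omega> t)" by (intro AE_I2 tendsto_mult tendsto_const lim)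
    show "AE \<omega> in \<Omega>. norm (F \<omega> * f n (\<omega> t)) \<le> C * (1 + (\<omega> t)\<^sup>2)" for n
      by (intro AE_I2) (unfold real_norm_def, rule b[OF quad_growthD(4)[OF g(1)] F(2)])
  qed (use test_integrable(1)[OF F g(2) t] test_integrable(1)[OF F g(1) t] in auto)
  have l0': "(\<lambda>n. \<integral>\<omega>. F \<omega> * (f n (\<omega> t) - f n 0) \<partial>\<Omega>) \<longlonglongrightarrow> (\<integral>\<omega>. F \<omega> * (f' (\<omega> t) - f' 0) \<partial>\<Omega>)"
  proof -
    have e: "(\<integral>\<omega>. F \<omega> * (h (\<omega> t) - h 0) \<partial>\<Omega>) = (\<integral>\<omega>. F \<omega> * h (\<omega> t) \<partial>\<Omega>) - (\<integral>\<omega>. F \<omega> \<partial>\<Omega>) * h 0"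
      if "quad_growth C h h1 h2" for h h1 h2
      using test_integrable(1)[OF F that t] Fi by (simp add: right_diff_distrib)
    show ?thesis unfolding e[OF g(1)] e[OF g(2)] by (intro tendsto_intros l0 lim)
  qed
  have l2: "(\<lambda>n. \<integral>\<omega>. F \<omega> * f2 n (\<omega> (clamp s)) \<partial>\<Omega>) \<longlonglongrightarrow> (\<integral>\<omega>. F \<omega> * f2' (\<omega> (clamp s)) \<partial>\<Omega>)" for s
  proof (rule integral_dominated_convergence[where w = "\<lambda>\<omega>. C"])
    show "AE \<omega> in \<Omega>. (\<lambda>n. F \<omega> * f2 n (\<omega> (clamp s))) \<longlonglongrightarrow> F \<omega> * f2' (\<omega> (clamp s))" by (intro AE_I2 tendsto_mult tendsto_const lim)
    show "AE \<omega> in \<Omega>. norm (F \<omega> * f2 n (\<omega> (clamp s))) \<le> C" for n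
      by (intro AE_I2) (unfold real_norm_def, rule b[OF quad_growthD(6)[OF g(1)] F(2)])
  qed (use test_integrable(3)[OF F g(2) clamp_range, of s] test_integrable(3)[OF F g(1) clamp_range, of _ s] in auto)
  have l1: "(\<lambda>n. \<integral>\<omega>. F1 \<omega> * f1 n (\<omega> (clamp s)) \<partial>\<Omega>) \<longlonglongrightarrow> (\<integral>\<omega>. F1 \<omega> * f1' (\<omega> (clamp s)) \<partial>\<Omega>)" for s
  proof (rule integral_dominated_convergence[where w = "\<lambda>\<omega>. C * (1 + \<bar>\<omega> (clamp s)\<bar>)"])
    show "integrable \<Omega> (\<lambda>\<omega>. C * (1 + \<bar>\<omega> (clamp s)\<bar>))" using \<Omega>.L2_rv_integrable[OF coord_L2[OF clamp_range]] by simp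
    show "AE \<omega> in \<Omega>. (\<lambda>n. F1 \<omega> * f1 n (\<omega> (clamp s))) \<longlonglongrightarrow> F1 \<omega> * f1' (\<omega> (clamp s))" by (intro AE_I2 tendsto_mult tendsto_const lim)
    show "AE \<omega> in \<Omega>. norm (F1 \<omega> * f1 n (\<omega> (clamp s))) \<le> C * (1 + \<bar>\<omega> (clamp s)\<bar>)" for n
      by (intro AE_I2) (unfold real_norm_def, rule b[OF quad_growthD(5)[OF g(1)] F1(2)])
  qed (use test_integrable(2)[OF F1 g(2) clamp_range, of s] test_integrable(2)[OF F1 g(1) clamp_range, of _ s] in auto)
  have t2: "(\<lambda>n. \<integral>s. indicator {0..t} s * ((\<integral>\<omega>. F \<omega> * f2 n (\<omega> (clamp s)) \<partial>\<Omega>) * s powr (p - 1)) \<partial>lborel)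
      \<longlonglongrightarrow> (\<integral>s. indicator {0..t} s * ((\<integral>\<omega>. F \<omega> * f2' (\<omega> (clamp s)) \<partial>\<Omega>) * s powr (p - 1)) \<partial>lborel)"
    by (rule integral_dominated_convergence[OF time_integrands(3)[OF g(2)] time_integrands(3)[OF g(1)] dominating_integrable(1)])
       (intro AE_I2 tendsto_mult tendsto_const l2, intro AE_I2, unfold real_norm_def, rule time_integrands(1)[OF g(1)])
  have t1: "(\<lambda>n. \<integral>s. indicator {0..t} s * ((\<integral>\<omega>. F1 \<omega> * f1 n (\<omega> (clamp s)) \<partial>\<Omega>) * \<kappa> s) \<partial>lborel)
      \<longlonglongrightarrow> (\<integral>s. indicator {0..t} s * ((\<integral>\<omega>. F1 \<omega> * f1' (\<omega> (clamp s)) \<partial>\<Omega>) * \<kappa> s) \<partial>lborel)"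
    by (rule integral_dominated_convergence[OF time_integrands(4)[OF g(2)] time_integrands(4)[OF g(1)] dominating_integrable(2)])
       (intro AE_I2 tendsto_mult tendsto_const l1, intro AE_I2, unfold real_norm_def, rule time_integrands(2)[OF g(1)])
  show ?thesis unfolding ito_defect_def by (intro tendsto_diff tendsto_mult tendsto_const l0' t2 t1)
qed

end
end

lemma lipschitz_bound_real:
  fixes g g' :: "real \<Rightarrow> real"
  assumes "\<And>y. (g has_real_derivative g' y) (at y)" "\<And>y. \<bar>y\<bar> \<le> \<bar>x\<bar> \<Longrightarrow> \<bar>g' y\<bar> \<le> c"
  shows "\<bar>g x - g 0\<bar> \<le> c * \<bar>x\<bar>"
proof -
  have "norm (g x - g 0) \<le> c * norm (x - 0)"
  proof (rule field_differentiable_bound[where S = "{- \<bar>x\<bar>..\<bar>x\<bar>}"])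
    show "(g has_field_derivative g' y) (at y within {- \<bar>x\<bar>..\<bar>x\<bar>})" for y
      by (rule has_field_derivative_at_within[OF assms(1)])
    show "norm (g' y) \<le> c" if "y \<in> {- \<bar>x\<bar>..\<bar>x\<bar>}" for y using assms(2)[of y] that by auto
  qed auto
  then show ?thesis by simp
qed

context bifbm_setting
begin

lemma power_FTC:
  assumes "0 \<le> s" shows "set_integrable lborel {0..s} (\<lambda>r. p * r powr (p - 1))" "(LBINT r:{0..s}. p * r powr (p - 1)) = s powr p"
proof -
  have b: "(\<lambda>r. p * r powr (p - 1)) \<in> borel_measurable borel" by simp
  show si: "set_integrable lborel {0..s} (\<lambda>r. p * r powr (p - 1))"
    unfolding set_integrable_def
  proof (rule Bochner_Integration.integrable_bound[where f = "\<lambda>r. p * s powr (p - 1) * indicator {0..s} r"])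
    have "integrable lborel (indicator {0..s} :: real \<Rightarrow> real)" by (rule integrable_real_indicator) (use assms in simp_all)
    then show "integrable lborel (\<lambda>r. p * s powr (p - 1) * indicator {0..s} r)" by (rule integrable_mult_right)
    show "AE r in lborel. norm (indicator {0..s} r *\<^sub>R (p * r powr (p - 1))) \<le> norm (p * s powr (p - 1) * indicator {0..s} r)"
    proof (rule AE_I2)
      fix r
      show "norm (indicator {0..s} r *\<^sub>R (p * r powr (p - 1))) \<le> norm (p * s powr (p - 1) * indicator {0..s} r)"
      proof (cases "r \<in> {0..s}")
        case True
        then have "r powr (p - 1) \<le> s powr (p - 1)" using p_ge_1 by (intro powr_mono2) auto
        then have "p * r powr (p - 1) \<le> p * s powr (p - 1)" using p_ge_1 by (intro mult_left_mono) auto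
        then show ?thesis using True p_ge_1 by (simp add: abs_of_nonneg)
      qed simp
    qed
  qed simp
  have hi: "((\<lambda>r. p * r powr (p - 1)) has_integral s powr p - 0 powr p) {0..s}"
  proof (rule fundamental_theorem_of_calculus_interior_strong[of "{}"])
    show "continuous_on {0..s} (\<lambda>r. r powr p)"
      using p_ge_1 by (intro continuous_on_powr_nonneg continuous_on_id) auto
    show "((\<lambda>r. r powr p) has_vector_derivative p * r powr (p - 1)) (at r)" if "r \<in> {0<..<s} - {}" for r
      unfolding has_real_derivative_iff_has_vector_derivative[symmetric]
      using has_real_derivative_powr[of r p] that by simp
  qed (use assms in auto)
  show "(LBINT r:{0..s}. p * r powr (p - 1)) = s powr p"
  proof -
    have "(0::real) powr p = 0" by simp
    then show ?thesis using set_borel_integral_eq_integral(2)[OF si] integral_unique[OF hi] by linarith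
  qed
qed

lemma growth_arith:
  fixes a b B y :: real
  assumes "0 \<le> a" "0 \<le> b" "0 \<le> B" "0 \<le> y"
  shows "a + b * (1 + y) + B * y \<le> (a + 2 * b + 2 * B) * (1 + y)" "b + B * y \<le> (a + 2 * b + 2 * B) * (1 + y)"
proof -
  have "0 \<le> a * y + b * (1 + y) + 2 * B + B * y" "0 \<le> a + a * y + b + 2 * b * y + 2 * B + B * y"
    using assms by (auto intro!: add_nonneg_nonneg mult_nonneg_nonneg)
  then show "a + b * (1 + y) + B * y \<le> (a + 2 * b + 2 * B) * (1 + y)" "b + B * y \<le> (a + 2 * b + 2 * B) * (1 + y)"
    by (simp_all add: algebra_simps)
qed

text \<open>The constant depends on \<open>f 0\<close>, \<open>f1 0\<close> and \<open>B\<close>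
  only; hence functions with the same initial data and a common bound on the second derivative share
  it.\<close>

lemma antiderivative_growth:
  assumes d: "\<And>x. (f has_real_derivative f1 x) (at x)" "\<And>x. (f1 has_real_derivative f2 x) (at x)"
    and b: "\<And>x. \<bar>f2 x\<bar> \<le> B"
  shows "\<bar>f1 x\<bar> \<le> (\<bar>f 0\<bar> + 2 * \<bar>f1 0\<bar> + 2 * B) * (1 + \<bar>x\<bar>)" "\<bar>f x\<bar> \<le> (\<bar>f 0\<bar> + 2 * \<bar>f1 0\<bar> + 2 * B) * (1 + x\<^sup>2)"
proof -
  have B: "0 \<le> B" using b[of 0] by linarith
  have l1: "\<bar>f1 y - f1 0\<bar> \<le> B * \<bar>y\<bar>" for y by (rule lipschitz_bound_real[OF d(2) b])
  have "\<bar>f1 x\<bar> \<le> \<bar>f1 0\<bar> + B * \<bar>x\<bar>" using l1[of x] by linarith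
  then show "\<bar>f1 x\<bar> \<le> (\<bar>f 0\<bar> + 2 * \<bar>f1 0\<bar> + 2 * B) * (1 + \<bar>x\<bar>)"
    by (rule order_trans) (rule growth_arith(2)[OF abs_ge_zero abs_ge_zero B abs_ge_zero])
  have "\<bar>f x - f 0\<bar> \<le> (\<bar>f1 0\<bar> + B * \<bar>x\<bar>) * \<bar>x\<bar>"
  proof (rule lipschitz_bound_real[OF d(1)])
    fix y assume "\<bar>y\<bar> \<le> \<bar>x\<bar>"
    then have "B * \<bar>y\<bar> \<le> B * \<bar>x\<bar>" using B by (intro mult_left_mono)
    then show "\<bar>f1 y\<bar> \<le> \<bar>f1 0\<bar> + B * \<bar>x\<bar>" using l1[of y] by linarith
  qed
  then have "\<bar>f x\<bar> \<le> \<bar>f 0\<bar> + \<bar>f1 0\<bar> * \<bar>x\<bar> + B * x\<^sup>2" by (simp add: algebra_simps power2_eq_square abs_if split: if_splits)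
  also have "\<dots> \<le> \<bar>f 0\<bar> + \<bar>f1 0\<bar> * (1 + x\<^sup>2) + B * x\<^sup>2"
    using B by (intro add_mono mult_left_mono abs_le_one_square) simp_all
  also have "\<dots> \<le> (\<bar>f 0\<bar> + 2 * \<bar>f1 0\<bar> + 2 * B) * (1 + x\<^sup>2)"
    by (rule growth_arith(1)[OF abs_ge_zero abs_ge_zero B zero_le_power2])
  finally show "\<bar>f x\<bar> \<le> (\<bar>f 0\<bar> + 2 * \<bar>f1 0\<bar> + 2 * B) * (1 + x\<^sup>2)" .
qed

lemma C2_quad_growth:
  assumes d: "\<And>x. (f has_real_derivative f1 x) (at x)" "\<And>x. (f1 has_real_derivative f2 x) (at x)"
    and c: "continuous_on UNIV f2" and b: "\<And>x. \<bar>f2 x\<bar> \<le> B"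
  shows "quad_growth (\<bar>f 0\<bar> + 2 * \<bar>f1 0\<bar> + 2 * B) f f1 f2"
proof -
  have B: "0 \<le> B" using b[of 0] by linarith
  have "\<bar>f2 x\<bar> \<le> \<bar>f 0\<bar> + 2 * \<bar>f1 0\<bar> + 2 * B" for x using b[of x] B by linarith
  moreover have "f \<in> borel_measurable borel" "f1 \<in> borel_measurable borel"
    using DERIV_continuous_on[of UNIV f f1] DERIV_continuous_on[of UNIV f1 f2] d
    by (auto intro!: borel_measurable_continuous_onI)
  moreover have "f2 \<in> borel_measurable borel" by (rule borel_measurable_continuous_onI[OF c])
  ultimately show ?thesis
    unfolding quad_growth_def using antiderivative_growth[OF d b] by blast
qed

section \<open>The formula tested against \<open>cos (\<Gamma> + \<alpha>)\<close>\<close>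

context
  fixes \<Gamma> :: "(real \<Rightarrow> real) \<Rightarrow> real" and \<kappa> :: "real \<Rightarrow> real" and t :: real and \<alpha> :: real
  assumes \<Gamma>: "\<Gamma> \<in> gaussian_space" and \<kappa>: "integrable lborel \<kappa>" and t: "t \<in> {0..T}"
    and cov_\<Gamma>: "\<And>s. s \<in> {0..T} \<Longrightarrow> (\<integral>\<omega>. \<Gamma> \<omega> * \<omega> s \<partial>\<Omega>) = (LBINT r:{0..s}. \<kappa> r)"
begin

lemma \<Gamma>_measurable: "\<Gamma> \<in> borel_measurable \<Omega>" by (rule L2_rv_measurable[OF gaussian_space_L2[OF \<Gamma>]])

lemma F_meas: "(\<lambda>\<omega>. cos (\<Gamma> \<omega> + \<alpha>)) \<in> borel_measurable \<Omega>" "(\<lambda>\<omega>. - sin (\<Gamma> \<omega> + \<alpha>)) \<in> borel_measurable \<Omega>"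
  using \<Gamma>_measurable by simp_all

lemma F_bound: "\<bar>cos (\<Gamma> \<omega> + \<alpha>)\<bar> \<le> 1" "\<bar>- sin (\<Gamma> \<omega> + \<alpha>)\<bar> \<le> 1" by simp_all

abbreviation "defect \<equiv> ito_defect (\<lambda>\<omega>. cos (\<Gamma> \<omega> + \<alpha>)) (\<lambda>\<omega>. - sin (\<Gamma> \<omega> + \<alpha>)) \<kappa> t"

lemmas defect_lin = ito_defect_lin[OF F_meas(1) F_bound(1) F_meas(2) F_bound(2) \<kappa> t]
lemmas defect_limit = ito_defect_limit[OF F_meas(1) F_bound(1) F_meas(2) F_bound(2) \<kappa> t]

text \<open>The characteristic function at 1 of the centered Gaussian variable
  \<open>\<Gamma> + \<theta> X_s\<close>; all expectations below are expressed through it.\<close>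

definition gexp :: "real \<Rightarrow> real \<Rightarrow> real" where
  "gexp \<theta> s = exp (- (\<integral>\<omega>. (\<Gamma> \<omega> + \<theta> * \<omega> s)\<^sup>2 \<partial>\<Omega>) / 2)"

lemma expectation_cos:
  assumes "s \<in> {0..T}"
  shows "(\<integral>\<omega>. cos (\<Gamma> \<omega> + \<theta> * \<omega> s + a) \<partial>\<Omega>) = cos a * gexp \<theta> s"
proof -
  have "(\<lambda>\<omega>. 1 * \<Gamma> \<omega> + \<theta> * \<omega> s) \<in> gaussian_space"
    by (rule gaussian_space_lin[OF \<Gamma>]) (use coord_gspan[OF assms] gspan_gaussian_space in blast)
  from gaussian_space_cos[OF this, of a] show ?thesis by (simp add: gexp_def)
qed

lemma cos_integrable: "s \<in> {0..T} \<Longrightarrow> integrable \<Omega> (\<lambda>\<omega>. cos (\<Gamma> \<omega> + \<theta> * \<omega> s + a))"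
  by (rule \<Omega>.integrable_const_bound[where B = 1])
     (use \<Gamma>_measurable coord_measurable in \<open>auto intro!: borel_measurable_add borel_measurable_times
        measurable_compose[OF _ borel_measurable_continuous_onI[OF continuous_on_cos[OF continuous_on_id]]]\<close>)

text \<open>Sum and difference of the two arguments are again Gaussian variables plus a phase, with
  frequencies \<open>\<theta>\<close> and \<open>- \<theta>\<close>.\<close>

lemma expectation_cos_cos:
  assumes s: "s \<in> {0..T}"
  shows "(\<integral>\<omega>. cos (\<Gamma> \<omega> + \<alpha>) * cos (\<theta> * \<omega> s + b) \<partial>\<Omega>) =
    (cos (\<alpha> + b) * gexp \<theta> s + cos (\<alpha> - b) * gexp (- \<theta>) s) / 2"
proof -
  have e: "cos (\<Gamma> \<omega> + \<alpha>) * cos (\<theta> * \<omega> s + b) = cos (\<Gamma> \<omega> + \<theta> * \<omega> s + (\<alpha> + b)) / 2 + cos (\<Gamma> \<omega> + - \<theta> * \<omega> s + (\<alpha> - b)) / 2" for \<omega>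
    by (simp add: cos_times_cos add_divide_distrib algebra_simps)
  have "(\<integral>\<omega>. cos (\<Gamma> \<omega> + \<alpha>) * cos (\<theta> * \<omega> s + b) \<partial>\<Omega>) =
      (\<integral>\<omega>. cos (\<Gamma> \<omega> + \<theta> * \<omega> s + (\<alpha> + b)) \<partial>\<Omega>) / 2 + (\<integral>\<omega>. cos (\<Gamma> \<omega> + - \<theta> * \<omega> s + (\<alpha> - b)) \<partial>\<Omega>) / 2"
    unfolding e by (subst Bochner_Integration.integral_add)
      (intro integrable_divide_zero impI cos_integrable[OF s] | simp only: integral_divide_zero)+
  then show ?thesis unfolding expectation_cos[OF s] by (simp add: add_divide_distrib)
qed

lemma expectation_sin_sin:
  assumes s: "s \<in> {0..T}"
  shows "(\<integral>\<omega>. - sin (\<Gamma> \<omega> + \<alpha>) * (- \<theta> * sin (\<theta> * \<omega> s + b)) \<partial>\<Omega>) =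
    \<theta> * (cos (\<alpha> - b) * gexp (- \<theta>) s - cos (\<alpha> + b) * gexp \<theta> s) / 2"
proof -
  have e: "- sin (\<Gamma> \<omega> + \<alpha>) * (- \<theta> * sin (\<theta> * \<omega> s + b)) = \<theta> / 2 * cos (\<Gamma> \<omega> + - \<theta> * \<omega> s + (\<alpha> - b)) - \<theta> / 2 * cos (\<Gamma> \<omega> + \<theta> * \<omega> s + (\<alpha> + b))" for \<omega>
  proof -
    have "sin (\<Gamma> \<omega> + \<alpha>) * sin (\<theta> * \<omega> s + b) = (cos (\<Gamma> \<omega> + - \<theta> * \<omega> s + (\<alpha> - b)) - cos (\<Gamma> \<omega> + \<theta> * \<omega> s + (\<alpha> + b))) / 2"
      by (simp add: sin_times_sin algebra_simps)
    then have "\<theta> * (sin (\<Gamma> \<omega> + \<alpha>) * sin (\<theta> * \<omega> s + b)) = \<theta> * ((cos (\<Gamma> \<omega> + - \<theta> * \<omega> s + (\<alpha> - b)) - cos (\<Gamma> \<omega> + \<theta> * \<omega> s + (\<alpha> + b))) / 2)"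
      by (rule arg_cong)
    then show ?thesis by (simp add: algebra_simps diff_divide_distrib)
  qed
  have "(\<integral>\<omega>. - sin (\<Gamma> \<omega> + \<alpha>) * (- \<theta> * sin (\<theta> * \<omega> s + b)) \<partial>\<Omega>) =
      \<theta> / 2 * (\<integral>\<omega>. cos (\<Gamma> \<omega> + - \<theta> * \<omega> s + (\<alpha> - b)) \<partial>\<Omega>) - \<theta> / 2 * (\<integral>\<omega>. cos (\<Gamma> \<omega> + \<theta> * \<omega> s + (\<alpha> + b)) \<partial>\<Omega>)"
    unfolding e by (subst Bochner_Integration.integral_diff)
      (intro integrable_mult_right cos_integrable[OF s] | simp only: integral_mult_right_zero)+
  then show ?thesis unfolding expectation_cos[OF s] by (simp add: algebra_simps diff_divide_distrib)
qed

text \<open>The formal derivative in \<open>r\<close> of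
  \<open>- E(\<Gamma> + \<theta> X_r)^2 / 2\<close>: \<open>\<kappa>\<close> is the density of the
  covariance with \<open>\<Gamma>\<close>, and \<open>p * r powr (p - 1)\<close> is the derivative
  of the variance \<open>r powr p\<close>.\<close>

definition gexp_rate :: "real \<Rightarrow> real \<Rightarrow> real" where
  "gexp_rate \<theta> r = - \<theta> * \<kappa> r - \<theta>\<^sup>2 / 2 * (p * r powr (p - 1))"

lemma \<kappa>_set: "set_integrable lborel A \<kappa>" if "A \<in> sets borel"
  unfolding set_integrable_def using integrable_mult_indicator[OF _ \<kappa>, of A] that by simp

lemma gexp_rate_integrable: "s \<in> {0..T} \<Longrightarrow> set_integrable lborel {0..s} (gexp_rate \<theta>)"
  unfolding gexp_rate_def
  using \<kappa>_set[of "{0..s}"] power_FTC(1)[of s] by (intro set_integral_diff(1) set_integrable_mult_right) auto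

text \<open>As \<open>\<kappa>\<close> is merely integrable, the exponent is known as an indefinite
  integral and not as a differentiable function; the integrated chain rule takes the place of
  differentiation.\<close>

lemma gexp_increment:
  assumes s: "s \<in> {0..T}"
  shows "gexp \<theta> s - gexp \<theta> 0 = (LBINT r:{0..s}. gexp \<theta> r * gexp_rate \<theta> r)"
proof -
  define q where "q r = - (\<integral>\<omega>. (\<Gamma> \<omega> + \<theta> * \<omega> r)\<^sup>2 \<partial>\<Omega>) / 2" for r
  have q: "q r = q 0 + (LBINT u:{0..r}. gexp_rate \<theta> u)" if r: "r \<in> {0..T}" for r
  proof -
    have sq: "(\<integral>\<omega>. (\<Gamma> \<omega> + \<theta> * \<omega> r)\<^sup>2 \<partial>\<Omega>) = (\<integral>\<omega>. (\<Gamma> \<omega>)\<^sup>2 \<partial>\<Omega>) + 2 * \<theta> * (LBINT u:{0..r}. \<kappa> u) + \<theta>\<^sup>2 * r powr p"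
      if r: "r \<in> {0..T}" for r
    proof -
      have "(\<integral>\<omega>. (\<Gamma> \<omega> + \<theta> * \<omega> r)\<^sup>2 \<partial>\<Omega>) = (\<integral>\<omega>. (\<Gamma> \<omega>)\<^sup>2 + 2 * \<theta> * (\<Gamma> \<omega> * \<omega> r) + \<theta>\<^sup>2 * (\<omega> r)\<^sup>2 \<partial>\<Omega>)"
        by (simp add: power2_eq_square algebra_simps)
      also have "\<dots> = (\<integral>\<omega>. (\<Gamma> \<omega>)\<^sup>2 \<partial>\<Omega>) + 2 * \<theta> * (\<integral>\<omega>. \<Gamma> \<omega> * \<omega> r \<partial>\<Omega>) + \<theta>\<^sup>2 * (\<integral>\<omega>. (\<omega> r)\<^sup>2 \<partial>\<Omega>)"
        using gaussian_space_L2[OF \<Gamma>] coord_L2[OF r] L2_rv_mult[OF gaussian_space_L2[OF \<Gamma>] coord_L2[OF r]]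
        by (simp add: L2_rv_def)
      finally show ?thesis using cov_\<Gamma>[OF r] coord_square[OF r] by simp
    qed
    \<comment> \<open>At time 0 the path vanishes, so the covariance with \<open>\<Gamma>\<close> is
      0 there; this evaluates \<open>q 0\<close>.\<close>
    have z: "(LBINT u:{0..0}. \<kappa> u) = 0" "(0::real) \<in> {0..T}"
    proof -
      have "(LBINT u:{0..0}. \<kappa> u) = (\<integral>\<omega>. \<Gamma> \<omega> * \<omega> 0 \<partial>\<Omega>)" using cov_\<Gamma>[of 0] T by simp
      also have "\<dots> = (\<integral>\<omega>. 0 \<partial>\<Omega>)" by (rule Bochner_Integration.integral_cong) (simp_all only: coord_0 mult_zero_right)
      finally show "(LBINT u:{0..0}. \<kappa> u) = 0" by simp
    qed (use T in simp)
    have "(LBINT u:{0..r}. gexp_rate \<theta> u) = - \<theta> * (LBINT u:{0..r}. \<kappa> u) - \<theta>\<^sup>2 / 2 * (LBINT u:{0..r}. p * u powr (p - 1))"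
    proof -
      have i1: "set_integrable lborel {0..r} (\<lambda>u. - \<theta> * \<kappa> u)"
        by (rule set_integrable_mult_right) (simp add: \<kappa>_set)
      have i2: "set_integrable lborel {0..r} (\<lambda>u. \<theta>\<^sup>2 / 2 * (p * u powr (p - 1)))"
        by (rule set_integrable_mult_right) (use power_FTC(1)[of r] r in simp)
      show ?thesis unfolding gexp_rate_def
        by (simp only: set_integral_diff(2)[OF i1 i2] set_integral_mult_right)
    qed
    also have "\<dots> = - \<theta> * (LBINT u:{0..r}. \<kappa> u) - \<theta>\<^sup>2 / 2 * r powr p"
      using power_FTC(2)[of r] r by simp
    finally show ?thesis unfolding q_def sq[OF r] sq[OF z(2)] z(1) by (simp add: algebra_simps add_divide_distrib diff_divide_distrib)
  qed
  have "exp (q s) - exp (q 0) = (LBINT r:{0..s}. exp (q r) * gexp_rate \<theta> r)"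
  proof (rule exp_chain_rule_integral)
    show "q r = q 0 + (LBINT u:{0..r}. gexp_rate \<theta> u)" if "r \<in> {0..s}" for r
      by (rule q) (use s that in auto)
  qed (use s gexp_rate_integrable[OF s] in simp_all)
  then show ?thesis unfolding gexp_def q_def .
qed

lemma quad_growth_cos: "quad_growth (1 + \<bar>\<theta>\<bar> + \<theta>\<^sup>2) (\<lambda>x. cos (\<theta> * x + b)) (\<lambda>x. - \<theta> * sin (\<theta> * x + b)) (\<lambda>x. - \<theta>\<^sup>2 * cos (\<theta> * x + b))"
  unfolding quad_growth_def
proof (intro conjI allI)
  fix x
  let ?C = "1 + \<bar>\<theta>\<bar> + \<theta>\<^sup>2"
  have C: "1 \<le> ?C" "\<bar>\<theta>\<bar> \<le> ?C" "\<theta>\<^sup>2 \<le> ?C" by auto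
  have m: "?C * 1 \<le> ?C * (1 + x\<^sup>2)" "?C * 1 \<le> ?C * (1 + \<bar>x\<bar>)" by (rule mult_left_mono; simp)+
  have bnd: "\<bar>cos (\<theta> * x + b)\<bar> \<le> 1" "\<bar>\<theta>\<bar> * \<bar>sin (\<theta> * x + b)\<bar> \<le> \<bar>\<theta>\<bar> * 1" "\<theta>\<^sup>2 * \<bar>cos (\<theta> * x + b)\<bar> \<le> \<theta>\<^sup>2 * 1"
    by (simp, (rule mult_left_mono; simp)+)
  have e: "\<bar>- \<theta> * sin (\<theta> * x + b)\<bar> = \<bar>\<theta>\<bar> * \<bar>sin (\<theta> * x + b)\<bar>" "\<bar>- \<theta>\<^sup>2 * cos (\<theta> * x + b)\<bar> = \<theta>\<^sup>2 * \<bar>cos (\<theta> * x + b)\<bar>"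
    by (simp_all add: abs_mult)
  show "\<bar>cos (\<theta> * x + b)\<bar> \<le> ?C * (1 + x\<^sup>2)"
    by (rule order_trans[OF order_trans[OF bnd(1) C(1)] m(1)[unfolded mult_1_right]])
  show "\<bar>- \<theta> * sin (\<theta> * x + b)\<bar> \<le> ?C * (1 + \<bar>x\<bar>)"
    unfolding e by (rule order_trans[OF order_trans[OF bnd(2)[unfolded mult_1_right] C(2)] m(2)[unfolded mult_1_right]])
  show "\<bar>- \<theta>\<^sup>2 * cos (\<theta> * x + b)\<bar> \<le> ?C"
    unfolding e by (rule order_trans[OF bnd(3)[unfolded mult_1_right] C(3)])
qed simp_all

lemma gexp_bounds: "0 \<le> gexp \<theta> s" "gexp \<theta> s \<le> 1" by (simp_all add: gexp_def)

text \<open>Product-to-sum formulas write all three terms of the defect as time integrals of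
  \<open>gexp \<theta>\<close> and \<open>gexp (- \<theta>)\<close> with the common coefficients
  \<open>A\<close> and \<open>B\<close>. The integrands cancel pointwise: the
  \<open>\<kappa>\<close> parts directly, the drift parts because
  \<open>p / 2 = H * K\<close>.\<close>

lemma defect_cos: "defect (\<lambda>x. cos (\<theta> * x + b)) (\<lambda>x. - \<theta> * sin (\<theta> * x + b)) (\<lambda>x. - \<theta>\<^sup>2 * cos (\<theta> * x + b)) = 0"
proof -
  define A B where "A = cos (\<alpha> + b) / 2" and "B = cos (\<alpha> - b) / 2"
  have z: "(0::real) \<in> {0..T}" using T by simp
  have cc: "(\<integral>\<omega>. cos (\<Gamma> \<omega> + \<alpha>) * cos (\<theta> * \<omega> s + b) \<partial>\<Omega>) = A * gexp \<theta> s + B * gexp (- \<theta>) s" if "s \<in> {0..T}" for s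
    unfolding expectation_cos_cos[OF that] A_def B_def by (simp add: add_divide_distrib)
  have ss: "(\<integral>\<omega>. - sin (\<Gamma> \<omega> + \<alpha>) * (- \<theta> * sin (\<theta> * \<omega> s + b)) \<partial>\<Omega>) = \<theta> * (B * gexp (- \<theta>) s - A * gexp \<theta> s)" if "s \<in> {0..T}" for s
    unfolding expectation_sin_sin[OF that] A_def B_def by (simp add: diff_divide_distrib algebra_simps)
  have "(\<integral>\<omega>. cos (\<Gamma> \<omega> + \<alpha>) * (cos (\<theta> * \<omega> t + b) - cos (\<theta> * 0 + b)) \<partial>\<Omega>) =
      (\<integral>\<omega>. cos (\<Gamma> \<omega> + \<alpha>) * cos (\<theta> * \<omega> t + b) - cos (\<Gamma> \<omega> + \<alpha>) * cos (\<theta> * \<omega> 0 + b) \<partial>\<Omega>)"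
    by (rule Bochner_Integration.integral_cong[OF refl]) (simp only: coord_0 right_diff_distrib)
  also have "\<dots> = (A * gexp \<theta> t + B * gexp (- \<theta>) t) - (A * gexp \<theta> 0 + B * gexp (- \<theta>) 0)"
    using test_integrable(1)[OF F_meas(1) F_bound(1) F_meas(2) F_bound(2) \<kappa> t F_meas(1) F_bound(1) quad_growth_cos[of \<theta> b] t]
      test_integrable(1)[OF F_meas(1) F_bound(1) F_meas(2) F_bound(2) \<kappa> t F_meas(1) F_bound(1) quad_growth_cos[of \<theta> b] z]
    by (simp only: Bochner_Integration.integral_diff cc[OF t] cc[OF z])
  also have "\<dots> = A * (gexp \<theta> t - gexp \<theta> 0) + B * (gexp (- \<theta>) t - gexp (- \<theta>) 0)" by (simp add: algebra_simps)
  also have "\<dots> = A * (LBINT r:{0..t}. gexp \<theta> r * gexp_rate \<theta> r) + B * (LBINT r:{0..t}. gexp (- \<theta>) r * gexp_rate (- \<theta>) r)"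
    unfolding gexp_increment[OF t] ..
  finally have term0: "(\<integral>\<omega>. cos (\<Gamma> \<omega> + \<alpha>) * (cos (\<theta> * \<omega> t + b) - cos (\<theta> * 0 + b)) \<partial>\<Omega>) =
      A * (LBINT r:{0..t}. gexp \<theta> r * gexp_rate \<theta> r) + B * (LBINT r:{0..t}. gexp (- \<theta>) r * gexp_rate (- \<theta>) r)" .
  have cl: "s \<in> {0..t} \<Longrightarrow> clamp s = s" "s \<in> {0..t} \<Longrightarrow> s \<in> {0..T}" for s using t by (auto simp: clamp_def)
  have "quad_growth (1 + \<bar>\<theta>\<bar> + \<theta>\<^sup>2) (\<lambda>x. cos (\<theta> * x + b)) (\<lambda>x. - \<theta> * sin (\<theta> * x + b)) (\<lambda>x. - \<theta>\<^sup>2 * cos (\<theta> * x + b))"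
    by (rule quad_growth_cos)
  note ti = time_integrable[OF F_meas(1) F_bound(1) F_meas(2) F_bound(2) \<kappa> t this]
  have E2: "indicator {0..t} s * ((\<integral>\<omega>. cos (\<Gamma> \<omega> + \<alpha>) * (- \<theta>\<^sup>2 * cos (\<theta> * \<omega> (clamp s) + b)) \<partial>\<Omega>) * s powr (p - 1)) =
      indicator {0..t} s * (- \<theta>\<^sup>2 * (A * gexp \<theta> s + B * gexp (- \<theta>) s) * s powr (p - 1))" for s
  proof (cases "s \<in> {0..t}")
    case True
    have "(\<integral>\<omega>. cos (\<Gamma> \<omega> + \<alpha>) * (- \<theta>\<^sup>2 * cos (\<theta> * \<omega> s + b)) \<partial>\<Omega>) = - \<theta>\<^sup>2 * (\<integral>\<omega>. cos (\<Gamma> \<omega> + \<alpha>) * cos (\<theta> * \<omega> s + b) \<partial>\<Omega>)"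
      by (simp only: mult.left_commute[of _ "- \<theta>\<^sup>2"] integral_mult_right_zero)
    then show ?thesis using True cl[OF True] cc by simp
  qed simp
  have E1: "indicator {0..t} s * ((\<integral>\<omega>. - sin (\<Gamma> \<omega> + \<alpha>) * (- \<theta> * sin (\<theta> * \<omega> (clamp s) + b)) \<partial>\<Omega>) * \<kappa> s) =
      indicator {0..t} s * (\<theta> * (B * gexp (- \<theta>) s - A * gexp \<theta> s) * \<kappa> s)" for s
  proof (cases "s \<in> {0..t}")
    case True
    show ?thesis unfolding cl(1)[OF True] ss[OF cl(2)[OF True]] ..
  qed simp
  \<comment> \<open>Merging the time integrals into one needs integrability of each integrand;
    \<open>gexp\<close> is at most 1 and is measurable after clamping the time.\<close>
  have rate_int: "integrable lborel (\<lambda>r. indicator {0..t} r * (gexp \<theta>' r * gexp_rate \<theta>' r))" for \<theta>'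
  proof -
    have m: "(\<lambda>s. gexp \<theta>' (clamp s)) \<in> borel_measurable borel"
    proof -
      have "(\<lambda>s. \<integral>\<omega>. (\<Gamma> \<omega> + \<theta>' * \<omega> (clamp s))\<^sup>2 \<partial>\<Omega>) \<in> borel_measurable borel"
      proof (rule \<Omega>.borel_measurable_lebesgue_integral[where f = "\<lambda>s \<omega>. (\<Gamma> \<omega> + \<theta>' * \<omega> (clamp s))\<^sup>2"])
        show "(\<lambda>(s, \<omega>). (\<Gamma> \<omega> + \<theta>' * \<omega> (clamp s))\<^sup>2) \<in> borel_measurable (borel \<Otimes>\<^sub>M \<Omega>)"
          unfolding case_prod_beta'
          by (intro borel_measurable_power borel_measurable_add borel_measurable_times borel_measurable_const
              measurable_compose[OF measurable_snd \<Gamma>_measurable] coord_joint_measurable)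
      qed
      then show ?thesis unfolding gexp_def by simp
    qed
    have g: "integrable lborel (\<lambda>r. indicator {0..t} r * gexp_rate \<theta>' r)"
      using gexp_rate_integrable[OF t, of \<theta>'] by (simp add: set_integrable_def)
    have "integrable lborel (\<lambda>r. gexp \<theta>' (clamp r) * (indicator {0..t} r * gexp_rate \<theta>' r))"
    proof (rule Bochner_Integration.integrable_bound[OF g])
      show "(\<lambda>r. gexp \<theta>' (clamp r) * (indicator {0..t} r * gexp_rate \<theta>' r)) \<in> borel_measurable lborel"
        by (rule borel_measurable_times) (use m borel_measurable_integrable[OF g] in simp_all)
      show "AE r in lborel. norm (gexp \<theta>' (clamp r) * (indicator {0..t} r * gexp_rate \<theta>' r)) \<le> norm (indicator {0..t} r * gexp_rate \<theta>' r)"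
      proof (rule AE_I2)
        fix r show "norm (gexp \<theta>' (clamp r) * (indicator {0..t} r * gexp_rate \<theta>' r)) \<le> norm (indicator {0..t} r * gexp_rate \<theta>' r)"
          unfolding norm_mult[of "gexp \<theta>' (clamp r)"] using gexp_bounds[of \<theta>' "clamp r"]
          by (intro mult_left_le_one_le) simp_all
      qed
    qed
    moreover have "gexp \<theta>' (clamp r) * (indicator {0..t} r * gexp_rate \<theta>' r) = indicator {0..t} r * (gexp \<theta>' r * gexp_rate \<theta>' r)" for r
      using cl(1)[of r] by (cases "r \<in> {0..t}") simp_all
    ultimately show ?thesis by simp
  qed
  have lb: "(LBINT r:{0..t}. h r) = (\<integral>r. indicator {0..t} r * h r \<partial>lborel)" for h :: "real \<Rightarrow> real"
    by (simp add: set_lebesgue_integral_def)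
  note i = ti[unfolded E2 E1] rate_int[of \<theta>] rate_int[of "- \<theta>"]
  have "defect (\<lambda>x. cos (\<theta> * x + b)) (\<lambda>x. - \<theta> * sin (\<theta> * x + b)) (\<lambda>x. - \<theta>\<^sup>2 * cos (\<theta> * x + b)) =
      A * (\<integral>r. indicator {0..t} r * (gexp \<theta> r * gexp_rate \<theta> r) \<partial>lborel) + B * (\<integral>r. indicator {0..t} r * (gexp (- \<theta>) r * gexp_rate (- \<theta>) r) \<partial>lborel)
      - H * K * (\<integral>s. indicator {0..t} s * (- \<theta>\<^sup>2 * (A * gexp \<theta> s + B * gexp (- \<theta>) s) * s powr (p - 1)) \<partial>lborel)
      - (\<integral>s. indicator {0..t} s * (\<theta> * (B * gexp (- \<theta>) s - A * gexp \<theta> s) * \<kappa> s) \<partial>lborel)"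
    unfolding ito_defect_def term0 E2 E1 lb ..
  also have "\<dots> = (\<integral>s. A * (indicator {0..t} s * (gexp \<theta> s * gexp_rate \<theta> s)) + B * (indicator {0..t} s * (gexp (- \<theta>) s * gexp_rate (- \<theta>) s))
      - H * K * (indicator {0..t} s * (- \<theta>\<^sup>2 * (A * gexp \<theta> s + B * gexp (- \<theta>) s) * s powr (p - 1)))
      - indicator {0..t} s * (\<theta> * (B * gexp (- \<theta>) s - A * gexp \<theta> s) * \<kappa> s) \<partial>lborel)"
    using i by (simp only: Bochner_Integration.integral_diff Bochner_Integration.integral_add integral_mult_right_zero
        Bochner_Integration.integrable_diff Bochner_Integration.integrable_add integrable_mult_right)
  also have "\<dots> = (\<integral>(s::real). 0 \<partial>lborel)"
    by (rule Bochner_Integration.integral_cong[OF refl]) (simp add: gexp_rate_def power2_eq_square algebra_simps indicator_def)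
  finally show ?thesis by simp
qed

lemma defect_lin_zero:
  assumes "quad_growth C f f1 f2" "quad_growth D g g1 g2" "defect f f1 f2 = 0" "defect g g1 g2 = 0"
  shows "defect (\<lambda>x. a * f x + b * g x) (\<lambda>x. a * f1 x + b * g1 x) (\<lambda>x. a * f2 x + b * g2 x) = 0"
  using defect_lin[OF assms(1,2)] assms(3,4) by simp

lemma quad_growth_lin:
  assumes "quad_growth C f f1 f2" "quad_growth D g g1 g2"
  shows "quad_growth (\<bar>a\<bar> * C + \<bar>b\<bar> * D) (\<lambda>x. a * f x + b * g x) (\<lambda>x. a * f1 x + b * g1 x) (\<lambda>x. a * f2 x + b * g2 x)"
proof -
  have b: "\<bar>a * u + b * v\<bar> \<le> (\<bar>a\<bar> * C + \<bar>b\<bar> * D) * w" if "\<bar>u\<bar> \<le> C * w" "\<bar>v\<bar> \<le> D * w" for u v w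
  proof -
    have "\<bar>a * u + b * v\<bar> \<le> \<bar>a\<bar> * \<bar>u\<bar> + \<bar>b\<bar> * \<bar>v\<bar>" using abs_triangle_ineq[of "a * u" "b * v"] by (simp add: abs_mult)
    also have "\<dots> \<le> \<bar>a\<bar> * (C * w) + \<bar>b\<bar> * (D * w)" using that by (intro add_mono mult_left_mono) auto
    finally show ?thesis by (simp add: algebra_simps)
  qed
  note f = quad_growthD[OF assms(1)] and g = quad_growthD[OF assms(2)]
  have "\<bar>a * f2 x + b * g2 x\<bar> \<le> \<bar>a\<bar> * C + \<bar>b\<bar> * D" for x using b[of "f2 x" 1 "g2 x"] f(6)[of x] g(6)[of x] by simp
  then show ?thesis unfolding quad_growth_def using b[OF f(4) g(4)] b[OF f(5) g(5)] f(1-3) g(1-3) by simp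
qed

lemma defect_const: "quad_growth 1 (\<lambda>x. 1) (\<lambda>x. 0) (\<lambda>x. 0)" "defect (\<lambda>x. 1) (\<lambda>x. 0) (\<lambda>x. 0) = 0"
  by (simp_all add: quad_growth_def ito_defect_def)

text \<open>As \<open>e\<close> tends to 0 these functions and their first two derivatives tend to
  those of the identity, which is not trigonometric. The phase \<open>- pi / 2\<close> turns the
  cosine into a sine; the summand with coefficient 0 fits the shape of
  \<open>defect_lin_zero\<close>.\<close>

lemma defect_sin_scaled:
  assumes "0 < e"
  shows "defect (\<lambda>x. sin (e * x) / e) (\<lambda>x. cos (e * x)) (\<lambda>x. - e * sin (e * x)) = 0"
    "quad_growth (\<bar>1 / e\<bar> * (1 + \<bar>e\<bar> + e\<^sup>2) + \<bar>0\<bar> * 1) (\<lambda>x. sin (e * x) / e) (\<lambda>x. cos (e * x)) (\<lambda>x. - e * sin (e * x))"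
proof -
  have eq: "(\<lambda>x. 1 / e * cos (e * x + (- pi / 2)) + 0 * 1) = (\<lambda>x. sin (e * x) / e)"
    "(\<lambda>x. 1 / e * (- e * sin (e * x + (- pi / 2))) + 0 * 0) = (\<lambda>x. cos (e * x))"
    "(\<lambda>x. 1 / e * (- e\<^sup>2 * cos (e * x + (- pi / 2))) + 0 * 0) = (\<lambda>x. - e * sin (e * x))"
    using assms by (auto simp: fun_eq_iff cos_diff sin_diff power2_eq_square)
  show "defect (\<lambda>x. sin (e * x) / e) (\<lambda>x. cos (e * x)) (\<lambda>x. - e * sin (e * x)) = 0"
    using defect_lin_zero[OF quad_growth_cos[of e "- pi / 2"] defect_const(1) defect_cos defect_const(2), of "1 / e" 0]
    unfolding eq .
  show "quad_growth (\<bar>1 / e\<bar> * (1 + \<bar>e\<bar> + e\<^sup>2) + \<bar>0\<bar> * 1) (\<lambda>x. sin (e * x) / e) (\<lambda>x. cos (e * x)) (\<lambda>x. - e * sin (e * x))"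
    using quad_growth_lin[OF quad_growth_cos[of e "- pi / 2"] defect_const(1), of "1 / e" 0]
    unfolding eq .
qed

lemma defect_cos_scaled:
  assumes "0 < e"
  shows "defect (\<lambda>x. (1 - cos (e * x)) / e\<^sup>2) (\<lambda>x. sin (e * x) / e) (\<lambda>x. cos (e * x)) = 0"
proof -
  have eq: "(\<lambda>x. - 1 / e\<^sup>2 * cos (e * x + 0) + 1 / e\<^sup>2 * 1) = (\<lambda>x. (1 - cos (e * x)) / e\<^sup>2)"
    "(\<lambda>x. - 1 / e\<^sup>2 * (- e * sin (e * x + 0)) + 1 / e\<^sup>2 * 0) = (\<lambda>x. sin (e * x) / e)"
    "(\<lambda>x. - 1 / e\<^sup>2 * (- e\<^sup>2 * cos (e * x + 0)) + 1 / e\<^sup>2 * 0) = (\<lambda>x. cos (e * x))"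
    using assms by (auto simp: fun_eq_iff diff_divide_distrib power2_eq_square)
  show ?thesis
    using defect_lin_zero[OF quad_growth_cos[of e 0] defect_const(1) defect_cos defect_const(2), of "- 1 / e\<^sup>2" "1 / e\<^sup>2"]
    unfolding eq .
qed

lemma sin_scaled_limit: "(\<lambda>n. sin (1 / real (Suc n) * x) / (1 / real (Suc n))) \<longlonglongrightarrow> x"
proof (cases "x = 0")
  case False
  have s: "((\<lambda>y. sin y / y) \<longlongrightarrow> 1) (at (0::real))"
    using DERIV_sin[of "0::real"] by (simp add: has_field_derivative_iff)
  have "filterlim (\<lambda>n. 1 / real (Suc n) * x) (at 0) sequentially"
    unfolding filterlim_at using False tendsto_mult_left_zero[OF LIMSEQ_Suc[OF lim_1_over_n], of x] by auto
  from filterlim_compose[OF s this] have "(\<lambda>n. sin (1 / real (Suc n) * x) / (1 / real (Suc n) * x)) \<longlonglongrightarrow> 1" .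
  from tendsto_mult[OF this tendsto_const[of x]] False show ?thesis by simp
qed simp

lemma scaled_to_zero: "(\<lambda>n. 1 / real (Suc n) * x) \<longlonglongrightarrow> 0"
  using tendsto_mult_left_zero[OF LIMSEQ_Suc[OF lim_1_over_n], of x] by simp

lemma sin_abs_le: "\<bar>sin (e * x) / e\<bar> \<le> \<bar>x\<bar>" if "0 < e" for e x :: real
  using abs_sin_x_le_abs_x[of "e * x"] that by (simp add: abs_mult field_simps)

text \<open>The growth constant 1 serves all approximations:
  \<open>\<bar>sin y\<bar> \<le> \<bar>y\<bar>\<close> removes the division by \<open>e\<close>,
  whereas the constant in \<open>defect_sin_scaled\<close> blows up as \<open>e\<close> tends to
  0.\<close>

lemma defect_id: "quad_growth 1 (\<lambda>x. x) (\<lambda>x. 1) (\<lambda>x. 0)" "defect (\<lambda>x. x) (\<lambda>x. 1) (\<lambda>x. 0) = 0"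
proof -
  show g: "quad_growth 1 (\<lambda>x. x) (\<lambda>x. 1) (\<lambda>x. 0)"
    unfolding quad_growth_def using abs_le_one_square by simp
  define e where "e n = 1 / real (Suc n)" for n
  have e: "0 < e n" "e n \<le> 1" for n by (simp_all add: e_def)
  have gn: "quad_growth 1 (\<lambda>x. sin (e n * x) / e n) (\<lambda>x. cos (e n * x)) (\<lambda>x. - e n * sin (e n * x))" for n
    unfolding quad_growth_def
  proof (intro conjI allI)
    fix x :: real
    show "\<bar>sin (e n * x) / e n\<bar> \<le> 1 * (1 + x\<^sup>2)" using sin_abs_le[OF e(1), of n x] abs_le_one_square[of x] by simp
    show "\<bar>cos (e n * x)\<bar> \<le> 1 * (1 + \<bar>x\<bar>)" by (rule order_trans[OF abs_cos_le_one]) simp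
    have "\<bar>e n\<bar> * \<bar>sin (e n * x)\<bar> \<le> 1 * 1" using e[of n] by (intro mult_mono) auto
    then show "\<bar>- e n * sin (e n * x)\<bar> \<le> 1" by (simp add: abs_mult)
  qed simp_all
  have "(\<lambda>n. defect (\<lambda>x. sin (e n * x) / e n) (\<lambda>x. cos (e n * x)) (\<lambda>x. - e n * sin (e n * x))) \<longlonglongrightarrow> defect (\<lambda>x. x) (\<lambda>x. 1) (\<lambda>x. 0)"
  proof (rule defect_limit[OF gn g])
    fix x :: real
    show "(\<lambda>n. sin (e n * x) / e n) \<longlonglongrightarrow> x" unfolding e_def by (rule sin_scaled_limit)
    have ex: "(\<lambda>n. e n * x) \<longlonglongrightarrow> 0" unfolding e_def by (rule scaled_to_zero)
    show "(\<lambda>n. cos (e n * x)) \<longlonglongrightarrow> 1" using tendsto_cos[OF ex] by simp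
    have "(\<lambda>n. e n) \<longlonglongrightarrow> 0" unfolding e_def by (rule LIMSEQ_Suc[OF lim_1_over_n])
    from tendsto_mult[OF tendsto_minus[OF this] tendsto_sin[OF ex]] show "(\<lambda>n. - e n * sin (e n * x)) \<longlonglongrightarrow> 0" by simp
  qed
  then show "defect (\<lambda>x. x) (\<lambda>x. 1) (\<lambda>x. 0) = 0"
    unfolding defect_sin_scaled(1)[OF e(1)] by (simp add: LIMSEQ_const_iff)
qed

lemma defect_square: "quad_growth 1 (\<lambda>x. x\<^sup>2 / 2) (\<lambda>x. x) (\<lambda>x. 1)" "defect (\<lambda>x. x\<^sup>2 / 2) (\<lambda>x. x) (\<lambda>x. 1) = 0"
proof -
  show g: "quad_growth 1 (\<lambda>x. x\<^sup>2 / 2) (\<lambda>x. x) (\<lambda>x. 1)"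
    unfolding quad_growth_def
  proof (intro conjI allI)
    fix x :: real have "0 \<le> x\<^sup>2" by simp
    then show "\<bar>x\<^sup>2 / 2\<bar> \<le> 1 * (1 + x\<^sup>2)" by simp
  qed simp_all
  define e where "e n = 1 / real (Suc n)" for n
  have e: "0 < e n" "e n \<le> 1" for n by (simp_all add: e_def)
  \<comment> \<open>The half-angle formula reduces the quotient to the square of a scaled sine, for
    which bound and limit are already known.\<close>
  have half: "(1 - cos (e n * x)) / (e n)\<^sup>2 = 2 * (sin (e n * (x / 2)) / e n)\<^sup>2" for n x
    using cos_double_sin[of "e n * (x / 2)"] by (simp add: power_divide)
  have gn: "quad_growth 1 (\<lambda>x. (1 - cos (e n * x)) / (e n)\<^sup>2) (\<lambda>x. sin (e n * x) / e n) (\<lambda>x. cos (e n * x))" for n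
    unfolding quad_growth_def
  proof (intro conjI allI)
    fix x :: real
    have "(sin (e n * (x / 2)) / e n)\<^sup>2 \<le> (x / 2)\<^sup>2"
      using sin_abs_le[OF e(1), of n "x / 2"] by (simp only: abs_le_square_iff)
    then have "2 * (sin (e n * (x / 2)) / e n)\<^sup>2 \<le> 2 * (x / 2)\<^sup>2" by simp
    also have "\<dots> \<le> 1 + x\<^sup>2" by (simp add: power_divide)
    finally show "\<bar>(1 - cos (e n * x)) / (e n)\<^sup>2\<bar> \<le> 1 * (1 + x\<^sup>2)" unfolding half by simp
    show "\<bar>sin (e n * x) / e n\<bar> \<le> 1 * (1 + \<bar>x\<bar>)" using sin_abs_le[OF e(1), of n x] by simp
    show "\<bar>cos (e n * x)\<bar> \<le> 1" by simp
  qed simp_all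
  have "(\<lambda>n. defect (\<lambda>x. (1 - cos (e n * x)) / (e n)\<^sup>2) (\<lambda>x. sin (e n * x) / e n) (\<lambda>x. cos (e n * x))) \<longlonglongrightarrow> defect (\<lambda>x. x\<^sup>2 / 2) (\<lambda>x. x) (\<lambda>x. 1)"
  proof (rule defect_limit[OF gn g])
    fix x :: real
    have "(\<lambda>n. 2 * (sin (e n * (x / 2)) / e n)\<^sup>2) \<longlonglongrightarrow> 2 * (x / 2)\<^sup>2"
      unfolding e_def by (intro tendsto_intros sin_scaled_limit)
    then show "(\<lambda>n. (1 - cos (e n * x)) / (e n)\<^sup>2) \<longlonglongrightarrow> x\<^sup>2 / 2" unfolding half by (simp add: power_divide)
    show "(\<lambda>n. sin (e n * x) / e n) \<longlonglongrightarrow> x" unfolding e_def by (rule sin_scaled_limit)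
    have ex: "(\<lambda>n. e n * x) \<longlonglongrightarrow> 0" unfolding e_def by (rule scaled_to_zero)
    show "(\<lambda>n. cos (e n * x)) \<longlonglongrightarrow> 1" using tendsto_cos[OF ex] by simp
  qed
  then show "defect (\<lambda>x. x\<^sup>2 / 2) (\<lambda>x. x) (\<lambda>x. 1) = 0"
    unfolding defect_cos_scaled[OF e(1)] by (simp add: LIMSEQ_const_iff)
qed

text \<open>A double antiderivative of each cosine with value and slope 0 at 0: quadratic for
  frequency 0, otherwise a cosine with an affine correction. The normalisation is preserved by sums
  and multiples and lets prescribed initial data be added later.\<close>

lemma defect_trig_poly:
  assumes "trig_poly 1 h"
  shows "\<exists>C f f1. quad_growth C f f1 (\<lambda>x. h (\<lambda>_. x)) \<and> defect f f1 (\<lambda>x. h (\<lambda>_. x)) = 0 \<and> f 0 = 0 \<and> f1 0 = 0 \<and>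
    (\<forall>x. (f has_real_derivative f1 x) (at x)) \<and> (\<forall>x. (f1 has_real_derivative h (\<lambda>_. x)) (at x))"
  using assms
proof induction
  case (cos l b)
  define \<theta> where "\<theta> = l 0"
  have h: "(\<lambda>x. cos ((\<Sum>i<1. l i * x) + b)) = (\<lambda>x. cos (\<theta> * x + b))" by (simp add: \<theta>_def)
  show ?case
  proof (cases "\<theta> = 0")
    case True
    then have l0: "l 0 = 0" by (simp add: \<theta>_def)
    have "defect (\<lambda>x. cos b * (x\<^sup>2 / 2)) (\<lambda>x. cos b * x) (\<lambda>x. cos b) = 0"
      using defect_lin_zero[OF defect_square(1) defect_const(1) defect_square(2) defect_const(2), of "cos b" 0] by simp
    moreover have "quad_growth \<bar>cos b\<bar> (\<lambda>x. cos b * (x\<^sup>2 / 2)) (\<lambda>x. cos b * x) (\<lambda>x. cos b)"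
      using quad_growth_lin[OF defect_square(1) defect_const(1), of "cos b" 0] by simp
    moreover have "((\<lambda>x. cos b * (x\<^sup>2 / 2)) has_real_derivative cos b * x) (at x)"
      "((\<lambda>x. cos b * x) has_real_derivative cos b) (at x)" for x
      by (auto intro!: derivative_eq_intros)
    ultimately show ?thesis
      by (intro exI[of _ "\<bar>cos b\<bar>"] exI[of _ "\<lambda>x. cos b * (x\<^sup>2 / 2)"] exI[of _ "\<lambda>x. cos b * x"])
         (simp add: l0)
  next
    case False
    \<comment> \<open>\<open>- (sin b / \<theta>) * x\<close> cancels the slope at 0 and
      \<open>cos b / \<theta>^2\<close> the value there. The factors 1 and the zero terms reproduce
      the shape of two applications of \<open>defect_lin_zero\<close>, so that folding
      succeeds.\<close>
    define f where "f x = 1 * (- 1 / \<theta>\<^sup>2 * cos (\<theta> * x + b) + - (sin b / \<theta>) * x) + cos b / \<theta>\<^sup>2 * 1" for x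
    define f1 where "f1 x = 1 * (- 1 / \<theta>\<^sup>2 * (- \<theta> * sin (\<theta> * x + b)) + - (sin b / \<theta>) * 1) + cos b / \<theta>\<^sup>2 * 0" for x
    define f2 where "f2 x = 1 * (- 1 / \<theta>\<^sup>2 * (- \<theta>\<^sup>2 * cos (\<theta> * x + b)) + - (sin b / \<theta>) * 0) + cos b / \<theta>\<^sup>2 * 0" for x
    have f2: "f2 = (\<lambda>x. cos ((\<Sum>i<1. l i * x) + b))" unfolding h f2_def using False by auto
    note q1 = quad_growth_lin[OF quad_growth_cos[of \<theta> b] defect_id(1), of "- 1 / \<theta>\<^sup>2" "- (sin b / \<theta>)"]
    note d1 = defect_lin_zero[OF quad_growth_cos[of \<theta> b] defect_id(1) defect_cos defect_id(2), of "- 1 / \<theta>\<^sup>2" "- (sin b / \<theta>)"]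
    note q2 = quad_growth_lin[OF q1 defect_const(1), of 1 "cos b / \<theta>\<^sup>2", folded f_def[abs_def] f1_def[abs_def] f2_def[abs_def]]
    note d2 = defect_lin_zero[OF q1 defect_const(1) d1 defect_const(2), of 1 "cos b / \<theta>\<^sup>2", folded f_def[abs_def] f1_def[abs_def] f2_def[abs_def]]
    have "f 0 = 0" "f1 0 = 0" using False by (simp_all add: f_def f1_def power2_eq_square)
    moreover have "(f has_real_derivative f1 x) (at x)" "(f1 has_real_derivative f2 x) (at x)" for x
      unfolding f_def[abs_def] f1_def[abs_def] f2_def using False
      by (auto intro!: derivative_eq_intros simp: power2_eq_square)
    ultimately show ?thesis using q2 d2 unfolding f2[symmetric] by (metis f2)
  qed
next
  case (add g h)
  then obtain C f f1 D k k1 where f: "quad_growth C f f1 (\<lambda>x. g (\<lambda>_. x))" "defect f f1 (\<lambda>x. g (\<lambda>_. x)) = 0" "f 0 = 0" "f1 0 = 0"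
      "\<And>x. (f has_real_derivative f1 x) (at x)" "\<And>x. (f1 has_real_derivative g (\<lambda>_. x)) (at x)"
    and k: "quad_growth D k k1 (\<lambda>x. h (\<lambda>_. x))" "defect k k1 (\<lambda>x. h (\<lambda>_. x)) = 0" "k 0 = 0" "k1 0 = 0"
      "\<And>x. (k has_real_derivative k1 x) (at x)" "\<And>x. (k1 has_real_derivative h (\<lambda>_. x)) (at x)"
    by metis
  have "quad_growth (\<bar>1\<bar> * C + \<bar>1\<bar> * D) (\<lambda>x. f x + k x) (\<lambda>x. f1 x + k1 x) (\<lambda>x. g (\<lambda>_. x) + h (\<lambda>_. x))"
    using quad_growth_lin[OF f(1) k(1), of 1 1] by simp
  moreover have "defect (\<lambda>x. f x + k x) (\<lambda>x. f1 x + k1 x) (\<lambda>x. g (\<lambda>_. x) + h (\<lambda>_. x)) = 0"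
    using defect_lin_zero[OF f(1) k(1) f(2) k(2), of 1 1] by simp
  ultimately show ?case using f(3-6) k(3-6)
    by (intro exI[of _ "\<bar>1\<bar> * C + \<bar>1\<bar> * D"] exI[of _ "\<lambda>x. f x + k x"] exI[of _ "\<lambda>x. f1 x + k1 x"])
       (simp add: DERIV_add)
next
  case (scale g c)
  then obtain C f f1 where f: "quad_growth C f f1 (\<lambda>x. g (\<lambda>_. x))" "defect f f1 (\<lambda>x. g (\<lambda>_. x)) = 0" "f 0 = 0" "f1 0 = 0"
      "\<And>x. (f has_real_derivative f1 x) (at x)" "\<And>x. (f1 has_real_derivative g (\<lambda>_. x)) (at x)"
    by metis
  have "quad_growth (\<bar>c\<bar> * C + \<bar>0\<bar> * 1) (\<lambda>x. c * f x) (\<lambda>x. c * f1 x) (\<lambda>x. c * g (\<lambda>_. x))"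
    using quad_growth_lin[OF f(1) defect_const(1), of c 0] by simp
  moreover have "defect (\<lambda>x. c * f x) (\<lambda>x. c * f1 x) (\<lambda>x. c * g (\<lambda>_. x)) = 0"
    using defect_lin_zero[OF f(1) defect_const(1) f(2) defect_const(2), of c 0] by simp
  ultimately show ?case using f(3-6)
    by (intro exI[of _ "\<bar>c\<bar> * C + \<bar>0\<bar> * 1"] exI[of _ "\<lambda>x. c * f x"] exI[of _ "\<lambda>x. c * f1 x"])
       (simp add: DERIV_cmult)
qed

text \<open>\<open>f2\<close> is approximated by trigonometric polynomials in one variable, which
  are integrated twice with the initial data of \<open>f\<close>. An error
  \<open>1 / (n + 1)\<close> on the interval of radius \<open>n + 1\<close> gains at most a factor
  \<open>\<bar>x\<bar>\<close> with each integration, so the antiderivatives converge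
  pointwise.\<close>

lemma defect_C2:
  assumes d: "\<And>x. (f has_real_derivative f1 x) (at x)" "\<And>x. (f1 has_real_derivative f2 x) (at x)"
    and c: "continuous_on UNIV f2" and b: "\<And>x. \<bar>f2 x\<bar> \<le> B"
  shows "defect f f1 f2 = 0"
proof -
  define h where "h x = f2 (x 0)" for x :: "nat \<Rightarrow> real"
  have hc: "continuous_on UNIV h" unfolding h_def
    by (rule continuous_on_compose2[OF c continuous_on_product_coordinates]) simp
  have "\<exists>q. trig_poly 1 q \<and> (\<forall>x. \<bar>q x\<bar> \<le> B + 1 / real (Suc n)) \<and>
      (\<forall>x. (\<forall>i<1. \<bar>x i\<bar> \<le> real (Suc n)) \<longrightarrow> \<bar>h x - q x\<bar> < 1 / real (Suc n))" for n
    by (rule trig_poly_approx) (use hc b in \<open>auto simp: h_def\<close>)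
  then obtain q where q: "\<And>n. trig_poly 1 (q n)" "\<And>n x. \<bar>q n x\<bar> \<le> B + 1 / real (Suc n)"
      "\<And>n x. (\<forall>i<1. \<bar>x i\<bar> \<le> real (Suc n)) \<Longrightarrow> \<bar>h x - q n x\<bar> < 1 / real (Suc n)"
    by metis
  obtain D k k1 where k: "\<And>n. quad_growth (D n) (k n) (k1 n) (\<lambda>x. q n (\<lambda>_. x))" "\<And>n. defect (k n) (k1 n) (\<lambda>x. q n (\<lambda>_. x)) = 0"
      "\<And>n. k n 0 = 0" "\<And>n. k1 n 0 = 0" "\<And>n x. (k n has_real_derivative k1 n x) (at x)"
      "\<And>n x. (k1 n has_real_derivative q n (\<lambda>_. x)) (at x)"
    using defect_trig_poly[OF q(1)] by metis
  define g where "g n x = f 0 + f1 0 * x + k n x" for n x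
  define g1 where "g1 n x = f1 0 + k1 n x" for n x
  define g2 where "g2 n x = q n (\<lambda>_. x)" for n and x :: real
  have gd: "(g n has_real_derivative g1 n x) (at x)" "(g1 n has_real_derivative g2 n x) (at x)" for n x
    unfolding g_def[abs_def] g1_def[abs_def] g2_def using k(5,6) by (auto intro!: derivative_eq_intros)
  have g0: "g n 0 = f 0" "g1 n 0 = f1 0" for n using k(3,4) by (simp_all add: g_def g1_def)
  have g2b: "\<bar>g2 n x\<bar> \<le> B + 1" for n x
  proof -
    have "1 / real (Suc n) \<le> 1" by simp
    then show ?thesis using q(2)[of n "\<lambda>_. x"] unfolding g2_def by linarith
  qed
  have g2c: "continuous_on UNIV (g2 n)" for n
    unfolding g2_def
    by (rule continuous_on_compose2[OF trig_poly_continuous[OF q(1)]])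
       (auto intro!: continuous_on_coordinatewise_then_product continuous_on_id)
  have zero: "defect (g n) (g1 n) (g2 n) = 0" for n
  proof -
    have a: "defect (\<lambda>x. f 0 * 1 + f1 0 * x) (\<lambda>x. f 0 * 0 + f1 0 * 1) (\<lambda>x. f 0 * 0 + f1 0 * 0) = 0"
      by (rule defect_lin_zero[OF defect_const(1) defect_id(1) defect_const(2) defect_id(2)])
    have "defect (\<lambda>x. 1 * (f 0 * 1 + f1 0 * x) + 1 * k n x) (\<lambda>x. 1 * (f 0 * 0 + f1 0 * 1) + 1 * k1 n x)
        (\<lambda>x. 1 * (f 0 * 0 + f1 0 * 0) + 1 * q n (\<lambda>_. x)) = 0"
      by (rule defect_lin_zero[OF quad_growth_lin[OF defect_const(1) defect_id(1)] k(1) a k(2)])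
    then show ?thesis by (simp add: g_def[abs_def] g1_def[abs_def] g2_def[abs_def])
  qed
  have close: "\<bar>f2 y - g2 n y\<bar> \<le> 1 / real (Suc n)" if "\<bar>y\<bar> \<le> real (Suc n)" for n y
    using q(3)[of "\<lambda>_. y" n] that by (simp add: h_def g2_def less_imp_le)
  have close1: "\<bar>f1 x - g1 n x\<bar> \<le> 1 / real (Suc n) * \<bar>x\<bar>" if "\<bar>x\<bar> \<le> real (Suc n)" for n x
  proof -
    have "\<bar>(f1 x - g1 n x) - (f1 0 - g1 n 0)\<bar> \<le> 1 / real (Suc n) * \<bar>x\<bar>"
    proof (rule lipschitz_bound_real)
      show "((\<lambda>x. f1 x - g1 n x) has_real_derivative f2 y - g2 n y) (at y)" for y
        by (rule DERIV_diff[OF d(2) gd(2)])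
    qed (use close that in auto)
    then show ?thesis using g0 by simp
  qed
  have close0: "\<bar>f x - g n x\<bar> \<le> 1 / real (Suc n) * \<bar>x\<bar> * \<bar>x\<bar>" if x: "\<bar>x\<bar> \<le> real (Suc n)" for n x
  proof -
    have "\<bar>(f x - g n x) - (f 0 - g n 0)\<bar> \<le> 1 / real (Suc n) * \<bar>x\<bar> * \<bar>x\<bar>"
    proof (rule lipschitz_bound_real)
      show "((\<lambda>x. f x - g n x) has_real_derivative f1 y - g1 n y) (at y)" for y
        by (rule DERIV_diff[OF d(1) gd(1)])
      fix y assume y: "\<bar>y\<bar> \<le> \<bar>x\<bar>"
      have "1 / real (Suc n) * \<bar>y\<bar> \<le> 1 / real (Suc n) * \<bar>x\<bar>" using y by (intro mult_left_mono) auto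
      then show "\<bar>f1 y - g1 n y\<bar> \<le> 1 / real (Suc n) * \<bar>x\<bar>" using close1[of y n] y x by linarith
    qed
    then show ?thesis using g0 by simp
  qed
  have conv: "(\<lambda>n. u n) \<longlonglongrightarrow> v" if "\<And>n. \<bar>x\<bar> \<le> real (Suc n) \<Longrightarrow> \<bar>v - u n\<bar> \<le> 1 / real (Suc n) * c" for u v c and x :: real
  proof -
    obtain N where N: "\<bar>x\<bar> \<le> real N" using real_arch_simple by blast
    have "(\<lambda>n. u n - v) \<longlonglongrightarrow> 0"
    proof (rule Lim_null_comparison[OF _ scaled_to_zero[of c]])
      show "\<forall>\<^sub>F n in sequentially. norm (u n - v) \<le> 1 / real (Suc n) * c"
        by (rule eventually_sequentiallyI[of N])
           (use that N in \<open>simp add: abs_minus_commute del: of_nat_Suc\<close>)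
    qed
    then show ?thesis by (simp add: LIM_zero_iff)
  qed
  have b1: "\<bar>f2 x\<bar> \<le> B + 1" for x using b[of x] by linarith
  have "(\<lambda>n. defect (g n) (g1 n) (g2 n)) \<longlonglongrightarrow> defect f f1 f2"
  \<comment> \<open>\<open>B + 1\<close> bounds both \<open>f2\<close> and its approximations, and
    \<open>f 0\<close> and \<open>f1 0\<close> are the same for all of them; so one growth constant
    serves the sequence and its limit.\<close>
  proof (rule defect_limit[where C = "\<bar>f 0\<bar> + 2 * \<bar>f1 0\<bar> + 2 * (B + 1)"])
    show "quad_growth (\<bar>f 0\<bar> + 2 * \<bar>f1 0\<bar> + 2 * (B + 1)) (g n) (g1 n) (g2 n)" for n
      using C2_quad_growth[OF gd g2c g2b, of n] unfolding g0 .
    show "quad_growth (\<bar>f 0\<bar> + 2 * \<bar>f1 0\<bar> + 2 * (B + 1)) f f1 f2"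
      by (rule C2_quad_growth[OF d c b1])
    fix x
    show "(\<lambda>n. g n x) \<longlonglongrightarrow> f x" by (rule conv[of x "f x" "\<lambda>n. g n x" "\<bar>x\<bar> * \<bar>x\<bar>"]) (use close0 in \<open>simp only: mult.assoc\<close>)
    show "(\<lambda>n. g1 n x) \<longlonglongrightarrow> f1 x" by (rule conv[of x "f1 x" "\<lambda>n. g1 n x" "\<bar>x\<bar>"]) (rule close1)
    show "(\<lambda>n. g2 n x) \<longlonglongrightarrow> f2 x" by (rule conv[of x "f2 x" "\<lambda>n. g2 n x" 1]) (use close in \<open>simp only: mult_1_right\<close>)
  qed
  then show ?thesis unfolding zero by (simp add: LIMSEQ_const_iff)
qed

end
end

section \<open>Uniqueness of the Skorohod integral\<close>

text \<open>With an amplitude and a free phase the family is closed under partial derivatives: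
  differentiating multiplies by \<open>l i\<close> and advances the phase by \<open>pi / 2\<close>.
  Iterated derivatives are then covered by one induction.\<close>

lemma cos_linear_partial_deriv:
  assumes "i < n"
  shows "partial_deriv i (\<lambda>x. c * cos ((\<Sum>j<n. l j * x j) + b)) = (\<lambda>x. (c * l i) * cos ((\<Sum>j<n. l j * x j) + (b + pi / 2)))"
    and "((\<lambda>y. c * cos ((\<Sum>j<n. l j * (x(i := y)) j) + b)) has_real_derivative (c * l i) * cos ((\<Sum>j<n. l j * x j) + (b + pi / 2))) (at (x i))"
proof -
  have s: "(\<Sum>j<n. l j * (x(i := y)) j) = l i * y + (\<Sum>j\<in>{..<n} - {i}. l j * x j)" for x :: "nat \<Rightarrow> real" and y
  proof -
    have "(\<Sum>j<n. l j * (x(i := y)) j) = l i * (x(i := y)) i + (\<Sum>j\<in>{..<n} - {i}. l j * (x(i := y)) j)"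
      using assms by (intro sum.remove) auto
    also have "(\<Sum>j\<in>{..<n} - {i}. l j * (x(i := y)) j) = (\<Sum>j\<in>{..<n} - {i}. l j * x j)"
      by (intro sum.cong) auto
    finally show ?thesis by simp
  qed
  have d: "((\<lambda>y. c * cos ((\<Sum>j<n. l j * (x(i := y)) j) + b)) has_real_derivative (c * l i) * cos ((\<Sum>j<n. l j * x j) + (b + pi / 2))) (at (x i))" for x :: "nat \<Rightarrow> real"
  proof -
    have e: "(\<Sum>j<n. l j * x j) = l i * x i + (\<Sum>j\<in>{..<n} - {i}. l j * x j)" using s[of x "x i"] by simp
    have h: "cos (A + (b + pi / 2)) = - sin (A + b)" for A
      using cos_add[of "A + b" "pi / 2"] by (simp add: add.assoc)
    show ?thesis unfolding s e h
      by (auto intro!: derivative_eq_intros)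
  qed
  show "partial_deriv i (\<lambda>x. c * cos ((\<Sum>j<n. l j * x j) + b)) = (\<lambda>x. (c * l i) * cos ((\<Sum>j<n. l j * x j) + (b + pi / 2)))"
    unfolding partial_deriv_def by (rule ext, rule DERIV_imp_deriv, rule d)
  show "((\<lambda>y. c * cos ((\<Sum>j<n. l j * (x(i := y)) j) + b)) has_real_derivative (c * l i) * cos ((\<Sum>j<n. l j * x j) + (b + pi / 2))) (at (x i))"
    by (rule d)
qed

lemma cos_linear_Cb_infinity: "(\<lambda>x. cos ((\<Sum>j<n. l j * x j) + b)) \<in> Cb_infinity n"
proof -
  define g where "g x = cos ((\<Sum>j<n. l j * x j) + b)" for x :: "nat \<Rightarrow> real"
  have form: "\<exists>c b'. iter_partial_deriv is g = (\<lambda>x. c * cos ((\<Sum>j<n. l j * x j) + b'))" if "set is \<subseteq> {..<n}" for "is"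
    using that
  proof (induction "is")
    case Nil
    show ?case by (intro exI[of _ 1] exI[of _ b]) (simp add: g_def[abs_def])
  next
    case (Cons i "is")
    then obtain c b' where "iter_partial_deriv is g = (\<lambda>x. c * cos ((\<Sum>j<n. l j * x j) + b'))" by auto
    then show ?case using cos_linear_partial_deriv(1)[of i n c l b'] Cons.prems by auto
  qed
  have "continuous_on UNIV (iter_partial_deriv is g) \<and> bounded (range (iter_partial_deriv is g)) \<and>
      (\<forall>i<n. \<forall>x. (\<lambda>y. iter_partial_deriv is g (x(i := y))) differentiable (at (x i)))" if sub: "set is \<subseteq> {..<n}" for "is"
  proof -
    obtain c b' where f: "iter_partial_deriv is g = (\<lambda>x. c * cos ((\<Sum>j<n. l j * x j) + b'))" using form[OF sub] by blast
    have "continuous_on UNIV (\<lambda>x. c * cos ((\<Sum>j<n. l j * x j) + b'))"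
      by (intro continuous_intros continuous_on_product_coordinates)
    moreover have "bounded (range (\<lambda>x. c * cos ((\<Sum>j<n. l j * x j) + b')))"
      unfolding bounded_iff by (intro exI[of _ "\<bar>c\<bar>"]) (auto simp: abs_mult intro: mult_left_le)
    moreover have "(\<lambda>y. c * cos ((\<Sum>j<n. l j * (x(i := y)) j) + b')) differentiable (at (x i))" if "i < n" for i x
      using cos_linear_partial_deriv(2)[OF that, of c l x b'] real_differentiable_def by blast
    ultimately show ?thesis unfolding f by blast
  qed
  moreover have "g x = g y" if "\<forall>i<n. x i = y i" for x y
    unfolding g_def using that by (auto intro!: arg_cong[of _ _ cos] sum.cong)
  ultimately have "g \<in> Cb_infinity n" unfolding Cb_infinity_def by blast
  then show ?thesis by (simp add: g_def[abs_def])
qed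

text \<open>Indicators of \<open>{x\<^sub>i > a\<^sub>i}\<close> are limits of bounded continuous functions, which are limits of
  trigonometric polynomials.\<close>

context bifbm_setting
begin

lemma trig_orthogonal_imp_AE_zero:
  assumes D: "integrable \<Omega> D"
    and orth: "\<And>(n :: nat) s l b. (\<And>i. i < n \<Longrightarrow> s i \<in> {0..T}) \<Longrightarrow> (\<integral>\<omega>. cos ((\<Sum>i<n. l i * \<omega> (s i)) + b) * D \<omega> \<partial>\<Omega>) = 0"
  shows "AE \<omega> in \<Omega>. D \<omega> = 0"
proof -
  have meas: "(\<lambda>\<omega>. g (\<lambda>i. if i < n then \<omega> (s i) else 0)) \<in> borel_measurable \<Omega>"
    if "g \<in> borel_measurable borel" "\<And>i. i < n \<Longrightarrow> s i \<in> {0..T}" for g :: "(nat \<Rightarrow> real) \<Rightarrow> real" and n s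
  proof (rule measurable_compose[OF _ that(1)], rule measurable_coordinatewise_then_product)
    show "(\<lambda>\<omega>. if i < n then \<omega> (s i) else 0) \<in> borel_measurable \<Omega>" for i
      using coord_measurable[OF that(2)] by (cases "i < n") auto
  qed
  have bint: "integrable \<Omega> (\<lambda>\<omega>. h \<omega> * D \<omega>)" if "h \<in> borel_measurable \<Omega>" "\<And>\<omega>. \<bar>h \<omega>\<bar> \<le> B" for h and B :: real
    by (rule Bochner_Integration.integrable_bound[OF integrable_mult_right[OF D, of B]])
       (use that D in \<open>auto simp: abs_mult intro!: mult_right_mono order_trans[OF that(2) abs_ge_self]\<close>)
  have trig: "(\<integral>\<omega>. g (\<lambda>i. if i < n then \<omega> (s i) else 0) * D \<omega> \<partial>\<Omega>) = 0"
    if s: "\<And>i. i < n \<Longrightarrow> s i \<in> {0..T}" and g: "trig_poly n g" for g n s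
    using g
  proof induction
    case (cos l b)
    have "(\<Sum>i<n. l i * (if i < n then \<omega> (s i) else 0)) = (\<Sum>i<n. l i * \<omega> (s i))" for \<omega> :: "real \<Rightarrow> real"
      by (intro sum.cong) auto
    then show ?case using orth[of n s l b] s by simp
  next
    case (add g h)
    obtain B1 where B1: "\<And>x. \<bar>g x\<bar> \<le> B1" using trig_poly_bounded[OF add.hyps(1)] by blast
    obtain B2 where B2: "\<And>x. \<bar>h x\<bar> \<le> B2" using trig_poly_bounded[OF add.hyps(2)] by blast
    have "integrable \<Omega> (\<lambda>\<omega>. g (\<lambda>i. if i < n then \<omega> (s i) else 0) * D \<omega>)"
      "integrable \<Omega> (\<lambda>\<omega>. h (\<lambda>i. if i < n then \<omega> (s i) else 0) * D \<omega>)"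
      by (rule bint[OF meas[OF borel_measurable_continuous_onI[OF trig_poly_continuous[OF add.hyps(1)]] s] B1], assumption)
         (rule bint[OF meas[OF borel_measurable_continuous_onI[OF trig_poly_continuous[OF add.hyps(2)]] s] B2], assumption)
    then show ?case using add.IH by (simp add: distrib_right)
  qed (simp add: mult.assoc)
  have cont: "(\<integral>\<omega>. g (\<lambda>i. if i < n then \<omega> (s i) else 0) * D \<omega> \<partial>\<Omega>) = 0"
    if s: "\<And>i. i < n \<Longrightarrow> s i \<in> {0..T}"
      and g: "\<And>x y. (\<forall>i<n. x i = y i) \<Longrightarrow> g x = g y" "continuous_on UNIV g" "\<And>x. \<bar>g x\<bar> \<le> B" for g :: "(nat \<Rightarrow> real) \<Rightarrow> real" and n s and B :: real
  proof -
    obtain q where q: "\<And>k. trig_poly n (q k)" "\<And>k x. \<bar>q k x\<bar> \<le> B + 1" "\<And>x. (\<lambda>k. q k x) \<longlonglongrightarrow> g x"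
      by (rule trig_poly_approx_seq[OF g]) (assumption | blast)+
    have "(\<lambda>k. \<integral>\<omega>. q k (\<lambda>i. if i < n then \<omega> (s i) else 0) * D \<omega> \<partial>\<Omega>) \<longlonglongrightarrow> (\<integral>\<omega>. g (\<lambda>i. if i < n then \<omega> (s i) else 0) * D \<omega> \<partial>\<Omega>)"
    proof (rule integral_dominated_convergence[where w = "\<lambda>\<omega>. (B + 1) * \<bar>D \<omega>\<bar>"])
      show "(\<lambda>\<omega>. g (\<lambda>i. if i < n then \<omega> (s i) else 0) * D \<omega>) \<in> borel_measurable \<Omega>"
        by (intro borel_measurable_times meas borel_measurable_continuous_onI g(2) s borel_measurable_integrable[OF D])
      show "(\<lambda>\<omega>. q k (\<lambda>i. if i < n then \<omega> (s i) else 0) * D \<omega>) \<in> borel_measurable \<Omega>" for k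
        by (intro borel_measurable_times borel_measurable_integrable[OF D] meas[OF borel_measurable_continuous_onI[OF trig_poly_continuous[OF q(1)]] s])
      show "AE \<omega> in \<Omega>. (\<lambda>k. q k (\<lambda>i. if i < n then \<omega> (s i) else 0) * D \<omega>) \<longlonglongrightarrow> g (\<lambda>i. if i < n then \<omega> (s i) else 0) * D \<omega>"
        by (intro AE_I2 tendsto_mult tendsto_const q(3))
      show "AE \<omega> in \<Omega>. norm (q k (\<lambda>i. if i < n then \<omega> (s i) else 0) * D \<omega>) \<le> (B + 1) * \<bar>D \<omega>\<bar>" for k
        unfolding real_norm_def abs_mult by (intro AE_I2 mult_right_mono q(2)) simp
    qed (use D in simp)
    moreover have "(\<integral>\<omega>. q k (\<lambda>i. if i < n then \<omega> (s i) else 0) * D \<omega> \<partial>\<Omega>) = 0" for k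
      by (rule trig[OF s q(1)])
    ultimately show ?thesis by (simp add: LIMSEQ_const_iff)
  qed
  \<comment> \<open>These finite-dimensional events form the generator. Index lists of any length,
    with repetitions allowed, make intersections a matter of concatenation.\<close>
  define rect where "rect n s a = {\<omega> \<in> space P. \<forall>i<n. a i < \<omega> (s i)}" for n :: nat and s a :: "nat \<Rightarrow> real"
  define \<G> where "\<G> = {rect n s a | n s a. \<forall>i<n. s i \<in> {0..T}}"
  have coordP: "(\<lambda>\<omega>. \<omega> t) \<in> borel_measurable P" if "t \<in> {0..T}" for t by (rule coord_measurable_P[OF that])
  have rect_meas: "rect n s a \<in> sets P" if s: "\<And>i. i < n \<Longrightarrow> s i \<in> {0..T}" for n s a
  proof -
    have "rect n s a = space P \<inter> (\<Inter>i<n. {\<omega> \<in> space P. a i < \<omega> (s i)})" by (auto simp: rect_def)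
    also have "\<dots> \<in> sets P"
    proof (cases "n = 0")
      case False
      have "(\<Inter>i<n. {\<omega> \<in> space P. a i < \<omega> (s i)}) \<in> sets P"
        using False s coordP by (intro sets.finite_INT) (auto intro!: borel_measurable_less)
      then show ?thesis by (intro sets.Int) auto
    qed simp
    finally show ?thesis .
  qed
  have rect_zero: "(\<integral>\<omega>. indicator (rect n s a) \<omega> * D \<omega> \<partial>\<Omega>) = 0" if s: "\<And>i. i < n \<Longrightarrow> s i \<in> {0..T}" for n s a
  proof -
    \<comment> \<open>A ramp of slope \<open>k\<close> starting at \<open>a i\<close> in each
      coordinate. It increases to the indicator of the open half line, which is why strict
      inequalities define \<open>rect\<close>.\<close>
    define g where "g k x = (\<Prod>i<n. min 1 (max 0 (real k * (x i - a i))))" for k :: nat and x :: "nat \<Rightarrow> real"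
    have gb: "\<bar>g k x\<bar> \<le> 1" for k x
      unfolding g_def by (auto simp: abs_prod intro!: prod_le_1)
    have gc: "continuous_on UNIV (g k)" for k
      unfolding g_def by (intro continuous_intros continuous_on_product_coordinates)
    have gd: "g k x = g k y" if "\<forall>i<n. x i = y i" for k x y
      unfolding g_def using that by (intro prod.cong) auto
    have z: "(\<integral>\<omega>. g k (\<lambda>i. if i < n then \<omega> (s i) else 0) * D \<omega> \<partial>\<Omega>) = 0" for k
      by (rule cont[OF s gd gc gb])
    have one: "(\<lambda>k. min 1 (max 0 (real k * y))) \<longlonglongrightarrow> (if 0 < y then 1 else 0)" for y :: real
    proof (cases "0 < y")
      case True
      obtain N where N: "1 / y \<le> real N" using real_arch_simple by blast
      have "min 1 (max 0 (real k * y)) = 1" if "N \<le> k" for k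
      proof -
        have "1 / y \<le> real k" using N that by linarith
        then have "1 \<le> real k * y" using True by (simp add: field_simps)
        then show ?thesis by simp
      qed
      then have "\<forall>\<^sub>F k in sequentially. min 1 (max 0 (real k * y)) = 1" by (intro eventually_sequentiallyI[of N])
      then show ?thesis using True by (simp add: tendsto_eventually)
    next
      case False
      then have "real k * y \<le> 0" for k by (simp add: mult_nonneg_nonpos)
      then have "max 0 (real k * y) = 0" for k by (rule max_absorb1)
      then show ?thesis using False by simp
    qed
    have lim: "(\<lambda>k. g k (\<lambda>i. if i < n then \<omega> (s i) else 0)) \<longlonglongrightarrow> indicator (rect n s a) \<omega>" if w: "\<omega> \<in> space \<Omega>" for \<omega>
    proof -
      have "(\<lambda>k. g k (\<lambda>i. if i < n then \<omega> (s i) else 0)) \<longlonglongrightarrow> (\<Prod>i<n. if 0 < (if i < n then \<omega> (s i) else 0) - a i then 1 else 0)"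
        unfolding g_def by (intro tendsto_prod one)
      also have "(\<Prod>i<n. if 0 < (if i < n then \<omega> (s i) else 0) - a i then 1 else 0 :: real) = indicator (rect n s a) \<omega>"
      proof (cases "\<forall>i<n. a i < \<omega> (s i)")
        case True
        then show ?thesis using w by (simp add: rect_def indicator_def)
      next
        case False
        then obtain i where i: "i < n" "\<not> a i < \<omega> (s i)" by blast
        then have "(\<Prod>i<n. if 0 < (if i < n then \<omega> (s i) else 0) - a i then 1 else 0 :: real) = 0"
          by (intro prod_zero) (auto intro!: bexI[of _ i])
        then show ?thesis using False by (auto simp: rect_def indicator_def)
      qed
      finally show ?thesis .
    qed
    have "(\<lambda>k. \<integral>\<omega>. g k (\<lambda>i. if i < n then \<omega> (s i) else 0) * D \<omega> \<partial>\<Omega>) \<longlonglongrightarrow> (\<integral>\<omega>. indicator (rect n s a) \<omega> * D \<omega> \<partial>\<Omega>)"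
    proof (rule integral_dominated_convergence[where w = "\<lambda>\<omega>. 1 * \<bar>D \<omega>\<bar>"])
      have "rect n s a \<in> sets \<Omega>" using rect_meas[OF s] by (simp add: sets_completionI_sets)
      then show "(\<lambda>\<omega>. indicator (rect n s a) \<omega> * D \<omega>) \<in> borel_measurable \<Omega>"
        by (intro borel_measurable_times borel_measurable_indicator borel_measurable_integrable[OF D])
      show "(\<lambda>\<omega>. g k (\<lambda>i. if i < n then \<omega> (s i) else 0) * D \<omega>) \<in> borel_measurable \<Omega>" for k
        by (intro borel_measurable_times meas borel_measurable_continuous_onI gc s borel_measurable_integrable[OF D])
      show "AE \<omega> in \<Omega>. (\<lambda>k. g k (\<lambda>i. if i < n then \<omega> (s i) else 0) * D \<omega>) \<longlonglongrightarrow> indicator (rect n s a) \<omega> * D \<omega>"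
        by (intro AE_I2 tendsto_mult tendsto_const lim)
      show "AE \<omega> in \<Omega>. norm (g k (\<lambda>i. if i < n then \<omega> (s i) else 0) * D \<omega>) \<le> 1 * \<bar>D \<omega>\<bar>" for k
        unfolding real_norm_def abs_mult by (intro AE_I2 mult_right_mono gb) simp
    qed (use D in simp)
    then show ?thesis unfolding z by (simp add: LIMSEQ_const_iff)
  qed
  \<comment> \<open>The harder inclusion: the coordinates are measurable for the generated field,
    hence so is the identity into \<open>path_space T\<close>, and every event of \<open>P\<close>
    is its own preimage.\<close>
  have sig: "sets P = sigma_sets (space P) \<G>"
  proof
    show "sigma_sets (space P) \<G> \<subseteq> sets P"
      by (rule sets.sigma_sets_subset) (auto simp: \<G>_def intro!: rect_meas)
    define M' where "M' = sigma (space P) \<G>"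
    have G: "\<G> \<subseteq> Pow (space P)" by (auto simp: \<G>_def rect_def)
    have sM': "sets M' = sigma_sets (space P) \<G>" "space M' = space P"
      unfolding M'_def using G by simp_all
    have coordM: "(\<lambda>\<omega>. \<omega> t) \<in> borel_measurable M'" if t: "t \<in> {0..T}" for t
    proof (subst borel_measurable_iff_greater, rule allI)
      fix a
      have "{w \<in> space M'. a < w t} = rect 1 (\<lambda>_. t) (\<lambda>_. a)" unfolding sM'(2) rect_def by auto
      moreover have "rect 1 (\<lambda>_. t) (\<lambda>_. a) \<in> \<G>" unfolding \<G>_def using t by blast
      ultimately show "{w \<in> space M'. a < w t} \<in> sets M'" unfolding sM'(1) by (simp add: sigma_sets.Basic)
    qed
    have "(\<lambda>\<omega>. \<omega>) \<in> M' \<rightarrow>\<^sub>M path_space T"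
      unfolding path_space_def
    proof (rule measurable_restrict_space2)
      show "(\<lambda>\<omega>. \<omega>) \<in> space M' \<rightarrow> C0_paths T" using sM'(2) space_P by simp
      show "(\<lambda>\<omega>. \<omega>) \<in> M' \<rightarrow>\<^sub>M Pi\<^sub>M {0..T} (\<lambda>_. borel)"
        by (rule measurable_PiM_single')
           (use coordM sM'(2) space_P in \<open>auto simp: C0_paths_def PiE_def\<close>)
    qed
    then show "sets P \<subseteq> sigma_sets (space P) \<G>"
    proof (intro subsetI)
      fix A assume "(\<lambda>\<omega>. \<omega>) \<in> M' \<rightarrow>\<^sub>M path_space T" and A: "A \<in> sets P"
      then have "(\<lambda>\<omega>. \<omega>) -` A \<inter> space M' \<in> sets M'" using sets_P by (intro measurable_sets) auto
      moreover have "A \<subseteq> space P" using A sets.sets_into_space by blast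
      ultimately show "A \<in> sigma_sets (space P) \<G>" unfolding sM' by (simp add: Int_absorb2)
    qed
  qed
  have stable: "Int_stable \<G>"
  proof (rule Int_stableI)
    fix A B assume "A \<in> \<G>" "B \<in> \<G>"
    then obtain n s a m r b where A: "A = rect n s a" "\<forall>i<n. s i \<in> {0..T}" and B: "B = rect m r b" "\<forall>i<m. r i \<in> {0..T}"
      unfolding \<G>_def by blast
    define s' where "s' i = (if i < n then s i else r (i - n))" for i
    define a' where "a' i = (if i < n then a i else b (i - n))" for i
    have all: "(\<forall>i<n + m. Q (s' i) (a' i)) \<longleftrightarrow> (\<forall>i<n. Q (s i) (a i)) \<and> (\<forall>i<m. Q (r i) (b i))" for Q
    proof (intro iffI conjI allI impI)
      assume Q: "\<forall>i<n + m. Q (s' i) (a' i)"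
      show "Q (s i) (a i)" if "i < n" for i using Q[rule_format, of i] that by (simp add: s'_def a'_def)
      show "Q (r i) (b i)" if "i < m" for i using Q[rule_format, of "n + i"] that by (simp add: s'_def a'_def)
    next
      fix i assume Q: "(\<forall>i<n. Q (s i) (a i)) \<and> (\<forall>i<m. Q (r i) (b i))" and i: "i < n + m"
      show "Q (s' i) (a' i)"
      proof (cases "i < n")
        case True then show ?thesis using Q by (simp add: s'_def a'_def)
      next
        case False
        then have "i - n < m" using i by simp
        then show ?thesis using Q False by (simp add: s'_def a'_def)
      qed
    qed
    have "A \<inter> B = rect (n + m) s' a'"
      unfolding A(1) B(1) rect_def using all[of "\<lambda>t c. c < _ t"] by auto
    moreover have "\<forall>i<n + m. s' i \<in> {0..T}" using all[of "\<lambda>t c. t \<in> {0..T}"] A(2) B(2) by blast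
    ultimately show "A \<inter> B \<in> \<G>" unfolding \<G>_def by blast
  qed
  \<comment> \<open>The empty list of constraints gives the whole space; its integral is what the
    step for complements uses.\<close>
  have Dtot: "(\<integral>\<omega>. D \<omega> \<partial>\<Omega>) = 0"
  proof -
    have "(\<integral>\<omega>. indicator (rect 0 (\<lambda>_. 0) (\<lambda>_. 0)) \<omega> * D \<omega> \<partial>\<Omega>) = (\<integral>\<omega>. D \<omega> \<partial>\<Omega>)"
      by (rule Bochner_Integration.integral_cong) (auto simp: rect_def indicator_def)
    then show ?thesis using rect_zero[of 0 "\<lambda>_. 0" "\<lambda>_. 0"] by simp
  qed
  have iA: "integrable \<Omega> (\<lambda>\<omega>. indicator A \<omega> * D \<omega>)" if "A \<in> sets P" for A
    by (rule bint[OF borel_measurable_indicator[OF sets_completionI_sets[OF that]], of 1]) (simp add: indicator_def)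
  have zeroP: "(\<integral>\<omega>. indicator A \<omega> * D \<omega> \<partial>\<Omega>) = 0" if "A \<in> sets P" for A
  proof -
    have "\<G> \<subseteq> Pow (space P)" by (auto simp: \<G>_def rect_def)
    from stable this that[unfolded sig] show ?thesis
    proof (induction rule: sigma_sets_induct_disjoint)
      case (basic A)
      then show ?case unfolding \<G>_def using rect_zero by auto
    next
      case (compl A)
      have A: "A \<in> sets P" using compl(1) sig by simp
      have "(\<integral>\<omega>. indicator (space P - A) \<omega> * D \<omega> \<partial>\<Omega>) = (\<integral>\<omega>. D \<omega> - indicator A \<omega> * D \<omega> \<partial>\<Omega>)"
        by (rule Bochner_Integration.integral_cong) (auto simp: indicator_def)
      then show ?case using D iA[OF A] compl(2) Dtot by simp
    next
      case (union A)
      have A: "A i \<in> sets P" for i using union(2) sig by auto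
      have part: "(\<integral>\<omega>. indicator (\<Union>i<n. A i) \<omega> * D \<omega> \<partial>\<Omega>) = 0" for n
      proof (induction n)
        case (Suc n)
        have "A n \<inter> A i = {}" if "i < n" for i
          using union(1) that unfolding disjoint_family_on_def by (metis UNIV_I less_irrefl)
        then have "indicator (\<Union>i<Suc n. A i) \<omega> * D \<omega> = indicator (\<Union>i<n. A i) \<omega> * D \<omega> + indicator (A n) \<omega> * D \<omega>" for \<omega>
          by (auto simp: indicator_def less_Suc_eq)
        moreover have "(\<Union>i<n. A i) \<in> sets P" using A by auto
        ultimately show ?case using Suc.IH union(3)[of n] iA A by simp
      qed simp
      have "(\<lambda>n. \<integral>\<omega>. indicator (\<Union>i<n. A i) \<omega> * D \<omega> \<partial>\<Omega>) \<longlonglongrightarrow> (\<integral>\<omega>. indicator (\<Union>i. A i) \<omega> * D \<omega> \<partial>\<Omega>)"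
      proof (rule integral_dominated_convergence[where w = "\<lambda>\<omega>. 1 * \<bar>D \<omega>\<bar>"])
        have "(\<Union>i<n. A i) \<in> sets P" "(\<Union>i. A i) \<in> sets P" for n using A by auto
        then show "(\<lambda>\<omega>. indicator (\<Union>i<n. A i) \<omega> * D \<omega>) \<in> borel_measurable \<Omega>"
          "(\<lambda>\<omega>. indicator (\<Union>i. A i) \<omega> * D \<omega>) \<in> borel_measurable \<Omega>" for n
          using iA by (blast intro: borel_measurable_integrable)+
        show "AE \<omega> in \<Omega>. norm (indicator (\<Union>i<n. A i) \<omega> * D \<omega>) \<le> 1 * \<bar>D \<omega>\<bar>" for n
          by (intro AE_I2) (auto simp: indicator_def)
        show "AE \<omega> in \<Omega>. (\<lambda>n. indicator (\<Union>i<n. A i) \<omega> * D \<omega>) \<longlonglongrightarrow> indicator (\<Union>i. A i) \<omega> * D \<omega>"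
          by (intro AE_I2 tendsto_mult tendsto_const LIMSEQ_indicator_UN)
      qed (use D in simp)
      then show ?case unfolding part by (simp add: LIMSEQ_const_iff)
    qed simp
  qed
  show ?thesis
  proof (rule \<Omega>.density_zero[OF D])
    \<comment> \<open>An event of the completion differs from an event of \<open>P\<close> by a null
      set, which does not affect the integral.\<close>
    fix A assume "A \<in> sets \<Omega>"
    then obtain S N N' where A: "A = S \<union> N" "N \<subseteq> N'" "N' \<in> null_sets P" "S \<in> sets P"
      by (rule sets_completionE)
    have "AE \<omega> in P. \<omega> \<notin> N'" by (rule AE_not_in[OF A(3)])
    then have "AE \<omega> in \<Omega>. \<omega> \<notin> N'" by (rule AE_completion)
    then have "AE \<omega> in \<Omega>. indicator A \<omega> *\<^sub>R D \<omega> = indicator S \<omega> * D \<omega>"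
      by eventually_elim (use A in \<open>auto simp: indicator_def\<close>)
    then have "(\<integral>\<omega>. indicator A \<omega> *\<^sub>R D \<omega> \<partial>\<Omega>) = (\<integral>\<omega>. indicator S \<omega> * D \<omega> \<partial>\<Omega>)"
      by (intro integral_cong_AE borel_measurable_scaleR borel_measurable_indicator \<open>A \<in> sets \<Omega>\<close>
          borel_measurable_integrable[OF D] borel_measurable_integrable[OF iA[OF A(4)]])
    then show "set_lebesgue_integral \<Omega> A D = 0"
      unfolding set_lebesgue_integral_def using zeroP[OF A(4)] by simp
  qed
qed

end

section \<open>The Ito formula\<close>

context bifbm_setting
begin

lemma clamp_path_measurable:
  assumes h: "h \<in> borel_measurable borel" and w: "\<omega> \<in> space \<Omega>"
  shows "(\<lambda>s. h (\<omega> (clamp s)) :: real) \<in> borel_measurable borel"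
proof -
  have c: "continuous_on {0..T} \<omega>" using w by (simp add: space_P C0_paths_def)
  have "continuous_on UNIV clamp" unfolding clamp_def[abs_def] by (intro continuous_intros)
  then have "continuous_on UNIV (\<lambda>s. \<omega> (clamp s))"
    by (rule continuous_on_compose2[OF c]) (use clamp_range in auto)
  then show ?thesis by (intro measurable_compose[OF borel_measurable_continuous_onI h])
qed

lemma linear_growth_square: "(C * (1 + \<bar>x\<bar>))\<^sup>2 \<le> 2 * C\<^sup>2 * (1 + (x::real)\<^sup>2)"
proof -
  have "(1 + \<bar>x\<bar>)\<^sup>2 \<le> 2 * 1\<^sup>2 + 2 * \<bar>x\<bar>\<^sup>2" by (rule square_add_le)
  then have "C\<^sup>2 * (1 + \<bar>x\<bar>)\<^sup>2 \<le> C\<^sup>2 * (2 + 2 * x\<^sup>2)" by (intro mult_left_mono) simp_all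
  moreover have "C\<^sup>2 * (2 + 2 * x\<^sup>2) = 2 * C\<^sup>2 * (1 + x\<^sup>2)" by (simp add: algebra_simps)
  ultimately show ?thesis by (simp only: power_mult_distrib)
qed

text \<open>Linear growth of \<open>h\<close> and the bound on first absolute moments, uniform in
  time, in \<open>test_integrable\<close> give integrability on the product space. The second claim
  also provides measurability in \<open>\<omega>\<close> of time integrals.\<close>

lemma time_Fubini:
  fixes V :: "(real \<Rightarrow> real) \<Rightarrow> real" and h w :: "real \<Rightarrow> real"
  assumes V: "V \<in> borel_measurable \<Omega>" "\<And>\<omega>. \<bar>V \<omega>\<bar> \<le> 1" and h: "h \<in> borel_measurable borel" "\<And>x. \<bar>h x\<bar> \<le> C * (1 + \<bar>x\<bar>)"
    and w: "integrable lborel w"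
  shows "(\<integral>s. w s * (\<integral>\<omega>. V \<omega> * h (\<omega> (clamp s)) \<partial>\<Omega>) \<partial>lborel) = (\<integral>\<omega>. V \<omega> * (\<integral>s. w s * h (\<omega> (clamp s)) \<partial>lborel) \<partial>\<Omega>)"
    and "integrable \<Omega> (\<lambda>\<omega>. V \<omega> * (\<integral>s. w s * h (\<omega> (clamp s)) \<partial>lborel))"
proof -
  interpret pr: pair_sigma_finite lborel \<Omega> by unfold_locales
  have C: "0 \<le> C" using h(2)[of 0] by simp
  define F where "F s \<omega> = w s * (V \<omega> * h (\<omega> (clamp s)))" for s \<omega>
  have wm: "w \<in> borel_measurable borel" using w by auto
  have m: "(\<lambda>(s, \<omega>). F s \<omega>) \<in> borel_measurable (lborel \<Otimes>\<^sub>M \<Omega>)"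
  proof -
    have "sets (lborel \<Otimes>\<^sub>M \<Omega>) = sets (borel \<Otimes>\<^sub>M \<Omega>)" by (intro sets_pair_measure_cong) simp_all
    then have "borel_measurable (lborel \<Otimes>\<^sub>M \<Omega>) = (borel_measurable (borel \<Otimes>\<^sub>M \<Omega>) :: (real \<times> (real \<Rightarrow> real) \<Rightarrow> real) set)"
      by (intro measurable_cong_sets) simp_all
    moreover have "(\<lambda>(s, \<omega>). F s \<omega>) \<in> borel_measurable (borel \<Otimes>\<^sub>M \<Omega>)"
      unfolding case_prod_beta' F_def
      by (intro borel_measurable_times measurable_compose[OF measurable_fst wm] measurable_compose[OF measurable_snd V(1)]
          measurable_compose[OF coord_joint_measurable h(1)])
    ultimately show ?thesis by simp
  qed
  \<comment> \<open>Padding with zero functions brings \<open>h\<close> into the middle slot of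
    \<open>quad_growth\<close>, the one that allows linear growth.\<close>
  have qg: "quad_growth C (\<lambda>x. 0) h (\<lambda>x. 0)" unfolding quad_growth_def using h C by simp
  have i1: "integrable \<Omega> (\<lambda>\<omega>. V \<omega> * h (\<omega> (clamp s)))" for s
    by (rule test_integrable(2)[OF V V w clamp_range[of 0] V qg clamp_range])
  have Vabs: "(\<lambda>\<omega>. \<bar>V \<omega>\<bar>) \<in> borel_measurable \<Omega>" "\<And>\<omega>. \<bar>\<bar>V \<omega>\<bar>\<bar> \<le> 1" using V by simp_all
  have qa: "quad_growth C (\<lambda>x. 0) (\<lambda>x. \<bar>h x\<bar>) (\<lambda>x. 0)" unfolding quad_growth_def using h C by simp
  have bnd: "\<bar>\<integral>\<omega>. \<bar>V \<omega>\<bar> * \<bar>h (\<omega> (clamp s))\<bar> \<partial>\<Omega>\<bar> \<le> C * (2 + T powr p)" for s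
    by (rule test_integrable(4)[OF V V w clamp_range[of 0] Vabs qa clamp_range])
  have int: "integrable (lborel \<Otimes>\<^sub>M \<Omega>) (\<lambda>(s, \<omega>). F s \<omega>)"
  proof (rule pr.Fubini_integrable[OF m])
    have e: "(\<integral>\<omega>. norm (F s \<omega>) \<partial>\<Omega>) = \<bar>w s\<bar> * (\<integral>\<omega>. \<bar>V \<omega>\<bar> * \<bar>h (\<omega> (clamp s))\<bar> \<partial>\<Omega>)" for s
      unfolding F_def real_norm_def abs_mult by simp
    show "integrable lborel (\<lambda>s. \<integral>\<omega>. norm (case (s, \<omega>) of (s, \<omega>) \<Rightarrow> F s \<omega>) \<partial>\<Omega>)"
      unfolding prod.case e
    proof (rule Bochner_Integration.integrable_bound[OF integrable_mult_right[OF w, of "C * (2 + T powr p)"]])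
      show "(\<lambda>s. \<bar>w s\<bar> * (\<integral>\<omega>. \<bar>V \<omega>\<bar> * \<bar>h (\<omega> (clamp s))\<bar> \<partial>\<Omega>)) \<in> borel_measurable lborel"
        using test_measurable[OF V V w clamp_range[of 0] Vabs(1), of "\<lambda>x. \<bar>h x\<bar>"] h(1) wm by simp
      have nn: "0 \<le> C * (2 + T powr p)" using C by simp
      show "AE s in lborel. norm (\<bar>w s\<bar> * (\<integral>\<omega>. \<bar>V \<omega>\<bar> * \<bar>h (\<omega> (clamp s))\<bar> \<partial>\<Omega>)) \<le> norm (C * (2 + T powr p) * w s)"
      proof (rule AE_I2)
        fix s
        have "\<bar>w s\<bar> * \<bar>\<integral>\<omega>. \<bar>V \<omega>\<bar> * \<bar>h (\<omega> (clamp s))\<bar> \<partial>\<Omega>\<bar> \<le> \<bar>w s\<bar> * (C * (2 + T powr p))"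
          by (rule mult_left_mono[OF bnd]) simp
        also have "\<dots> = \<bar>C * (2 + T powr p)\<bar> * \<bar>w s\<bar>"
          unfolding abs_of_nonneg[OF nn] by (rule mult.commute)
        finally show "norm (\<bar>w s\<bar> * (\<integral>\<omega>. \<bar>V \<omega>\<bar> * \<bar>h (\<omega> (clamp s))\<bar> \<partial>\<Omega>)) \<le> norm (C * (2 + T powr p) * w s)"
          unfolding real_norm_def abs_mult[of "C * (2 + T powr p)"] abs_mult[of "\<bar>w s\<bar>"] abs_abs .
      qed
    qed
    show "AE s in lborel. integrable \<Omega> (\<lambda>\<omega>. case (s, \<omega>) of (s, \<omega>) \<Rightarrow> F s \<omega>)"
      unfolding prod.case F_def by (intro AE_I2 integrable_mult_right i1)
  qed
  have swap: "(\<integral>s. F s \<omega> \<partial>lborel) = V \<omega> * (\<integral>s. w s * h (\<omega> (clamp s)) \<partial>lborel)" for \<omega>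
    unfolding F_def mult.left_commute[of _ "V \<omega>"] by simp
  have "(\<integral>\<omega>. (\<integral>s. F s \<omega> \<partial>lborel) \<partial>\<Omega>) = (\<integral>s. (\<integral>\<omega>. F s \<omega> \<partial>\<Omega>) \<partial>lborel)"
    by (rule pr.Fubini_integral[OF int])
  then show "(\<integral>s. w s * (\<integral>\<omega>. V \<omega> * h (\<omega> (clamp s)) \<partial>\<Omega>) \<partial>lborel) = (\<integral>\<omega>. V \<omega> * (\<integral>s. w s * h (\<omega> (clamp s)) \<partial>lborel) \<partial>\<Omega>)"
    unfolding swap by (simp add: F_def)
  show "integrable \<Omega> (\<lambda>\<omega>. V \<omega> * (\<integral>s. w s * h (\<omega> (clamp s)) \<partial>lborel))"
    using pr.integrable_snd[OF int] unfolding swap .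
qed

text \<open>The candidate \<open>ito_rv\<close> grows quadratically in \<open>X_t\<close>, so its
  square integrability rests on the fourth moment.\<close>

lemma coord_fourth_moment:
  assumes t: "t \<in> {0..T}" shows "integrable \<Omega> (\<lambda>\<omega>. (\<omega> t) ^ 4)"
proof -
  note g = gspan_P[OF coord_gspan[OF t]]
  have m: "(\<lambda>\<omega>. (\<omega> t) ^ 4) \<in> borel_measurable P" using coord_measurable_P[OF t] by simp
  have "integrable P (\<lambda>\<omega>. (\<omega> t) ^ 4)"
    using g(1) unfolding gaussian_rv_def
  proof
    assume "\<exists>m. (\<lambda>\<omega>. \<omega> t) \<in> borel_measurable P \<and> (AE \<omega> in P. \<omega> t = m)"
    then obtain c where "AE \<omega> in P. \<omega> t = c" by blast
    then have "AE \<omega> in P. (\<omega> t) ^ 4 = c ^ 4" by eventually_elim simp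
    then show ?thesis using m by (subst integrable_cong_AE[of _ _ "\<lambda>_. c ^ 4"]) simp_all
  next
    assume "\<exists>m \<sigma>. 0 < \<sigma> \<and> distributed P lborel (\<lambda>\<omega>. \<omega> t) (\<lambda>x. ennreal (normal_density m \<sigma> x))"
    then obtain c \<sigma> where s: "0 < \<sigma>" and D: "distributed P lborel (\<lambda>\<omega>. \<omega> t) (\<lambda>x. ennreal (normal_density c \<sigma> x))" by blast
    have c: "c = 0" using P.normal_distributed_expectation[OF s D] g(2) by simp
    have "integrable lborel (\<lambda>x. normal_density 0 \<sigma> x * x ^ 4)" using integrable_normal_moment[OF s, of 0 4] by simp
    then show ?thesis
      using distributed_integrable[OF D, of "\<lambda>x. x ^ 4"] c by simp
  qed
  then show ?thesis by (simp add: integrable_completion m)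
qed

lemma inner_H_sum_left:
  assumes "\<And>i. i < n \<Longrightarrow> \<phi> i \<in> L1" "\<psi> \<in> Lbdd"
  shows "inner_H \<mu> (\<lambda>s. \<Sum>i<n. c i * \<phi> i s) \<psi> = (\<Sum>i<n. c i * inner_H \<mu> (\<phi> i) \<psi>)"
proof -
  have "(\<integral>z. (\<Sum>i<n. c i * \<phi> i (fst z)) * \<psi> (snd z) \<partial>M) = (\<Sum>i<n. c i * (\<integral>z. \<phi> i (fst z) * \<psi> (snd z) \<partial>M))" if M: "M \<in> {\<mu>p, \<mu>m}" for M
  proof -
    have "(\<integral>z. (\<Sum>i<n. c i * \<phi> i (fst z)) * \<psi> (snd z) \<partial>M) = (\<integral>z. (\<Sum>i<n. c i * (\<phi> i (fst z) * \<psi> (snd z))) \<partial>M)"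
      by (simp add: sum_distrib_right mult.assoc)
    also have "\<dots> = (\<Sum>i<n. \<integral>z. c i * (\<phi> i (fst z) * \<psi> (snd z)) \<partial>M)"
      by (rule Bochner_Integration.integral_sum) (simp add: L1_integrable[OF assms(1) assms(2) M])
    finally show ?thesis by simp
  qed
  then show ?thesis unfolding inner_H_eq by (simp add: sum_subtractf right_diff_distrib)
qed

lemma gaussian_space_sum:
  assumes "\<And>i. i < n \<Longrightarrow> Y i \<in> gaussian_space"
  shows "(\<lambda>\<omega>. \<Sum>i<(n::nat). l i * Y i \<omega>) \<in> gaussian_space"
  using assms
proof (induction n)
  case 0
  have "(\<lambda>\<omega>. 0) \<in> gspan" unfolding gspan_def by (auto intro!: exI[of _ "{}"])
  then show ?case using gspan_gaussian_space by auto
next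
  case (Suc n)
  then have "(\<lambda>\<omega>. 1 * (\<Sum>i<n. l i * Y i \<omega>) + l n * Y n \<omega>) \<in> gaussian_space"
    by (intro gaussian_space_lin) auto
  then show ?case by simp
qed

section \<open>The candidate for the Skorohod integral and its duality relation\<close>

context
  fixes f f' f'' :: "real \<Rightarrow> real" and t C :: real
  assumes f': "\<And>x. (f has_real_derivative f' x) (at x)" and f'': "\<And>x. (f' has_real_derivative f'' x) (at x)"
    and cont: "continuous_on UNIV f''" and bdd: "\<And>x. \<bar>f'' x\<bar> \<le> C" and growth: "quad_growth C f f' f''"
    and t: "t \<in> {0..T}"
begin

definition ito_rv :: "(real \<Rightarrow> real) \<Rightarrow> real" where
  "ito_rv \<omega> = f (\<omega> t) - f 0 - H * K * (LBINT s:{0..t}. f'' (\<omega> s) * s powr (p - 1))"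

abbreviation "integrand \<equiv> restrict_process t (\<lambda>s \<omega>. f' (\<omega> s))"

definition drift_weight :: "real \<Rightarrow> real" where "drift_weight s = indicator {0..t} s * s powr (p - 1)"

lemma drift_weight_integrable: "integrable lborel drift_weight"
proof (rule Bochner_Integration.integrable_bound[where f = "\<lambda>s. T powr (p - 1) * indicator {0..t} s"])
  have "integrable lborel (indicator {0..t} :: real \<Rightarrow> real)" by (rule integrable_real_indicator) (use t in simp_all)
  then show "integrable lborel (\<lambda>s. T powr (p - 1) * indicator {0..t} s)" by (rule integrable_mult_right)
  show "drift_weight \<in> borel_measurable lborel" unfolding drift_weight_def[abs_def] by simp
  have "s powr (p - 1) \<le> T powr (p - 1)" if "s \<in> {0..t}" for s using that t p_ge_1 by (intro powr_mono2) auto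
  then show "AE s in lborel. norm (drift_weight s) \<le> norm (T powr (p - 1) * indicator {0..t} s)"
    by (intro AE_I2) (auto simp: drift_weight_def indicator_def)
qed

lemma clamp_on: "s \<in> {0..t} \<Longrightarrow> clamp s = s" using t by (auto simp: clamp_def)

lemma ito_rv_eq: "ito_rv \<omega> = f (\<omega> t) - f 0 - H * K * (\<integral>s. drift_weight s * f'' (\<omega> (clamp s)) \<partial>lborel)"
proof -
  have "(LBINT s:{0..t}. f'' (\<omega> s) * s powr (p - 1)) = (\<integral>s. drift_weight s * f'' (\<omega> (clamp s)) \<partial>lborel)"
    unfolding set_lebesgue_integral_def drift_weight_def
    by (rule Bochner_Integration.integral_cong) (auto simp: indicator_def clamp_on)
  then show ?thesis by (simp add: ito_rv_def)
qed

lemma f_meas: "f \<in> borel_measurable borel" "f' \<in> borel_measurable borel" "f'' \<in> borel_measurable borel"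
  using quad_growthD[OF growth] by blast+

lemma drift_measurable: "(\<lambda>\<omega>. \<integral>s. drift_weight s * f'' (\<omega> (clamp s)) \<partial>lborel) \<in> borel_measurable \<Omega>"
proof -
  have "(\<lambda>\<omega>. 1 * (\<integral>s. drift_weight s * f'' (\<omega> (clamp s)) \<partial>lborel)) \<in> borel_measurable \<Omega>"
  proof (rule borel_measurable_integrable[OF time_Fubini(2)[OF _ _ f_meas(3) _ drift_weight_integrable]])
    show "\<bar>f'' x\<bar> \<le> C * (1 + \<bar>x\<bar>)" for x
      using bdd[of x] quad_growthD(7)[OF growth] mult_left_mono[of 1 "1 + \<bar>x\<bar>" C] by simp
  qed simp_all
  then show ?thesis by simp
qed

lemma ito_rv_L2: "ito_rv \<in> L2_rv \<Omega>"
proof -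
  define c1 where "c1 = H * K * (C * (\<integral>s. drift_weight s \<partial>lborel))"
  have C0: "0 \<le> C" by (rule quad_growthD(7)[OF growth])
  have w0: "0 \<le> drift_weight s" for s by (simp add: drift_weight_def)
  have db: "\<bar>\<integral>s. drift_weight s * f'' (\<omega> (clamp s)) \<partial>lborel\<bar> \<le> C * (\<integral>s. drift_weight s \<partial>lborel)" if w: "\<omega> \<in> space \<Omega>" for \<omega>
  proof -
    have b: "\<bar>drift_weight s * f'' (\<omega> (clamp s))\<bar> \<le> C * drift_weight s" for s
      using mult_left_mono[OF bdd[of "\<omega> (clamp s)"] w0[of s]] w0[of s] by (simp add: abs_mult mult.commute)
    have i: "integrable lborel (\<lambda>s. drift_weight s * f'' (\<omega> (clamp s)))"
      by (rule Bochner_Integration.integrable_bound[OF integrable_mult_right[OF drift_weight_integrable, of C]])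
         (use b clamp_path_measurable[OF f_meas(3) w] drift_weight_integrable in \<open>auto intro: order_trans[OF _ abs_ge_self]\<close>)
    have "\<bar>\<integral>s. drift_weight s * f'' (\<omega> (clamp s)) \<partial>lborel\<bar> \<le> (\<integral>s. \<bar>drift_weight s * f'' (\<omega> (clamp s))\<bar> \<partial>lborel)"
      by (rule integral_abs_bound)
    also have "\<dots> \<le> (\<integral>s. C * drift_weight s \<partial>lborel)"
      using i drift_weight_integrable b by (intro integral_mono) auto
    finally show ?thesis by simp
  qed
  have c1: "0 \<le> c1" unfolding c1_def using H K C0 w0 by (auto intro!: mult_nonneg_nonneg Bochner_Integration.integral_nonneg)
  \<comment> \<open>One \<open>C\<close> for \<open>f (\<omega> t)\<close>, one for
    \<open>f 0\<close>, and \<open>c1\<close> for the drift.\<close>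
  define D where "D = 2 * C + c1"
  have bound: "\<bar>ito_rv \<omega>\<bar> \<le> D * (1 + (\<omega> t)\<^sup>2)" if w: "\<omega> \<in> space \<Omega>" for \<omega>
  proof -
    have "\<bar>H * K * (\<integral>s. drift_weight s * f'' (\<omega> (clamp s)) \<partial>lborel)\<bar> \<le> c1"
      unfolding c1_def abs_mult[of "H * K"] using H K db[OF w] by (intro mult_mono) auto
    moreover have "\<bar>f (\<omega> t)\<bar> \<le> C * (1 + (\<omega> t)\<^sup>2)" "\<bar>f 0\<bar> \<le> C" using quad_growthD(4)[OF growth, of "\<omega> t"] quad_growthD(4)[OF growth, of 0] by simp_all
    moreover have "0 \<le> C * (\<omega> t)\<^sup>2" "0 \<le> c1 * (\<omega> t)\<^sup>2" using C0 c1 by simp_all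
    moreover have "D * (1 + (\<omega> t)\<^sup>2) = 2 * C + c1 + 2 * (C * (\<omega> t)\<^sup>2) + c1 * (\<omega> t)\<^sup>2" "C * (1 + (\<omega> t)\<^sup>2) = C + C * (\<omega> t)\<^sup>2"
      by (simp_all add: D_def algebra_simps)
    ultimately show ?thesis unfolding ito_rv_eq by linarith
  qed
  have m: "ito_rv \<in> borel_measurable \<Omega>"
    unfolding ito_rv_eq[abs_def] using drift_measurable measurable_compose[OF coord_measurable[OF t] f_meas(1)] by simp
  have "integrable \<Omega> (\<lambda>\<omega>. (ito_rv \<omega>)\<^sup>2)"
  proof (rule Bochner_Integration.integrable_bound)
    have "integrable \<Omega> (\<lambda>\<omega>. D\<^sup>2 * (1 + 2 * (\<omega> t)\<^sup>2 + (\<omega> t) ^ 4))"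
      using coord_fourth_moment[OF t] coord_L2[OF t] by (simp add: L2_rv_def)
    moreover have "(D * (1 + x\<^sup>2))\<^sup>2 = D\<^sup>2 * (1 + 2 * x\<^sup>2 + x ^ 4)" for x :: real
      by (simp add: power2_eq_square power4_eq_xxxx algebra_simps)
    ultimately show "integrable \<Omega> (\<lambda>\<omega>. (D * (1 + (\<omega> t)\<^sup>2))\<^sup>2)" by simp
    have "(ito_rv \<omega>)\<^sup>2 \<le> (D * (1 + (\<omega> t)\<^sup>2))\<^sup>2" if "\<omega> \<in> space \<Omega>" for \<omega>
      using power_mono[OF bound[OF that], of 2] by simp
    then show "AE \<omega> in \<Omega>. norm ((ito_rv \<omega>)\<^sup>2) \<le> norm ((D * (1 + (\<omega> t)\<^sup>2))\<^sup>2)" by (intro AE_I2) simp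
  qed (use m in simp)
  then show ?thesis using m by (simp add: L2_rv_def)
qed

lemma integrand_eq: "integrand s \<omega> = indicator {0..t} s * f' (\<omega> (clamp s))"
  by (auto simp: restrict_process_def indicator_def clamp_on)

lemma integrand_Lbdd:
  assumes w: "\<omega> \<in> space \<Omega>" shows "(\<lambda>s. integrand s \<omega>) \<in> Lbdd"
proof -
  have c: "continuous_on {0..T} \<omega>" using w by (simp add: space_P C0_paths_def)
  then obtain B where B: "\<And>s. s \<in> {0..T} \<Longrightarrow> \<bar>\<omega> s\<bar> \<le> B"
    using compact_imp_bounded[OF compact_continuous_image[OF c compact_Icc]] unfolding bounded_iff by (metis imageI real_norm_def)
  have C0: "0 \<le> C" by (rule quad_growthD(7)[OF growth])
  have "(\<lambda>s. integrand s \<omega>) \<in> brl"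
    unfolding integrand_eq using clamp_path_measurable[OF f_meas(2) w] by (intro measurable_restrict_space1) simp
  moreover have "\<bar>integrand s \<omega>\<bar> \<le> C * (1 + B)" for s
  proof -
    have "\<bar>f' (\<omega> (clamp s))\<bar> \<le> C * (1 + \<bar>\<omega> (clamp s)\<bar>)" by (rule quad_growthD(5)[OF growth])
    also have "\<dots> \<le> C * (1 + B)" using B[OF clamp_range] C0 by (intro mult_left_mono) auto
    finally show ?thesis unfolding integrand_eq using order_trans[OF abs_ge_zero] by (auto simp: indicator_def)
  qed
  ultimately show ?thesis unfolding Lbdd_def by blast
qed

text \<open>One density \<open>k\<close> represents two things: through indicators it gives the
  covariance of \<open>W \<phi>\<close> with the coordinates, and it gives the pairing of
  \<open>\<phi>\<close> with the integrand. This links the duality relation to the computation with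
  exponentials.\<close>

lemma integrand_pairing:
  assumes \<phi>: "\<phi> \<in> L1"
  obtains k where "integrable lborel k"
    "\<And>s. s \<in> {0..T} \<Longrightarrow> inner_H \<mu> \<phi> (indicator {0..s}) = (LBINT r:{0..s}. k r)"
    "\<And>\<omega>. \<omega> \<in> space \<Omega> \<Longrightarrow> inner_H \<mu> \<phi> (\<lambda>s. integrand s \<omega>) = (\<integral>s. (indicator {0..t} s * k s) * f' (\<omega> (clamp s)) \<partial>lborel)"
proof -
  obtain k where k: "integrable lborel k" "\<And>\<psi>. \<psi> \<in> Lbdd \<Longrightarrow> inner_H \<mu> \<phi> \<psi> = (LBINT s:{0..T}. k s * \<psi> s)"
    by (rule inner_H_density[OF \<phi>]) (assumption | blast)+
  show thesis
  proof (rule that[OF k(1)])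
    show "inner_H \<mu> \<phi> (indicator {0..s}) = (LBINT r:{0..s}. k r)" if "s \<in> {0..T}" for s
      unfolding k(2)[OF ind_Lbdd] set_lebesgue_integral_def
      by (rule Bochner_Integration.integral_cong) (use that in \<open>auto simp: indicator_def\<close>)
    show "inner_H \<mu> \<phi> (\<lambda>s. integrand s \<omega>) = (\<integral>s. (indicator {0..t} s * k s) * f' (\<omega> (clamp s)) \<partial>lborel)" if w: "\<omega> \<in> space \<Omega>" for \<omega>
      unfolding k(2)[OF integrand_Lbdd[OF w]] set_lebesgue_integral_def
      unfolding integrand_eq
      by (rule Bochner_Integration.integral_cong) (use t in \<open>auto simp: indicator_def\<close>)
  qed
qed

lemma f'_growth: "\<bar>f' x\<bar> \<le> C * (1 + \<bar>x\<bar>)" by (rule quad_growthD(5)[OF growth])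

lemma f''_growth: "\<bar>f'' x\<bar> \<le> C * (1 + \<bar>x\<bar>)"
  using bdd[of x] quad_growthD(7)[OF growth] mult_left_mono[of 1 "1 + \<bar>x\<bar>" C] by simp

lemma indicator_mult_integrable: "integrable lborel k \<Longrightarrow> integrable lborel (\<lambda>s. indicator {0..t} s * k s :: real)"
  using integrable_mult_indicator[of "{0..t}" lborel k] by simp

text \<open>For a cosine of a linear combination of the \<open>W (\<phi> i)\<close> the claim is
  \<open>defect_C2\<close> after exchanging time integral and expectation.
  \<open>integration_by_parts_extend\<close> lifts it to \<open>Cb_infinity\<close>, with
  \<open>A i\<close> the pairing of \<open>\<phi> i\<close> with the integrand.\<close>

lemma weak_ito_formula:
  assumes \<phi>: "\<And>i. i < n \<Longrightarrow> \<phi> i \<in> L_mu T \<mu>" and g: "g \<in> Cb_infinity n"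
  shows "(\<integral>\<omega>. cyl W g \<phi> \<omega> * ito_rv \<omega> \<partial>\<Omega>) = (\<integral>\<omega>. inner_H \<mu> (\<lambda>s. cyl_deriv W n g \<phi> s \<omega>) (\<lambda>s. integrand s \<omega>) \<partial>\<Omega>)"
proof -
  have \<phi>1: "\<phi> i \<in> L1" if "i < n" for i using \<phi>[OF that] L_mu_L1 by blast
  have "\<forall>i. \<exists>k. i < n \<longrightarrow> integrable lborel k \<and> (\<forall>s\<in>{0..T}. inner_H \<mu> (\<phi> i) (indicator {0..s}) = (LBINT r:{0..s}. k r)) \<and>
      (\<forall>\<omega>\<in>space \<Omega>. inner_H \<mu> (\<phi> i) (\<lambda>s. integrand s \<omega>) = (\<integral>s. (indicator {0..t} s * k s) * f' (\<omega> (clamp s)) \<partial>lborel))"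
  proof
    fix i
    show "\<exists>k. i < n \<longrightarrow> integrable lborel k \<and> (\<forall>s\<in>{0..T}. inner_H \<mu> (\<phi> i) (indicator {0..s}) = (LBINT r:{0..s}. k r)) \<and>
      (\<forall>\<omega>\<in>space \<Omega>. inner_H \<mu> (\<phi> i) (\<lambda>s. integrand s \<omega>) = (\<integral>s. (indicator {0..t} s * k s) * f' (\<omega> (clamp s)) \<partial>lborel))"
    proof (cases "i < n")
      case True
      show ?thesis by (rule integrand_pairing[OF \<phi>1[OF True]]) blast
    qed simp
  qed
  then obtain k where k: "\<And>i. i < n \<Longrightarrow> integrable lborel (k i)"
    "\<And>i s. i < n \<Longrightarrow> s \<in> {0..T} \<Longrightarrow> inner_H \<mu> (\<phi> i) (indicator {0..s}) = (LBINT r:{0..s}. k i r)"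
    "\<And>i \<omega>. i < n \<Longrightarrow> \<omega> \<in> space \<Omega> \<Longrightarrow> inner_H \<mu> (\<phi> i) (\<lambda>s. integrand s \<omega>) = (\<integral>s. (indicator {0..t} s * k i s) * f' (\<omega> (clamp s)) \<partial>lborel)"
    unfolding choice_iff by blast
  \<comment> \<open>From \<open>n\<close> on nothing is known of \<open>\<phi> i\<close>, so
    \<open>W (\<phi> i)\<close> might fail to be measurable; \<open>G\<close> is set to 0
    there.\<close>
  define G where "G i = (if i < n then W (\<phi> i) else (\<lambda>_. 0))" for i
  define A where "A i \<omega> = (\<integral>s. (indicator {0..t} s * k i s) * f' (\<omega> (clamp s)) \<partial>lborel)" for i \<omega>
  have Gm: "G i \<in> borel_measurable \<Omega>" for i
    using L2_rv_measurable[OF W_L2[OF \<phi>]] by (simp add: G_def)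
  have kw: "integrable lborel (\<lambda>s. indicator {0..t} s * k i s)" if "i < n" for i
    by (rule indicator_mult_integrable[OF k(1)[OF that]])
  have Ai: "integrable \<Omega> (A i)" if "i < n" for i
    using time_Fubini(2)[OF _ _ f_meas(2) f'_growth kw[OF that], of "\<lambda>_. 1"] by (simp add: A_def[abs_def])
  have Zi: "integrable \<Omega> ito_rv" by (rule \<Omega>.L2_rv_integrable[OF ito_rv_L2])
  have trig: "(\<integral>\<omega>. cos ((\<Sum>i<n. l i * G i \<omega>) + b) * ito_rv \<omega> \<partial>\<Omega>) =
      (\<Sum>j<n. \<integral>\<omega>. - l j * sin ((\<Sum>i<n. l i * G i \<omega>) + b) * A j \<omega> \<partial>\<Omega>)" for l b
  proof -
    define \<Gamma> where "\<Gamma> \<omega> = (\<Sum>i<n. l i * W (\<phi> i) \<omega>)" for \<omega>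
    \<comment> \<open>Densities are linear in \<open>\<phi>\<close>: the coefficients that form
      \<open>\<Gamma>\<close> also form the density of its covariance with the coordinates.\<close>
    define \<kappa> where "\<kappa> r = (\<Sum>i<n. l i * k i r)" for r
    have G\<Gamma>: "(\<Sum>i<n. l i * G i \<omega>) = \<Gamma> \<omega>" for \<omega> by (simp add: \<Gamma>_def G_def)
    have \<Gamma>: "\<Gamma> \<in> gaussian_space" unfolding \<Gamma>_def[abs_def] by (rule gaussian_space_sum[OF W_facts(1)[OF \<phi>]])
    have \<kappa>: "integrable lborel \<kappa>" unfolding \<kappa>_def[abs_def] using k(1) by (intro Bochner_Integration.integrable_sum) auto
    have cov\<Gamma>: "(\<integral>\<omega>. \<Gamma> \<omega> * \<omega> s \<partial>\<Omega>) = (LBINT r:{0..s}. \<kappa> r)" if s: "s \<in> {0..T}" for s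
    proof -
      have "(\<integral>\<omega>. \<Gamma> \<omega> * \<omega> s \<partial>\<Omega>) = (\<integral>\<omega>. (\<Sum>i<n. l i * (W (\<phi> i) \<omega> * \<omega> s)) \<partial>\<Omega>)"
        by (simp add: \<Gamma>_def sum_distrib_right mult.assoc)
      also have "\<dots> = (\<Sum>i<n. \<integral>\<omega>. l i * (W (\<phi> i) \<omega> * \<omega> s) \<partial>\<Omega>)"
        by (rule Bochner_Integration.integral_sum) (simp add: L2_rv_mult[OF W_L2[OF \<phi>] coord_L2[OF s]])
      also have "\<dots> = (\<Sum>i<n. l i * (LBINT r:{0..s}. k i r))"
        by (rule sum.cong) (simp_all add: W_facts(2)[OF \<phi> s] k(2)[OF _ s])
      also have "\<dots> = (\<Sum>i<n. \<integral>r. l i * (indicator {0..s} r * k i r) \<partial>lborel)"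
        by (simp add: set_lebesgue_integral_def)
      also have "\<dots> = (\<integral>r. (\<Sum>i<n. l i * (indicator {0..s} r * k i r)) \<partial>lborel)"
      proof (rule Bochner_Integration.integral_sum[symmetric])
        fix i assume "i \<in> {..<n}"
        then show "integrable lborel (\<lambda>r. l i * (indicator {0..s} r * k i r))"
          using integrable_mult_indicator[OF _ k(1)[of i], of "{0..s}"] by simp
      qed
      also have "\<dots> = (LBINT r:{0..s}. \<kappa> r)"
        unfolding set_lebesgue_integral_def \<kappa>_def
        by (rule Bochner_Integration.integral_cong) (simp_all add: sum_distrib_left algebra_simps)
      finally show ?thesis .
    qed
    have Fm: "(\<lambda>\<omega>. cos (\<Gamma> \<omega> + b)) \<in> borel_measurable \<Omega>" "(\<lambda>\<omega>. - sin (\<Gamma> \<omega> + b)) \<in> borel_measurable \<Omega>"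
      by (rule F_meas[OF \<Gamma> \<kappa> t cov\<Gamma>], assumption)+
    have F1: "\<bar>cos (\<Gamma> \<omega> + b)\<bar> \<le> 1" "\<bar>- sin (\<Gamma> \<omega> + b)\<bar> \<le> 1" for \<omega> by simp_all
    have zero: "ito_defect (\<lambda>\<omega>. cos (\<Gamma> \<omega> + b)) (\<lambda>\<omega>. - sin (\<Gamma> \<omega> + b)) \<kappa> t f f' f'' = 0"
      by (rule defect_C2[OF \<Gamma> \<kappa> t cov\<Gamma> f' f'' cont bdd])
    have I2: "(\<integral>s. indicator {0..t} s * ((\<integral>\<omega>. cos (\<Gamma> \<omega> + b) * f'' (\<omega> (clamp s)) \<partial>\<Omega>) * s powr (p - 1)) \<partial>lborel) =
        (\<integral>\<omega>. cos (\<Gamma> \<omega> + b) * (\<integral>s. drift_weight s * f'' (\<omega> (clamp s)) \<partial>lborel) \<partial>\<Omega>)"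
      unfolding time_Fubini(1)[OF Fm(1) F1(1) f_meas(3) f''_growth drift_weight_integrable, symmetric]
      by (rule Bochner_Integration.integral_cong) (simp_all add: drift_weight_def)
    have I1: "(\<integral>s. indicator {0..t} s * ((\<integral>\<omega>. - sin (\<Gamma> \<omega> + b) * f' (\<omega> (clamp s)) \<partial>\<Omega>) * \<kappa> s) \<partial>lborel) =
        (\<integral>\<omega>. - sin (\<Gamma> \<omega> + b) * (\<integral>s. (indicator {0..t} s * \<kappa> s) * f' (\<omega> (clamp s)) \<partial>lborel) \<partial>\<Omega>)"
      unfolding time_Fubini(1)[OF Fm(2) F1(2) f_meas(2) f'_growth indicator_mult_integrable[OF \<kappa>], symmetric]
      by (rule Bochner_Integration.integral_cong) (simp_all only: refl ac_simps)
    \<comment> \<open>Pathwise linearity of the time integral in \<open>\<kappa>\<close> splits the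
      term into one summand per \<open>\<phi> j\<close>; boundedness of \<open>f'\<close> along a
      continuous path makes each integrand integrable.\<close>
    have S: "(\<integral>\<omega>. - sin (\<Gamma> \<omega> + b) * (\<integral>s. (indicator {0..t} s * \<kappa> s) * f' (\<omega> (clamp s)) \<partial>lborel) \<partial>\<Omega>) =
        (\<Sum>j<n. \<integral>\<omega>. - l j * sin (\<Gamma> \<omega> + b) * A j \<omega> \<partial>\<Omega>)"
    proof -
      have "(\<integral>s. (indicator {0..t} s * \<kappa> s) * f' (\<omega> (clamp s)) \<partial>lborel) = (\<Sum>j<n. l j * A j \<omega>)" if w: "\<omega> \<in> space \<Omega>" for \<omega>
      proof -
        obtain B where B: "\<And>s. \<bar>f' (\<omega> (clamp s))\<bar> \<le> B"
        proof -
          have c: "continuous_on {0..T} \<omega>" using w by (simp add: space_P C0_paths_def)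
          then obtain B0 where B0: "\<And>s. s \<in> {0..T} \<Longrightarrow> \<bar>\<omega> s\<bar> \<le> B0"
            using compact_imp_bounded[OF compact_continuous_image[OF c compact_Icc]] unfolding bounded_iff by (metis imageI real_norm_def)
          have "\<bar>f' (\<omega> (clamp s))\<bar> \<le> C * (1 + B0)" for s
            by (rule order_trans[OF f'_growth]) (use B0[OF clamp_range] quad_growthD(7)[OF growth] in \<open>intro mult_left_mono; simp\<close>)
          then show thesis using that by blast
        qed
        have i: "integrable lborel (\<lambda>s. (indicator {0..t} s * k j s) * f' (\<omega> (clamp s)))" if "j < n" for j
        proof (rule Bochner_Integration.integrable_bound[OF integrable_mult_right[OF kw[OF that], of B]])
          show "(\<lambda>s. (indicator {0..t} s * k j s) * f' (\<omega> (clamp s))) \<in> borel_measurable lborel"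
            by (rule borel_measurable_times[OF borel_measurable_integrable[OF kw[OF that]]])
               (simp add: clamp_path_measurable[OF f_meas(2) w])
          show "AE s in lborel. norm ((indicator {0..t} s * k j s) * f' (\<omega> (clamp s))) \<le> norm (B * (indicator {0..t} s * k j s))"
          proof (rule AE_I2)
            fix s
            have "\<bar>f' (\<omega> (clamp s))\<bar> \<le> \<bar>B\<bar>" by (rule order_trans[OF B abs_ge_self])
            then have "\<bar>f' (\<omega> (clamp s))\<bar> * \<bar>indicator {0..t} s * k j s\<bar> \<le> \<bar>B\<bar> * \<bar>indicator {0..t} s * k j s\<bar>" by (rule mult_right_mono) simp
            then show "norm ((indicator {0..t} s * k j s) * f' (\<omega> (clamp s))) \<le> norm (B * (indicator {0..t} s * k j s))"
              by (simp only: real_norm_def abs_mult[of B] abs_mult[of _ "f' (\<omega> (clamp s))"] mult.commute[of _ "\<bar>f' (\<omega> (clamp s))\<bar>"])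
          qed
        qed
        have "(\<integral>s. (indicator {0..t} s * \<kappa> s) * f' (\<omega> (clamp s)) \<partial>lborel) = (\<integral>s. (\<Sum>j<n. l j * ((indicator {0..t} s * k j s) * f' (\<omega> (clamp s)))) \<partial>lborel)"
          by (rule Bochner_Integration.integral_cong) (simp_all add: \<kappa>_def sum_distrib_left sum_distrib_right ac_simps)
        also have "\<dots> = (\<Sum>j<n. \<integral>s. l j * ((indicator {0..t} s * k j s) * f' (\<omega> (clamp s))) \<partial>lborel)"
          by (rule Bochner_Integration.integral_sum) (simp add: i)
        finally show ?thesis by (simp only: A_def integral_mult_right_zero)
      qed
      then have "(\<integral>\<omega>. - sin (\<Gamma> \<omega> + b) * (\<integral>s. (indicator {0..t} s * \<kappa> s) * f' (\<omega> (clamp s)) \<partial>lborel) \<partial>\<Omega>) =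
          (\<integral>\<omega>. (\<Sum>j<n. - l j * sin (\<Gamma> \<omega> + b) * A j \<omega>) \<partial>\<Omega>)"
        by (intro Bochner_Integration.integral_cong[OF refl]) (simp add: sum_distrib_left ac_simps)
      also have "\<dots> = (\<Sum>j<n. \<integral>\<omega>. - l j * sin (\<Gamma> \<omega> + b) * A j \<omega> \<partial>\<Omega>)"
      proof (rule Bochner_Integration.integral_sum)
        fix j assume "j \<in> {..<n}"
        then have j: "j < n" by simp
        have "integrable \<Omega> (\<lambda>\<omega>. - sin (\<Gamma> \<omega> + b) * (\<integral>s. (indicator {0..t} s * k j s) * f' (\<omega> (clamp s)) \<partial>lborel))"
          by (rule time_Fubini(2)[OF Fm(2) F1(2) f_meas(2) f'_growth kw[OF j]])
        then have "integrable \<Omega> (\<lambda>\<omega>. l j * (- sin (\<Gamma> \<omega> + b) * A j \<omega>))" unfolding A_def by (rule integrable_mult_right)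
        then show "integrable \<Omega> (\<lambda>\<omega>. - l j * sin (\<Gamma> \<omega> + b) * A j \<omega>)" by (simp add: mult.assoc)
      qed
      finally show ?thesis .
    qed
    have i1: "integrable \<Omega> (\<lambda>\<omega>. cos (\<Gamma> \<omega> + b) * (f (\<omega> t) - f 0))"
    proof -
      have "integrable \<Omega> (\<lambda>\<omega>. cos (\<Gamma> \<omega> + b) * f (\<omega> t))"
        by (rule test_integrable(1)[OF Fm(1) F1(1) Fm(2) F1(2) \<kappa> t Fm(1) F1(1) growth t])
      moreover have "integrable \<Omega> (\<lambda>\<omega>. cos (\<Gamma> \<omega> + b))"
        by (rule \<Omega>.integrable_const_bound[where B = 1]) (use Fm(1) in simp_all)
      ultimately show ?thesis by (simp add: right_diff_distrib)
    qed
    have i2: "integrable \<Omega> (\<lambda>\<omega>. cos (\<Gamma> \<omega> + b) * (\<integral>s. drift_weight s * f'' (\<omega> (clamp s)) \<partial>lborel))"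
      by (rule time_Fubini(2)[OF Fm(1) F1(1) f_meas(3) f''_growth drift_weight_integrable])
    have "(\<integral>\<omega>. cos (\<Gamma> \<omega> + b) * ito_rv \<omega> \<partial>\<Omega>) = (\<integral>\<omega>. cos (\<Gamma> \<omega> + b) * (f (\<omega> t) - f 0) -
        H * K * (cos (\<Gamma> \<omega> + b) * (\<integral>s. drift_weight s * f'' (\<omega> (clamp s)) \<partial>lborel)) \<partial>\<Omega>)"
      by (rule Bochner_Integration.integral_cong) (simp_all add: ito_rv_eq algebra_simps)
    also have "\<dots> = (\<integral>\<omega>. cos (\<Gamma> \<omega> + b) * (f (\<omega> t) - f 0) \<partial>\<Omega>) -
        H * K * (\<integral>\<omega>. cos (\<Gamma> \<omega> + b) * (\<integral>s. drift_weight s * f'' (\<omega> (clamp s)) \<partial>lborel) \<partial>\<Omega>)"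
      using i1 i2 by (simp only: Bochner_Integration.integral_diff integrable_mult_right integral_mult_right_zero)
    finally show ?thesis
      using zero unfolding ito_defect_def I1 I2 S G\<Gamma> by linarith
  qed
  have dep: "g x = g y" if "\<forall>i<n. x i = y i" for x y using g that unfolding Cb_infinity_def by blast
  have it: "continuous_on UNIV (iter_partial_deriv is g)" "bounded (range (iter_partial_deriv is g))"
    "i < n \<Longrightarrow> (\<lambda>y. iter_partial_deriv is g (x(i := y))) differentiable (at (x i))" if "set is \<subseteq> {..<n}" for "is" i x
    using g that unfolding Cb_infinity_def by blast+
  \<comment> \<open>The empty list of derivatives yields \<open>g\<close> itself, the one-element
    lists its first partial derivatives.\<close>
  have g_cont: "continuous_on UNIV g" and g_bdd: "bounded (range g)" using it(1,2)[of "[]"] by simp_all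
  obtain B where B: "\<And>x. \<bar>g x\<bar> \<le> B" using g_bdd unfolding bounded_iff by auto
  have d_cont: "continuous_on UNIV (partial_deriv j g)" and d_bdd: "bounded (range (partial_deriv j g))" if "j < n" for j
    using it(1,2)[of "[j]"] that by simp_all
  have "\<forall>j. \<exists>c. j < n \<longrightarrow> (\<forall>x. \<bar>partial_deriv j g x\<bar> \<le> c)"
    using d_bdd unfolding bounded_iff by fastforce
  then obtain c where c: "\<And>j x. j < n \<Longrightarrow> \<bar>partial_deriv j g x\<bar> \<le> c j" unfolding choice_iff by blast
  have d_deriv: "((\<lambda>y. g (x(j := y))) has_real_derivative partial_deriv j g x) (at (x j))" if "j < n" for j x
    using it(3)[of "[]" j x] that unfolding partial_deriv_def by (simp add: DERIV_deriv_iff_real_differentiable)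
  have main: "(\<integral>\<omega>. g (\<lambda>i. G i \<omega>) * ito_rv \<omega> \<partial>\<Omega>) = (\<Sum>j<n. \<integral>\<omega>. partial_deriv j g (\<lambda>i. G i \<omega>) * A j \<omega> \<partial>\<Omega>)"
    by (rule \<Omega>.integration_by_parts_extend[OF Gm Zi Ai trig dep g_cont B d_deriv d_cont c])
  have Geq: "\<forall>i<n. W (\<phi> i) \<omega> = G i \<omega>" for \<omega> by (simp add: G_def)
  have cylG: "cyl W g \<phi> \<omega> = g (\<lambda>i. G i \<omega>)" for \<omega> unfolding cyl_def by (rule dep) (rule Geq)
  have pdG: "partial_deriv j g (\<lambda>i. W (\<phi> i) \<omega>) = partial_deriv j g (\<lambda>i. G i \<omega>)" if "j < n" for j \<omega>
  proof -
    have "(\<lambda>y. g ((\<lambda>i. W (\<phi> i) \<omega>)(j := y))) = (\<lambda>y. g ((\<lambda>i. G i \<omega>)(j := y)))"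
      by (rule ext, rule dep) (simp add: G_def)
    then show ?thesis unfolding partial_deriv_def using Geq that by simp
  qed
  have Am: "integrable \<Omega> (\<lambda>\<omega>. partial_deriv j g (\<lambda>i. G i \<omega>) * A j \<omega>)" if j: "j < n" for j
  proof (rule Bochner_Integration.integrable_bound[OF integrable_mult_right[OF Ai[OF j], of "c j"]])
    have "(\<lambda>\<omega> i. G i \<omega>) \<in> borel_measurable \<Omega>" by (rule measurable_coordinatewise_then_product) (rule Gm)
    then have "(\<lambda>\<omega>. partial_deriv j g (\<lambda>i. G i \<omega>)) \<in> borel_measurable \<Omega>"
      by (rule measurable_compose[OF _ borel_measurable_continuous_onI[OF d_cont[OF j]]])
    then show "(\<lambda>\<omega>. partial_deriv j g (\<lambda>i. G i \<omega>) * A j \<omega>) \<in> borel_measurable \<Omega>"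
      by (rule borel_measurable_times[OF _ borel_measurable_integrable[OF Ai[OF j]]])
    show "AE \<omega> in \<Omega>. norm (partial_deriv j g (\<lambda>i. G i \<omega>) * A j \<omega>) \<le> norm (c j * A j \<omega>)"
      unfolding real_norm_def abs_mult by (intro AE_I2 mult_right_mono order_trans[OF c[OF j] abs_ge_self]) simp
  qed
  have "(\<integral>\<omega>. inner_H \<mu> (\<lambda>s. cyl_deriv W n g \<phi> s \<omega>) (\<lambda>s. integrand s \<omega>) \<partial>\<Omega>) =
      (\<integral>\<omega>. (\<Sum>j<n. partial_deriv j g (\<lambda>i. G i \<omega>) * A j \<omega>) \<partial>\<Omega>)"
  proof (rule Bochner_Integration.integral_cong[OF refl])
    fix \<omega> assume w: "\<omega> \<in> space \<Omega>"
    have "inner_H \<mu> (\<lambda>s. cyl_deriv W n g \<phi> s \<omega>) (\<lambda>s. integrand s \<omega>) =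
        (\<Sum>j<n. partial_deriv j g (\<lambda>i. W (\<phi> i) \<omega>) * inner_H \<mu> (\<phi> j) (\<lambda>s. integrand s \<omega>))"
      unfolding cyl_deriv_def by (rule inner_H_sum_left[OF \<phi>1 integrand_Lbdd[OF w]])
    then show "inner_H \<mu> (\<lambda>s. cyl_deriv W n g \<phi> s \<omega>) (\<lambda>s. integrand s \<omega>) = (\<Sum>j<n. partial_deriv j g (\<lambda>i. G i \<omega>) * A j \<omega>)"
      by (simp add: pdG k(3)[OF _ w] A_def)
  qed
  also have "\<dots> = (\<Sum>j<n. \<integral>\<omega>. partial_deriv j g (\<lambda>i. G i \<omega>) * A j \<omega> \<partial>\<Omega>)"
    by (rule Bochner_Integration.integral_sum) (simp add: Am)
  finally show ?thesis using main by (simp add: cylG)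
qed

text \<open>Duality with the constant 1, the cylindrical variable of no integrals, whose derivative
  is 0.\<close>

lemma ito_rv_mean: "(\<integral>\<omega>. ito_rv \<omega> \<partial>\<Omega>) = 0"
proof -
  have "(\<lambda>x. 1) \<in> Cb_infinity 0" using cos_linear_Cb_infinity[where n = 0 and b = 0] by simp
  then have "(\<integral>\<omega>. cyl W (\<lambda>x. 1) (\<lambda>_ _. 0) \<omega> * ito_rv \<omega> \<partial>\<Omega>) =
      (\<integral>\<omega>. inner_H \<mu> (\<lambda>s. cyl_deriv W 0 (\<lambda>x. 1) (\<lambda>_ _. 0) s \<omega>) (\<lambda>s. integrand s \<omega>) \<partial>\<Omega>)"
    by (intro weak_ito_formula) simp_all
  then show ?thesis by (simp add: cyl_def cyl_deriv_def inner_H_eq)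
qed

lemma integrand_joint_measurable:
  "(\<lambda>z. indicator {0..t} (fst z) * f' (snd z (clamp (fst z)))) \<in> borel_measurable (borel \<Otimes>\<^sub>M \<Omega>)"
proof (rule borel_measurable_times)
  have "(indicator {0..t} :: real \<Rightarrow> real) \<in> borel_measurable borel" by simp
  then show "(\<lambda>z. indicator {0..t} (fst z) :: real) \<in> borel_measurable (borel \<Otimes>\<^sub>M \<Omega>)"
    by (rule measurable_compose[OF measurable_fst])
  show "(\<lambda>z. f' (snd z (clamp (fst z)))) \<in> borel_measurable (borel \<Otimes>\<^sub>M \<Omega>)"
    by (rule measurable_compose[OF coord_joint_measurable f_meas(2)])
qed

lemma integrand_measurable:
  "(\<lambda>(s, \<omega>). integrand s \<omega>) \<in> borel_measurable (restrict_space borel {0..T} \<Otimes>\<^sub>M \<Omega>)"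
proof -
  have "(\<lambda>z. (fst z, snd z)) \<in> restrict_space borel {0..T} \<Otimes>\<^sub>M \<Omega> \<rightarrow>\<^sub>M (borel :: real measure) \<Otimes>\<^sub>M \<Omega>"
  proof (rule measurable_Pair)
    have "(\<lambda>x. x) \<in> restrict_space borel {0..T} \<rightarrow>\<^sub>M (borel :: real measure)"
      by (rule measurable_restrict_space1) simp
    then show "fst \<in> restrict_space borel {0..T} \<Otimes>\<^sub>M \<Omega> \<rightarrow>\<^sub>M (borel :: real measure)"
      by (rule measurable_compose[OF measurable_fst])
  qed (rule measurable_snd)
  from measurable_compose[OF this integrand_joint_measurable] show ?thesis
    by (simp add: case_prod_beta' integrand_eq)
qed

text \<open>\<open>\<bar>x * y\<bar> \<le> x^2 + y^2\<close> decouples the two time variables, each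
  of which has a bounded marginal; what is left is the time integral of second moments of the
  integrand, controlled by those of \<open>X_s\<close>.\<close>

lemma integrand_norm_finite: "(\<integral>\<^sup>+\<omega>. norm_absH_sq \<mu> (\<lambda>s. integrand s \<omega>) \<partial>\<Omega>) < \<infinity>"
proof -
  interpret pr: pair_sigma_finite lborel \<Omega> by unfold_locales
  obtain B c where C: "0 < c"
    "\<And>h M. h \<in> borel_measurable borel \<Longrightarrow> M \<in> {\<mu>p, \<mu>m} \<Longrightarrow>
      (\<integral>\<^sup>+z. h (fst z) \<partial>M) \<le> ennreal B * (\<integral>\<^sup>+x. h x * indicator {0..T} x \<partial>lborel)"
    "\<And>h M. h \<in> borel_measurable borel \<Longrightarrow> M \<in> {\<mu>p, \<mu>m} \<Longrightarrow>
      (\<integral>\<^sup>+z. h (snd z) \<partial>M) \<le> ennreal B * (\<integral>\<^sup>+x. h x * indicator {0..T} x \<partial>lborel)"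
    "\<And>h. h \<in> borel_measurable borel \<Longrightarrow>
      (\<integral>\<^sup>+z. h (fst z) \<partial>\<mu>m) + ennreal c * (\<integral>\<^sup>+x. h x * indicator {0..T} x \<partial>lborel) \<le> (\<integral>\<^sup>+z. h (fst z) \<partial>\<mu>p)"
    by (rule nn_marginals) (assumption | rule that)+
  define U where "U s \<omega> = ennreal ((integrand s \<omega>)\<^sup>2) * indicator {0..T} s" for s \<omega>
  \<comment> \<open>The factor 4 counts two Jordan parts and two marginals.\<close>
  have pt: "norm_absH_sq \<mu> (\<lambda>s. integrand s \<omega>) \<le> 4 * ennreal B * (\<integral>\<^sup>+s. U s \<omega> \<partial>lborel)" if w: "\<omega> \<in> space \<Omega>" for \<omega>
  proof -
    have "(\<lambda>s. integrand s \<omega>) \<in> borel_measurable borel"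
      unfolding integrand_eq using clamp_path_measurable[OF f_meas(2) w] by simp
    then have hm: "(\<lambda>s. ennreal ((integrand s \<omega>)\<^sup>2)) \<in> borel_measurable borel" by simp
    have one: "(\<integral>\<^sup>+z. ennreal (\<bar>integrand (fst z) \<omega>\<bar> * \<bar>integrand (snd z) \<omega>\<bar>) \<partial>M) \<le> 2 * (ennreal B * (\<integral>\<^sup>+s. U s \<omega> \<partial>lborel))"
      if M: "M \<in> {\<mu>p, \<mu>m}" for M
    proof -
      have fs: "fst \<in> M \<rightarrow>\<^sub>M (borel :: real measure)" "snd \<in> M \<rightarrow>\<^sub>M (borel :: real measure)"
        using fst_snd_measurable M by blast+
      have "\<bar>x\<bar> * \<bar>y\<bar> \<le> x\<^sup>2 + y\<^sup>2" for x y :: real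
      proof -
        have "0 \<le> (\<bar>x\<bar> - \<bar>y\<bar>)\<^sup>2" by simp
        then have "2 * (\<bar>x\<bar> * \<bar>y\<bar>) \<le> x\<^sup>2 + y\<^sup>2" by (simp add: power2_diff)
        moreover have "0 \<le> \<bar>x\<bar> * \<bar>y\<bar>" by simp
        ultimately show ?thesis by linarith
      qed
      then have "(\<integral>\<^sup>+z. ennreal (\<bar>integrand (fst z) \<omega>\<bar> * \<bar>integrand (snd z) \<omega>\<bar>) \<partial>M) \<le>
          (\<integral>\<^sup>+z. ennreal ((integrand (fst z) \<omega>)\<^sup>2) + ennreal ((integrand (snd z) \<omega>)\<^sup>2) \<partial>M)"
        by (intro nn_integral_mono) (simp add: ennreal_plus[symmetric] ennreal_leI del: ennreal_plus)
      also have "\<dots> = (\<integral>\<^sup>+z. ennreal ((integrand (fst z) \<omega>)\<^sup>2) \<partial>M) + (\<integral>\<^sup>+z. ennreal ((integrand (snd z) \<omega>)\<^sup>2) \<partial>M)"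
        by (rule nn_integral_add) (rule measurable_compose[OF fs(1) hm], rule measurable_compose[OF fs(2) hm])
      also have "\<dots> \<le> ennreal B * (\<integral>\<^sup>+s. U s \<omega> \<partial>lborel) + ennreal B * (\<integral>\<^sup>+s. U s \<omega> \<partial>lborel)"
        unfolding U_def by (intro add_mono C(2)[OF hm M] C(3)[OF hm M])
      finally show ?thesis by (simp add: mult_2)
    qed
    have "norm_absH_sq \<mu> (\<lambda>s. integrand s \<omega>) \<le> 2 * (ennreal B * (\<integral>\<^sup>+s. U s \<omega> \<partial>lborel)) + 2 * (ennreal B * (\<integral>\<^sup>+s. U s \<omega> \<partial>lborel))"
      unfolding norm_absH_sq_eq by (intro add_mono one) simp_all
    also have "\<dots> = (2 + 2) * (ennreal B * (\<integral>\<^sup>+s. U s \<omega> \<partial>lborel))" by (rule distrib_right[symmetric])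
    finally show ?thesis by (simp add: mult.assoc)
  qed
  have Um: "case_prod U \<in> borel_measurable (lborel \<Otimes>\<^sub>M \<Omega>)"
  proof -
    have "sets (lborel \<Otimes>\<^sub>M \<Omega>) = sets (borel \<Otimes>\<^sub>M \<Omega>)" by (intro sets_pair_measure_cong) simp_all
    then have e: "borel_measurable (lborel \<Otimes>\<^sub>M \<Omega>) = (borel_measurable (borel \<Otimes>\<^sub>M \<Omega>) :: (real \<times> (real \<Rightarrow> real) \<Rightarrow> ennreal) set)"
      by (intro measurable_cong_sets) simp_all
    have "(\<lambda>z. ennreal ((indicator {0..t} (fst z) * f' (snd z (clamp (fst z))))\<^sup>2)) \<in> borel_measurable (borel \<Otimes>\<^sub>M \<Omega>)"
      using integrand_joint_measurable by (intro measurable_compose[OF _ measurable_ennreal] borel_measurable_power)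
    moreover have "(indicator {0..T} :: real \<Rightarrow> ennreal) \<in> borel_measurable borel" by simp
    then have "(\<lambda>z. indicator {0..T} (fst z) :: ennreal) \<in> borel_measurable (borel \<Otimes>\<^sub>M \<Omega>)"
      by (rule measurable_compose[OF measurable_fst])
    ultimately show ?thesis unfolding e U_def[abs_def] case_prod_beta' integrand_eq
      by (rule borel_measurable_times_ennreal)
  qed
  have C0: "0 \<le> C" by (rule quad_growthD(7)[OF growth])
  define D where "D = 2 * C\<^sup>2 * (1 + T powr p)"
  have inner: "(\<integral>\<^sup>+\<omega>. U s \<omega> \<partial>\<Omega>) \<le> ennreal D * indicator {0..T} s" for s
  proof (cases "s \<in> {0..T}")
    case True
    have "(\<integral>\<^sup>+\<omega>. U s \<omega> \<partial>\<Omega>) \<le> (\<integral>\<^sup>+\<omega>. ennreal (2 * C\<^sup>2 * (1 + (\<omega> s)\<^sup>2)) \<partial>\<Omega>)"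
    proof (rule nn_integral_mono)
      fix \<omega>
      have "\<bar>integrand s \<omega>\<bar> \<le> C * (1 + \<bar>\<omega> s\<bar>)"
        using f'_growth[of "\<omega> s"] order_trans[OF abs_ge_zero f'_growth[of "\<omega> s"]]
        by (simp add: restrict_process_def indicator_def)
      then have "(integrand s \<omega>)\<^sup>2 \<le> (C * (1 + \<bar>\<omega> s\<bar>))\<^sup>2" by (rule power2_le_iff_abs_le[THEN iffD2, rotated]) (use C0 in simp)
      also have "\<dots> \<le> 2 * C\<^sup>2 * (1 + (\<omega> s)\<^sup>2)" by (rule linear_growth_square)
      finally show "U s \<omega> \<le> ennreal (2 * C\<^sup>2 * (1 + (\<omega> s)\<^sup>2))" using True by (simp add: U_def ennreal_leI)
    qed
    also have "\<dots> = ennreal (\<integral>\<omega>. 2 * C\<^sup>2 * (1 + (\<omega> s)\<^sup>2) \<partial>\<Omega>)"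
      by (rule nn_integral_eq_integral) (use coord_L2[OF True] in \<open>simp_all add: L2_rv_def\<close>)
    also have "(\<integral>\<omega>. 2 * C\<^sup>2 * (1 + (\<omega> s)\<^sup>2) \<partial>\<Omega>) = 2 * C\<^sup>2 * (1 + s powr p)"
      using coord_L2[OF True] coord_square[OF True] by (simp add: L2_rv_def P.prob_space)
    also have "ennreal \<dots> \<le> ennreal D"
      unfolding D_def using True p_ge_1 by (intro ennreal_leI mult_left_mono add_left_mono powr_mono2) auto
    finally show ?thesis using True by simp
  qed (simp add: U_def)
  have "(\<integral>\<^sup>+\<omega>. norm_absH_sq \<mu> (\<lambda>s. integrand s \<omega>) \<partial>\<Omega>) \<le> (\<integral>\<^sup>+\<omega>. 4 * ennreal B * (\<integral>\<^sup>+s. U s \<omega> \<partial>lborel) \<partial>\<Omega>)"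
    by (rule nn_integral_mono) (rule pt)
  also have "\<dots> = 4 * ennreal B * (\<integral>\<^sup>+\<omega>. (\<integral>\<^sup>+s. U s \<omega> \<partial>lborel) \<partial>\<Omega>)"
  proof (rule nn_integral_cmult)
    have "case_prod (\<lambda>\<omega> s. U s \<omega>) \<in> borel_measurable (\<Omega> \<Otimes>\<^sub>M lborel)"
      using measurable_pair_swap[OF Um] by simp
    then show "(\<lambda>\<omega>. \<integral>\<^sup>+s. U s \<omega> \<partial>lborel) \<in> borel_measurable \<Omega>" by (rule lborel.borel_measurable_nn_integral)
  qed
  also have "(\<integral>\<^sup>+\<omega>. (\<integral>\<^sup>+s. U s \<omega> \<partial>lborel) \<partial>\<Omega>) = (\<integral>\<^sup>+s. (\<integral>\<^sup>+\<omega>. U s \<omega> \<partial>\<Omega>) \<partial>lborel)"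
    by (rule pr.Fubini'[OF Um])
  also have "\<dots> \<le> (\<integral>\<^sup>+s. ennreal D * indicator {0..T} s \<partial>lborel)" by (rule nn_integral_mono) (rule inner)
  also have "\<dots> = ennreal D * ennreal T" using T by (simp add: nn_integral_cmult_indicator)
  finally have "(\<integral>\<^sup>+\<omega>. norm_absH_sq \<mu> (\<lambda>s. integrand s \<omega>) \<partial>\<Omega>) \<le> 4 * ennreal B * (ennreal D * ennreal T)"
    by (simp add: mult_left_mono)
  also have "\<dots> < \<infinity>" by (simp add: ennreal_mult_less_top)
  finally show ?thesis .
qed

lemma ito_has_skorohod_integral: "has_skorohod_integral T \<mu> \<Omega> W integrand ito_rv"
  unfolding has_skorohod_integral_def
  by (intro conjI allI ballI impI integrand_measurable integrand_norm_finite ito_rv_L2 ito_rv_mean weak_ito_formula) blast+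

end

text \<open>Indicators of \<open>[0, s i]\<close> as \<open>\<phi> i\<close> turn
  \<open>W (\<phi> i)\<close> into coordinates almost surely. So the difference of two candidates is
  orthogonal to all cosines of linear combinations of finitely many coordinates, and these determine
  it.\<close>

lemma has_skorohod_integral_unique:
  assumes Z1: "has_skorohod_integral T \<mu> \<Omega> W u Z1" and Z2: "has_skorohod_integral T \<mu> \<Omega> W u Z2"
  shows "AE \<omega> in \<Omega>. Z1 \<omega> = Z2 \<omega>"
proof -
  have L2: "Z1 \<in> L2_rv \<Omega>" "Z2 \<in> L2_rv \<Omega>" using Z1 Z2 by (simp_all add: has_skorohod_integral_def)
  have "(\<integral>\<omega>. cos ((\<Sum>i<n. l i * \<omega> (s i)) + b) * (Z1 \<omega> - Z2 \<omega>) \<partial>\<Omega>) = 0"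
    if s: "\<And>i. i < n \<Longrightarrow> s i \<in> {0..T}" for n :: nat and s l b
  proof -
    define g where "g x = cos ((\<Sum>i<n. l i * x i) + b)" for x :: "nat \<Rightarrow> real"
    define \<phi> where "\<phi> i = (indicator {0..s i} :: real \<Rightarrow> real)" for i :: nat
    have \<phi>: "\<phi> i \<in> L_mu T \<mu>" for i unfolding \<phi>_def using ind_Lbdd Lbdd_L_mu by blast
    have g: "g \<in> Cb_infinity n" unfolding g_def[abs_def] by (rule cos_linear_Cb_infinity)
    have eq: "(\<integral>\<omega>. cyl W g \<phi> \<omega> * Z1 \<omega> \<partial>\<Omega>) = (\<integral>\<omega>. cyl W g \<phi> \<omega> * Z2 \<omega> \<partial>\<Omega>)"
      using Z1 Z2 g \<phi> unfolding has_skorohod_integral_def by simp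
    have cm: "(\<lambda>\<omega>. cos ((\<Sum>i<n. l i * \<omega> (s i)) + b)) \<in> borel_measurable \<Omega>"
    proof -
      have "(\<lambda>\<omega>. \<Sum>i<n. l i * \<omega> (s i)) \<in> borel_measurable \<Omega>"
        by (intro borel_measurable_sum borel_measurable_times borel_measurable_const coord_measurable s) simp
      then show ?thesis by simp
    qed
    have "(\<lambda>\<omega>. \<Sum>i<n. l i * W (\<phi> i) \<omega>) \<in> borel_measurable \<Omega>"
      by (intro borel_measurable_sum borel_measurable_times borel_measurable_const L2_rv_measurable[OF W_L2[OF \<phi>]])
    then have cylm: "cyl W g \<phi> \<in> borel_measurable \<Omega>" unfolding cyl_def[abs_def] g_def by simp
    have "AE \<omega> in \<Omega>. \<forall>i\<in>{..<n}. W (\<phi> i) \<omega> = \<omega> (s i)"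
      unfolding \<phi>_def by (rule AE_finite_allI) (use W_ind[OF s] in simp_all)
    then have ae: "AE \<omega> in \<Omega>. cyl W g \<phi> \<omega> = cos ((\<Sum>i<n. l i * \<omega> (s i)) + b)"
      by eventually_elim (simp add: cyl_def g_def)
    have i: "integrable \<Omega> (\<lambda>\<omega>. cos ((\<Sum>i<n. l i * \<omega> (s i)) + b) * Z \<omega>)"
      and e: "(\<integral>\<omega>. cos ((\<Sum>i<n. l i * \<omega> (s i)) + b) * Z \<omega> \<partial>\<Omega>) = (\<integral>\<omega>. cyl W g \<phi> \<omega> * Z \<omega> \<partial>\<Omega>)"
      if Z: "Z \<in> L2_rv \<Omega>" for Z
    proof -
      note Zm = L2_rv_measurable[OF Z]
      show "integrable \<Omega> (\<lambda>\<omega>. cos ((\<Sum>i<n. l i * \<omega> (s i)) + b) * Z \<omega>)"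
      proof (rule Bochner_Integration.integrable_bound[OF \<Omega>.L2_rv_integrable[OF Z]])
        show "AE \<omega> in \<Omega>. norm (cos ((\<Sum>i<n. l i * \<omega> (s i)) + b) * Z \<omega>) \<le> norm (Z \<omega>)"
          unfolding real_norm_def abs_mult by (intro AE_I2 mult_left_le_one_le abs_ge_zero abs_cos_le_one)
      qed (rule borel_measurable_times[OF cm Zm])
      show "(\<integral>\<omega>. cos ((\<Sum>i<n. l i * \<omega> (s i)) + b) * Z \<omega> \<partial>\<Omega>) = (\<integral>\<omega>. cyl W g \<phi> \<omega> * Z \<omega> \<partial>\<Omega>)"
      proof (rule integral_cong_AE[OF borel_measurable_times[OF cm Zm] borel_measurable_times[OF cylm Zm]])
        show "AE \<omega> in \<Omega>. cos ((\<Sum>i<n. l i * \<omega> (s i)) + b) * Z \<omega> = cyl W g \<phi> \<omega> * Z \<omega>"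
          using ae by eventually_elim simp
      qed
    qed
    show ?thesis
      unfolding right_diff_distrib Bochner_Integration.integral_diff[OF i[OF L2(1)] i[OF L2(2)]] e[OF L2(1)] e[OF L2(2)] eq by simp
  qed
  with \<Omega>.L2_rv_integrable[OF L2_rv_diff[OF L2]] have "AE \<omega> in \<Omega>. Z1 \<omega> - Z2 \<omega> = 0"
    by (rule trig_orthogonal_imp_AE_zero)
  then show ?thesis by eventually_elim simp
qed

end

theorem mainTheorem3:
  fixes T H K :: real
    and P :: "(real \<Rightarrow> real) measure"
    and \<mu> :: "(real \<times> real) signed_measure"
    and W :: "(real \<Rightarrow> real) \<Rightarrow> (real \<Rightarrow> real) \<Rightarrow> real"
    and f f' f'' :: "real \<Rightarrow> real"
  assumes T: "0 < T"
    and H: "0 < H" "H < 1"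
    and K: "0 < K" "K \<le> 1"
    and HK: "1 / 2 \<le> H * K"
    and P: "bifbm_law H K T P"
    and \<mu>: "covariance_measure H K T \<mu>"
    and W: "wiener_integral T \<mu> (completion P) W"
    and f': "\<And>x. (f has_real_derivative f' x) (at x)"
    and f'': "\<And>x. (f' has_real_derivative f'' x) (at x)"
    and cont: "continuous_on UNIV f''"
    and bdd: "bounded (range f'')"
  shows "\<forall>t\<in>{0..T}.
    restrict_process t (\<lambda>s \<omega>. f' (\<omega> s)) \<in> skorohod_dom T \<mu> (completion P) W \<and>
    (AE \<omega> in completion P. f (\<omega> t) = f 0
        + skorohod_integral T \<mu> (completion P) W (restrict_process t (\<lambda>s \<omega>. f' (\<omega> s))) \<omega>
        + H * K * (LBINT s:{0..t}. f'' (\<omega> s) * s powr (2 * H * K - 1))) \<and>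
    (2 * H * K = 1 \<longrightarrow>
      (AE \<omega> in completion P. f (\<omega> t) = f 0
        + skorohod_integral T \<mu> (completion P) W (restrict_process t (\<lambda>s \<omega>. f' (\<omega> s))) \<omega>
        + 1 / 2 * (LBINT s:{0..t}. f'' (\<omega> s))))"
proof
  fix t assume t: "t \<in> {0..T}"
  interpret bifbm_setting T H K \<mu> P W
    by unfold_locales (rule T H K HK \<mu> P W)+
  obtain B where B: "\<And>x. \<bar>f'' x\<bar> \<le> B" using bdd unfolding bounded_iff by auto
  define C where "C = \<bar>f 0\<bar> + 2 * \<bar>f' 0\<bar> + 2 * B"
  have growth: "quad_growth C f f' f''" unfolding C_def by (rule C2_quad_growth[OF f' f'' cont B])
  \<comment> \<open>The context asks for one constant that bounds \<open>f''\<close> and also serves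
    in \<open>quad_growth\<close>; \<open>C\<close> does both.\<close>
  note S = f' f'' cont quad_growthD(6)[OF growth] growth t
  define u where "u = restrict_process t (\<lambda>s \<omega>. f' (\<omega> s))"
  have Z: "has_skorohod_integral T \<mu> \<Omega> W u (ito_rv f f'' t)"
    unfolding u_def by (rule ito_has_skorohod_integral[OF S])
  \<comment> \<open>The witness \<open>ito_rv\<close> makes the choice in
    \<open>skorohod_integral\<close> an actual Skorohod integral; uniqueness then identifies the
    two.\<close>
  then have "has_skorohod_integral T \<mu> \<Omega> W u (skorohod_integral T \<mu> \<Omega> W u)"
    unfolding skorohod_integral_def by (rule someI[where P = "has_skorohod_integral T \<mu> \<Omega> W u"])
  from has_skorohod_integral_unique[OF this Z]
  have ito: "AE \<omega> in \<Omega>. f (\<omega> t) = f 0 + skorohod_integral T \<mu> \<Omega> W u \<omega> + H * K * (LBINT s:{0..t}. f'' (\<omega> s) * s powr (p - 1))"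
    by eventually_elim (simp add: ito_rv_def[OF S])
  have "AE \<omega> in \<Omega>. f (\<omega> t) = f 0 + skorohod_integral T \<mu> \<Omega> W u \<omega> + 1 / 2 * (LBINT s:{0..t}. f'' (\<omega> s))" if p1: "p = 1"
  proof -
    have "(LBINT s:{0..t}. f'' (\<omega> s) * s powr (p - 1)) = (LBINT s:{0..t}. f'' (\<omega> s))" if w: "\<omega> \<in> space \<Omega>" for \<omega>
      unfolding set_lebesgue_integral_def
    proof (rule integral_cong_AE)
      have c: "(\<lambda>s. indicator {0..t} s *\<^sub>R f'' (\<omega> s)) = (\<lambda>s. indicator {0..t} s *\<^sub>R f'' (\<omega> (clamp s)))"
        using t clamp_id by (auto simp: indicator_def)
      have m: "(\<lambda>s. indicator {0..t} s *\<^sub>R f'' (\<omega> s)) \<in> borel_measurable lborel"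
        unfolding c using clamp_path_measurable[OF quad_growthD(3)[OF growth] w] by simp
      then show "(\<lambda>s. indicator {0..t} s *\<^sub>R f'' (\<omega> s)) \<in> borel_measurable lborel" .
      have "(\<lambda>s. (indicator {0..t} s *\<^sub>R f'' (\<omega> s)) * s powr (p - 1)) \<in> borel_measurable lborel"
        by (rule borel_measurable_times[OF m]) simp
      then show "(\<lambda>s. indicator {0..t} s *\<^sub>R (f'' (\<omega> s) * s powr (p - 1))) \<in> borel_measurable lborel"
        by (simp add: mult.assoc)
      \<comment> \<open>\<open>s powr 0\<close> is 1 except at \<open>s = 0\<close>, where it is 0
        by convention; a single time point does not count.\<close>
      have "AE s in lborel. s \<noteq> (0 :: real)" by (rule AE_lborel_singleton)
      then show "AE s in lborel. indicator {0..t} s *\<^sub>R (f'' (\<omega> s) * s powr (p - 1)) = indicator {0..t} s *\<^sub>R f'' (\<omega> s)"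
        by eventually_elim (simp add: p1)
    qed
    then have ae: "AE \<omega> in \<Omega>. (LBINT s:{0..t}. f'' (\<omega> s) * s powr (p - 1)) = (LBINT s:{0..t}. f'' (\<omega> s))" by (rule AE_I2)
    have hk: "H * K = 1 / 2" using p1 by simp
    show ?thesis using ae ito by eventually_elim (simp only: hk)
  qed
  with ito Z show "restrict_process t (\<lambda>s \<omega>. f' (\<omega> s)) \<in> skorohod_dom T \<mu> (completion P) W \<and>
    (AE \<omega> in completion P. f (\<omega> t) = f 0
        + skorohod_integral T \<mu> (completion P) W (restrict_process t (\<lambda>s \<omega>. f' (\<omega> s))) \<omega>
        + H * K * (LBINT s:{0..t}. f'' (\<omega> s) * s powr (2 * H * K - 1))) \<and>
    (2 * H * K = 1 \<longrightarrow>
      (AE \<omega> in completion P. f (\<omega> t) = f 0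
        + skorohod_integral T \<mu> (completion P) W (restrict_process t (\<lambda>s \<omega>. f' (\<omega> s))) \<omega>
        + 1 / 2 * (LBINT s:{0..t}. f'' (\<omega> s))))"
    unfolding u_def skorohod_dom_def by blast
qed

end
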